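(* Let $(\mathcal B,d,\eta,\tau)$ be an $\mathrm{O}(1)$-volutive 2-category. Then the triple $(S_{\mathrm{O}(1)}\mathcal B,\,S_{\mathrm{O}(1)}d,\,S_{\mathrm{O}(1)}\eta)$ defined in the context is an $\mathrm{O}(1)$-dagger 2-category.
   Context: "2-category" means bicategory, etc.; coherence isomorphisms are suppressed. A 2-transformation $\alpha\colon F\Rightarrow G$ has components $\alpha_a\colon F(a)\to G(a)$, $\alpha_X\colon G(X)\circ\alpha_a\to\alpha_b\circ F(X)$ for $X\colon a\to b$. $\mathcal B^{1\text{-op}}$ is $\mathcal B$ with reversed 1-morphisms. A 2-isomorphism $f\colon X\Rightarrow Y$ between invertible 1-morphisms is also regarded as a 2-isomorphism $Y^{-1}\Rightarrow X^{-1}$ (and similarly after moving invertible 1-morphisms to the other side). $\mathrm{O}(1)$-volutive 2-category $(\mathcal B,d,\eta,\tau)$: a 2-functor $d\colon\mathcal B\to\mathcal B^{1\text{-op}}$, an invertible 2-transformation $\eta\colon d^{1\text{-op}}\circ d\Rightarrow\mathrm{id}_{\mathcal B}$ (components $\eta_a\colon d^2(a)\to a$, $\eta_X\colon X\circ\eta_a\to\eta_b\circ d^2(X)$), and an invertible modification $\tau\colon(\eta^{1\text{-op}})^{-1}\circ\mathrm{id}_d\Rrightarrow\mathrm{id}_d\circ\eta$ (components $\tau_a\colon\eta_{d(a)}^{-1}\to d(\eta_a)$), such that for every $a$ the 2-isomorphism $\eta_a\circ\eta_{d^2(a)}\cong\eta_a\circ d(\eta_{d(a)})^{-1}\cong\eta_a\circ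 d(\eta_{d(a)}^{-1})\xrightarrow{\mathrm{id}\circ d(\tau_a)}\eta_a\circ d^2(\eta_a)$, whose first step is induced by $\tau_{d(a)}$, equals the naturality 2-isomorphism of $\eta$ at the 1-morphism $\eta_a$. $\mathrm{O}(1)$-dagger 2-category $(\mathcal B,d,\eta)$: an identity-on-objects 2-functor $d\colon\mathcal B\to\mathcal B^{1\text{-op}}$ and an invertible 2-transformation $\eta\colon d^{1\text{-op}}\circ d\Rightarrow\mathrm{id}_{\mathcal B}$ with identity 1-morphism components such that $(\eta^{1\text{-op}})^{-1}\circ\mathrm{id}_d=\mathrm{id}_d\circ\eta$ (i.e. $d(\eta_X)=\eta_{d(X)}$, where $\eta_X\colon X\to d^2(X)$). Strictification: objects of $S_{\mathrm{O}(1)}\mathcal B$ are triples $(c,\theta_c,\Pi_c)$ with $c\in\mathcal B$, $\theta_c\colon c\to d(c)$ an invertible 1-morphism, and $\Pi_c\colon\eta_c\circ d(\theta_c)^{-1}\circ\theta_c\Rightarrow\mathrm{id}_c$ a 2-isomorphism such that the following two 2-isomorphisms $\eta_{d(c)}\circ d^2(\theta_c)\circ d(\theta_c)^{-1}\circ\theta_c\Rightarrow\theta_c$ agree: (i) naturality of $\eta$, $\eta_{d(c)}\circ d^2(\theta_c)\cong\theta_c\circ\eta_c$, followed by $\mathrm{id}_{\theta_c}\circ\Pi_c$; (ii) the 2-isomorphism $\eta_{d(c)}\cong d(\eta_c)^{-1}$ induced by $\tau_c$, followed by the 2-isomorphism $d(\eta_c)^{-1}\circ d^2(\theta_c)\circ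 d(\theta_c)^{-1}\cong\mathrm{id}_{d(c)}$ obtained from $d(\Pi_c)\colon d(\theta_c)\circ d^2(\theta_c)^{-1}\circ d(\eta_c)\Rightarrow\mathrm{id}_{d(c)}$ by passing to inverse 1-morphisms. 1-morphisms $(c,\theta_c,\Pi_c)\to(c',\theta_{c'},\Pi_{c'})$ are 1-morphisms $c\to c'$ in $\mathcal B$, and 2-morphisms are those of $\mathcal B$. $S_{\mathrm{O}(1)}d$ is the identity on objects, sends $X\colon(a,\theta_a,\Pi_a)\to(b,\theta_b,\Pi_b)$ to $\theta_a^{-1}\circ d(X)\circ\theta_b$, and $f\colon X\to Y$ to $\mathrm{id}_{\theta_a^{-1}}\circ d(f)\circ\mathrm{id}_{\theta_b}$. $S_{\mathrm{O}(1)}\eta$ has identity 1-morphism components and 2-morphism component at $X$ $$X\cong\mathrm{id}_b\circ X\circ\mathrm{id}_a\xrightarrow{\Pi_b\circ\mathrm{id}_X\circ\Pi_a^{-1}}\theta_b^{-1}d(\theta_b)\eta_b^{-1}X\eta_ad(\theta_a)^{-1}\theta_a\longrightarrow\theta_b^{-1}d(\theta_b)d^2(X)d(\theta_a)^{-1}\theta_a=(S_{\mathrm{O}(1)}d)^2(X),$$ where the second arrow is induced by $\eta_X$. *)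

theory Defs
  imports Main
begin

section \<open>Bicategories\<close>

record ('o, 'm, 'c) bicat =
  obj :: "'o set"
  mor :: "'m set"
  src :: "'m \<Rightarrow> 'o"
  trg :: "'m \<Rightarrow> 'o"
  one :: "'o \<Rightarrow> 'm" (\<open>\<one>\<index>\<close>)
  comp1 :: "'m \<Rightarrow> 'm \<Rightarrow> 'm" (infixr \<open>\<cdot>\<index>\<close> 75)
  cell :: "'c set"
  dom2 :: "'c \<Rightarrow> 'm"
  cod2 :: "'c \<Rightarrow> 'm"
  id2 :: "'m \<Rightarrow> 'c"
  vcomp :: "'c \<Rightarrow> 'c \<Rightarrow> 'c" (infixr \<open>\<bullet>\<index>\<close> 65)
  hcomp :: "'c \<Rightarrow> 'c \<Rightarrow> 'c" (infixr \<open>\<star>\<index>\<close> 70)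
  assoc :: "'m \<Rightarrow> 'm \<Rightarrow> 'm \<Rightarrow> 'c" (\<open>\<a>\<index>\<close>)
  lunit :: "'m \<Rightarrow> 'c" (\<open>\<l>\<index>\<close>)
  runit :: "'m \<Rightarrow> 'c" (\<open>\<r>\<index>\<close>)

definition hom :: "('o, 'm, 'c) bicat \<Rightarrow> 'o \<Rightarrow> 'o \<Rightarrow> 'm set" where
  "hom B a b = {X \<in> mor B. src B X = a \<and> trg B X = b}"

definition cells :: "('o, 'm, 'c) bicat \<Rightarrow> 'm \<Rightarrow> 'm \<Rightarrow> 'c set" where
  "cells B X Y = {f \<in> cell B. dom2 B f = X \<and> cod2 B f = Y}"

definition inverse_cells :: "('o, 'm, 'c) bicat \<Rightarrow> 'c \<Rightarrow> 'c \<Rightarrow> bool" where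
  "inverse_cells B f g \<longleftrightarrow>
     f \<in> cell B \<and> g \<in> cells B (cod2 B f) (dom2 B f) \<and>
     g \<bullet>\<^bsub>B\<^esub> f = id2 B (dom2 B f) \<and> f \<bullet>\<^bsub>B\<^esub> g = id2 B (cod2 B f)"

definition isos :: "('o, 'm, 'c) bicat \<Rightarrow> 'm \<Rightarrow> 'm \<Rightarrow> 'c set" where
  "isos B X Y = {f \<in> cells B X Y. \<exists>g. inverse_cells B f g}"

definition inv2 :: "('o, 'm, 'c) bicat \<Rightarrow> 'c \<Rightarrow> 'c" (\<open>inv\<index> _\<close> [81] 80) where
  "inv\<^bsub>B\<^esub> f = (THE g. inverse_cells B f g)"

abbreviation lwhisker :: "('o, 'm, 'c) bicat \<Rightarrow> 'm \<Rightarrow> 'c \<Rightarrow> 'c" (infixr \<open>\<rhd>\<index>\<close> 70) where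
  "X \<rhd>\<^bsub>B\<^esub> f \<equiv> id2 B X \<star>\<^bsub>B\<^esub> f"

abbreviation rwhisker :: "('o, 'm, 'c) bicat \<Rightarrow> 'c \<Rightarrow> 'm \<Rightarrow> 'c" (infixl \<open>\<lhd>\<index>\<close> 70) where
  "f \<lhd>\<^bsub>B\<^esub> X \<equiv> f \<star>\<^bsub>B\<^esub> id2 B X"

text \<open>The associator is directed as \<open>\<a> Z Y X : (Z \<cdot> Y) \<cdot> X \<Rightarrow> Z \<cdot> (Y \<cdot> X)\<close>.\<close>

locale bicategory =
  fixes B :: "('o, 'm, 'c) bicat" (structure)
  assumes src_obj: "X \<in> mor B \<Longrightarrow> src B X \<in> obj B"
    and trg_obj: "X \<in> mor B \<Longrightarrow> trg B X \<in> obj B"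
    and one_hom: "a \<in> obj B \<Longrightarrow> \<one> a \<in> hom B a a"
    and comp1_hom: "\<lbrakk>X \<in> hom B a b; Y \<in> hom B b c\<rbrakk> \<Longrightarrow> Y \<cdot> X \<in> hom B a c"
    and dom2_mor: "f \<in> cell B \<Longrightarrow> dom2 B f \<in> mor B"
    and cod2_hom: "f \<in> cell B \<Longrightarrow> cod2 B f \<in> hom B (src B (dom2 B f)) (trg B (dom2 B f))"
    and id2_cells: "X \<in> mor B \<Longrightarrow> id2 B X \<in> cells B X X"
    and vcomp_cells: "\<lbrakk>f \<in> cells B X Y; g \<in> cells B Y Z\<rbrakk> \<Longrightarrow> g \<bullet> f \<in> cells B X Z"
    and vcomp_assoc:
      "\<lbrakk>f \<in> cells B W X; g \<in> cells B X Y; h \<in> cells B Y Z\<rbrakk> \<Longrightarrow> (h \<bullet> g) \<bullet> f = h \<bullet> (g \<bullet> f)"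
    and vcomp_id2_left: "f \<in> cells B X Y \<Longrightarrow> id2 B Y \<bullet> f = f"
    and vcomp_id2_right: "f \<in> cells B X Y \<Longrightarrow> f \<bullet> id2 B X = f"
    and hcomp_cells:
      "\<lbrakk>f \<in> cells B X X'; g \<in> cells B Y Y'; X \<in> hom B a b; Y \<in> hom B b c\<rbrakk>
        \<Longrightarrow> g \<star> f \<in> cells B (Y \<cdot> X) (Y' \<cdot> X')"
    and hcomp_id2:
      "\<lbrakk>X \<in> hom B a b; Y \<in> hom B b c\<rbrakk> \<Longrightarrow> id2 B Y \<star> id2 B X = id2 B (Y \<cdot> X)"
    and interchange:
      "\<lbrakk>f \<in> cells B X X'; f' \<in> cells B X' X''; g \<in> cells B Y Y'; g' \<in> cells B Y' Y'';
        X \<in> hom B a b; Y \<in> hom B b c\<rbrakk>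
        \<Longrightarrow> (g' \<bullet> g) \<star> (f' \<bullet> f) = (g' \<star> f') \<bullet> (g \<star> f)"
    and assoc_iso:
      "\<lbrakk>X \<in> hom B a b; Y \<in> hom B b c; Z \<in> hom B c d\<rbrakk>
        \<Longrightarrow> \<a> Z Y X \<in> isos B ((Z \<cdot> Y) \<cdot> X) (Z \<cdot> (Y \<cdot> X))"
    and lunit_iso: "X \<in> hom B a b \<Longrightarrow> \<l> X \<in> isos B (\<one> b \<cdot> X) X"
    and runit_iso: "X \<in> hom B a b \<Longrightarrow> \<r> X \<in> isos B (X \<cdot> \<one> a) X"
    and assoc_natural:
      "\<lbrakk>f \<in> cells B X X'; g \<in> cells B Y Y'; h \<in> cells B Z Z';
        X \<in> hom B a b; Y \<in> hom B b c; Z \<in> hom B c d\<rbrakk>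
        \<Longrightarrow> \<a> Z' Y' X' \<bullet> ((h \<star> g) \<star> f) = (h \<star> (g \<star> f)) \<bullet> \<a> Z Y X"
    and lunit_natural:
      "\<lbrakk>f \<in> cells B X X'; X \<in> hom B a b\<rbrakk> \<Longrightarrow> \<l> X' \<bullet> (\<one> b \<rhd> f) = f \<bullet> \<l> X"
    and runit_natural:
      "\<lbrakk>f \<in> cells B X X'; X \<in> hom B a b\<rbrakk> \<Longrightarrow> \<r> X' \<bullet> (f \<lhd> \<one> a) = f \<bullet> \<r> X"
    and pentagon:
      "\<lbrakk>W \<in> hom B a b; X \<in> hom B b c; Y \<in> hom B c d; Z \<in> hom B d e\<rbrakk>
        \<Longrightarrow> \<a> Z Y (X \<cdot> W) \<bullet> \<a> (Z \<cdot> Y) X W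
            = (Z \<rhd> \<a> Y X W) \<bullet> \<a> Z (Y \<cdot> X) W \<bullet> (\<a> Z Y X \<lhd> W)"
    and triangle:
      "\<lbrakk>X \<in> hom B a b; Y \<in> hom B b c\<rbrakk> \<Longrightarrow> (Y \<rhd> \<l> X) \<bullet> \<a> Y (\<one> b) X = \<r> Y \<lhd> X"

definition op1 :: "('o, 'm, 'c) bicat \<Rightarrow> ('o, 'm, 'c) bicat" where
  "op1 B = B\<lparr>
     src := trg B,
     trg := src B,
     comp1 := (\<lambda>Y X. X \<cdot>\<^bsub>B\<^esub> Y),
     hcomp := (\<lambda>g f. f \<star>\<^bsub>B\<^esub> g),
     assoc := (\<lambda>Z Y X. inv\<^bsub>B\<^esub> (\<a>\<^bsub>B\<^esub> X Y Z)),
     lunit := runit B,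
     runit := lunit B\<rparr>"


section \<open>Invertible 1-morphisms and their inverses\<close>

definition invertible1 :: "('o, 'm, 'c) bicat \<Rightarrow> 'm \<Rightarrow> bool" where
  "invertible1 B X \<longleftrightarrow>
     X \<in> mor B \<and>
     (\<exists>Y \<in> hom B (trg B X) (src B X).
        isos B (\<one>\<^bsub>B\<^esub> (src B X)) (Y \<cdot>\<^bsub>B\<^esub> X) \<noteq> {} \<and>
        isos B (X \<cdot>\<^bsub>B\<^esub> Y) (\<one>\<^bsub>B\<^esub> (trg B X)) \<noteq> {})"

text \<open>
  The expression \<open>X\<^sup>-\<^sup>1\<close> presupposes a choice of an inverse, together with coherent isomorphisms
  \<open>iunit X : \<one> \<Rightarrow> X\<^sup>-\<^sup>1 \<cdot> X\<close> and \<open>icounit X : X \<cdot> X\<^sup>-\<^sup>1 \<Rightarrow> \<one>\<close>; it is the two triangle identities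
  that make the passage between a 2-isomorphism \<open>X \<Rightarrow> Y\<close> and a 2-isomorphism \<open>Y\<^sup>-\<^sup>1 \<Rightarrow> X\<^sup>-\<^sup>1\<close>
  unambiguous. Every invertible 1-morphism admits such data, so a choice always exists.
\<close>

record ('m, 'c) inverses =
  inv1 :: "'m \<Rightarrow> 'm"
  iunit :: "'m \<Rightarrow> 'c"
  icounit :: "'m \<Rightarrow> 'c"

locale inverse_choice =
  fixes B :: "('o, 'm, 'c) bicat" (structure) and J :: "('m, 'c) inverses"
  assumes inv1_hom:
      "\<lbrakk>invertible1 B X; X \<in> hom B a b\<rbrakk> \<Longrightarrow> inv1 J X \<in> hom B b a"
    and iunit_iso:
      "\<lbrakk>invertible1 B X; X \<in> hom B a b\<rbrakk> \<Longrightarrow> iunit J X \<in> isos B (\<one> a) (inv1 J X \<cdot> X)"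
    and icounit_iso:
      "\<lbrakk>invertible1 B X; X \<in> hom B a b\<rbrakk> \<Longrightarrow> icounit J X \<in> isos B (X \<cdot> inv1 J X) (\<one> b)"
    and triangle_left:
      "invertible1 B X \<Longrightarrow>
        \<l> X \<bullet> (icounit J X \<lhd> X) \<bullet> inv (\<a> X (inv1 J X) X) \<bullet> (X \<rhd> iunit J X) = \<r> X"
    and triangle_right:
      "invertible1 B X \<Longrightarrow>
        \<r> (inv1 J X) \<bullet> (inv1 J X \<rhd> icounit J X) \<bullet> \<a> (inv1 J X) X (inv1 J X)
          \<bullet> (iunit J X \<lhd> inv1 J X) = \<l> (inv1 J X)"

definition op1_inverses ::
    "('o, 'm, 'c) bicat \<Rightarrow> ('m, 'c) inverses \<Rightarrow> ('m, 'c) inverses" where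
  "op1_inverses B J =
     \<lparr>inv1 = inv1 J,
      iunit = (\<lambda>X. inv\<^bsub>B\<^esub> (icounit J X)),
      icounit = (\<lambda>X. inv\<^bsub>B\<^esub> (iunit J X))\<rparr>"


section \<open>2-functors, 2-transformations, modifications\<close>

text \<open>
  \<open>fcomp F Y X : F Y \<cdot> F X \<Rightarrow> F (Y \<cdot> X)\<close> and \<open>funit F a : \<one> (F a) \<Rightarrow> F (\<one> a)\<close>
  are the coherence isomorphisms of a 2-functor.
\<close>

record ('o, 'm, 'c, 'p, 'n, 'e) functor2 =
  f0 :: "'o \<Rightarrow> 'p"
  f1 :: "'m \<Rightarrow> 'n"
  f2 :: "'c \<Rightarrow> 'e"
  fcomp :: "'m \<Rightarrow> 'm \<Rightarrow> 'e"
  funit :: "'o \<Rightarrow> 'e"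

locale pseudofunctor =
  fixes B :: "('o, 'm, 'c) bicat"
    and C :: "('p, 'n, 'e) bicat" (structure)
    and F :: "('o, 'm, 'c, 'p, 'n, 'e) functor2"
  assumes f0_obj: "a \<in> obj B \<Longrightarrow> f0 F a \<in> obj C"
    and f1_hom: "X \<in> hom B a b \<Longrightarrow> f1 F X \<in> hom C (f0 F a) (f0 F b)"
    and f2_cells: "f \<in> cells B X Y \<Longrightarrow> f2 F f \<in> cells C (f1 F X) (f1 F Y)"
    and f2_id2: "X \<in> mor B \<Longrightarrow> f2 F (id2 B X) = id2 C (f1 F X)"
    and f2_vcomp:
      "\<lbrakk>f \<in> cells B X Y; g \<in> cells B Y Z\<rbrakk> \<Longrightarrow> f2 F (g \<bullet>\<^bsub>B\<^esub> f) = f2 F g \<bullet> f2 F f"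
    and fcomp_iso:
      "\<lbrakk>X \<in> hom B a b; Y \<in> hom B b c\<rbrakk>
        \<Longrightarrow> fcomp F Y X \<in> isos C (f1 F Y \<cdot> f1 F X) (f1 F (Y \<cdot>\<^bsub>B\<^esub> X))"
    and funit_iso: "a \<in> obj B \<Longrightarrow> funit F a \<in> isos C (\<one> (f0 F a)) (f1 F (\<one>\<^bsub>B\<^esub> a))"
    and fcomp_natural:
      "\<lbrakk>f \<in> cells B X X'; g \<in> cells B Y Y'; X \<in> hom B a b; Y \<in> hom B b c\<rbrakk>
        \<Longrightarrow> fcomp F Y' X' \<bullet> (f2 F g \<star> f2 F f) = f2 F (g \<star>\<^bsub>B\<^esub> f) \<bullet> fcomp F Y X"
    and fcomp_assoc:
      "\<lbrakk>X \<in> hom B a b; Y \<in> hom B b c; Z \<in> hom B c d\<rbrakk>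
        \<Longrightarrow> f2 F (\<a>\<^bsub>B\<^esub> Z Y X) \<bullet> fcomp F (Z \<cdot>\<^bsub>B\<^esub> Y) X \<bullet> (fcomp F Z Y \<lhd> f1 F X)
            = fcomp F Z (Y \<cdot>\<^bsub>B\<^esub> X) \<bullet> (f1 F Z \<rhd> fcomp F Y X) \<bullet> \<a> (f1 F Z) (f1 F Y) (f1 F X)"
    and fcomp_lunit:
      "X \<in> hom B a b \<Longrightarrow>
        f2 F (\<l>\<^bsub>B\<^esub> X) \<bullet> fcomp F (\<one>\<^bsub>B\<^esub> b) X \<bullet> (funit F b \<lhd> f1 F X) = \<l> (f1 F X)"
    and fcomp_runit:
      "X \<in> hom B a b \<Longrightarrow>
        f2 F (\<r>\<^bsub>B\<^esub> X) \<bullet> fcomp F X (\<one>\<^bsub>B\<^esub> a) \<bullet> (f1 F X \<rhd> funit F a) = \<r> (f1 F X)"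

definition id_functor :: "('o, 'm, 'c) bicat \<Rightarrow> ('o, 'm, 'c, 'o, 'm, 'c) functor2" where
  "id_functor B =
     \<lparr>f0 = (\<lambda>a. a), f1 = (\<lambda>X. X), f2 = (\<lambda>f. f),
      fcomp = (\<lambda>Y X. id2 B (Y \<cdot>\<^bsub>B\<^esub> X)), funit = (\<lambda>a. id2 B (\<one>\<^bsub>B\<^esub> a))\<rparr>"

definition comp_functor ::
    "('r, 'l, 'h) bicat \<Rightarrow> ('p, 'n, 'e, 'r, 'l, 'h) functor2
      \<Rightarrow> ('o, 'm, 'c, 'p, 'n, 'e) functor2 \<Rightarrow> ('o, 'm, 'c, 'r, 'l, 'h) functor2" where
  "comp_functor D G F =
     \<lparr>f0 = (\<lambda>a. f0 G (f0 F a)), f1 = (\<lambda>X. f1 G (f1 F X)), f2 = (\<lambda>f. f2 G (f2 F f)),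
      fcomp = (\<lambda>Y X. f2 G (fcomp F Y X) \<bullet>\<^bsub>D\<^esub> fcomp G (f1 F Y) (f1 F X)),
      funit = (\<lambda>a. f2 G (funit F a) \<bullet>\<^bsub>D\<^esub> funit G (f0 F a))\<rparr>"

text \<open>
  The same operation turns a 2-functor \<open>B \<rightarrow> C\<close> into one \<open>op1 B \<rightarrow> op1 C\<close>, and a 2-functor
  \<open>B \<rightarrow> op1 C\<close> into one \<open>op1 B \<rightarrow> C\<close>.
\<close>

definition op1_functor ::
    "('o, 'm, 'c, 'p, 'n, 'e) functor2 \<Rightarrow> ('o, 'm, 'c, 'p, 'n, 'e) functor2" where
  "op1_functor F = F\<lparr>fcomp := (\<lambda>Y X. fcomp F X Y)\<rparr>"

text \<open>
  A 2-transformation \<open>\<alpha> : F \<Rightarrow> G\<close> has components \<open>t1 \<alpha> a : F a \<rightarrow> G a\<close> and, for \<open>X : a \<rightarrow> b\<close>,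
  \<open>t2 \<alpha> X : G X \<cdot> t1 \<alpha> a \<Rightarrow> t1 \<alpha> b \<cdot> F X\<close>.
\<close>

record ('o, 'm, 'n, 'e) trans2 =
  t1 :: "'o \<Rightarrow> 'n"
  t2 :: "'m \<Rightarrow> 'e"

locale pseudotransformation =
  fixes B :: "('o, 'm, 'c) bicat"
    and C :: "('p, 'n, 'e) bicat" (structure)
    and F G :: "('o, 'm, 'c, 'p, 'n, 'e) functor2"
    and \<alpha> :: "('o, 'm, 'n, 'e) trans2"
  assumes t1_hom: "a \<in> obj B \<Longrightarrow> t1 \<alpha> a \<in> hom C (f0 F a) (f0 G a)"
    and t2_iso:
      "X \<in> hom B a b \<Longrightarrow> t2 \<alpha> X \<in> isos C (f1 G X \<cdot> t1 \<alpha> a) (t1 \<alpha> b \<cdot> f1 F X)"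
    and t2_natural:
      "\<lbrakk>f \<in> cells B X Y; X \<in> hom B a b\<rbrakk>
        \<Longrightarrow> t2 \<alpha> Y \<bullet> (f2 G f \<lhd> t1 \<alpha> a) = (t1 \<alpha> b \<rhd> f2 F f) \<bullet> t2 \<alpha> X"
    and t2_comp1:
      "\<lbrakk>X \<in> hom B a b; Y \<in> hom B b c\<rbrakk>
        \<Longrightarrow> t2 \<alpha> (Y \<cdot>\<^bsub>B\<^esub> X) \<bullet> (fcomp G Y X \<lhd> t1 \<alpha> a)
            = (t1 \<alpha> c \<rhd> fcomp F Y X) \<bullet> \<a> (t1 \<alpha> c) (f1 F Y) (f1 F X)
              \<bullet> (t2 \<alpha> Y \<lhd> f1 F X) \<bullet> inv (\<a> (f1 G Y) (t1 \<alpha> b) (f1 F X))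
              \<bullet> (f1 G Y \<rhd> t2 \<alpha> X) \<bullet> \<a> (f1 G Y) (f1 G X) (t1 \<alpha> a)"
    and t2_one:
      "a \<in> obj B \<Longrightarrow>
        t2 \<alpha> (\<one>\<^bsub>B\<^esub> a) \<bullet> (funit G a \<lhd> t1 \<alpha> a)
          = (t1 \<alpha> a \<rhd> funit F a) \<bullet> inv (\<r> (t1 \<alpha> a)) \<bullet> \<l> (t1 \<alpha> a)"

locale invertible_transformation = pseudotransformation +
  assumes t1_invertible: "a \<in> obj B \<Longrightarrow> invertible1 C (t1 \<alpha> a)"

text \<open>For \<open>\<alpha> : F \<Rightarrow> G\<close> and \<open>H\<close> defined on the target of \<open>F\<close> and \<open>G\<close>:
  the 2-transformation \<open>id\<^sub>H \<circ> \<alpha> : H F \<Rightarrow> H G\<close>.\<close>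

definition whisker_functor_left ::
    "('o, 'm, 'c) bicat \<Rightarrow> ('r, 'l, 'h) bicat \<Rightarrow> ('p, 'n, 'e, 'r, 'l, 'h) functor2
      \<Rightarrow> ('o, 'm, 'c, 'p, 'n, 'e) functor2 \<Rightarrow> ('o, 'm, 'c, 'p, 'n, 'e) functor2
      \<Rightarrow> ('o, 'm, 'n, 'e) trans2 \<Rightarrow> ('o, 'm, 'l, 'h) trans2" where
  "whisker_functor_left B D H F G \<alpha> =
     \<lparr>t1 = (\<lambda>a. f1 H (t1 \<alpha> a)),
      t2 = (\<lambda>X. inv\<^bsub>D\<^esub> (fcomp H (t1 \<alpha> (trg B X)) (f1 F X)) \<bullet>\<^bsub>D\<^esub> f2 H (t2 \<alpha> X)
                \<bullet>\<^bsub>D\<^esub> fcomp H (f1 G X) (t1 \<alpha> (src B X)))\<rparr>"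

definition whisker_functor_right ::
    "('p, 'n, 'l, 'h) trans2 \<Rightarrow> ('o, 'm, 'c, 'p, 'n, 'e) functor2
      \<Rightarrow> ('o, 'm, 'l, 'h) trans2" where
  "whisker_functor_right \<alpha> F = \<lparr>t1 = (\<lambda>a. t1 \<alpha> (f0 F a)), t2 = (\<lambda>X. t2 \<alpha> (f1 F X))\<rparr>"

text \<open>Reversing 1-morphisms turns \<open>\<alpha> : F \<Rightarrow> G\<close> into a 2-transformation from \<open>op1_functor G\<close> to
  \<open>op1_functor F\<close>, whose 2-morphism components are therefore the inverses of those of \<open>\<alpha>\<close>.\<close>

definition op1_trans ::
    "('p, 'n, 'e) bicat \<Rightarrow> ('o, 'm, 'n, 'e) trans2 \<Rightarrow> ('o, 'm, 'n, 'e) trans2" where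
  "op1_trans C \<alpha> = \<lparr>t1 = t1 \<alpha>, t2 = (\<lambda>X. inv\<^bsub>C\<^esub> (t2 \<alpha> X))\<rparr>"

text \<open>
  The inverse of \<open>\<alpha> : F \<Rightarrow> G\<close>: for \<open>X : a \<rightarrow> b\<close>, its 2-morphism component is
  \<open>F X \<alpha>\<^sub>a\<^sup>-\<^sup>1 \<cong> \<alpha>\<^sub>b\<^sup>-\<^sup>1 \<alpha>\<^sub>b F X \<alpha>\<^sub>a\<^sup>-\<^sup>1 \<cong> \<alpha>\<^sub>b\<^sup>-\<^sup>1 G X \<alpha>\<^sub>a \<alpha>\<^sub>a\<^sup>-\<^sup>1 \<cong> \<alpha>\<^sub>b\<^sup>-\<^sup>1 G X\<close>.
\<close>

definition inv_trans ::
    "('o, 'm, 'c) bicat \<Rightarrow> ('p, 'n, 'e) bicat \<Rightarrow> ('n, 'e) inverses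
      \<Rightarrow> ('o, 'm, 'c, 'p, 'n, 'e) functor2 \<Rightarrow> ('o, 'm, 'c, 'p, 'n, 'e) functor2
      \<Rightarrow> ('o, 'm, 'n, 'e) trans2 \<Rightarrow> ('o, 'm, 'n, 'e) trans2" where
  "inv_trans B C J F G \<alpha> =
     \<lparr>t1 = (\<lambda>a. inv1 J (t1 \<alpha> a)),
      t2 = (\<lambda>X.
        let P = t1 \<alpha> (src B X); P' = inv1 J P; Q = t1 \<alpha> (trg B X); Q' = inv1 J Q;
            FX = f1 F X; GX = f1 G X
        in (Q' \<rhd>\<^bsub>C\<^esub> \<r>\<^bsub>C\<^esub> GX) \<bullet>\<^bsub>C\<^esub> (Q' \<rhd>\<^bsub>C\<^esub> (GX \<rhd>\<^bsub>C\<^esub> icounit J P))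
           \<bullet>\<^bsub>C\<^esub> (Q' \<rhd>\<^bsub>C\<^esub> \<a>\<^bsub>C\<^esub> GX P P') \<bullet>\<^bsub>C\<^esub> (Q' \<rhd>\<^bsub>C\<^esub> (inv\<^bsub>C\<^esub> (t2 \<alpha> X) \<lhd>\<^bsub>C\<^esub> P'))
           \<bullet>\<^bsub>C\<^esub> (Q' \<rhd>\<^bsub>C\<^esub> inv\<^bsub>C\<^esub> (\<a>\<^bsub>C\<^esub> Q FX P')) \<bullet>\<^bsub>C\<^esub> \<a>\<^bsub>C\<^esub> Q' Q (FX \<cdot>\<^bsub>C\<^esub> P')
           \<bullet>\<^bsub>C\<^esub> (iunit J Q \<lhd>\<^bsub>C\<^esub> (FX \<cdot>\<^bsub>C\<^esub> P')) \<bullet>\<^bsub>C\<^esub> inv\<^bsub>C\<^esub> (\<l>\<^bsub>C\<^esub> (FX \<cdot>\<^bsub>C\<^esub> P')))\<rparr>"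

locale modification =
  fixes B :: "('o, 'm, 'c) bicat"
    and C :: "('p, 'n, 'e) bicat" (structure)
    and F G :: "('o, 'm, 'c, 'p, 'n, 'e) functor2"
    and \<alpha> \<beta> :: "('o, 'm, 'n, 'e) trans2"
    and \<Gamma> :: "'o \<Rightarrow> 'e"
  assumes modification_cells: "a \<in> obj B \<Longrightarrow> \<Gamma> a \<in> cells C (t1 \<alpha> a) (t1 \<beta> a)"
    and modification_natural:
      "X \<in> hom B a b \<Longrightarrow>
        (\<Gamma> b \<lhd> f1 F X) \<bullet> t2 \<alpha> X = t2 \<beta> X \<bullet> (f1 G X \<rhd> \<Gamma> a)"

locale invertible_modification = modification +
  assumes modification_iso: "a \<in> obj B \<Longrightarrow> \<Gamma> a \<in> isos C (t1 \<alpha> a) (t1 \<beta> a)"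


section \<open>Passing to inverse 1-morphisms\<close>

text \<open>For \<open>f : P\<^sup>-\<^sup>1 \<Rightarrow> Q\<close>, the induced
  \<open>P \<cong> P Q Q\<^sup>-\<^sup>1 \<cong> P P\<^sup>-\<^sup>1 Q\<^sup>-\<^sup>1 \<cong> Q\<^sup>-\<^sup>1\<close>.\<close>

definition transpose_inverse ::
    "('o, 'm, 'c) bicat \<Rightarrow> ('m, 'c) inverses \<Rightarrow> 'm \<Rightarrow> 'm \<Rightarrow> 'c \<Rightarrow> 'c" where
  "transpose_inverse B J P Q f =
     \<l>\<^bsub>B\<^esub> (inv1 J Q) \<bullet>\<^bsub>B\<^esub> (icounit J P \<lhd>\<^bsub>B\<^esub> inv1 J Q)
     \<bullet>\<^bsub>B\<^esub> inv\<^bsub>B\<^esub> (\<a>\<^bsub>B\<^esub> P (inv1 J P) (inv1 J Q))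
     \<bullet>\<^bsub>B\<^esub> (P \<rhd>\<^bsub>B\<^esub> (inv\<^bsub>B\<^esub> f \<lhd>\<^bsub>B\<^esub> inv1 J Q))
     \<bullet>\<^bsub>B\<^esub> (P \<rhd>\<^bsub>B\<^esub> inv\<^bsub>B\<^esub> (icounit J Q)) \<bullet>\<^bsub>B\<^esub> inv\<^bsub>B\<^esub> (\<r>\<^bsub>B\<^esub> P)"

text \<open>For \<open>f : P R \<Rightarrow> S\<close>, the induced \<open>R \<cong> P\<^sup>-\<^sup>1 P R \<Rightarrow> P\<^sup>-\<^sup>1 S\<close>.\<close>

definition move_left ::
    "('o, 'm, 'c) bicat \<Rightarrow> ('m, 'c) inverses \<Rightarrow> 'm \<Rightarrow> 'm \<Rightarrow> 'c \<Rightarrow> 'c" where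
  "move_left B J P R f =
     (inv1 J P \<rhd>\<^bsub>B\<^esub> f) \<bullet>\<^bsub>B\<^esub> \<a>\<^bsub>B\<^esub> (inv1 J P) P R
     \<bullet>\<^bsub>B\<^esub> (iunit J P \<lhd>\<^bsub>B\<^esub> R) \<bullet>\<^bsub>B\<^esub> inv\<^bsub>B\<^esub> (\<l>\<^bsub>B\<^esub> R)"

text \<open>For \<open>f : P\<^sup>-\<^sup>1 R \<Rightarrow> S\<close>, the induced \<open>R \<cong> P P\<^sup>-\<^sup>1 R \<Rightarrow> P S\<close>.\<close>

definition move_left_inverse ::
    "('o, 'm, 'c) bicat \<Rightarrow> ('m, 'c) inverses \<Rightarrow> 'm \<Rightarrow> 'm \<Rightarrow> 'c \<Rightarrow> 'c" where
  "move_left_inverse B J P R f =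
     (P \<rhd>\<^bsub>B\<^esub> f) \<bullet>\<^bsub>B\<^esub> \<a>\<^bsub>B\<^esub> P (inv1 J P) R
     \<bullet>\<^bsub>B\<^esub> (inv\<^bsub>B\<^esub> (icounit J P) \<lhd>\<^bsub>B\<^esub> R) \<bullet>\<^bsub>B\<^esub> inv\<^bsub>B\<^esub> (\<l>\<^bsub>B\<^esub> R)"

text \<open>
  A 2-isomorphism \<open>f : P Q\<^sup>-\<^sup>1 R \<Rightarrow> \<one>\<close> regarded as a 2-isomorphism
  \<open>\<one> \<Rightarrow> (P Q\<^sup>-\<^sup>1 R)\<^sup>-\<^sup>1 = R\<^sup>-\<^sup>1 Q P\<^sup>-\<^sup>1\<close>, by successively moving \<open>P\<close>, \<open>Q\<^sup>-\<^sup>1\<close> and \<open>R\<close>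
  to the other side.
\<close>

definition pass_to_inverses ::
    "('o, 'm, 'c) bicat \<Rightarrow> ('m, 'c) inverses \<Rightarrow> 'm \<Rightarrow> 'm \<Rightarrow> 'm \<Rightarrow> 'c \<Rightarrow> 'c" where
  "pass_to_inverses B J P Q R f =
     (let g = \<r>\<^bsub>B\<^esub> (inv1 J P) \<bullet>\<^bsub>B\<^esub> move_left B J P (inv1 J Q \<cdot>\<^bsub>B\<^esub> R) f;
          h = move_left_inverse B J Q R g
      in move_left B J R (\<one>\<^bsub>B\<^esub> (src B R)) (h \<bullet>\<^bsub>B\<^esub> \<r>\<^bsub>B\<^esub> R))"

text \<open>For \<open>d : B \<rightarrow> op1 B\<close>, the canonical
  \<open>d(X)\<^sup>-\<^sup>1 \<cong> d(X)\<^sup>-\<^sup>1 d(X\<^sup>-\<^sup>1 X) \<cong> d(X)\<^sup>-\<^sup>1 d(X) d(X\<^sup>-\<^sup>1) \<cong> d(X\<^sup>-\<^sup>1)\<close>.\<close>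

definition dual_inverse ::
    "('o, 'm, 'c) bicat \<Rightarrow> ('m, 'c) inverses \<Rightarrow> ('o, 'm, 'c, 'o, 'm, 'c) functor2
      \<Rightarrow> 'm \<Rightarrow> 'c" where
  "dual_inverse B J d X =
     (let X' = inv1 J X; dX = f1 d X; dX' = inv1 J dX
      in \<l>\<^bsub>B\<^esub> (f1 d X') \<bullet>\<^bsub>B\<^esub> (inv\<^bsub>B\<^esub> (iunit J dX) \<lhd>\<^bsub>B\<^esub> f1 d X')
         \<bullet>\<^bsub>B\<^esub> inv\<^bsub>B\<^esub> (\<a>\<^bsub>B\<^esub> dX' dX (f1 d X')) \<bullet>\<^bsub>B\<^esub> (dX' \<rhd>\<^bsub>B\<^esub> inv\<^bsub>B\<^esub> (fcomp d X' X))
         \<bullet>\<^bsub>B\<^esub> (dX' \<rhd>\<^bsub>B\<^esub> f2 d (iunit J X)) \<bullet>\<^bsub>B\<^esub> (dX' \<rhd>\<^bsub>B\<^esub> funit d (src B X))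
         \<bullet>\<^bsub>B\<^esub> inv\<^bsub>B\<^esub> (\<r>\<^bsub>B\<^esub> dX'))"


section \<open>O(1)-volutive and O(1)-dagger 2-categories\<close>

definition double_dual ::
    "('o, 'm, 'c) bicat \<Rightarrow> ('o, 'm, 'c, 'o, 'm, 'c) functor2
      \<Rightarrow> ('o, 'm, 'c, 'o, 'm, 'c) functor2" where
  "double_dual B d = comp_functor B (op1_functor d) d"

locale O1_volutive =
  bicategory B +
  inverse_choice B J +
  dual: pseudofunctor B "op1 B" d +
  eta: invertible_transformation B B "double_dual B d" "id_functor B" \<eta> +
  tau: invertible_modification B "op1 B" "comp_functor (op1 B) d (double_dual B d)" d
    "whisker_functor_right
       (inv_trans (op1 B) (op1 B) (op1_inverses B J)
          (id_functor (op1 B)) (op1_functor (double_dual B d)) (op1_trans B \<eta>)) d"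
    "whisker_functor_left B (op1 B) d (double_dual B d) (id_functor B) \<eta>"
    \<tau>
  for B :: "('o, 'm, 'c) bicat" (structure)
    and J :: "('m, 'c) inverses"
    and d :: "('o, 'm, 'c, 'o, 'm, 'c) functor2"
    and \<eta> :: "('o, 'm, 'm, 'c) trans2"
    and \<tau> :: "'o \<Rightarrow> 'c" +
  assumes tau_eta:
    "a \<in> obj B \<Longrightarrow>
      (t1 \<eta> a \<rhd> f2 d (\<tau> a))
      \<bullet> (t1 \<eta> a \<rhd> dual_inverse B J d (t1 \<eta> (f0 d a)))
      \<bullet> (t1 \<eta> a \<rhd> transpose_inverse B J
            (t1 \<eta> (f0 d (f0 d a))) (f1 d (t1 \<eta> (f0 d a))) (\<tau> (f0 d a)))
      = t2 \<eta> (t1 \<eta> a)"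

text \<open>
  Since \<open>\<eta>\<close> has identity 1-morphism components, \<open>t2 \<eta> X : X \<cdot> \<one> \<Rightarrow> \<one> \<cdot> d(d(X))\<close> amounts to
  a 2-morphism \<open>X \<Rightarrow> d(d(X))\<close>.
\<close>

definition dagger_cell ::
    "('o, 'm, 'c) bicat \<Rightarrow> ('o, 'm, 'c, 'o, 'm, 'c) functor2
      \<Rightarrow> ('o, 'm, 'm, 'c) trans2 \<Rightarrow> 'm \<Rightarrow> 'c" where
  "dagger_cell B d \<eta> X =
     \<l>\<^bsub>B\<^esub> (f1 d (f1 d X)) \<bullet>\<^bsub>B\<^esub> t2 \<eta> X \<bullet>\<^bsub>B\<^esub> inv\<^bsub>B\<^esub> (\<r>\<^bsub>B\<^esub> X)"

locale O1_dagger =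
  bicategory B +
  dual: pseudofunctor B "op1 B" d +
  eta: invertible_transformation B B "double_dual B d" "id_functor B" \<eta>
  for B :: "('o, 'm, 'c) bicat" (structure)
    and d :: "('o, 'm, 'c, 'o, 'm, 'c) functor2"
    and \<eta> :: "('o, 'm, 'm, 'c) trans2" +
  assumes dual_obj: "a \<in> obj B \<Longrightarrow> f0 d a = a"
    and eta_one: "a \<in> obj B \<Longrightarrow> t1 \<eta> a = \<one> a"
    and dual_eta: "X \<in> mor B \<Longrightarrow> f2 d (dagger_cell B d \<eta> X) = dagger_cell B d \<eta> (f1 d X)"


section \<open>Strictification\<close>

text \<open>
  Iterated composites are bracketed to the right: the 2-morphism of an object
  \<open>(c, \<theta>, \<Pi>)\<close> is \<open>\<Pi> : \<eta>\<^sub>c \<cdot> (d(\<theta>)\<^sup>-\<^sup>1 \<cdot> \<theta>) \<Rightarrow> \<one> c\<close>. A 1-morphism of the strictification is stored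
  as \<open>(A, X, A')\<close> with its source and target, and likewise a 2-morphism.
\<close>

type_synonym ('o, 'm, 'c) sobj = "'o \<times> 'm \<times> 'c"
type_synonym ('o, 'm, 'c) smor = "('o, 'm, 'c) sobj \<times> 'm \<times> ('o, 'm, 'c) sobj"
type_synonym ('o, 'm, 'c) scell = "('o, 'm, 'c) sobj \<times> 'c \<times> ('o, 'm, 'c) sobj"

locale volutive_data =
  fixes B :: "('o, 'm, 'c) bicat" (structure)
    and J :: "('m, 'c) inverses"
    and d :: "('o, 'm, 'c, 'o, 'm, 'c) functor2"
    and \<eta> :: "('o, 'm, 'm, 'c) trans2"
    and \<tau> :: "'o \<Rightarrow> 'c"
begin

text \<open>The 2-isomorphism \<open>d(\<theta>) (d\<^sup>2(\<theta>)\<^sup>-\<^sup>1 d(\<eta>\<^sub>c)) \<Rightarrow> \<one> (d c)\<close> given by \<open>d(\<Pi>)\<close>.\<close>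

definition dual_Pi :: "'o \<Rightarrow> 'm \<Rightarrow> 'c \<Rightarrow> 'c" where
  "dual_Pi c \<theta> \<Pi> =
     (let d\<theta> = f1 d \<theta>; dd\<theta>' = inv1 J (f1 d d\<theta>); d\<eta> = f1 d (t1 \<eta> c)
      in inv (funit d c) \<bullet> f2 d \<Pi>
         \<bullet> fcomp d (t1 \<eta> c) (inv1 J d\<theta> \<cdot> \<theta>)
         \<bullet> (fcomp d (inv1 J d\<theta>) \<theta> \<lhd> d\<eta>)
         \<bullet> ((d\<theta> \<rhd> dual_inverse B J d d\<theta>) \<lhd> d\<eta>)
         \<bullet> inv (\<a> d\<theta> dd\<theta>' d\<eta>))"

text \<open>
  The two 2-isomorphisms \<open>\<eta>\<^bsub>d(c)\<^esub> (d\<^sup>2(\<theta>) (d(\<theta>)\<^sup>-\<^sup>1 \<theta>)) \<Rightarrow> \<theta>\<close> whose equality is required of an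
  object: \<open>object_cell_1\<close> uses naturality of \<open>\<eta>\<close> at \<open>\<theta>\<close> and \<open>\<Pi>\<close>; \<open>object_cell_2\<close> uses
  \<open>\<eta>\<^bsub>d(c)\<^esub> \<cong> d(\<eta>\<^sub>c)\<^sup>-\<^sup>1\<close>, induced by \<open>\<tau>\<close>, and \<open>d(\<eta>\<^sub>c)\<^sup>-\<^sup>1 d\<^sup>2(\<theta>) d(\<theta>)\<^sup>-\<^sup>1 \<cong> \<one>\<close>, obtained
  from \<open>d(\<Pi>)\<close> by passing to inverse 1-morphisms.
\<close>

definition object_cell_1 :: "'o \<Rightarrow> 'm \<Rightarrow> 'c \<Rightarrow> 'c" where
  "object_cell_1 c \<theta> \<Pi> =
     (let T = inv1 J (f1 d \<theta>) \<cdot> \<theta>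
      in \<r> \<theta> \<bullet> (\<theta> \<rhd> \<Pi>) \<bullet> \<a> \<theta> (t1 \<eta> c) T \<bullet> (inv (t2 \<eta> \<theta>) \<lhd> T)
         \<bullet> inv (\<a> (t1 \<eta> (f0 d c)) (f1 d (f1 d \<theta>)) T))"

definition object_cell_2 :: "'o \<Rightarrow> 'm \<Rightarrow> 'c \<Rightarrow> 'c" where
  "object_cell_2 c \<theta> \<Pi> =
     (let d\<theta>' = inv1 J (f1 d \<theta>); dd\<theta> = f1 d (f1 d \<theta>); d\<eta> = f1 d (t1 \<eta> c); d\<eta>' = inv1 J d\<eta>
      in \<l> \<theta> \<bullet> (inv (pass_to_inverses B J (f1 d \<theta>) dd\<theta> d\<eta> (dual_Pi c \<theta> \<Pi>)) \<lhd> \<theta>)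
         \<bullet> inv (\<a> d\<eta>' (dd\<theta> \<cdot> d\<theta>') \<theta>)
         \<bullet> (d\<eta>' \<rhd> inv (\<a> dd\<theta> d\<theta>' \<theta>))
         \<bullet> (transpose_inverse B J (t1 \<eta> (f0 d c)) d\<eta> (\<tau> c) \<lhd> (dd\<theta> \<cdot> (d\<theta>' \<cdot> \<theta>))))"

definition S_obj :: "('o, 'm, 'c) sobj set" where
  "S_obj =
     {(c, \<theta>, \<Pi>). c \<in> obj B \<and> \<theta> \<in> hom B c (f0 d c) \<and> invertible1 B \<theta> \<and>
        \<Pi> \<in> isos B (t1 \<eta> c \<cdot> (inv1 J (f1 d \<theta>) \<cdot> \<theta>)) (\<one> c) \<and>
        object_cell_1 c \<theta> \<Pi> = object_cell_2 c \<theta> \<Pi>}"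

definition S_bicat :: "(('o, 'm, 'c) sobj, ('o, 'm, 'c) smor, ('o, 'm, 'c) scell) bicat" where
  "S_bicat =
     \<lparr>obj = S_obj,
      mor = {(A, X, A'). A \<in> S_obj \<and> A' \<in> S_obj \<and> X \<in> hom B (fst A) (fst A')},
      src = (\<lambda>(A, X, A'). A),
      trg = (\<lambda>(A, X, A'). A'),
      one = (\<lambda>A. (A, \<one> (fst A), A)),
      comp1 = (\<lambda>(A', Y, A'') (A, X, _). (A, Y \<cdot> X, A'')),
      cell = {(A, f, A'). A \<in> S_obj \<and> A' \<in> S_obj \<and> f \<in> cell B \<and>
                dom2 B f \<in> hom B (fst A) (fst A')},
      dom2 = (\<lambda>(A, f, A'). (A, dom2 B f, A')),
      cod2 = (\<lambda>(A, f, A'). (A, cod2 B f, A')),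
      id2 = (\<lambda>(A, X, A'). (A, id2 B X, A')),
      vcomp = (\<lambda>(A, g, A') (_, f, _). (A, g \<bullet> f, A')),
      hcomp = (\<lambda>(A', g, A'') (A, f, _). (A, g \<star> f, A'')),
      assoc = (\<lambda>(_, Z, D) (_, Y, _) (A, X, _). (A, \<a> Z Y X, D)),
      lunit = (\<lambda>(A, X, A'). (A, \<l> X, A')),
      runit = (\<lambda>(A, X, A'). (A, \<r> X, A'))\<rparr>"

text \<open>
  The coherence isomorphisms of the 2-functor \<open>S d\<close>:
  \<open>\<theta>\<^sub>a\<^sup>-\<^sup>1 d(X) \<theta>\<^sub>b \<theta>\<^sub>b\<^sup>-\<^sup>1 d(Y) \<theta>\<^sub>c \<cong> \<theta>\<^sub>a\<^sup>-\<^sup>1 d(X) d(Y) \<theta>\<^sub>c \<cong> \<theta>\<^sub>a\<^sup>-\<^sup>1 d(Y X) \<theta>\<^sub>c\<close>, where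
  \<open>\<theta>\<close>, \<open>\<theta>'\<close>, \<open>\<theta>''\<close> stand for \<open>\<theta>\<^sub>a\<close>, \<open>\<theta>\<^sub>b\<close>, \<open>\<theta>\<^sub>c\<close>, and
  \<open>\<one> a \<cong> \<theta>\<^sub>a\<^sup>-\<^sup>1 \<theta>\<^sub>a \<cong> \<theta>\<^sub>a\<^sup>-\<^sup>1 d(\<one> a) \<theta>\<^sub>a\<close>.
\<close>

definition S_fcomp :: "'m \<Rightarrow> 'm \<Rightarrow> 'm \<Rightarrow> 'm \<Rightarrow> 'm \<Rightarrow> 'c" where
  "S_fcomp \<theta> \<theta>' \<theta>'' Y X =
     (let i = inv1 J \<theta>; i' = inv1 J \<theta>'; dX = f1 d X; dY = f1 d Y; T = dY \<cdot> \<theta>''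
      in (i \<rhd> (fcomp d Y X \<lhd> \<theta>'')) \<bullet> (i \<rhd> inv (\<a> dX dY \<theta>''))
         \<bullet> (i \<rhd> (dX \<rhd> \<l> T)) \<bullet> (i \<rhd> (dX \<rhd> (icounit J \<theta>' \<lhd> T)))
         \<bullet> (i \<rhd> (dX \<rhd> inv (\<a> \<theta>' i' T))) \<bullet> (i \<rhd> \<a> dX \<theta>' (i' \<cdot> T))
         \<bullet> \<a> i (dX \<cdot> \<theta>') (i' \<cdot> T))"

definition S_funit :: "'o \<Rightarrow> 'm \<Rightarrow> 'c" where
  "S_funit a \<theta> =
     (inv1 J \<theta> \<rhd> (funit d a \<lhd> \<theta>)) \<bullet> (inv1 J \<theta> \<rhd> inv (\<l> \<theta>)) \<bullet> iunit J \<theta>"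

definition S_dual ::
    "(('o, 'm, 'c) sobj, ('o, 'm, 'c) smor, ('o, 'm, 'c) scell,
      ('o, 'm, 'c) sobj, ('o, 'm, 'c) smor, ('o, 'm, 'c) scell) functor2" where
  "S_dual =
     \<lparr>f0 = (\<lambda>A. A),
      f1 = (\<lambda>((a, \<theta>, \<Pi>), X, (b, \<theta>', \<Pi>')).
              ((b, \<theta>', \<Pi>'), inv1 J \<theta> \<cdot> (f1 d X \<cdot> \<theta>'), (a, \<theta>, \<Pi>))),
      f2 = (\<lambda>((a, \<theta>, \<Pi>), f, (b, \<theta>', \<Pi>')).
              ((b, \<theta>', \<Pi>'), inv1 J \<theta> \<rhd> (f2 d f \<lhd> \<theta>'), (a, \<theta>, \<Pi>))),
      fcomp = (\<lambda>((b, \<theta>', \<Pi>'), Y, (c, \<theta>'', \<Pi>'')) ((a, \<theta>, \<Pi>), X, _).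
              ((c, \<theta>'', \<Pi>''), S_fcomp \<theta> \<theta>' \<theta>'' Y X, (a, \<theta>, \<Pi>))),
      funit = (\<lambda>(a, \<theta>, \<Pi>). ((a, \<theta>, \<Pi>), S_funit a \<theta>, (a, \<theta>, \<Pi>)))\<rparr>"

text \<open>The 2-morphism \<open>\<eta>\<^sub>b\<^sup>-\<^sup>1 (X \<eta>\<^sub>a) \<Rightarrow> d\<^sup>2(X)\<close> induced by \<open>\<eta>\<^sub>X\<close>, for \<open>X : a \<rightarrow> b\<close>.\<close>

definition eta_induced :: "'m \<Rightarrow> 'c" where
  "eta_induced X =
     (let \<eta>b = t1 \<eta> (trg B X); ddX = f1 d (f1 d X)
      in \<l> ddX \<bullet> (inv (iunit J \<eta>b) \<lhd> ddX) \<bullet> inv (\<a> (inv1 J \<eta>b) \<eta>b ddX)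
         \<bullet> (inv1 J \<eta>b \<rhd> t2 \<eta> X))"

text \<open>
  For \<open>X : (a, \<theta>, \<Pi>) \<rightarrow> (b, \<theta>', \<Pi>')\<close>, the identification
  \<open>\<theta>\<^sub>b\<^sup>-\<^sup>1 d(\<theta>\<^sub>b) d\<^sup>2(X) d(\<theta>\<^sub>a)\<^sup>-\<^sup>1 \<theta>\<^sub>a \<cong> \<theta>\<^sub>b\<^sup>-\<^sup>1 d(\<theta>\<^sub>a\<^sup>-\<^sup>1 d(X) \<theta>\<^sub>b) \<theta>\<^sub>a\<close>.
\<close>

definition S_double_dual_iso :: "'m \<Rightarrow> 'm \<Rightarrow> 'm \<Rightarrow> 'c" where
  "S_double_dual_iso \<theta> \<theta>' X =
     (let i = inv1 J \<theta>; i' = inv1 J \<theta>'; d\<theta> = f1 d \<theta>; d\<theta>' = f1 d \<theta>'; j = inv1 J d\<theta>;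
          dX = f1 d X; ddX = f1 d dX
      in i' \<rhd> ((fcomp d i (dX \<cdot> \<theta>') \<bullet> (fcomp d dX \<theta>' \<lhd> f1 d i)
                  \<bullet> inv (\<a> d\<theta>' ddX (f1 d i))
                  \<bullet> (d\<theta>' \<rhd> (ddX \<rhd> dual_inverse B J d \<theta>))) \<lhd> \<theta>
               \<bullet> inv (\<a> d\<theta>' (ddX \<cdot> j) \<theta>) \<bullet> (d\<theta>' \<rhd> inv (\<a> ddX j \<theta>))))"

definition S_eta_cell :: "('o, 'm, 'c) smor \<Rightarrow> 'c" where
  "S_eta_cell = (\<lambda>((a, \<theta>, \<Pi>), X, (b, \<theta>', \<Pi>')).
     let \<eta>a = t1 \<eta> a; \<eta>b' = inv1 J (t1 \<eta> b); d\<theta>' = f1 d \<theta>';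
         i' = inv1 J \<theta>'; T = inv1 J (f1 d \<theta>) \<cdot> \<theta>; R = \<eta>a \<cdot> T
     in S_double_dual_iso \<theta> \<theta>' X
        \<bullet> (i' \<rhd> (d\<theta>' \<rhd> (eta_induced X \<lhd> T \<bullet> inv (\<a> \<eta>b' (X \<cdot> \<eta>a) T)
                          \<bullet> (\<eta>b' \<rhd> inv (\<a> X \<eta>a T)))))
        \<bullet> (i' \<rhd> \<a> d\<theta>' \<eta>b' (X \<cdot> R)) \<bullet> \<a> i' (d\<theta>' \<cdot> \<eta>b') (X \<cdot> R)
        \<bullet> (pass_to_inverses B J (t1 \<eta> b) d\<theta>' \<theta>' \<Pi>' \<star> (X \<rhd> inv \<Pi>))
        \<bullet> inv (\<l> (X \<cdot> \<one> a)) \<bullet> inv (\<r> X))"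

text \<open>\<open>S_eta_cell X : X \<Rightarrow> (S d)\<^sup>2(X)\<close> is converted by the unit isomorphisms to the form
  \<open>X \<cdot> \<one> \<Rightarrow> \<one> \<cdot> (S d)\<^sup>2(X)\<close> of a component of a 2-transformation.\<close>

definition S_eta ::
    "(('o, 'm, 'c) sobj, ('o, 'm, 'c) smor, ('o, 'm, 'c) smor, ('o, 'm, 'c) scell) trans2" where
  "S_eta =
     \<lparr>t1 = (\<lambda>A. (A, \<one> (fst A), A)),
      t2 = (\<lambda>(A, X, A').
              (A, inv (\<l> (fst (snd (f1 S_dual (f1 S_dual (A, X, A'))))))
                    \<bullet> S_eta_cell (A, X, A') \<bullet> \<r> X, A'))\<rparr>"

end

end

theory Submission
  imports Defs
begin

text \<open>
  Coherence isomorphisms are dealt with by diagrams: a 2-morphism between composites bracketed in any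
  way, with units and with duals of composites, is transported to one between the right-bracketed
  composites of the lists of factors, where both compositions are strictly associative and \<open>d\<close>
  is a strict contravariant operation.

  On diagrams, an object \<open>(a, \<theta>\<^sub>a, \<Pi>\<^sub>a)\<close> amounts to a form \<open>p\<^sub>a : \<theta>\<^sub>a \<eta>\<^sub>a \<Rightarrow> d(\<theta>\<^sub>a)\<close>, a mate of
  \<open>\<Pi>\<^sub>a\<close>, and the condition on \<open>\<Pi>\<^sub>a\<close> says that the form is symmetric with respect to \<open>\<eta>\<close> and \<open>\<tau>\<close>.
  For \<open>X : a \<rightarrow> b\<close> and \<open>Y : b \<rightarrow> a\<close>, call \<open>\<phi> : \<theta>\<^sub>a Y \<Rightarrow> d(X) \<theta>\<^sub>b\<close> and \<open>\<psi> : \<theta>\<^sub>b X \<Rightarrow> d(Y) \<theta>\<^sub>a\<close> adjoint if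
  \<open>d(\<phi>) \<circ> d(Y) p\<^sub>a \<circ> \<psi> \<eta>\<^sub>a = p\<^sub>b d\<^sup>2(X) \<circ> \<theta>\<^sub>b \<eta>\<^sub>X\<close>.
  An invertible \<open>\<phi>\<close> determines \<open>\<psi>\<close>, the relation is compatible with composition, and it is symmetric
  because the forms are symmetric and \<open>\<tau>\<close> is a modification.
  For \<open>Y = \<theta>\<^sub>a\<^sup>-\<^sup>1 d(X) \<theta>\<^sub>b\<close> the counit \<open>\<epsilon>\<^sub>X : \<theta>\<^sub>a Y \<Rightarrow> d(X) \<theta>\<^sub>b\<close> is adjoint to \<open>\<epsilon>\<^sub>Y \<circ> \<theta>\<^sub>b (S \<eta>)\<^sub>X\<close>, which
  determines \<open>(S \<eta>)\<^sub>X\<close>. Hence naturality and the behaviour of \<open>S \<eta>\<close> on composites and units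
  follow from the compatibility of the relation, and \<open>d((S \<eta>)\<^sub>X) = (S \<eta>)\<^bsub>d(X)\<^esub>\<close> from its symmetry.
\<close>

section \<open>Bicategories\<close>

text \<open>A direct attack fails on the shape of (S eta)_X: it contains two objects'
  \<open>\<Pi>\<close>, one of them inverted, then eta_X and the comparison of d(theta)^-1 with
  d(theta^-1), and its dual would have to be matched with a component at d(X) in which all of these
  occur again. The boundary of the mate p_a contains no chosen inverse, so d can be applied to it
  without comparison isomorphisms; the comparison is absorbed once for the objects and once for the
  counits. Adjointness imitates operators between spaces with forms: phi witnesses that Y is the
  adjoint of X, psi that X is the adjoint of Y, and the equation says that these witnesses are
  transposes of each other. The psi belonging to an invertible phi is unique because d(phi) and p_a
  are invertible and whiskering by the equivalence eta_a is faithful. The relation itself does not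
  mention tau. It enters only through symmetry, and there as a pairing eta_{d(a)} d(eta_a) => 1,
  which again keeps chosen inverses off the boundary.\<close>

lemma hom_iff: "X \<in> hom B a b \<longleftrightarrow> X \<in> mor B \<and> src B X = a \<and> trg B X = b"
  by (simp add: hom_def)

lemma cells_iff: "f \<in> cells B X Y \<longleftrightarrow> f \<in> cell B \<and> dom2 B f = X \<and> cod2 B f = Y"
  by (simp add: cells_def)

definition iso2 :: "('o, 'm, 'c) bicat \<Rightarrow> 'c \<Rightarrow> bool" where
  "iso2 B f \<longleftrightarrow> (\<exists>g. inverse_cells B f g)"

lemma isos_iff: "f \<in> isos B X Y \<longleftrightarrow> f \<in> cell B \<and> dom2 B f = X \<and> cod2 B f = Y \<and> iso2 B f"
  by (auto simp: isos_def iso2_def cells_def)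

section \<open>Calculus of 2-morphisms and coherence of the unitors\<close>

context bicategory
begin

text \<open>Here and below the axioms are recast with equations between sources and targets as
  hypotheses in place of membership in hom sets, so that rewriting can discharge typing
  conditions.\<close>

lemma mor_src_trg [simp]:
  "X \<in> mor B \<Longrightarrow> src B X \<in> obj B" "X \<in> mor B \<Longrightarrow> trg B X \<in> obj B"
  by (rule src_obj trg_obj; assumption)+

lemma one_simps [simp]:
  assumes "a \<in> obj B" shows "\<one> a \<in> mor B" "src B (\<one> a) = a" "trg B (\<one> a) = a"
  using one_hom[OF assms] by (auto simp: hom_def)

lemma comp1_simps [simp]:
  assumes "X \<in> mor B" "Y \<in> mor B" "src B Y = trg B X"
  shows "Y \<cdot> X \<in> mor B" "src B (Y \<cdot> X) = src B X" "trg B (Y \<cdot> X) = trg B Y"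
  using comp1_hom[of X "src B X" "trg B X" Y "trg B Y"] assms by (auto simp: hom_def)

lemma cell_simps [simp]:
  assumes "f \<in> cell B"
  shows "dom2 B f \<in> mor B" "cod2 B f \<in> mor B"
    "src B (cod2 B f) = src B (dom2 B f)" "trg B (cod2 B f) = trg B (dom2 B f)"
  using dom2_mor[OF assms] cod2_hom[OF assms] by (auto simp: hom_def)

lemma id2_simps [simp]:
  assumes "X \<in> mor B" shows "id2 B X \<in> cell B" "dom2 B (id2 B X) = X" "cod2 B (id2 B X) = X"
  using id2_cells[OF assms] by (auto simp: cells_def)

lemma vcomp_simps [simp]:
  assumes "f \<in> cell B" "g \<in> cell B" "dom2 B g = cod2 B f"
  shows "g \<bullet> f \<in> cell B" "dom2 B (g \<bullet> f) = dom2 B f" "cod2 B (g \<bullet> f) = cod2 B g"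
  using vcomp_cells[of f "dom2 B f" "cod2 B f" g "cod2 B g"] assms by (auto simp: cells_def)

lemma hcomp_simps [simp]:
  assumes "f \<in> cell B" "g \<in> cell B" "src B (dom2 B g) = trg B (dom2 B f)"
  shows "g \<star> f \<in> cell B" "dom2 B (g \<star> f) = dom2 B g \<cdot> dom2 B f"
    "cod2 B (g \<star> f) = cod2 B g \<cdot> cod2 B f"
  using hcomp_cells[of f "dom2 B f" "cod2 B f" g "dom2 B g" "cod2 B g"
      "src B (dom2 B f)" "trg B (dom2 B f)" "trg B (dom2 B g)"] assms
  by (auto simp: cells_def hom_def)

lemma vcomp_assoc' [simp]:
  assumes "f \<in> cell B" "g \<in> cell B" "h \<in> cell B" "dom2 B g = cod2 B f" "dom2 B h = cod2 B g"
  shows "(h \<bullet> g) \<bullet> f = h \<bullet> g \<bullet> f"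
  using vcomp_assoc[of f "dom2 B f" "cod2 B f" g "cod2 B g" h "cod2 B h"] assms
  by (simp add: cells_def)

lemma vcomp_id [simp]:
  "f \<in> cell B \<Longrightarrow> cod2 B f = X \<Longrightarrow> id2 B X \<bullet> f = f"
  "f \<in> cell B \<Longrightarrow> dom2 B f = X \<Longrightarrow> f \<bullet> id2 B X = f"
  using vcomp_id2_left[of f] vcomp_id2_right[of f] by (auto simp: cells_def)

lemma hcomp_id [simp]:
  assumes "X \<in> mor B" "Y \<in> mor B" "src B Y = trg B X"
  shows "id2 B Y \<star> id2 B X = id2 B (Y \<cdot> X)"
  using hcomp_id2[of X "src B X" "trg B X" Y "trg B Y"] assms by (auto simp: hom_def)

lemma hcomp_vcomp:
  assumes "f \<in> cell B" "g \<in> cell B" "f' \<in> cell B" "g' \<in> cell B"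
    "dom2 B f' = cod2 B f" "dom2 B g' = cod2 B g" "src B (dom2 B g) = trg B (dom2 B f)"
  shows "(g' \<bullet> g) \<star> (f' \<bullet> f) = (g' \<star> f') \<bullet> (g \<star> f)"
  using interchange[of f "dom2 B f" "cod2 B f" f' "cod2 B f'" g "dom2 B g" "cod2 B g" g' "cod2 B g'"
      "src B (dom2 B f)" "trg B (dom2 B f)" "trg B (dom2 B g)"] assms
  by (simp add: cells_def hom_def)

lemma lwhisker_vcomp:
  assumes "f \<in> cell B" "f' \<in> cell B" "dom2 B f' = cod2 B f" "X \<in> mor B" "src B X = trg B (dom2 B f)"
  shows "X \<rhd> (f' \<bullet> f) = (X \<rhd> f') \<bullet> (X \<rhd> f)"
  using hcomp_vcomp[of f "id2 B X" f' "id2 B X"] assms by simp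

lemma rwhisker_vcomp:
  assumes "g \<in> cell B" "g' \<in> cell B" "dom2 B g' = cod2 B g" "X \<in> mor B" "src B (dom2 B g) = trg B X"
  shows "(g' \<bullet> g) \<lhd> X = (g' \<lhd> X) \<bullet> (g \<lhd> X)"
  using hcomp_vcomp[of "id2 B X" g "id2 B X" g'] assms by simp

lemma inverse_cells_unique:
  assumes "inverse_cells B f g" "inverse_cells B f g'" shows "g = g'"
proof -
  have "g' = g' \<bullet> f \<bullet> g" using assms by (auto simp: inverse_cells_def cells_def)
  also have "\<dots> = (g' \<bullet> f) \<bullet> g" using assms by (subst vcomp_assoc') (auto simp: inverse_cells_def cells_def)
  also have "\<dots> = g" using assms by (auto simp: inverse_cells_def cells_def)
  finally show ?thesis by simp
qed

lemma inv2_eq: "inverse_cells B f g \<Longrightarrow> inv f = g"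
  unfolding inv2_def by (rule the_equality) (auto intro: inverse_cells_unique)

lemma iso2_inverse: "iso2 B f \<Longrightarrow> inverse_cells B f (inv f)"
  using inv2_eq by (auto simp: iso2_def)

lemma iso2_cell: "iso2 B f \<Longrightarrow> f \<in> cell B"
  by (auto simp: iso2_def inverse_cells_def)

lemma inv2_simps [simp]:
  assumes "iso2 B f"
  shows "inv f \<in> cell B" "dom2 B (inv f) = cod2 B f" "cod2 B (inv f) = dom2 B f"
    "inv f \<bullet> f = id2 B (dom2 B f)" "f \<bullet> inv f = id2 B (cod2 B f)"
  using iso2_inverse[OF assms] by (auto simp: inverse_cells_def cells_def)

lemma inverse_cells_sym: "inverse_cells B f g \<Longrightarrow> inverse_cells B g f"
  by (auto simp: inverse_cells_def cells_def)

lemma iso2_inv [simp]: assumes "iso2 B f" shows "iso2 B (inv f)" "inv (inv f) = f"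
  using inverse_cells_sym[OF iso2_inverse[OF assms]] inv2_eq by (auto simp: iso2_def)

lemma inv2_cancel [simp]:
  assumes "iso2 B f"
  shows "g \<in> cell B \<Longrightarrow> cod2 B g = dom2 B f \<Longrightarrow> inv f \<bullet> f \<bullet> g = g"
    "g \<in> cell B \<Longrightarrow> cod2 B g = cod2 B f \<Longrightarrow> f \<bullet> inv f \<bullet> g = g"
  using assms iso2_cell[OF assms]
  by (auto simp flip: vcomp_assoc')

lemma inverse_cells_vcomp:
  assumes "inverse_cells B f f'" "inverse_cells B g g'" "dom2 B g = cod2 B f"
  shows "inverse_cells B (g \<bullet> f) (f' \<bullet> g')"
proof -
  have c: "f \<in> cell B" "f' \<in> cell B" "g \<in> cell B" "g' \<in> cell B"
    "dom2 B f' = cod2 B f" "cod2 B f' = dom2 B f" "dom2 B g' = cod2 B g" "cod2 B g' = dom2 B g"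
    "f' \<bullet> f = id2 B (dom2 B f)" "f \<bullet> f' = id2 B (cod2 B f)"
    "g' \<bullet> g = id2 B (dom2 B g)" "g \<bullet> g' = id2 B (cod2 B g)"
    using assms by (auto simp: inverse_cells_def cells_def)
  have i: "inv f = f'" "inv g = g'" "iso2 B f" "iso2 B g" using assms inv2_eq by (auto simp: iso2_def)
  have "(f' \<bullet> g') \<bullet> (g \<bullet> f) = id2 B (dom2 B f)" "(g \<bullet> f) \<bullet> (f' \<bullet> g') = id2 B (cod2 B g)"
    using c assms(3) inv2_cancel[OF i(3)] inv2_cancel[OF i(4)] by (simp_all add: i)
  then show ?thesis using c assms(3) by (simp add: inverse_cells_def cells_def)
qed

lemma iso2_vcomp [simp]:
  assumes "iso2 B f" "iso2 B g" "dom2 B g = cod2 B f"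
  shows "iso2 B (g \<bullet> f)" "inv (g \<bullet> f) = inv f \<bullet> inv g"
  using inverse_cells_vcomp[OF assms(1,2)[THEN iso2_inverse] assms(3)] inv2_eq by (auto simp: iso2_def)

lemma inverse_cells_id: "X \<in> mor B \<Longrightarrow> inverse_cells B (id2 B X) (id2 B X)"
  by (simp add: inverse_cells_def cells_def)

lemma iso2_id [simp]: "X \<in> mor B \<Longrightarrow> iso2 B (id2 B X)" "X \<in> mor B \<Longrightarrow> inv (id2 B X) = id2 B X"
  using inverse_cells_id inv2_eq by (auto simp: iso2_def)

lemma inverse_cells_hcomp:
  assumes "inverse_cells B f f'" "inverse_cells B g g'" "src B (dom2 B g) = trg B (dom2 B f)"
  shows "inverse_cells B (g \<star> f) (g' \<star> f')"
proof -
  have c: "f \<in> cell B" "f' \<in> cell B" "g \<in> cell B" "g' \<in> cell B"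
    "dom2 B f' = cod2 B f" "cod2 B f' = dom2 B f" "dom2 B g' = cod2 B g" "cod2 B g' = dom2 B g"
    "f' \<bullet> f = id2 B (dom2 B f)" "f \<bullet> f' = id2 B (cod2 B f)"
    "g' \<bullet> g = id2 B (dom2 B g)" "g \<bullet> g' = id2 B (cod2 B g)"
    using assms by (auto simp: inverse_cells_def cells_def)
  then show ?thesis using assms(3) by (simp add: inverse_cells_def cells_def flip: hcomp_vcomp)
qed

lemma iso2_hcomp [simp]:
  assumes "iso2 B f" "iso2 B g" "src B (dom2 B g) = trg B (dom2 B f)"
  shows "iso2 B (g \<star> f)" "inv (g \<star> f) = inv g \<star> inv f"
  using inverse_cells_hcomp[OF assms(1,2)[THEN iso2_inverse] assms(3)] inv2_eq by (auto simp: iso2_def)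

lemma iso2_cancel_left:
  assumes "iso2 B h" "f \<in> cell B" "g \<in> cell B" "cod2 B f = dom2 B h" "cod2 B g = dom2 B h"
    "h \<bullet> f = h \<bullet> g"
  shows "f = g"
  using assms inv2_cancel(1) by metis

lemma iso2_cancel_right:
  assumes "iso2 B h" "f \<in> cell B" "g \<in> cell B" "dom2 B f = cod2 B h" "dom2 B g = cod2 B h"
    "f \<bullet> h = g \<bullet> h"
  shows "f = g"
proof -
  have "(f \<bullet> h) \<bullet> inv h = (g \<bullet> h) \<bullet> inv h" using assms by simp
  then show ?thesis using assms(1-5) iso2_cell[OF assms(1)] by simp
qed

lemma assoc_simps [simp]:
  assumes "X \<in> mor B" "Y \<in> mor B" "Z \<in> mor B" "src B Y = trg B X" "src B Z = trg B Y"
  shows "\<a> Z Y X \<in> cell B" "dom2 B (\<a> Z Y X) = (Z \<cdot> Y) \<cdot> X" "cod2 B (\<a> Z Y X) = Z \<cdot> Y \<cdot> X"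
    "iso2 B (\<a> Z Y X)"
  using assoc_iso[of X "src B X" "trg B X" Y "trg B Y" Z "trg B Z"] assms
  by (auto simp: hom_iff isos_iff)

lemma lunit_simps [simp]:
  assumes "X \<in> mor B"
  shows "\<l> X \<in> cell B" "dom2 B (\<l> X) = \<one> (trg B X) \<cdot> X" "cod2 B (\<l> X) = X" "iso2 B (\<l> X)"
  using lunit_iso[of X "src B X" "trg B X"] assms by (auto simp: hom_iff isos_iff)

lemma runit_simps [simp]:
  assumes "X \<in> mor B"
  shows "\<r> X \<in> cell B" "dom2 B (\<r> X) = X \<cdot> \<one> (src B X)" "cod2 B (\<r> X) = X" "iso2 B (\<r> X)"
  using runit_iso[of X "src B X" "trg B X"] assms by (auto simp: hom_iff isos_iff)

lemma assoc_nat: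
  assumes "f \<in> cell B" "g \<in> cell B" "h \<in> cell B"
    "src B (dom2 B g) = trg B (dom2 B f)" "src B (dom2 B h) = trg B (dom2 B g)"
    "dom2 B f = X" "dom2 B g = Y" "dom2 B h = Z" "cod2 B f = X'" "cod2 B g = Y'" "cod2 B h = Z'"
  shows "\<a> Z' Y' X' \<bullet> ((h \<star> g) \<star> f) = (h \<star> (g \<star> f)) \<bullet> \<a> Z Y X"
  by (rule assoc_natural[where a = "src B X" and b = "trg B X" and c = "trg B Y" and d = "trg B Z"])
    (use assms in \<open>auto simp: hom_iff cells_iff\<close>)

lemma lunit_nat:
  assumes "f \<in> cell B" "cod2 B f = X'" "dom2 B f = X" "trg B X = b"
  shows "\<l> X' \<bullet> (\<one> b \<rhd> f) = f \<bullet> \<l> X"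
  by (rule lunit_natural) (use assms in \<open>auto simp: cells_iff hom_iff\<close>)

lemma runit_nat:
  assumes "f \<in> cell B" "cod2 B f = X'" "dom2 B f = X" "src B X = a"
  shows "\<r> X' \<bullet> (f \<lhd> \<one> a) = f \<bullet> \<r> X"
  by (rule runit_natural) (use assms in \<open>auto simp: cells_iff hom_iff\<close>)

lemma pentagon':
  assumes "W \<in> mor B" "X \<in> mor B" "Y \<in> mor B" "Z \<in> mor B"
    "src B X = trg B W" "src B Y = trg B X" "src B Z = trg B Y"
  shows "\<a> Z Y (X \<cdot> W) \<bullet> \<a> (Z \<cdot> Y) X W
            = (Z \<rhd> \<a> Y X W) \<bullet> \<a> Z (Y \<cdot> X) W \<bullet> (\<a> Z Y X \<lhd> W)"
  by (rule pentagon[where a = "src B W" and b = "trg B W" and c = "trg B X" and d = "trg B Y" and e = "trg B Z"])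
    (use assms in \<open>simp_all add: hom_iff\<close>)

lemma triangle':
  assumes "X \<in> mor B" "Y \<in> mor B" "src B Y = trg B X" "trg B X = b"
  shows "(Y \<rhd> \<l> X) \<bullet> \<a> Y (\<one> b) X = \<r> Y \<lhd> X"
  by (rule triangle[where a = "src B X" and c = "trg B Y"]) (use assms in \<open>simp_all add: hom_iff\<close>)

text \<open>Naturality of the unitors rewrites \<open>f \<bullet> \<l> X\<close> through the
  whiskered 2-morphism, and the unitors are invertible.\<close>

lemma one_whisker_inject:
  assumes "f \<in> cell B" "g \<in> cell B" "dom2 B f = dom2 B g" "cod2 B f = cod2 B g"
  shows "\<one> (trg B (dom2 B f)) \<rhd> f = \<one> (trg B (dom2 B f)) \<rhd> g \<Longrightarrow> f = g"
    "f \<lhd> \<one> (src B (dom2 B f)) = g \<lhd> \<one> (src B (dom2 B f)) \<Longrightarrow> f = g"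
proof -
  assume *: "\<one> (trg B (dom2 B f)) \<rhd> f = \<one> (trg B (dom2 B f)) \<rhd> g"
  have "f \<bullet> \<l> (dom2 B f) = g \<bullet> \<l> (dom2 B f)"
    using assms * lunit_nat[OF assms(1) refl refl refl] lunit_nat[OF assms(2) refl refl refl] by simp
  then show "f = g" by (rule iso2_cancel_right[rotated -1]) (simp_all add: assms)
next
  assume *: "f \<lhd> \<one> (src B (dom2 B f)) = g \<lhd> \<one> (src B (dom2 B f))"
  have "f \<bullet> \<r> (dom2 B f) = g \<bullet> \<r> (dom2 B f)"
    using assms * runit_nat[OF assms(1) refl refl refl] runit_nat[OF assms(2) refl refl refl] by simp
  then show "f = g" by (rule iso2_cancel_right[rotated -1]) (simp_all add: assms)
qed

text \<open>Vertical composites are kept bracketed to the right, so an equation for two adjacent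
  factors is usable in the middle of a composite only in the form with a tail
  \<open>h\<close>.\<close>

lemma vcomp_extend:
  assumes "g \<bullet> f = k" "f \<in> cell B" "g \<in> cell B" "dom2 B g = cod2 B f" "h \<in> cell B" "cod2 B h = dom2 B f"
  shows "g \<bullet> f \<bullet> h = k \<bullet> h"
  using assms by (simp flip: vcomp_assoc')

text \<open>Kelly's argument: the identity is not among the axioms, but after whiskering by the unit
  on the left it follows from one pentagon and two triangles, and such a whiskering can be
  cancelled.\<close>

lemma lunit_comp1:
  assumes [simp]: "X \<in> mor B" "Y \<in> mor B" "src B Y = trg B X" "trg B Y = c"
  shows "\<l> (Y \<cdot> X) \<bullet> \<a> (\<one> c) Y X = \<l> Y \<lhd> X"
proof -
  have [simp]: "c \<in> obj B" using mor_src_trg(2)[of Y] by simp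
  let ?k = "\<a> (\<one> c) (\<one> c \<cdot> Y) X \<bullet> (\<a> (\<one> c) (\<one> c) Y \<lhd> X)"
  have "(\<one> c \<rhd> (\<l> (Y \<cdot> X) \<bullet> \<a> (\<one> c) Y X)) \<bullet> ?k
      = (\<one> c \<rhd> \<l> (Y \<cdot> X)) \<bullet> (\<one> c \<rhd> \<a> (\<one> c) Y X) \<bullet> ?k"
    by (simp add: lwhisker_vcomp)
  also have "\<dots> = (\<one> c \<rhd> \<l> (Y \<cdot> X)) \<bullet> \<a> (\<one> c) (\<one> c) (Y \<cdot> X) \<bullet> \<a> (\<one> c \<cdot> \<one> c) Y X"
    by (simp add: pentagon')
  also have "\<dots> = (\<r> (\<one> c) \<lhd> (Y \<cdot> X)) \<bullet> \<a> (\<one> c \<cdot> \<one> c) Y X"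
    by (rule vcomp_extend) (simp_all add: triangle')
  also have "\<dots> = \<a> (\<one> c) Y X \<bullet> ((\<r> (\<one> c) \<lhd> Y) \<lhd> X)"
    using assoc_nat[of "id2 B X" "id2 B Y" "\<r> (\<one> c)" X Y "\<one> c \<cdot> \<one> c" X Y "\<one> c"] by simp
  also have "\<r> (\<one> c) \<lhd> Y = (\<one> c \<rhd> \<l> Y) \<bullet> \<a> (\<one> c) (\<one> c) Y"
    by (simp add: triangle')
  also have "\<a> (\<one> c) Y X \<bullet> (((\<one> c \<rhd> \<l> Y) \<bullet> \<a> (\<one> c) (\<one> c) Y) \<lhd> X)
      = \<a> (\<one> c) Y X \<bullet> ((\<one> c \<rhd> \<l> Y) \<lhd> X) \<bullet> (\<a> (\<one> c) (\<one> c) Y \<lhd> X)"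
    by (simp add: rwhisker_vcomp)
  also have "\<dots> = ((\<one> c \<rhd> (\<l> Y \<lhd> X)) \<bullet> \<a> (\<one> c) (\<one> c \<cdot> Y) X) \<bullet> (\<a> (\<one> c) (\<one> c) Y \<lhd> X)"
    by (rule vcomp_extend) (simp_all add: assoc_nat)
  also have "\<dots> = (\<one> c \<rhd> (\<l> Y \<lhd> X)) \<bullet> ?k"
    by simp
  finally have "\<one> c \<rhd> (\<l> (Y \<cdot> X) \<bullet> \<a> (\<one> c) Y X) = \<one> c \<rhd> (\<l> Y \<lhd> X)"
    by (rule iso2_cancel_right[rotated -1]) simp_all
  then show ?thesis by - (rule one_whisker_inject(1), simp_all)
qed

text \<open>Mirror image of the preceding argument, with the unit whiskered on the right.\<close>

lemma runit_comp1:
  assumes [simp]: "X \<in> mor B" "Y \<in> mor B" "src B Y = trg B X" "src B X = a"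
  shows "(Y \<rhd> \<r> X) \<bullet> \<a> Y X (\<one> a) = \<r> (Y \<cdot> X)"
proof -
  have [simp]: "a \<in> obj B" using mor_src_trg(1)[of X] by simp
  have "\<a> Y X (\<one> a) \<bullet> (((Y \<rhd> \<r> X) \<bullet> \<a> Y X (\<one> a)) \<lhd> \<one> a)
      = \<a> Y X (\<one> a) \<bullet> ((Y \<rhd> \<r> X) \<lhd> \<one> a) \<bullet> (\<a> Y X (\<one> a) \<lhd> \<one> a)"
    by (simp add: rwhisker_vcomp)
  also have "\<dots> = ((Y \<rhd> (\<r> X \<lhd> \<one> a)) \<bullet> \<a> Y (X \<cdot> \<one> a) (\<one> a)) \<bullet> (\<a> Y X (\<one> a) \<lhd> \<one> a)"
    by (rule vcomp_extend) (simp_all add: assoc_nat)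
  also have "\<r> X \<lhd> \<one> a = (X \<rhd> \<l> (\<one> a)) \<bullet> \<a> X (\<one> a) (\<one> a)"
    by (simp add: triangle')
  also have "((Y \<rhd> ((X \<rhd> \<l> (\<one> a)) \<bullet> \<a> X (\<one> a) (\<one> a))) \<bullet> \<a> Y (X \<cdot> \<one> a) (\<one> a)) \<bullet> (\<a> Y X (\<one> a) \<lhd> \<one> a)
     = (Y \<rhd> (X \<rhd> \<l> (\<one> a))) \<bullet> \<a> Y X (\<one> a \<cdot> \<one> a) \<bullet> \<a> (Y \<cdot> X) (\<one> a) (\<one> a)"
    by (simp add: lwhisker_vcomp pentagon')
  also have "\<dots> = (\<a> Y X (\<one> a) \<bullet> ((Y \<cdot> X) \<rhd> \<l> (\<one> a))) \<bullet> \<a> (Y \<cdot> X) (\<one> a) (\<one> a)"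
    by (rule vcomp_extend) (use assoc_nat[of "\<l> (\<one> a)" "id2 B X" "id2 B Y" "\<one> a \<cdot> \<one> a" X Y "\<one> a" X Y] in simp_all)
  also have "\<dots> = \<a> Y X (\<one> a) \<bullet> (\<r> (Y \<cdot> X) \<lhd> \<one> a)"
    by (simp add: triangle')
  finally have "((Y \<rhd> \<r> X) \<bullet> \<a> Y X (\<one> a)) \<lhd> \<one> a = \<r> (Y \<cdot> X) \<lhd> \<one> a"
    by (rule iso2_cancel_left[rotated -1]) simp_all
  then show ?thesis by - (rule one_whisker_inject(2), simp_all)
qed

text \<open>Naturality of the left unitor at itself identifies
  \<open>\<one> a \<rhd> \<l> (\<one> a)\<close> with
  \<open>\<l> (\<one> a \<cdot> \<one> a)\<close>. Then \<open>lunit_comp1\<close> and the triangle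
  express the same 2-morphism by \<open>\<l>\<close> and by \<open>\<r>\<close>.\<close>

lemma lunit_one_eq_runit_one:
  assumes [simp]: "a \<in> obj B" shows "\<l> (\<one> a) = \<r> (\<one> a)"
proof -
  have "\<l> (\<one> a) \<bullet> (\<one> a \<rhd> \<l> (\<one> a)) = \<l> (\<one> a) \<bullet> \<l> (\<one> a \<cdot> \<one> a)"
    using lunit_nat[of "\<l> (\<one> a)" "\<one> a" "\<one> a \<cdot> \<one> a" a] by simp
  then have *: "\<one> a \<rhd> \<l> (\<one> a) = \<l> (\<one> a \<cdot> \<one> a)"
    by (rule iso2_cancel_left[rotated -1]) simp_all
  have "\<l> (\<one> a) \<lhd> \<one> a = \<r> (\<one> a) \<lhd> \<one> a"
    using lunit_comp1[of "\<one> a" "\<one> a" a] triangle'[of "\<one> a" "\<one> a" a] * by simp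
  then show ?thesis by - (rule one_whisker_inject(2), simp_all)
qed

end

section \<open>Diagrams\<close>

text \<open>
  A diagram \<open>PCell a xs f ys\<close> is a 2-morphism \<open>f\<close> between the composites of two lists of 1-morphisms
  starting at \<open>a\<close>; the head of a list is the 1-morphism that is applied last. \<open>PNull\<close> is the value
  of ill-typed composites, which makes both compositions associative without any hypotheses.
\<close>

datatype ('o, 'm, 'c) pcell = PCell (psrc: 'o) (pdom: "'m list") (pun: 'c) (pcod: "'m list") | PNull

section \<open>Lists of 1-morphisms and their composites\<close>

context bicategory
begin

text \<open>The starting object is a separate argument because the empty list, which stands for an
  identity, carries no endpoints.\<close>

primrec tgt :: "'o \<Rightarrow> 'm list \<Rightarrow> 'o" where
  "tgt a [] = a"
| "tgt a (X # xs) = trg B X"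

primrec path :: "'o \<Rightarrow> 'm list \<Rightarrow> bool" where
  "path a [] \<longleftrightarrow> a \<in> obj B"
| "path a (X # xs) \<longleftrightarrow> X \<in> mor B \<and> src B X = tgt a xs \<and> path a xs"

text \<open>Every composite ends in an identity, even for a single factor: \<open>ev a [X]\<close>
  is \<open>X \<cdot> \<one> a\<close>. This keeps the recursion for \<open>cj\<close> uniform and
  is the origin of the right unitors in \<open>phi\<close> and \<open>tcan\<close>.\<close>

primrec ev :: "'o \<Rightarrow> 'm list \<Rightarrow> 'm" where
  "ev a [] = \<one> a"
| "ev a (X # xs) = X \<cdot> ev a xs"

text \<open>The coherence isomorphism from the product of two composites to the composite of the
  concatenated list: associators, and one left unitor that removes the identity at the end of the
  first composite.\<close>

primrec cj :: "'o \<Rightarrow> 'm list \<Rightarrow> 'm list \<Rightarrow> 'c" where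
  "cj a [] ys = \<l> (ev a ys)"
| "cj a (X # xs) ys = (X \<rhd> cj a xs ys) \<bullet> \<a> X (ev (tgt a ys) xs) (ev a ys)"

lemma tgt_append [simp]: "tgt a (xs @ ys) = tgt (tgt a ys) xs"
  by (cases xs) auto

lemma path_append [simp]: "path a (xs @ ys) \<longleftrightarrow> path a ys \<and> path (tgt a ys) xs"
proof (induction xs)
  case Nil
  have "path a ys \<Longrightarrow> tgt a ys \<in> obj B" by (cases ys) auto
  then show ?case by auto
qed auto

lemma ev_simps [simp]:
  assumes "path a xs"
  shows "ev a xs \<in> mor B" "src B (ev a xs) = a" "trg B (ev a xs) = tgt a xs"
proof -
  have "ev a xs \<in> mor B \<and> src B (ev a xs) = a \<and> trg B (ev a xs) = tgt a xs"
    using assms by (induction xs) auto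
  then show "ev a xs \<in> mor B" "src B (ev a xs) = a" "trg B (ev a xs) = tgt a xs" by auto
qed

lemma path_tgt_obj [simp]: "path a xs \<Longrightarrow> tgt a xs \<in> obj B"
  by (cases xs) auto

lemma path_src_obj: "path a xs \<Longrightarrow> a \<in> obj B"
  by (induction xs) auto

lemma cj_simps [simp]:
  assumes "path a ys" "path (tgt a ys) xs"
  shows "cj a xs ys \<in> cell B" "dom2 B (cj a xs ys) = ev (tgt a ys) xs \<cdot> ev a ys"
    "cod2 B (cj a xs ys) = ev a (xs @ ys)" "iso2 B (cj a xs ys)"
proof -
  have "cj a xs ys \<in> cell B \<and> dom2 B (cj a xs ys) = ev (tgt a ys) xs \<cdot> ev a ys \<and>
    cod2 B (cj a xs ys) = ev a (xs @ ys) \<and> iso2 B (cj a xs ys)"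
    using assms by (induction xs) auto
  then show "cj a xs ys \<in> cell B" "dom2 B (cj a xs ys) = ev (tgt a ys) xs \<cdot> ev a ys"
    "cod2 B (cj a xs ys) = ev a (xs @ ys)" "iso2 B (cj a xs ys)" by auto
qed

text \<open>Source of the strict right unit law for diagrams: the empty list needs the equality of
  both unitors at an identity, and each further factor needs \<open>runit_comp1\<close>.\<close>

lemma cj_Nil_right: "path a xs \<Longrightarrow> cj a xs [] = \<r> (ev a xs)"
  by (induction xs) (auto simp: lunit_one_eq_runit_one runit_comp1 path_src_obj)

text \<open>Source of the strict associativity of the horizontal composition of diagrams. Induction
  on the leftmost list: the empty list is \<open>lunit_comp1\<close>, and a further factor is a
  pentagon together with naturality of the associator.\<close>

lemma cj_assoc:
  assumes "path a zs" "path (tgt a zs) ys" "path (tgt (tgt a zs) ys) xs"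
  shows "cj a (xs @ ys) zs \<bullet> (cj (tgt a zs) xs ys \<lhd> ev a zs)
    = cj a xs (ys @ zs) \<bullet> (ev (tgt (tgt a zs) ys) xs \<rhd> cj a ys zs)
      \<bullet> \<a> (ev (tgt (tgt a zs) ys) xs) (ev (tgt a zs) ys) (ev a zs)"
  using assms
proof (induction xs)
  case Nil
  let ?b = "tgt a zs" let ?c = "tgt ?b ys"
  have "cj a ys zs \<bullet> (\<l> (ev ?b ys) \<lhd> ev a zs)
      = cj a ys zs \<bullet> \<l> (ev ?b ys \<cdot> ev a zs) \<bullet> \<a> (\<one> ?c) (ev ?b ys) (ev a zs)"
    using Nil by (simp add: lunit_comp1)
  also have "\<dots> = (\<l> (ev a (ys @ zs)) \<bullet> (\<one> ?c \<rhd> cj a ys zs)) \<bullet> \<a> (\<one> ?c) (ev ?b ys) (ev a zs)"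
    using Nil lunit_nat[of "cj a ys zs" "ev a (ys @ zs)" "ev ?b ys \<cdot> ev a zs" ?c] by simp
  finally show ?case using Nil by simp
next
  case (Cons X xs)
  let ?b = "tgt a zs" let ?c = "tgt ?b ys"
  let ?x = "ev ?c xs" let ?y = "ev ?b ys" let ?z = "ev a zs"
  note [simp] = Cons.prems(1,2)
  have [simp]: "path ?c xs" "X \<in> mor B" "src B X = tgt ?c xs" using Cons.prems(3) by auto
  have "((X \<rhd> cj a (xs @ ys) zs) \<bullet> \<a> X (ev ?b (xs @ ys)) ?z) \<bullet> (((X \<rhd> cj ?b xs ys) \<bullet> \<a> X ?x ?y) \<lhd> ?z)
      = (X \<rhd> cj a (xs @ ys) zs) \<bullet> (\<a> X (ev ?b (xs @ ys)) ?z \<bullet> ((X \<rhd> cj ?b xs ys) \<lhd> ?z)) \<bullet> (\<a> X ?x ?y \<lhd> ?z)"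
    by (simp add: rwhisker_vcomp)
  also have "\<a> X (ev ?b (xs @ ys)) ?z \<bullet> ((X \<rhd> cj ?b xs ys) \<lhd> ?z)
      = (X \<rhd> (cj ?b xs ys \<lhd> ?z)) \<bullet> \<a> X (?x \<cdot> ?y) ?z"
    by (rule assoc_nat) simp_all
  also have "(X \<rhd> cj a (xs @ ys) zs) \<bullet> ((X \<rhd> (cj ?b xs ys \<lhd> ?z)) \<bullet> \<a> X (?x \<cdot> ?y) ?z) \<bullet> (\<a> X ?x ?y \<lhd> ?z)
     = (X \<rhd> (cj a (xs @ ys) zs \<bullet> (cj ?b xs ys \<lhd> ?z))) \<bullet> \<a> X (?x \<cdot> ?y) ?z \<bullet> (\<a> X ?x ?y \<lhd> ?z)"
    by (simp add: lwhisker_vcomp)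
  also have "cj a (xs @ ys) zs \<bullet> (cj ?b xs ys \<lhd> ?z)
      = cj a xs (ys @ zs) \<bullet> (?x \<rhd> cj a ys zs) \<bullet> \<a> ?x ?y ?z"
    using Cons.IH by simp
  also have "(X \<rhd> \<dots>) \<bullet> \<a> X (?x \<cdot> ?y) ?z \<bullet> (\<a> X ?x ?y \<lhd> ?z)
     = (X \<rhd> cj a xs (ys @ zs)) \<bullet> (X \<rhd> (?x \<rhd> cj a ys zs)) \<bullet>
       (X \<rhd> \<a> ?x ?y ?z) \<bullet> \<a> X (?x \<cdot> ?y) ?z \<bullet> (\<a> X ?x ?y \<lhd> ?z)"
    by (simp add: lwhisker_vcomp)
  also have "(X \<rhd> \<a> ?x ?y ?z) \<bullet> \<a> X (?x \<cdot> ?y) ?z \<bullet> (\<a> X ?x ?y \<lhd> ?z)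
     = \<a> X ?x (?y \<cdot> ?z) \<bullet> \<a> (X \<cdot> ?x) ?y ?z"
    by (rule pentagon'[symmetric]) simp_all
  also have "(X \<rhd> (?x \<rhd> cj a ys zs)) \<bullet> \<a> X ?x (?y \<cdot> ?z) \<bullet> \<a> (X \<cdot> ?x) ?y ?z
     = (\<a> X ?x (ev a (ys @ zs)) \<bullet> ((X \<cdot> ?x) \<rhd> cj a ys zs)) \<bullet> \<a> (X \<cdot> ?x) ?y ?z"
    by (rule vcomp_extend)
      (use assoc_nat[of "cj a ys zs" "id2 B ?x" "id2 B X" "?y \<cdot> ?z" ?x X "ev a (ys @ zs)" ?x X] in simp_all)
  finally show ?case by simp
qed

section \<open>Vertical and horizontal composition of diagrams\<close>

definition parr :: "('o, 'm, 'c) pcell \<Rightarrow> bool" where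
  "parr \<phi> \<longleftrightarrow> \<phi> \<noteq> PNull \<and> path (psrc \<phi>) (pdom \<phi>) \<and> path (psrc \<phi>) (pcod \<phi>) \<and> pun \<phi> \<in> cell B \<and>
     dom2 B (pun \<phi>) = ev (psrc \<phi>) (pdom \<phi>) \<and> cod2 B (pun \<phi>) = ev (psrc \<phi>) (pcod \<phi>)"

definition ptrg :: "('o, 'm, 'c) pcell \<Rightarrow> 'o" where
  "ptrg \<phi> = tgt (psrc \<phi>) (pdom \<phi>)"

definition pcomp :: "('o, 'm, 'c) pcell \<Rightarrow> ('o, 'm, 'c) pcell \<Rightarrow> ('o, 'm, 'c) pcell" (infixr \<open>\<odot>\<close> 55) where
  "\<psi> \<odot> \<phi> = (if parr \<phi> \<and> parr \<psi> \<and> psrc \<phi> = psrc \<psi> \<and> pcod \<phi> = pdom \<psi>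
     then PCell (psrc \<phi>) (pdom \<phi>) (pun \<psi> \<bullet> pun \<phi>) (pcod \<psi>) else PNull)"

definition ptensor :: "('o, 'm, 'c) pcell \<Rightarrow> ('o, 'm, 'c) pcell \<Rightarrow> ('o, 'm, 'c) pcell" (infixr \<open>\<otimes>\<close> 60) where
  "\<psi> \<otimes> \<phi> = (if parr \<phi> \<and> parr \<psi> \<and> ptrg \<phi> = psrc \<psi>
     then PCell (psrc \<phi>) (pdom \<psi> @ pdom \<phi>)
       (cj (psrc \<phi>) (pcod \<psi>) (pcod \<phi>) \<bullet> (pun \<psi> \<star> pun \<phi>) \<bullet> inv (cj (psrc \<phi>) (pdom \<psi>) (pdom \<phi>)))
       (pcod \<psi> @ pcod \<phi>) else PNull)"

definition pid :: "'o \<Rightarrow> 'm list \<Rightarrow> ('o, 'm, 'c) pcell" where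
  "pid a xs = (if path a xs then PCell a xs (id2 B (ev a xs)) xs else PNull)"

text \<open>Not guarded by a typing test, in contrast to the compositions; the result is meaningful
  only under \<open>piso\<close>.\<close>

definition pinv :: "('o, 'm, 'c) pcell \<Rightarrow> ('o, 'm, 'c) pcell" where
  "pinv \<phi> = PCell (psrc \<phi>) (pcod \<phi>) (inv (pun \<phi>)) (pdom \<phi>)"

definition piso :: "('o, 'm, 'c) pcell \<Rightarrow> bool" where
  "piso \<phi> \<longleftrightarrow> parr \<phi> \<and> iso2 B (pun \<phi>)"

lemma pcell_eqI:
  "parr \<phi> \<Longrightarrow> parr \<psi> \<Longrightarrow> psrc \<phi> = psrc \<psi> \<Longrightarrow> pdom \<phi> = pdom \<psi> \<Longrightarrow> pcod \<phi> = pcod \<psi> \<Longrightarrow> pun \<phi> = pun \<psi> \<Longrightarrow> \<phi> = \<psi>"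
  by (cases \<phi>; cases \<psi>) (auto simp: parr_def)

lemma parr_PNull [simp]: "\<not> parr PNull"
  by (simp add: parr_def)

lemma parrD [simp]:
  assumes "parr \<phi>"
  shows "path (psrc \<phi>) (pdom \<phi>)" "path (psrc \<phi>) (pcod \<phi>)" "pun \<phi> \<in> cell B"
    "dom2 B (pun \<phi>) = ev (psrc \<phi>) (pdom \<phi>)" "cod2 B (pun \<phi>) = ev (psrc \<phi>) (pcod \<phi>)"
    "tgt (psrc \<phi>) (pdom \<phi>) = ptrg \<phi>" "tgt (psrc \<phi>) (pcod \<phi>) = ptrg \<phi>"
proof -
  show *: "path (psrc \<phi>) (pdom \<phi>)" "path (psrc \<phi>) (pcod \<phi>)" "pun \<phi> \<in> cell B"
    "dom2 B (pun \<phi>) = ev (psrc \<phi>) (pdom \<phi>)" "cod2 B (pun \<phi>) = ev (psrc \<phi>) (pcod \<phi>)"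
    "tgt (psrc \<phi>) (pdom \<phi>) = ptrg \<phi>"
    using assms by (auto simp: parr_def ptrg_def)
  show "tgt (psrc \<phi>) (pcod \<phi>) = ptrg \<phi>"
    using * cell_simps(4)[OF *(3)] by (metis ev_simps(3))
qed

lemma parr_pcomp [simp]:
  "parr (\<psi> \<odot> \<phi>) \<longleftrightarrow> parr \<phi> \<and> parr \<psi> \<and> psrc \<phi> = psrc \<psi> \<and> pcod \<phi> = pdom \<psi>"
proof -
  have "parr (PCell (psrc \<phi>) (pdom \<phi>) (pun \<psi> \<bullet> pun \<phi>) (pcod \<psi>))"
    if "parr \<phi>" "parr \<psi>" "psrc \<phi> = psrc \<psi>" "pcod \<phi> = pdom \<psi>"
    using that parrD[OF that(1)] parrD[OF that(2)] unfolding parr_def[of "PCell _ _ _ _"] by simp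
  then show ?thesis by (simp add: pcomp_def)
qed

lemma pcomp_simps:
  assumes "parr (\<psi> \<odot> \<phi>)"
  shows "psrc (\<psi> \<odot> \<phi>) = psrc \<phi>" "pdom (\<psi> \<odot> \<phi>) = pdom \<phi>" "pcod (\<psi> \<odot> \<phi>) = pcod \<psi>"
    "pun (\<psi> \<odot> \<phi>) = pun \<psi> \<bullet> pun \<phi>" "ptrg (\<psi> \<odot> \<phi>) = ptrg \<phi>"
proof -
  show *: "psrc (\<psi> \<odot> \<phi>) = psrc \<phi>" "pdom (\<psi> \<odot> \<phi>) = pdom \<phi>" "pcod (\<psi> \<odot> \<phi>) = pcod \<psi>"
    "pun (\<psi> \<odot> \<phi>) = pun \<psi> \<bullet> pun \<phi>"
    using assms by (auto simp: pcomp_def)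
  show "ptrg (\<psi> \<odot> \<phi>) = ptrg \<phi>" by (simp only: * ptrg_def)
qed

lemma pcomp_assoc [simp]: "(\<chi> \<odot> \<psi>) \<odot> \<phi> = \<chi> \<odot> \<psi> \<odot> \<phi>"
proof (cases "parr \<phi> \<and> parr \<psi> \<and> parr \<chi> \<and> psrc \<phi> = psrc \<psi> \<and> psrc \<psi> = psrc \<chi> \<and> pcod \<phi> = pdom \<psi> \<and> pcod \<psi> = pdom \<chi>")
  case True
  then have "parr (\<psi> \<odot> \<phi>)" "parr (\<chi> \<odot> \<psi>)" by simp_all
  note s = this[THEN pcomp_simps(1)] this[THEN pcomp_simps(2)] this[THEN pcomp_simps(3)] this[THEN pcomp_simps(4)]
  have "parr ((\<chi> \<odot> \<psi>) \<odot> \<phi>)" "parr (\<chi> \<odot> \<psi> \<odot> \<phi>)" using True s by simp_all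
  note s' = this[THEN pcomp_simps(1)] this[THEN pcomp_simps(2)] this[THEN pcomp_simps(3)] this[THEN pcomp_simps(4)]
  show ?thesis by (rule pcell_eqI) (use True s s' in simp_all)
next
  case False
  have n: "\<not> parr ((\<chi> \<odot> \<psi>) \<odot> \<phi>)" "\<not> parr (\<chi> \<odot> \<psi> \<odot> \<phi>)"
    using False pcomp_simps(1,2,3)[of \<chi> \<psi>] pcomp_simps(1,2,3)[of \<psi> \<phi>] by (auto simp del: parr_pcomp simp: parr_pcomp[of \<chi>] parr_pcomp[of _ \<phi>])
  have "\<And>\<alpha> \<beta>. \<not> parr (\<alpha> \<odot> \<beta>) \<Longrightarrow> \<alpha> \<odot> \<beta> = PNull"
    unfolding parr_pcomp by (auto simp: pcomp_def)
  with n show ?thesis by metis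
qed

lemma parr_ptensor [simp]:
  "parr (\<psi> \<otimes> \<phi>) \<longleftrightarrow> parr \<phi> \<and> parr \<psi> \<and> ptrg \<phi> = psrc \<psi>"
proof -
  have "parr (PCell (psrc \<phi>) (pdom \<psi> @ pdom \<phi>)
       (cj (psrc \<phi>) (pcod \<psi>) (pcod \<phi>) \<bullet> (pun \<psi> \<star> pun \<phi>) \<bullet> inv (cj (psrc \<phi>) (pdom \<psi>) (pdom \<phi>)))
       (pcod \<psi> @ pcod \<phi>))"
    if "parr \<phi>" "parr \<psi>" "ptrg \<phi> = psrc \<psi>"
    using that parrD[OF that(1)] parrD[OF that(2)] unfolding parr_def[of "PCell _ _ _ _"] by simp
  then show ?thesis by (simp add: ptensor_def)
qed

lemma ptensor_simps:
  assumes "parr (\<psi> \<otimes> \<phi>)"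
  shows "psrc (\<psi> \<otimes> \<phi>) = psrc \<phi>" "pdom (\<psi> \<otimes> \<phi>) = pdom \<psi> @ pdom \<phi>" "pcod (\<psi> \<otimes> \<phi>) = pcod \<psi> @ pcod \<phi>"
    "pun (\<psi> \<otimes> \<phi>) = cj (psrc \<phi>) (pcod \<psi>) (pcod \<phi>) \<bullet> (pun \<psi> \<star> pun \<phi>) \<bullet> inv (cj (psrc \<phi>) (pdom \<psi>) (pdom \<phi>))"
    "ptrg (\<psi> \<otimes> \<phi>) = ptrg \<psi>"
proof -
  show *: "psrc (\<psi> \<otimes> \<phi>) = psrc \<phi>" "pdom (\<psi> \<otimes> \<phi>) = pdom \<psi> @ pdom \<phi>" "pcod (\<psi> \<otimes> \<phi>) = pcod \<psi> @ pcod \<phi>"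
    "pun (\<psi> \<otimes> \<phi>) = cj (psrc \<phi>) (pcod \<psi>) (pcod \<phi>) \<bullet> (pun \<psi> \<star> pun \<phi>) \<bullet> inv (cj (psrc \<phi>) (pdom \<psi>) (pdom \<phi>))"
    using assms by (auto simp: ptensor_def)
  show "ptrg (\<psi> \<otimes> \<phi>) = ptrg \<psi>"
    using assms unfolding ptrg_def[of "\<psi> \<otimes> \<phi>"] * by simp
qed

lemma pid_simps [simp]:
  "parr (pid a xs) \<longleftrightarrow> path a xs"
  "path a xs \<Longrightarrow> psrc (pid a xs) = a" "path a xs \<Longrightarrow> pdom (pid a xs) = xs" "path a xs \<Longrightarrow> pcod (pid a xs) = xs"
  "path a xs \<Longrightarrow> pun (pid a xs) = id2 B (ev a xs)" "path a xs \<Longrightarrow> ptrg (pid a xs) = tgt a xs"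
  by (auto simp: pid_def parr_def ptrg_def simp del: parrD)

text \<open>The inner coherence isomorphisms \<open>cj\<close> cancel, and what remains is
  interchange in the bicategory. Unlike associativity it needs the ends to match.\<close>

lemma ptensor_pcomp:
  assumes "parr (\<psi>' \<odot> \<psi>)" "parr (\<phi>' \<odot> \<phi>)" "ptrg \<phi> = psrc \<psi>"
  shows "(\<psi>' \<odot> \<psi>) \<otimes> (\<phi>' \<odot> \<phi>) = (\<psi>' \<otimes> \<phi>') \<odot> (\<psi> \<otimes> \<phi>)"
proof -
  have t: "ptrg \<phi>' = ptrg \<phi>" using assms(2) parrD(7)[of \<phi>] parrD(6)[of \<phi>'] by simp
  have a: "parr \<psi>" "parr \<psi>'" "parr \<phi>" "parr \<phi>'" "psrc \<psi>' = psrc \<psi>" "psrc \<phi>' = psrc \<phi>"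
    "pcod \<psi> = pdom \<psi>'" "pcod \<phi> = pdom \<phi>'" using assms by auto
  then have p: "parr (\<psi>' \<otimes> \<phi>')" "parr (\<psi> \<otimes> \<phi>)" using assms(3) t by auto
  have l: "parr ((\<psi>' \<odot> \<psi>) \<otimes> (\<phi>' \<odot> \<phi>))"
    using assms(3) a by (simp add: pcomp_simps)
  have r: "parr ((\<psi>' \<otimes> \<phi>') \<odot> (\<psi> \<otimes> \<phi>))"
    using a p by (simp add: ptensor_simps)
  have u: "tgt (psrc \<phi>) (pdom \<phi>') = psrc \<psi>" "tgt (psrc \<phi>) (pcod \<phi>') = psrc \<psi>"
    "tgt (psrc \<phi>) (pdom \<phi>) = psrc \<psi>"
    using parrD(6,7)[of \<phi>'] a t assms(3) by auto
  have q: "path (psrc \<phi>) (pdom \<phi>')" "path (psrc \<phi>) (pcod \<phi>')" "path (psrc \<phi>) (pdom \<phi>)"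
    "path (psrc \<psi>) (pdom \<psi>')" "path (psrc \<psi>) (pcod \<psi>')" "path (psrc \<psi>) (pdom \<psi>)"
    "pun \<phi> \<in> cell B" "dom2 B (pun \<phi>) = ev (psrc \<phi>) (pdom \<phi>)" "cod2 B (pun \<phi>) = ev (psrc \<phi>) (pdom \<phi>')"
    "pun \<phi>' \<in> cell B" "dom2 B (pun \<phi>') = ev (psrc \<phi>) (pdom \<phi>')" "cod2 B (pun \<phi>') = ev (psrc \<phi>) (pcod \<phi>')"
    "pun \<psi> \<in> cell B" "dom2 B (pun \<psi>) = ev (psrc \<psi>) (pdom \<psi>)" "cod2 B (pun \<psi>) = ev (psrc \<psi>) (pdom \<psi>')"
    "pun \<psi>' \<in> cell B" "dom2 B (pun \<psi>') = ev (psrc \<psi>) (pdom \<psi>')" "cod2 B (pun \<psi>') = ev (psrc \<psi>) (pcod \<psi>')"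
    using parrD[OF a(1)] parrD[OF a(2)] parrD[OF a(3)] parrD[OF a(4)] a by simp_all
  show ?thesis
  proof (rule pcell_eqI[OF l r])
    show "pun ((\<psi>' \<odot> \<psi>) \<otimes> (\<phi>' \<odot> \<phi>)) = pun ((\<psi>' \<otimes> \<phi>') \<odot> (\<psi> \<otimes> \<phi>))"
      unfolding ptensor_simps(4)[OF l] pcomp_simps(4)[OF r] ptensor_simps(4)[OF p(1)] ptensor_simps(4)[OF p(2)]
        pcomp_simps(1-4)[OF assms(1)] pcomp_simps(1-4)[OF assms(2)] a
      using q u by (simp add: hcomp_vcomp)
  qed (simp_all add: pcomp_simps[OF r] ptensor_simps[OF l] ptensor_simps[OF p(1)] ptensor_simps[OF p(2)]
        pcomp_simps[OF assms(1)] pcomp_simps[OF assms(2)] a)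
qed

lemma not_parr_ptensor: "\<not> parr (\<psi> \<otimes> \<phi>) \<Longrightarrow> \<psi> \<otimes> \<phi> = PNull"
  unfolding parr_ptensor by (auto simp: ptensor_def)

lemma not_parr_pcomp: "\<not> parr (\<psi> \<odot> \<phi>) \<Longrightarrow> \<psi> \<odot> \<phi> = PNull"
  unfolding parr_pcomp by (auto simp: pcomp_def)

text \<open>In the well-typed case three facts are chained: \<open>cj_assoc\<close> on the
  codomains, naturality of the associator in the middle, and the inverted \<open>cj_assoc\<close> on
  the domains.\<close>

lemma ptensor_assoc [simp]: "(\<chi> \<otimes> \<psi>) \<otimes> \<phi> = \<chi> \<otimes> \<psi> \<otimes> \<phi>"
proof (cases "parr \<phi> \<and> parr \<psi> \<and> parr \<chi> \<and> ptrg \<phi> = psrc \<psi> \<and> ptrg \<psi> = psrc \<chi>")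
  case True
  then have p: "parr (\<chi> \<otimes> \<psi>)" "parr (\<psi> \<otimes> \<phi>)" by auto
  then have l: "parr ((\<chi> \<otimes> \<psi>) \<otimes> \<phi>)" and r: "parr (\<chi> \<otimes> \<psi> \<otimes> \<phi>)"
    using True by (simp_all add: ptensor_simps)
  obtain a f xs xs' where f: "\<phi> = PCell a xs f xs'" using True by (cases \<phi>) auto
  obtain b g ys ys' where g: "\<psi> = PCell b ys g ys'" using True by (cases \<psi>) auto
  obtain c h zs zs' where h: "\<chi> = PCell c zs h zs'" using True by (cases \<chi>) auto
  have q: "path a xs" "path a xs'" "path b ys" "path b ys'" "path c zs" "path c zs'"
    "f \<in> cell B" "dom2 B f = ev a xs" "cod2 B f = ev a xs'"
    "g \<in> cell B" "dom2 B g = ev b ys" "cod2 B g = ev b ys'"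
    "h \<in> cell B" "dom2 B h = ev c zs" "cod2 B h = ev c zs'"
    "tgt a xs = b" "tgt a xs' = b" "tgt b ys = c" "tgt b ys' = c"
    using True parrD[of \<phi>] parrD[of \<psi>] parrD[of \<chi>] by (simp_all add: f g h)
  let ?k = "inv (cj b zs ys) \<lhd> ev a xs" and ?m = "inv (cj a (zs @ ys) xs)"
  have "cj a (zs' @ ys') xs' \<bullet> ((cj b zs' ys' \<bullet> (h \<star> g) \<bullet> inv (cj b zs ys)) \<star> f) \<bullet> inv (cj a (zs @ ys) xs)
      = (cj a (zs' @ ys') xs' \<bullet> (cj b zs' ys' \<lhd> ev a xs')) \<bullet> ((h \<star> g) \<star> f) \<bullet> ?k \<bullet> ?m"
    using q hcomp_vcomp[of f "inv (cj b zs ys)" "id2 B (ev a xs')" "cj b zs' ys' \<bullet> (h \<star> g)"]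
      hcomp_vcomp[of f "h \<star> g" "id2 B (ev a xs')" "cj b zs' ys'"]
      hcomp_vcomp[of "id2 B (ev a xs)" "inv (cj b zs ys)" f "h \<star> g"]
      hcomp_vcomp[of "id2 B (ev a xs)" "inv (cj b zs ys)" "id2 B (ev a xs') \<bullet> f" "cj b zs' ys' \<bullet> h \<star> g"]
    by simp
  also have "\<dots> = cj a zs' (ys' @ xs') \<bullet> (ev c zs' \<rhd> cj a ys' xs') \<bullet> (\<a> (ev c zs') (ev b ys') (ev a xs') \<bullet> ((h \<star> g) \<star> f)) \<bullet> ?k \<bullet> ?m"
    using q cj_assoc[of a xs' ys' zs'] by simp
  also have "\<a> (ev c zs') (ev b ys') (ev a xs') \<bullet> ((h \<star> g) \<star> f) = (h \<star> (g \<star> f)) \<bullet> \<a> (ev c zs) (ev b ys) (ev a xs)"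
    by (rule assoc_nat) (use q in simp_all)
  also have "cj a zs' (ys' @ xs') \<bullet> (ev c zs' \<rhd> cj a ys' xs') \<bullet> ((h \<star> (g \<star> f)) \<bullet> \<a> (ev c zs) (ev b ys) (ev a xs)) \<bullet> ?k \<bullet> ?m
    = cj a zs' (ys' @ xs') \<bullet> (ev c zs' \<rhd> cj a ys' xs') \<bullet> (h \<star> (g \<star> f)) \<bullet> (\<a> (ev c zs) (ev b ys) (ev a xs) \<bullet> ?k \<bullet> ?m)"
    using q by simp
  \<comment> \<open>This is \<open>cj_assoc\<close> for the domains, inverted; it is checked after
    composing with an isomorphism that turns both sides into an identity.\<close>
  also have "\<a> (ev c zs) (ev b ys) (ev a xs) \<bullet> ?k \<bullet> ?m = inv (ev c zs \<rhd> cj a ys xs) \<bullet> inv (cj a zs (ys @ xs))"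
  proof (rule iso2_cancel_left)
    show "(cj a zs (ys @ xs) \<bullet> (ev c zs \<rhd> cj a ys xs)) \<bullet> \<a> (ev c zs) (ev b ys) (ev a xs) \<bullet> ?k \<bullet> ?m
      = (cj a zs (ys @ xs) \<bullet> (ev c zs \<rhd> cj a ys xs)) \<bullet> inv (ev c zs \<rhd> cj a ys xs) \<bullet> inv (cj a zs (ys @ xs))"
    proof -
      have "(cj a zs (ys @ xs) \<bullet> (ev c zs \<rhd> cj a ys xs)) \<bullet> \<a> (ev c zs) (ev b ys) (ev a xs) \<bullet> ?k \<bullet> ?m
        = (cj a zs (ys @ xs) \<bullet> (ev c zs \<rhd> cj a ys xs) \<bullet> \<a> (ev c zs) (ev b ys) (ev a xs)) \<bullet> ?k \<bullet> ?m"
        using q by simp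
      also have "\<dots> = (cj a (zs @ ys) xs \<bullet> (cj b zs ys \<lhd> ev a xs)) \<bullet> ?k \<bullet> ?m"
        using q cj_assoc[of a xs ys zs] by simp
      also have "\<dots> = cj a (zs @ ys) xs \<bullet> (cj b zs ys \<lhd> ev a xs) \<bullet> inv (cj b zs ys \<lhd> ev a xs) \<bullet> ?m"
        using q by simp
      also have "\<dots> = id2 B (ev a (zs @ ys @ xs))"
        using q by (simp del: iso2_hcomp(2))
      also have "\<dots> = (cj a zs (ys @ xs) \<bullet> (ev c zs \<rhd> cj a ys xs)) \<bullet> inv (ev c zs \<rhd> cj a ys xs) \<bullet> inv (cj a zs (ys @ xs))"
        using q by (simp del: iso2_hcomp(2))
      finally show ?thesis .
    qed
  qed (use q in simp_all)
  also have "cj a zs' (ys' @ xs') \<bullet> (ev c zs' \<rhd> cj a ys' xs') \<bullet> (h \<star> (g \<star> f)) \<bullet> inv (ev c zs \<rhd> cj a ys xs) \<bullet> inv (cj a zs (ys @ xs))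
    = cj a zs' (ys' @ xs') \<bullet> (h \<star> (cj a ys' xs' \<bullet> (g \<star> f) \<bullet> inv (cj a ys xs))) \<bullet> inv (cj a zs (ys @ xs))"
    using q hcomp_vcomp[of "g \<star> f" h "cj a ys' xs'" "id2 B (ev c zs')"]
      hcomp_vcomp[of "inv (cj a ys xs)" "id2 B (ev c zs)" "cj a ys' xs' \<bullet> (g \<star> f)" "id2 B (ev c zs') \<bullet> h"]
    by simp
  finally have "pun ((\<chi> \<otimes> \<psi>) \<otimes> \<phi>) = pun (\<chi> \<otimes> \<psi> \<otimes> \<phi>)"
    by (simp add: ptensor_simps[OF l] ptensor_simps[OF r] ptensor_simps[OF p(1)] ptensor_simps[OF p(2)])
      (simp add: f g h)
  then show ?thesis
    by (intro pcell_eqI[OF l r]) (simp_all add: ptensor_simps[OF l] ptensor_simps[OF r] ptensor_simps[OF p(1)] ptensor_simps[OF p(2)])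
next
  case False
  then have "\<not> parr ((\<chi> \<otimes> \<psi>) \<otimes> \<phi>)" "\<not> parr (\<chi> \<otimes> \<psi> \<otimes> \<phi>)"
    by (auto simp: ptensor_simps)
  then show ?thesis using not_parr_ptensor by metis
qed

text \<open>The object at which \<open>ys\<close> starts, when it is known to end at \<open>a\<close> (so that \<open>ys\<close> may be empty).\<close>

definition psrcl :: "'o \<Rightarrow> 'm list \<Rightarrow> 'o" where
  "psrcl a ys = (if ys = [] then a else src B (last ys))"

text \<open>Normal form of the later calculations: a vertical composite of generators, each
  whiskered by lists on both sides. The base point of the right-hand list is recovered by
  \<open>psrcl\<close>, so it need not be written.\<close>

definition wh :: "'m list \<Rightarrow> ('o, 'm, 'c) pcell \<Rightarrow> 'm list \<Rightarrow> ('o, 'm, 'c) pcell" where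
  "wh xs \<phi> ys = pid (ptrg \<phi>) xs \<otimes> \<phi> \<otimes> pid (psrcl (psrc \<phi>) ys) ys"

definition pty :: "('o, 'm, 'c) pcell \<Rightarrow> 'o \<Rightarrow> 'm list \<Rightarrow> 'm list \<Rightarrow> bool" where
  "pty \<phi> a xs ys \<longleftrightarrow> parr \<phi> \<and> psrc \<phi> = a \<and> pdom \<phi> = xs \<and> pcod \<phi> = ys"

lemma psrcl_simps: "psrcl a [] = a" "psrcl a (X # xs) = psrcl (src B X) xs" "psrcl a (xs @ ys) = psrcl (psrcl a xs) ys"
  by (auto simp: psrcl_def)

lemma psrcl_path: "path c ys \<Longrightarrow> tgt c ys = a \<Longrightarrow> psrcl a ys = c"
proof -
  have "ys \<noteq> [] \<Longrightarrow> path c ys \<Longrightarrow> src B (last ys) = c"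
    by (induction ys) auto
  then show "path c ys \<Longrightarrow> tgt c ys = a \<Longrightarrow> psrcl a ys = c" by (auto simp: psrcl_def)
qed

lemma pid_ptensor_pid:
  assumes "path a ys" "path (tgt a ys) xs"
  shows "pid (tgt a ys) xs \<otimes> pid a ys = pid a (xs @ ys)"
proof -
  have p: "parr (pid (tgt a ys) xs \<otimes> pid a ys)" using assms by simp
  show ?thesis by (rule pcell_eqI) (use assms in \<open>simp_all add: ptensor_simps[OF p]\<close>)
qed

lemma pid_ptensor_left [simp]:
  assumes "parr \<phi>" "a = ptrg \<phi>" shows "pid a [] \<otimes> \<phi> = \<phi>"
proof -
  have o: "path (ptrg \<phi>) []" using assms parrD(1,6)[of \<phi>] path_tgt_obj by fastforce
  then have p: "parr (pid (ptrg \<phi>) [] \<otimes> \<phi>)" using assms by simp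
  have "\<l> (ev (psrc \<phi>) (pcod \<phi>)) \<bullet> (\<one> (ptrg \<phi>) \<rhd> pun \<phi>) \<bullet> inv (\<l> (ev (psrc \<phi>) (pdom \<phi>)))
    = (pun \<phi> \<bullet> \<l> (ev (psrc \<phi>) (pdom \<phi>))) \<bullet> inv (\<l> (ev (psrc \<phi>) (pdom \<phi>)))"
    by (rule vcomp_extend) (use o assms in \<open>simp_all add: lunit_nat\<close>)
  then show ?thesis
    unfolding assms(2)
    by (intro pcell_eqI[OF p assms(1)]) (use o assms in \<open>simp_all add: ptensor_simps[OF p]\<close>)
qed

lemma pid_ptensor_right [simp]:
  assumes "parr \<phi>" "a = psrc \<phi>" shows "\<phi> \<otimes> pid a [] = \<phi>"
proof -
  have o: "path (psrc \<phi>) []" using assms parrD(1)[of \<phi>] path_src_obj by fastforce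
  then have p: "parr (\<phi> \<otimes> pid (psrc \<phi>) [])" using assms by simp
  have "\<r> (ev (psrc \<phi>) (pcod \<phi>)) \<bullet> (pun \<phi> \<lhd> \<one> (psrc \<phi>)) \<bullet> inv (\<r> (ev (psrc \<phi>) (pdom \<phi>)))
    = (pun \<phi> \<bullet> \<r> (ev (psrc \<phi>) (pdom \<phi>))) \<bullet> inv (\<r> (ev (psrc \<phi>) (pdom \<phi>)))"
    by (rule vcomp_extend) (use o assms in \<open>simp_all add: runit_nat\<close>)
  then show ?thesis
    unfolding assms(2)
    by (intro pcell_eqI[OF p assms(1)]) (use o assms in \<open>simp_all add: ptensor_simps[OF p] cj_Nil_right\<close>)
qed

lemma pid_pcomp_left [simp]:
  assumes "parr \<phi>" "a = psrc \<phi>" "xs = pcod \<phi>" shows "pid a xs \<odot> \<phi> = \<phi>"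
proof -
  have p: "parr (pid (psrc \<phi>) (pcod \<phi>) \<odot> \<phi>)" using assms by simp
  show ?thesis unfolding assms(2,3)
    by (rule pcell_eqI[OF p assms(1)]) (use assms in \<open>simp_all add: pcomp_simps[OF p]\<close>)
qed

lemma pid_pcomp_right [simp]:
  assumes "parr \<phi>" "a = psrc \<phi>" "xs = pdom \<phi>" shows "\<phi> \<odot> pid a xs = \<phi>"
proof -
  have p: "parr (\<phi> \<odot> pid (psrc \<phi>) (pdom \<phi>))" using assms by simp
  show ?thesis unfolding assms(2,3)
    by (rule pcell_eqI[OF p assms(1)]) (use assms in \<open>simp_all add: pcomp_simps[OF p]\<close>)
qed

lemma parr_wh:
  "parr (wh xs \<phi> ys) \<longleftrightarrow> parr \<phi> \<and> path (ptrg \<phi>) xs \<and> path (psrcl (psrc \<phi>) ys) ys \<and>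
    tgt (psrcl (psrc \<phi>) ys) ys = psrc \<phi>"
proof -
  let ?\<psi> = "\<phi> \<otimes> pid (psrcl (psrc \<phi>) ys) ys"
  have 1: "parr ?\<psi> \<longleftrightarrow> parr \<phi> \<and> path (psrcl (psrc \<phi>) ys) ys \<and> tgt (psrcl (psrc \<phi>) ys) ys = psrc \<phi>"
    by auto
  have 2: "parr ?\<psi> \<Longrightarrow> ptrg ?\<psi> = ptrg \<phi>" by (rule ptensor_simps(5))
  have "parr (wh xs \<phi> ys) \<longleftrightarrow> parr ?\<psi> \<and> path (ptrg \<phi>) xs"
    unfolding wh_def parr_ptensor[of "pid _ _" ?\<psi>] using 2 by (metis pid_simps(1,2))
  then show ?thesis unfolding 1 by auto
qed

lemma wh_simps:
  assumes "parr (wh xs \<phi> ys)"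
  shows "psrc (wh xs \<phi> ys) = psrcl (psrc \<phi>) ys" "pdom (wh xs \<phi> ys) = xs @ pdom \<phi> @ ys"
    "pcod (wh xs \<phi> ys) = xs @ pcod \<phi> @ ys" "ptrg (wh xs \<phi> ys) = tgt (ptrg \<phi>) xs"
proof -
  have a: "parr (pid (ptrg \<phi>) xs \<otimes> \<phi> \<otimes> pid (psrcl (psrc \<phi>) ys) ys)"
    "parr (\<phi> \<otimes> pid (psrcl (psrc \<phi>) ys) ys)"
    and p: "path (ptrg \<phi>) xs" "path (psrcl (psrc \<phi>) ys) ys"
    using assms by (auto simp: wh_def)
  show "psrc (wh xs \<phi> ys) = psrcl (psrc \<phi>) ys" "pdom (wh xs \<phi> ys) = xs @ pdom \<phi> @ ys"
    "pcod (wh xs \<phi> ys) = xs @ pcod \<phi> @ ys" "ptrg (wh xs \<phi> ys) = tgt (ptrg \<phi>) xs"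
    by (simp_all add: wh_def ptensor_simps[OF a(1)] ptensor_simps[OF a(2)] p)
qed

lemma not_parr_wh: "\<not> parr (wh xs \<phi> ys) \<Longrightarrow> wh xs \<phi> ys = PNull"
  unfolding wh_def by (rule not_parr_ptensor)

lemma wh_PNull [simp]: "wh xs PNull ys = PNull"
  by (rule not_parr_wh) (simp add: parr_wh)

lemma pcomp_PNull [simp]: "PNull \<odot> \<phi> = PNull" "\<phi> \<odot> PNull = PNull"
  by (simp_all add: pcomp_def)

lemma wh_Nil [simp]: "parr \<phi> \<Longrightarrow> wh [] \<phi> [] = \<phi>"
  by (simp add: wh_def psrcl_def)

lemma not_path_pid: "\<not> path a xs \<Longrightarrow> pid a xs = PNull"
  by (simp add: pid_def)

text \<open>Holds without typing hypotheses, since the two sides are well-typed under the same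
  conditions and are \<open>PNull\<close> otherwise. This is what allows its unconditional use as a
  rewrite rule.\<close>

lemma wh_wh [simp]: "wh xs (wh xs' \<phi> ys') ys = wh (xs @ xs') \<phi> (ys' @ ys)"
proof -
  let ?c = "psrcl (psrc \<phi>) ys'" let ?e = "psrcl ?c ys"
  have s: "psrcl (psrc \<phi>) (ys' @ ys) = ?e" by (simp add: psrcl_def)
  have c: "?c = tgt ?e ys" if "path ?e (ys' @ ys)" "tgt ?e (ys' @ ys) = psrc \<phi>"
    using that by (intro psrcl_path) auto
  have "parr (wh xs (wh xs' \<phi> ys') ys) \<longleftrightarrow> parr (wh xs' \<phi> ys') \<and> path (tgt (ptrg \<phi>) xs') xs \<and> path ?e ys \<and> tgt ?e ys = ?c"
    using wh_simps[of xs' \<phi> ys'] by (auto simp: parr_wh[of xs])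
  also have "\<dots> \<longleftrightarrow> parr (wh (xs @ xs') \<phi> (ys' @ ys))"
    unfolding parr_wh s using c by auto
  finally have eq: "parr (wh xs (wh xs' \<phi> ys') ys) \<longleftrightarrow> parr (wh (xs @ xs') \<phi> (ys' @ ys))" .
  show ?thesis
  proof (cases "parr (wh xs (wh xs' \<phi> ys') ys)")
    case True
    then have t: "parr (wh xs' \<phi> ys')" unfolding parr_wh[of xs] by simp
    note w = wh_simps[OF this]
    have p: "path (ptrg \<phi>) xs'" "path (tgt (ptrg \<phi>) xs') xs" "path ?e ys" "tgt ?e ys = ?c" "path ?c ys'"
      using True unfolding parr_wh by (auto simp: w)
    have "wh xs (wh xs' \<phi> ys') ys = (pid (tgt (ptrg \<phi>) xs') xs \<otimes> pid (ptrg \<phi>) xs') \<otimes> \<phi> \<otimes> pid ?c ys' \<otimes> pid ?e ys"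
      unfolding wh_def[of _ "wh _ _ _"] w by (simp add: wh_def)
    also have "pid (tgt (ptrg \<phi>) xs') xs \<otimes> pid (ptrg \<phi>) xs' = pid (ptrg \<phi>) (xs @ xs')"
      using p by (simp add: pid_ptensor_pid)
    also have "pid ?c ys' \<otimes> pid ?e ys = pid ?e (ys' @ ys)"
      using p pid_ptensor_pid[of ?e ys ys'] by simp
    finally show ?thesis by (simp add: wh_def s)
  next
    case False
    then show ?thesis using eq not_parr_wh by metis
  qed
qed

lemma wh_pcomp: "wh xs (\<psi> \<odot> \<phi>) ys = wh xs \<psi> ys \<odot> wh xs \<phi> ys"
proof (cases "parr (wh xs (\<psi> \<odot> \<phi>) ys)")
  case True
  then have p: "parr (\<psi> \<odot> \<phi>)" unfolding parr_wh by simp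
  have q: "path (ptrg \<phi>) xs" "path (psrcl (psrc \<phi>) ys) ys" "tgt (psrcl (psrc \<phi>) ys) ys = psrc \<phi>"
    using True pcomp_simps[OF p] unfolding parr_wh by auto
  have t: "ptrg \<psi> = ptrg \<phi>" using p parrD(7)[of \<phi>] parrD(6)[of \<psi>] by simp
  let ?c = "psrcl (psrc \<phi>) ys"
  have "wh xs (\<psi> \<odot> \<phi>) ys = (pid (ptrg \<phi>) xs \<odot> pid (ptrg \<phi>) xs) \<otimes> ((\<psi> \<odot> \<phi>) \<otimes> (pid ?c ys \<odot> pid ?c ys))"
    using q pcomp_simps[OF p] by (simp add: wh_def)
  also have "(\<psi> \<odot> \<phi>) \<otimes> (pid ?c ys \<odot> pid ?c ys) = (\<psi> \<otimes> pid ?c ys) \<odot> (\<phi> \<otimes> pid ?c ys)"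
    by (rule ptensor_pcomp) (use p q in simp_all)
  also have "(pid (ptrg \<phi>) xs \<odot> pid (ptrg \<phi>) xs) \<otimes> \<dots> = (pid (ptrg \<phi>) xs \<otimes> (\<psi> \<otimes> pid ?c ys)) \<odot> (pid (ptrg \<phi>) xs \<otimes> (\<phi> \<otimes> pid ?c ys))"
    by (rule ptensor_pcomp) (use p q in \<open>auto simp: ptensor_simps\<close>)
  finally show ?thesis using p t by (simp add: wh_def)
next
  case False
  \<comment> \<open>Typing of the unwhiskered composite can be read back: the common lists
    \<open>xs\<close> and \<open>ys\<close> cancel from the boundaries, and the end of
    \<open>ys\<close> gives the common source.\<close>
  have "\<not> parr (wh xs \<psi> ys \<odot> wh xs \<phi> ys)"
  proof
    assume "parr (wh xs \<psi> ys \<odot> wh xs \<phi> ys)"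
    then have p: "parr (wh xs \<psi> ys)" "parr (wh xs \<phi> ys)" "psrc (wh xs \<psi> ys) = psrc (wh xs \<phi> ys)"
      "pcod (wh xs \<phi> ys) = pdom (wh xs \<psi> ys)" by auto
    note w = wh_simps[OF p(1)] wh_simps[OF p(2)]
    have d: "pcod \<phi> = pdom \<psi>" using p(4) by (simp add: w)
    have "psrcl (psrc \<psi>) ys = psrcl (psrc \<phi>) ys" using p(3) by (simp add: w)
    then have "psrc \<phi> = psrc \<psi>" using p(1,2) unfolding parr_wh by metis
    then have c: "parr (\<psi> \<odot> \<phi>)" using d p(1,2) unfolding parr_wh by simp
    then have "parr (wh xs (\<psi> \<odot> \<phi>) ys)" using p(2) unfolding parr_wh pcomp_simps[OF c] by simp
    then show False using False by simp
  qed
  then show ?thesis using False not_parr_wh not_parr_pcomp by metis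
qed

lemma ptyD: assumes "pty \<phi> a xs ys"
  shows "parr \<phi>" "psrc \<phi> = a" "pdom \<phi> = xs" "pcod \<phi> = ys" "path a xs" "path a ys" "ptrg \<phi> = tgt a xs" "tgt a ys = tgt a xs"
  using assms parrD(1,2,6,7)[of \<phi>] by (auto simp: pty_def)

lemma pty_pcomp: "pty \<phi> a xs ys \<Longrightarrow> pty \<psi> a ys zs \<Longrightarrow> pty (\<psi> \<odot> \<phi>) a xs zs"
  unfolding pty_def by (simp add: pcomp_simps)

lemma pty_wh:
  assumes "pty \<phi> a xs ys" "path c (us @ xs @ vs)" "tgt c vs = a"
  shows "pty (wh us \<phi> vs) c (us @ xs @ vs) (us @ ys @ vs)"
proof -
  note \<phi> = ptyD[OF assms(1)]
  have s: "psrcl a vs = c" using assms(2,3) by (intro psrcl_path) auto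
  have p: "parr (wh us \<phi> vs)" using assms(2,3) \<phi> s by (simp add: parr_wh)
  show ?thesis unfolding pty_def using wh_simps[OF p] p \<phi> assms(2,3) s by simp
qed

lemma ptensor_eq_pcomp:
  assumes "pty \<phi> b p p'" "pty \<psi> a q q'" "tgt a q = b"
  shows "\<phi> \<otimes> \<psi> = wh [] \<phi> q' \<odot> wh p \<psi> []" "\<phi> \<otimes> \<psi> = wh p' \<psi> [] \<odot> wh [] \<phi> q"
proof -
  note \<phi> = ptyD[OF assms(1)] and \<psi> = ptyD[OF assms(2)]
  have o: "b \<in> obj B" "tgt b p \<in> obj B" "a \<in> obj B"
    using \<phi> \<psi> path_src_obj path_tgt_obj by blast+
  have w: "wh [] \<phi> q' = \<phi> \<otimes> pid a q'" "wh [] \<phi> q = \<phi> \<otimes> pid a q"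
    "wh p \<psi> [] = pid b p \<otimes> \<psi>" "wh p' \<psi> [] = pid b p' \<otimes> \<psi>"
    using \<phi> \<psi> assms(3) o by (simp_all add: wh_def psrcl_path ptensor_simps)
  have "\<phi> \<otimes> \<psi> = (\<phi> \<odot> pid b p) \<otimes> (pid a q' \<odot> \<psi>)" using \<phi> \<psi> by simp
  also have "\<dots> = (\<phi> \<otimes> pid a q') \<odot> (pid b p \<otimes> \<psi>)"
    by (rule ptensor_pcomp) (use \<phi> \<psi> assms(3) in simp_all)
  finally show "\<phi> \<otimes> \<psi> = wh [] \<phi> q' \<odot> wh p \<psi> []" using w by simp
  have "\<phi> \<otimes> \<psi> = (pid b p' \<odot> \<phi>) \<otimes> (\<psi> \<odot> pid a q)" using \<phi> \<psi> by simp
  also have "\<dots> = (pid b p' \<otimes> \<psi>) \<odot> (\<phi> \<otimes> pid a q)"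
    by (rule ptensor_pcomp) (use \<phi> \<psi> assms(3) in simp_all)
  finally show "\<phi> \<otimes> \<psi> = wh p' \<psi> [] \<odot> wh [] \<phi> q" using w by simp
qed

lemma exchange0:
  assumes "pty \<phi> b p p'" "pty \<psi> a q q'"
  shows "wh [] \<phi> q' \<odot> wh p \<psi> [] = wh p' \<psi> [] \<odot> wh [] \<phi> q"
proof (cases "tgt a q = b")
  case True
  then show ?thesis using ptensor_eq_pcomp[OF assms] by simp
next
  case False
  note \<phi> = ptyD[OF assms(1)] and \<psi> = ptyD[OF assms(2)]
  \<comment> \<open>When the ends do not match, a whiskering on either side can be well-typed only
    if its list is empty; the two factors then start at the different objects \<open>a\<close> and
    \<open>b\<close>, so both composites are \<open>PNull\<close>.\<close>
  have "path b p \<Longrightarrow> path (tgt a q) p \<Longrightarrow> p = []" "path b p' \<Longrightarrow> path (tgt a q) p' \<Longrightarrow> p' = []"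
    using False psrcl_path by (metis psrcl_def)+
  then have 1: "parr (wh p \<psi> []) \<Longrightarrow> p = []" "parr (wh p' \<psi> []) \<Longrightarrow> p' = []"
    using \<phi> \<psi> by (auto simp: parr_wh)
  have 2: "parr (wh [] \<phi> x) \<Longrightarrow> x = q \<or> x = q' \<Longrightarrow> x = []" for x
  proof (rule ccontr)
    assume x: "x \<noteq> []" and "parr (wh [] \<phi> x)" "x = q \<or> x = q'"
    then have "tgt (psrcl b x) x = b" "tgt a x = tgt a q" using \<phi> \<psi> by (auto simp: parr_wh)
    moreover have "tgt (psrcl b x) x = tgt a x" using x by (cases x) auto
    ultimately show False using False by simp
  qed
  have "\<not> parr (wh [] \<phi> q' \<odot> wh p \<psi> [])"
  proof
    assume "parr (wh [] \<phi> q' \<odot> wh p \<psi> [])"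
    then have "parr (wh p \<psi> [])" "parr (wh [] \<phi> q')" "psrc (wh [] \<phi> q') = psrc (wh p \<psi> [])" by auto
    then show False using 1(1) 2[of q'] False \<phi> \<psi> by (auto simp: wh_simps psrcl_def)
  qed
  moreover have "\<not> parr (wh p' \<psi> [] \<odot> wh [] \<phi> q)"
  proof
    assume "parr (wh p' \<psi> [] \<odot> wh [] \<phi> q)"
    then have "parr (wh p' \<psi> [])" "parr (wh [] \<phi> q)" "psrc (wh [] \<phi> q) = psrc (wh p' \<psi> [])" by auto
    then show False using 1(2) 2[of q] False \<phi> \<psi> by (auto simp: wh_simps psrcl_def)
  qed
  ultimately show ?thesis using not_parr_pcomp by metis
qed

text \<open>The working form of interchange: two generators separated by the factors
  \<open>ms\<close>, inside a context \<open>us\<close>, \<open>vs\<close>, change their order.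
  Since it has no preferred direction, the calculations below always use explicit instances.\<close>

lemma exchange:
  assumes "pty \<phi> b p p'" "pty \<psi> a q q'"
  shows "wh us \<phi> (ms @ q' @ vs) \<odot> wh (us @ p @ ms) \<psi> vs = wh (us @ p' @ ms) \<psi> vs \<odot> wh us \<phi> (ms @ q @ vs)"
proof -
  have "wh [] \<phi> (ms @ q') \<odot> wh (p @ ms) \<psi> [] = wh (p' @ ms) \<psi> [] \<odot> wh [] \<phi> (ms @ q)"
  proof (cases "parr (wh [] \<phi> ms)")
    case True
    have "pty (wh [] \<phi> ms) (psrcl b ms) (p @ ms) (p' @ ms)"
      using True ptyD[OF assms(1)] by (simp add: pty_def wh_simps)
    from exchange0[OF this assms(2)] show ?thesis by simp
  next
    case False
    have "wh [] \<phi> (ms @ q) = wh [] (wh [] \<phi> ms) q" "wh [] \<phi> (ms @ q') = wh [] (wh [] \<phi> ms) q'" by simp_all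
    then show ?thesis using False by (simp add: not_parr_wh del: wh_wh)
  qed
  then have "wh us (wh [] \<phi> (ms @ q') \<odot> wh (p @ ms) \<psi> []) vs = wh us (wh (p' @ ms) \<psi> [] \<odot> wh [] \<phi> (ms @ q)) vs"
    by simp
  then show ?thesis by (simp add: wh_pcomp)
qed

section \<open>Inverses of diagrams and cancellation\<close>

lemma pty_pinv: "piso \<phi> \<Longrightarrow> pty \<phi> a xs ys \<Longrightarrow> pty (pinv \<phi>) a ys xs"
  using parrD(1-5)[of \<phi>] unfolding piso_def pty_def pinv_def parr_def[of "PCell _ _ _ _"] by simp

lemma piso_pinv: "piso \<phi> \<Longrightarrow> piso (pinv \<phi>)"
  using parrD(1-5)[of \<phi>] unfolding piso_def pinv_def parr_def[of "PCell _ _ _ _"] by simp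

lemma pinv_pcomp:
  assumes "piso \<phi>" shows "pinv \<phi> \<odot> \<phi> = pid (psrc \<phi>) (pdom \<phi>)" "\<phi> \<odot> pinv \<phi> = pid (psrc \<phi>) (pcod \<phi>)"
  using assms piso_pinv[OF assms]
  by (simp_all add: pcomp_def piso_def pid_def) (simp_all add: pinv_def)

lemma pinv_cancel:
  assumes "piso \<chi>" "pty \<chi> a xs ys"
  shows "pty \<phi> a zs xs \<Longrightarrow> pinv \<chi> \<odot> \<chi> \<odot> \<phi> = \<phi>" "pty \<phi> a zs ys \<Longrightarrow> \<chi> \<odot> pinv \<chi> \<odot> \<phi> = \<phi>"
    "pty \<psi> a ys zs \<Longrightarrow> (\<psi> \<odot> \<chi>) \<odot> pinv \<chi> = \<psi>" "pty \<psi> a xs zs \<Longrightarrow> (\<psi> \<odot> pinv \<chi>) \<odot> \<chi> = \<psi>"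
  using assms pinv_pcomp[OF assms(1)]
  by (simp_all add: pty_def flip: pcomp_assoc) (simp_all add: pcomp_assoc)

lemma pinv_unique:
  assumes "pty \<phi> a xs ys" "pty \<psi> a ys xs" "\<psi> \<odot> \<phi> = pid a xs" "\<phi> \<odot> \<psi> = pid a ys"
  shows "piso \<phi>" "pinv \<phi> = \<psi>"
proof -
  have "inverse_cells B (pun \<phi>) (pun \<psi>)"
    using arg_cong[OF assms(3), of pun] arg_cong[OF assms(4), of pun] assms(1,2) parrD[of \<phi>] parrD[of \<psi>]
    by (auto simp: pty_def inverse_cells_def cells_def pcomp_simps)
  then show "piso \<phi>" "pinv \<phi> = \<psi>" using assms(1,2) inv2_eq
    by (auto simp: piso_def iso2_def pty_def pinv_def intro!: pcell_eqI) (cases \<psi>; auto)+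
qed

lemma wh_pid: "wh us (pid a xs) vs = (if tgt (psrcl a vs) vs = a then pid (psrcl a vs) (us @ xs @ vs) else PNull)"
proof (cases "parr (wh us (pid a xs) vs)")
  case True
  then have p: "path a xs" "path (tgt a xs) us" "path (psrcl a vs) vs" "tgt (psrcl a vs) vs = a"
    unfolding parr_wh by auto
  then show ?thesis
    using pid_ptensor_pid[of "psrcl a vs" vs xs] pid_ptensor_pid[of "psrcl a vs" "xs @ vs" us] by (simp add: wh_def)
next
  case False
  then have "\<not> (path (psrcl a vs) (us @ xs @ vs) \<and> tgt (psrcl a vs) vs = a)"
    unfolding parr_wh by auto
  then show ?thesis using False not_parr_wh not_path_pid by metis
qed

lemma piso_wh:
  assumes "piso \<phi>" "parr (wh us \<phi> vs)"
  shows "piso (wh us \<phi> vs)" "pinv (wh us \<phi> vs) = wh us (pinv \<phi>) vs"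
proof -
  let ?a = "psrc \<phi>"
  have \<phi>: "pty \<phi> ?a (pdom \<phi>) (pcod \<phi>)" using assms(1) by (simp add: pty_def piso_def)
  have c: "tgt (psrcl ?a vs) vs = ?a" and p: "path (psrcl ?a vs) (us @ pdom \<phi> @ vs)"
    using assms(2) unfolding parr_wh by simp_all
  note t = pty_wh[OF \<phi> p c]
  have p': "path (psrcl ?a vs) (us @ pcod \<phi> @ vs)" using ptyD(6)[OF t] .
  note t' = pty_wh[OF pty_pinv[OF assms(1) \<phi>] p' c]
  have "wh us (pinv \<phi>) vs \<odot> wh us \<phi> vs = pid (psrcl ?a vs) (us @ pdom \<phi> @ vs)"
    unfolding wh_pcomp[symmetric] pinv_pcomp[OF assms(1)] wh_pid using c by simp
  moreover have "wh us \<phi> vs \<odot> wh us (pinv \<phi>) vs = pid (psrcl ?a vs) (us @ pcod \<phi> @ vs)"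
    unfolding wh_pcomp[symmetric] pinv_pcomp[OF assms(1)] wh_pid using c by simp
  ultimately show "piso (wh us \<phi> vs)" "pinv (wh us \<phi> vs) = wh us (pinv \<phi>) vs"
    using pinv_unique[OF t t'] by auto
qed

lemma piso_pcomp:
  assumes "piso \<phi>" "piso \<psi>" "pty \<phi> a xs ys" "pty \<psi> a ys zs"
  shows "piso (\<psi> \<odot> \<phi>)" "pinv (\<psi> \<odot> \<phi>) = pinv \<phi> \<odot> pinv \<psi>"
proof -
  note t = pty_pcomp[OF assms(3,4)] pty_pcomp[OF pty_pinv[OF assms(2,4)] pty_pinv[OF assms(1,3)]]
  have "(pinv \<phi> \<odot> pinv \<psi>) \<odot> (\<psi> \<odot> \<phi>) = pid a xs"
    unfolding pcomp_assoc pinv_cancel(1)[OF assms(2,4,3)] pinv_pcomp[OF assms(1)] ptyD(2,3)[OF assms(3)] ..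
  moreover have "(\<psi> \<odot> \<phi>) \<odot> (pinv \<phi> \<odot> pinv \<psi>) = pid a zs"
    unfolding pcomp_assoc pinv_cancel(2)[OF assms(1,3) pty_pinv[OF assms(2,4)]] pinv_pcomp[OF assms(2)] ptyD(2,4)[OF assms(4)] ..
  ultimately show "piso (\<psi> \<odot> \<phi>)" "pinv (\<psi> \<odot> \<phi>) = pinv \<phi> \<odot> pinv \<psi>"
    using pinv_unique[OF t] by auto
qed

lemma pcomp_cancel_left:
  assumes "\<chi> \<odot> \<phi> = \<chi> \<odot> \<psi>" "piso \<chi>" "pty \<chi> a ys zs" "pty \<phi> a xs ys" "pty \<psi> a xs ys"
  shows "\<phi> = \<psi>"
  using pinv_cancel(1)[OF assms(2,3,4)] pinv_cancel(1)[OF assms(2,3,5)] assms(1) by metis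

lemma pcomp_cancel_right:
  assumes "\<phi> \<odot> \<chi> = \<psi> \<odot> \<chi>" "piso \<chi>" "pty \<chi> a xs ys" "pty \<phi> a ys zs" "pty \<psi> a ys zs"
  shows "\<phi> = \<psi>"
  using pinv_cancel(3)[OF assms(2,3,4)] pinv_cancel(3)[OF assms(2,3,5)] assms(1) by metis

text \<open>The analogue of \<open>vcomp_extend\<close>; it is free of typing hypotheses because
  ill-typed composites are all \<open>PNull\<close>.\<close>

lemma pcomp_extend: "\<psi> \<odot> \<phi> = \<chi> \<Longrightarrow> \<psi> \<odot> \<phi> \<odot> \<omega> = \<chi> \<odot> \<omega>"
  by (metis pcomp_assoc)

end

section \<open>Contravariant 2-functors\<close>

lemma op1_simps [simp]:
  "obj (op1 B) = obj B" "mor (op1 B) = mor B" "src (op1 B) = trg B" "trg (op1 B) = src B"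
  "one (op1 B) = one B" "cell (op1 B) = cell B" "dom2 (op1 B) = dom2 B" "cod2 (op1 B) = cod2 B"
  "id2 (op1 B) = id2 B" "vcomp (op1 B) = vcomp B" "comp1 (op1 B) Y X = comp1 B X Y"
  "hcomp (op1 B) g f = hcomp B f g" "assoc (op1 B) Z Y X = inv2 B (assoc B X Y Z)"
  "lunit (op1 B) = runit B" "runit (op1 B) = lunit B"
  by (simp_all add: op1_def)

lemma cells_op1 [simp]: "cells (op1 B) = cells B"
  by (simp add: cells_def fun_eq_iff)

lemma inverse_cells_op1 [simp]: "inverse_cells (op1 B) = inverse_cells B"
  by (simp add: inverse_cells_def fun_eq_iff)

lemma inv2_op1 [simp]: "inv2 (op1 B) = inv2 B"
  by (simp add: inv2_def fun_eq_iff)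

lemma isos_op1 [simp]: "isos (op1 B) = isos B"
  by (simp add: isos_def fun_eq_iff)

lemma hom_op1 [simp]: "hom (op1 B) a b = hom B b a"
  by (auto simp: hom_def)

section \<open>Formal 1-morphisms and the diagram of a 2-morphism\<close>

text \<open>
  The constructors stand for a 1-morphism, an identity, a composite and a dual.
  A formal 1-morphism \<open>t\<close> has a value \<open>tev t\<close>, a list of factors \<open>tfl t\<close>, and a coherence isomorphism
  \<open>tcan t\<close> from its value to the composite of its factors; conjugation by \<open>tcan\<close> turns a 2-morphism
  into the diagram \<open>rep t f t'\<close>.
\<close>

datatype ('o, 'm) mterm = At 'm | On 'o | Cm "('o, 'm) mterm" "('o, 'm) mterm" (infixr \<open>\<diamondop>\<close> 75)
  | Du "('o, 'm) mterm"

locale contravariant_functor = bicategory B + dual: pseudofunctor B "op1 B" d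
  for B :: "('o, 'm, 'c) bicat" (structure) and d :: "('o, 'm, 'c, 'o, 'm, 'c) functor2"
begin

lemma f0_obj' [simp]: "a \<in> obj B \<Longrightarrow> f0 d a \<in> obj B"
  using dual.f0_obj by simp

lemma f1_simps [simp]:
  assumes "X \<in> mor B"
  shows "f1 d X \<in> mor B" "src B (f1 d X) = f0 d (trg B X)" "trg B (f1 d X) = f0 d (src B X)"
  using dual.f1_hom[of X "src B X" "trg B X"] assms by (auto simp: hom_iff)

lemma f2_simps [simp]:
  assumes "f \<in> cell B"
  shows "f2 d f \<in> cell B" "dom2 B (f2 d f) = f1 d (dom2 B f)" "cod2 B (f2 d f) = f1 d (cod2 B f)"
  using dual.f2_cells[of f "dom2 B f" "cod2 B f"] assms by (auto simp: cells_iff)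

lemma f2_id [simp]: "X \<in> mor B \<Longrightarrow> f2 d (id2 B X) = id2 B (f1 d X)"
  using dual.f2_id2 by simp

lemma f2_vcomp':
  assumes "f \<in> cell B" "g \<in> cell B" "dom2 B g = cod2 B f"
  shows "f2 d (g \<bullet> f) = f2 d g \<bullet> f2 d f"
  using dual.f2_vcomp[of f "dom2 B f" "cod2 B f" g "cod2 B g"] assms by (simp add: cells_iff)

lemma f2_iso [simp]:
  assumes "iso2 B f" shows "iso2 B (f2 d f)" "inv (f2 d f) = f2 d (inv f)"
proof -
  have "inverse_cells B (f2 d f) (f2 d (inv f))"
    using assms iso2_cell[OF assms] by (simp add: inverse_cells_def cells_iff flip: f2_vcomp')
  then show "iso2 B (f2 d f)" "inv (f2 d f) = f2 d (inv f)" using inv2_eq by (auto simp: iso2_def)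
qed

lemma fcomp_simps [simp]:
  assumes "X \<in> mor B" "Y \<in> mor B" "src B Y = trg B X"
  shows "fcomp d Y X \<in> cell B" "dom2 B (fcomp d Y X) = f1 d X \<cdot> f1 d Y"
    "cod2 B (fcomp d Y X) = f1 d (Y \<cdot> X)" "iso2 B (fcomp d Y X)"
  using dual.fcomp_iso[of X "src B X" "trg B X" Y "trg B Y"] assms by (auto simp: hom_iff isos_iff)

lemma funit_simps [simp]:
  assumes "a \<in> obj B"
  shows "funit d a \<in> cell B" "dom2 B (funit d a) = \<one> (f0 d a)"
    "cod2 B (funit d a) = f1 d (\<one> a)" "iso2 B (funit d a)"
  using dual.funit_iso[of a] assms by (auto simp: isos_iff)

lemma fcomp_nat:
  assumes "f \<in> cell B" "g \<in> cell B" "src B (dom2 B g) = trg B (dom2 B f)"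
    "dom2 B f = X" "dom2 B g = Y" "cod2 B f = X'" "cod2 B g = Y'"
  shows "fcomp d Y' X' \<bullet> (f2 d f \<star> f2 d g) = f2 d (g \<star> f) \<bullet> fcomp d Y X"
  using dual.fcomp_natural[of f X X' g Y Y' "src B X" "trg B X" "trg B Y"] assms
  by (auto simp: hom_iff cells_iff)

lemma fcomp_assoc':
  assumes "X \<in> mor B" "Y \<in> mor B" "Z \<in> mor B" "src B Y = trg B X" "src B Z = trg B Y"
  shows "f2 d (\<a> Z Y X) \<bullet> fcomp d (Z \<cdot> Y) X \<bullet> (f1 d X \<rhd> fcomp d Z Y)
    = fcomp d Z (Y \<cdot> X) \<bullet> (fcomp d Y X \<lhd> f1 d Z) \<bullet> inv (\<a> (f1 d X) (f1 d Y) (f1 d Z))"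
  using dual.fcomp_assoc[of X "src B X" "trg B X" Y "trg B Y" Z "trg B Z"] assms
  by (auto simp: hom_iff)

lemma fcomp_lunit':
  assumes "X \<in> mor B" "trg B X = b"
  shows "f2 d (\<l> X) \<bullet> fcomp d (\<one> b) X \<bullet> (f1 d X \<rhd> funit d b) = \<r> (f1 d X)"
  using dual.fcomp_lunit[of X "src B X" b] assms by (auto simp: hom_iff)

lemma fcomp_runit':
  assumes "X \<in> mor B" "src B X = a"
  shows "f2 d (\<r> X) \<bullet> fcomp d X (\<one> a) \<bullet> (funit d a \<lhd> f1 d X) = \<l> (f1 d X)"
  using dual.fcomp_runit[of X a "trg B X"] assms by (auto simp: hom_iff)

section \<open>Duals of lists and of diagrams\<close>

definition dl :: "'m list \<Rightarrow> 'm list" where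
  "dl xs = rev (map (f1 d) xs)"

lemma dl_simps [simp]: "dl [] = []" "dl (X # xs) = dl xs @ [f1 d X]" "dl (xs @ ys) = dl ys @ dl xs"
  by (simp_all add: dl_def)

lemma path_dl [simp]:
  assumes "path a xs"
  shows "path (f0 d (tgt a xs)) (dl xs)" "tgt (f0 d (tgt a xs)) (dl xs) = f0 d a"
proof -
  have "path (f0 d (tgt a xs)) (dl xs) \<and> tgt (f0 d (tgt a xs)) (dl xs) = f0 d a"
    using assms by (induction xs) auto
  then show "path (f0 d (tgt a xs)) (dl xs)" "tgt (f0 d (tgt a xs)) (dl xs) = f0 d a" by auto
qed

text \<open>The isomorphism from the composite of the duals, in the opposite order, to the dual of the composite.\<close>

primrec phi :: "'o \<Rightarrow> 'm list \<Rightarrow> 'c" where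
  "phi a [] = funit d a"
| "phi a (X # xs) = fcomp d X (ev a xs) \<bullet> (phi a xs \<star> \<r> (f1 d X))
     \<bullet> inv (cj (f0 d (trg B X)) (dl xs) [f1 d X])"

lemma phi_simps [simp]:
  assumes "path a xs"
  shows "phi a xs \<in> cell B" "dom2 B (phi a xs) = ev (f0 d (tgt a xs)) (dl xs)"
    "cod2 B (phi a xs) = f1 d (ev a xs)" "iso2 B (phi a xs)"
proof -
  have "phi a xs \<in> cell B \<and> dom2 B (phi a xs) = ev (f0 d (tgt a xs)) (dl xs) \<and>
    cod2 B (phi a xs) = f1 d (ev a xs) \<and> iso2 B (phi a xs)"
    using assms
  proof (induction xs)
    case (Cons X xs)
    then have [simp]: "X \<in> mor B" "src B X = tgt a xs" "path a xs" by auto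
    have [simp]: "path (f0 d (trg B X)) [f1 d X]" "path (f0 d (tgt a xs)) (dl xs)"
      "tgt (f0 d (tgt a xs)) (dl xs) = f0 d a"
      by (auto simp: path_dl)
    show ?case using Cons by simp
  qed simp
  then show "phi a xs \<in> cell B" "dom2 B (phi a xs) = ev (f0 d (tgt a xs)) (dl xs)"
    "cod2 B (phi a xs) = f1 d (ev a xs)" "iso2 B (phi a xs)" by auto
qed

text \<open>Source of the strict compatibility of \<open>pdual\<close> with horizontal composition.
  Induction on the left list: the empty list is the unit axiom \<open>fcomp_lunit'\<close>, and a
  further factor combines \<open>fcomp_assoc'\<close> with the naturality of \<open>fcomp\<close>
  and of the associator.\<close>

lemma phi_append:
  assumes "path a ys" "path (tgt a ys) xs"
  shows "phi a (xs @ ys) \<bullet> cj (f0 d (tgt (tgt a ys) xs)) (dl ys) (dl xs)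
    = f2 d (cj a xs ys) \<bullet> fcomp d (ev (tgt a ys) xs) (ev a ys) \<bullet> (phi a ys \<star> phi (tgt a ys) xs)"
  using assms
proof (induction xs)
  case Nil
  let ?b = "tgt a ys" let ?y = "ev a ys"
  have o [simp]: "?b \<in> obj B" "a \<in> obj B" using Nil path_tgt_obj path_src_obj by blast+
  have "f2 d (\<l> ?y) \<bullet> fcomp d (\<one> ?b) ?y \<bullet> (phi a ys \<star> funit d ?b)
      = f2 d (\<l> ?y) \<bullet> fcomp d (\<one> ?b) ?y \<bullet> (f1 d ?y \<rhd> funit d ?b) \<bullet> (phi a ys \<lhd> \<one> (f0 d ?b))"
    using Nil hcomp_vcomp[of "id2 B (\<one> (f0 d ?b))" "phi a ys" "funit d ?b" "id2 B (f1 d ?y)"] by simp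
  also have "\<dots> = (f2 d (\<l> ?y) \<bullet> fcomp d (\<one> ?b) ?y \<bullet> (f1 d ?y \<rhd> funit d ?b)) \<bullet> (phi a ys \<lhd> \<one> (f0 d ?b))"
    using Nil by simp
  also have "\<dots> = \<r> (f1 d ?y) \<bullet> (phi a ys \<lhd> \<one> (f0 d ?b))"
    using Nil by (simp only: fcomp_lunit' ev_simps)
  also have "\<dots> = phi a ys \<bullet> \<r> (ev (f0 d ?b) (dl ys))"
    using Nil by (simp add: runit_nat)
  finally show ?case using Nil by (simp add: cj_Nil_right)
next
  case (Cons X xs)
  let ?b = "tgt a ys" let ?y = "ev a ys" let ?x = "ev ?b xs" let ?e = "f0 d (trg B X)"
  let ?dX = "f1 d X" let ?c = "tgt ?b xs"
  have [simp]: "X \<in> mor B" "src B X = ?c" "path ?b xs" "path a ys" using Cons.prems by auto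
  have o [simp]: "?b \<in> obj B" "a \<in> obj B" "?c \<in> obj B"
    using \<open>path ?b xs\<close> \<open>path a ys\<close> path_tgt_obj path_src_obj by blast+
  have p [simp]: "path (f0 d ?c) (dl xs)" "tgt (f0 d ?c) (dl xs) = f0 d ?b" "path (f0 d ?b) (dl ys)"
    "tgt (f0 d ?b) (dl ys) = f0 d a"
    by (simp_all add: path_dl)
  let ?k = "cj ?e (dl xs) [?dX]" let ?k' = "cj ?e (dl ys @ dl xs) [?dX]"
  let ?m = "cj (f0 d ?c) (dl ys) (dl xs)" let ?l = "cj ?e (dl ys) (dl xs @ [?dX])"
  let ?Y = "ev (f0 d ?b) (dl ys)" let ?X = "ev (f0 d ?c) (dl xs)"
  \<comment> \<open>This is \<open>cj_assoc\<close> for the dual lists, solved for the part that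
    separates the last factor \<open>f1 d X\<close>.\<close>
  have k: "inv ?k' \<bullet> ?l = (?m \<lhd> ev ?e [?dX]) \<bullet> inv (\<a> ?Y ?X (ev ?e [?dX])) \<bullet> (?Y \<rhd> inv ?k)"
  proof -
    have "?k' \<bullet> (?m \<lhd> ev ?e [?dX]) = ?l \<bullet> (?Y \<rhd> ?k) \<bullet> \<a> ?Y ?X (ev ?e [?dX])"
      using cj_assoc[of ?e "[?dX]" "dl xs" "dl ys"] by simp
    then have "inv ?k' \<bullet> (?k' \<bullet> (?m \<lhd> ev ?e [?dX])) \<bullet> inv (\<a> ?Y ?X (ev ?e [?dX])) \<bullet> inv (?Y \<rhd> ?k) =
      inv ?k' \<bullet> (?l \<bullet> (?Y \<rhd> ?k) \<bullet> \<a> ?Y ?X (ev ?e [?dX])) \<bullet> inv (\<a> ?Y ?X (ev ?e [?dX])) \<bullet> inv (?Y \<rhd> ?k)"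
      by presburger
    then show ?thesis by (simp flip: iso2_hcomp(2)) (simp)
  qed
  have "phi a (X # xs @ ys) \<bullet> ?l = fcomp d X (ev a (xs @ ys)) \<bullet> (phi a (xs @ ys) \<star> \<r> ?dX) \<bullet> (inv ?k' \<bullet> ?l)"
    by simp
  also have "\<dots> = fcomp d X (ev a (xs @ ys)) \<bullet> ((phi a (xs @ ys) \<bullet> ?m) \<star> \<r> ?dX)
     \<bullet> inv (\<a> ?Y ?X (ev ?e [?dX])) \<bullet> (?Y \<rhd> inv ?k)"
    unfolding k using hcomp_vcomp[of "id2 B (ev ?e [?dX])" ?m "\<r> ?dX" "phi a (xs @ ys)"] by simp
  also have "phi a (xs @ ys) \<bullet> ?m = f2 d (cj a xs ys) \<bullet> fcomp d ?x ?y \<bullet> (phi a ys \<star> phi ?b xs)"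
    using Cons.IH by simp
  also have "\<dots> \<star> \<r> ?dX = (f2 d (cj a xs ys) \<lhd> ?dX) \<bullet> (fcomp d ?x ?y \<lhd> ?dX) \<bullet> ((phi a ys \<star> phi ?b xs) \<star> \<r> ?dX)"
    using hcomp_vcomp[of "\<r> ?dX" "fcomp d ?x ?y \<bullet> (phi a ys \<star> phi ?b xs)" "id2 B ?dX" "f2 d (cj a xs ys)"]
     hcomp_vcomp[of "\<r> ?dX" "phi a ys \<star> phi ?b xs" "id2 B ?dX" "fcomp d ?x ?y"] by simp
  also have "fcomp d X (ev a (xs @ ys)) \<bullet> ((f2 d (cj a xs ys) \<lhd> ?dX) \<bullet> (fcomp d ?x ?y \<lhd> ?dX) \<bullet> ((phi a ys \<star> phi ?b xs) \<star> \<r> ?dX))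
      \<bullet> inv (\<a> ?Y ?X (ev ?e [?dX])) \<bullet> (?Y \<rhd> inv ?k)
    = (fcomp d X (ev a (xs @ ys)) \<bullet> (f2 d (cj a xs ys) \<lhd> ?dX)) \<bullet> (fcomp d ?x ?y \<lhd> ?dX)
      \<bullet> (((phi a ys \<star> phi ?b xs) \<star> \<r> ?dX) \<bullet> inv (\<a> ?Y ?X (ev ?e [?dX]))) \<bullet> (?Y \<rhd> inv ?k)"
    by simp
  also have "fcomp d X (ev a (xs @ ys)) \<bullet> (f2 d (cj a xs ys) \<lhd> ?dX) = f2 d (X \<rhd> cj a xs ys) \<bullet> fcomp d X (?x \<cdot> ?y)"
    using fcomp_nat[of "cj a xs ys" "id2 B X" "?x \<cdot> ?y" X "ev a (xs @ ys)" X] by simp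
  also have "((phi a ys \<star> phi ?b xs) \<star> \<r> ?dX) \<bullet> inv (\<a> ?Y ?X (ev ?e [?dX]))
     = inv (\<a> (f1 d ?y) (f1 d ?x) ?dX) \<bullet> (phi a ys \<star> (phi ?b xs \<star> \<r> ?dX))"
  proof (rule iso2_cancel_left[of "\<a> (f1 d ?y) (f1 d ?x) ?dX"])
    have "\<a> (f1 d ?y) (f1 d ?x) ?dX \<bullet> ((phi a ys \<star> phi ?b xs) \<star> \<r> ?dX) \<bullet> inv (\<a> ?Y ?X (ev ?e [?dX]))
      = (\<a> (f1 d ?y) (f1 d ?x) ?dX \<bullet> ((phi a ys \<star> phi ?b xs) \<star> \<r> ?dX)) \<bullet> inv (\<a> ?Y ?X (ev ?e [?dX]))"
      by simp
    also have "\<a> (f1 d ?y) (f1 d ?x) ?dX \<bullet> ((phi a ys \<star> phi ?b xs) \<star> \<r> ?dX)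
      = (phi a ys \<star> (phi ?b xs \<star> \<r> ?dX)) \<bullet> \<a> ?Y ?X (ev ?e [?dX])"
      by (rule assoc_nat) simp_all
    finally show "\<a> (f1 d ?y) (f1 d ?x) ?dX \<bullet> ((phi a ys \<star> phi ?b xs) \<star> \<r> ?dX) \<bullet> inv (\<a> ?Y ?X (ev ?e [?dX]))
      = \<a> (f1 d ?y) (f1 d ?x) ?dX \<bullet> inv (\<a> (f1 d ?y) (f1 d ?x) ?dX) \<bullet> (phi a ys \<star> (phi ?b xs \<star> \<r> ?dX))"
      by simp
  qed simp_all
  also have "(f2 d (X \<rhd> cj a xs ys) \<bullet> fcomp d X (?x \<cdot> ?y)) \<bullet> (fcomp d ?x ?y \<lhd> ?dX)
      \<bullet> (inv (\<a> (f1 d ?y) (f1 d ?x) ?dX) \<bullet> (phi a ys \<star> (phi ?b xs \<star> \<r> ?dX))) \<bullet> (?Y \<rhd> inv ?k)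
    = f2 d (X \<rhd> cj a xs ys) \<bullet> (fcomp d X (?x \<cdot> ?y) \<bullet> (fcomp d ?x ?y \<lhd> ?dX)
      \<bullet> inv (\<a> (f1 d ?y) (f1 d ?x) ?dX)) \<bullet> (phi a ys \<star> (phi ?b xs \<star> \<r> ?dX)) \<bullet> (?Y \<rhd> inv ?k)"
    by simp
  also have "fcomp d X (?x \<cdot> ?y) \<bullet> (fcomp d ?x ?y \<lhd> ?dX) \<bullet> inv (\<a> (f1 d ?y) (f1 d ?x) ?dX)
    = f2 d (\<a> X ?x ?y) \<bullet> fcomp d (X \<cdot> ?x) ?y \<bullet> (f1 d ?y \<rhd> fcomp d X ?x)"
    by (rule fcomp_assoc'[symmetric]) simp_all
  also have "f2 d (X \<rhd> cj a xs ys) \<bullet> (f2 d (\<a> X ?x ?y) \<bullet> fcomp d (X \<cdot> ?x) ?y \<bullet> (f1 d ?y \<rhd> fcomp d X ?x))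
       \<bullet> (phi a ys \<star> (phi ?b xs \<star> \<r> ?dX)) \<bullet> (?Y \<rhd> inv ?k)
    = f2 d (cj a (X # xs) ys) \<bullet> fcomp d (X \<cdot> ?x) ?y \<bullet> (phi a ys \<star> (fcomp d X ?x \<bullet> (phi ?b xs \<star> \<r> ?dX) \<bullet> inv ?k))"
    using hcomp_vcomp[of "(phi ?b xs \<star> \<r> ?dX) \<bullet> inv ?k" "phi a ys" "fcomp d X ?x" "id2 B (f1 d ?y)"]
      hcomp_vcomp[of "inv ?k" "id2 B ?Y" "phi ?b xs \<star> \<r> ?dX" "phi a ys"]
    by (simp add: f2_vcomp')
  finally show ?case by simp
qed

text \<open>Conjugation by \<open>phi\<close> makes the boundary the reversed list of duals of the
  factors instead of the dual of a composite. As with \<open>pinv\<close>, there is no guard against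
  ill-typed arguments.\<close>

definition pdual :: "('o, 'm, 'c) pcell \<Rightarrow> ('o, 'm, 'c) pcell" where
  "pdual \<phi> = PCell (f0 d (ptrg \<phi>)) (dl (pdom \<phi>))
     (inv (phi (psrc \<phi>) (pcod \<phi>)) \<bullet> f2 d (pun \<phi>) \<bullet> phi (psrc \<phi>) (pdom \<phi>)) (dl (pcod \<phi>))"

lemma pdual_simps [simp]:
  assumes "parr \<phi>"
  shows "parr (pdual \<phi>)" "psrc (pdual \<phi>) = f0 d (ptrg \<phi>)" "ptrg (pdual \<phi>) = f0 d (psrc \<phi>)"
    "pdom (pdual \<phi>) = dl (pdom \<phi>)" "pcod (pdual \<phi>) = dl (pcod \<phi>)"
    "pun (pdual \<phi>) = inv (phi (psrc \<phi>) (pcod \<phi>)) \<bullet> f2 d (pun \<phi>) \<bullet> phi (psrc \<phi>) (pdom \<phi>)"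
proof -
  note p = path_dl[of "psrc \<phi>" "pdom \<phi>"] path_dl[of "psrc \<phi>" "pcod \<phi>"] parrD[OF assms]
  show 1: "parr (pdual \<phi>)"
    using assms p unfolding parr_def[of "pdual \<phi>"] by (simp add: pdual_def)
  show "psrc (pdual \<phi>) = f0 d (ptrg \<phi>)"
    "pdom (pdual \<phi>) = dl (pdom \<phi>)" "pcod (pdual \<phi>) = dl (pcod \<phi>)"
    "pun (pdual \<phi>) = inv (phi (psrc \<phi>) (pcod \<phi>)) \<bullet> f2 d (pun \<phi>) \<bullet> phi (psrc \<phi>) (pdom \<phi>)"
    by (simp_all add: pdual_def)
  then show "ptrg (pdual \<phi>) = f0 d (psrc \<phi>)"
    using p parrD(6)[OF 1] by simp
qed

lemma pdual_pcomp:
  assumes "parr (\<psi> \<odot> \<phi>)"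
  shows "pdual (\<psi> \<odot> \<phi>) = pdual \<psi> \<odot> pdual \<phi>"
proof -
  have a: "parr \<phi>" "parr \<psi>" "psrc \<psi> = psrc \<phi>" "pdom \<psi> = pcod \<phi>" using assms by auto
  have t: "ptrg \<psi> = ptrg \<phi>" using parrD(7)[OF a(1)] parrD(6)[OF a(2)] a(3,4) by simp
  have r: "parr (pdual \<psi> \<odot> pdual \<phi>)" using a t by simp
  have q: "pun \<phi> \<in> cell B" "dom2 B (pun \<phi>) = ev (psrc \<phi>) (pdom \<phi>)" "cod2 B (pun \<phi>) = ev (psrc \<phi>) (pcod \<phi>)"
    "pun \<psi> \<in> cell B" "dom2 B (pun \<psi>) = ev (psrc \<phi>) (pcod \<phi>)" "cod2 B (pun \<psi>) = ev (psrc \<phi>) (pcod \<psi>)"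
    "path (psrc \<phi>) (pdom \<phi>)" "path (psrc \<phi>) (pcod \<phi>)" "path (psrc \<phi>) (pcod \<psi>)"
    using parrD(1-5)[OF a(1)] parrD(1-5)[OF a(2)] a(3,4) by simp_all
  show ?thesis
    by (rule pcell_eqI[OF pdual_simps(1)[OF assms] r])
      (use a q t in \<open>simp_all add: pdual_simps[OF assms] pcomp_simps[OF assms] pcomp_simps[OF r] f2_vcomp'\<close>)
qed

lemma pdual_pid:
  assumes "path a xs"
  shows "pdual (pid a xs) = pid (f0 d (tgt a xs)) (dl xs)"
  by (rule pcell_eqI) (use assms in simp_all)

lemma phi_append':
  assumes "path a ys" "path (tgt a ys) xs"
  shows "phi a (xs @ ys) = f2 d (cj a xs ys) \<bullet> fcomp d (ev (tgt a ys) xs) (ev a ys) \<bullet> (phi a ys \<star> phi (tgt a ys) xs)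
     \<bullet> inv (cj (f0 d (tgt (tgt a ys) xs)) (dl ys) (dl xs))"
proof -
  note p = path_dl[OF assms(1)] path_dl[OF assms(2)] path_tgt_obj[OF assms(1)] path_tgt_obj[OF assms(2)]
  let ?k = "cj (f0 d (tgt (tgt a ys) xs)) (dl ys) (dl xs)"
  have "(phi a (xs @ ys) \<bullet> ?k) \<bullet> inv ?k = (f2 d (cj a xs ys) \<bullet> fcomp d (ev (tgt a ys) xs) (ev a ys) \<bullet> (phi a ys \<star> phi (tgt a ys) xs)) \<bullet> inv ?k"
    by (simp only: phi_append[OF assms])
  then show ?thesis using assms p by simp
qed

text \<open>By \<open>phi_append'\<close> the coherence isomorphisms on both boundaries split into
  those of the two factors; between them only the naturality of \<open>fcomp\<close> is
  left.\<close>

lemma pdual_ptensor: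
  assumes "parr (\<psi> \<otimes> \<phi>)"
  shows "pdual (\<psi> \<otimes> \<phi>) = pdual \<phi> \<otimes> pdual \<psi>"
proof -
  have a: "parr \<phi>" "parr \<psi>" "ptrg \<phi> = psrc \<psi>" using assms by auto
  have r: "parr (pdual \<phi> \<otimes> pdual \<psi>)" using a by simp
  obtain a0 f xs xs' where f: "\<phi> = PCell a0 xs f xs'" using a by (cases \<phi>) auto
  obtain b g ys ys' where g: "\<psi> = PCell b ys g ys'" using a by (cases \<psi>) auto
  have q: "path a0 xs" "path a0 xs'" "path b ys" "path b ys'"
    "f \<in> cell B" "dom2 B f = ev a0 xs" "cod2 B f = ev a0 xs'"
    "g \<in> cell B" "dom2 B g = ev b ys" "cod2 B g = ev b ys'"
    "tgt a0 xs = b" "tgt a0 xs' = b" and c: "tgt b ys' = tgt b ys"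
    using a parrD[of \<phi>] parrD[of \<psi>] by (simp_all add: f g)
  note p = path_dl[OF q(1)] path_dl[OF q(2)] path_dl[OF q(3)] path_dl[OF q(4)]
  let ?e = "f0 d (tgt b ys)"
  let ?F = "fcomp d (ev b ys) (ev a0 xs)" and ?F' = "fcomp d (ev b ys') (ev a0 xs')"
  let ?k = "cj ?e (dl xs) (dl ys)" and ?k' = "cj ?e (dl xs') (dl ys')"
  \<comment> \<open>Naturality of \<open>fcomp\<close> in conjugated form, ready to be applied
    between the two occurrences of \<open>phi\<close>.\<close>
  have n: "inv ?F' \<bullet> f2 d (g \<star> f) \<bullet> ?F = f2 d f \<star> f2 d g"
    by (rule iso2_cancel_left[of ?F']) (use q c fcomp_nat[of f g "ev a0 xs" "ev b ys" "ev a0 xs'" "ev b ys'"] in simp_all)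
  have "inv (phi a0 (ys' @ xs')) \<bullet> f2 d (cj a0 ys' xs' \<bullet> (g \<star> f) \<bullet> inv (cj a0 ys xs)) \<bullet> phi a0 (ys @ xs)
    = ?k' \<bullet> inv (phi a0 xs' \<star> phi b ys') \<bullet> (inv ?F' \<bullet> f2 d (g \<star> f) \<bullet> ?F) \<bullet> (phi a0 xs \<star> phi b ys) \<bullet> inv ?k"
  proof -
    have "f2 d (cj a0 ys' xs' \<bullet> (g \<star> f) \<bullet> inv (cj a0 ys xs)) = f2 d (cj a0 ys' xs') \<bullet> f2 d (g \<star> f) \<bullet> inv (f2 d (cj a0 ys xs))"
      using q c by (simp add: f2_vcomp')
    then show ?thesis unfolding phi_append'[OF q(1), of ys, unfolded q(11), OF q(3)] phi_append'[OF q(2), of ys', unfolded q(12), OF q(4)]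
      using q c p by (simp del: iso2_hcomp(2) f2_iso(2))
  qed
  also have "\<dots> = ?k' \<bullet> ((inv (phi a0 xs') \<bullet> f2 d f \<bullet> phi a0 xs) \<star> (inv (phi b ys') \<bullet> f2 d g \<bullet> phi b ys)) \<bullet> inv ?k"
    unfolding n using q c p hcomp_vcomp[of "f2 d g \<bullet> phi b ys" "f2 d f \<bullet> phi a0 xs" "inv (phi b ys')" "inv (phi a0 xs')"]
      hcomp_vcomp[of "phi b ys" "phi a0 xs" "f2 d g" "f2 d f"] by simp
  finally have "pun (pdual (\<psi> \<otimes> \<phi>)) = pun (pdual \<phi> \<otimes> pdual \<psi>)"
    unfolding pdual_simps(6)[OF assms] ptensor_simps[OF r] ptensor_simps[OF assms] pdual_simps[OF a(1)] pdual_simps[OF a(2)]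
    using c q(11) a by (simp add: f g ptrg_def)
  then show ?thesis
    by (intro pcell_eqI[OF pdual_simps(1)[OF assms] r])
      (simp_all add: pdual_simps[OF assms] ptensor_simps[OF assms] ptensor_simps[OF r] a)
qed

lemma pdual_wh:
  assumes "parr (wh us \<phi> vs)"
  shows "pdual (wh us \<phi> vs) = wh (dl vs) (pdual \<phi>) (dl us)"
proof -
  let ?c = "psrcl (psrc \<phi>) vs"
  have w: "parr \<phi>" "path (ptrg \<phi>) us" "path ?c vs" "tgt ?c vs = psrc \<phi>" using assms unfolding parr_wh by auto
  have p: "parr (pid (ptrg \<phi>) us \<otimes> \<phi> \<otimes> pid ?c vs)" "parr (\<phi> \<otimes> pid ?c vs)"
    using assms by (auto simp: wh_def)
  have s: "psrcl (f0 d (ptrg \<phi>)) (dl us) = f0 d (tgt (ptrg \<phi>) us)"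
    by (rule psrcl_path) (use path_dl[OF w(2)] in simp_all)
  show ?thesis
    unfolding wh_def pdual_ptensor[OF p(1)] pdual_ptensor[OF p(2)] using w s by (simp add: pdual_pid)
qed

lemma pty_pdual: "pty \<phi> a xs ys \<Longrightarrow> pty (pdual \<phi>) (f0 d (tgt a xs)) (dl xs) (dl ys)"
  using ptyD(7) by (auto simp: pty_def)

lemma piso_pdual:
  assumes "piso \<phi>" shows "piso (pdual \<phi>)" "pinv (pdual \<phi>) = pdual (pinv \<phi>)"
proof -
  have \<phi>: "pty \<phi> (psrc \<phi>) (pdom \<phi>) (pcod \<phi>)" using assms by (simp add: pty_def piso_def)
  note i = pty_pinv[OF assms \<phi>]
  have "pdual (pinv \<phi>) \<odot> pdual \<phi> = pid (f0 d (tgt (psrc \<phi>) (pdom \<phi>))) (dl (pdom \<phi>))"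
    "pdual \<phi> \<odot> pdual (pinv \<phi>) = pid (f0 d (tgt (psrc \<phi>) (pdom \<phi>))) (dl (pcod \<phi>))"
    using ptyD(1)[OF pty_pcomp[OF \<phi> i]] ptyD(1)[OF pty_pcomp[OF i \<phi>]] pinv_pcomp[OF assms] ptyD(5,6,8)[OF \<phi>]
    by (simp_all add: pdual_pid flip: pdual_pcomp)
  then show "piso (pdual \<phi>)" "pinv (pdual \<phi>) = pdual (pinv \<phi>)"
    using pinv_unique[OF pty_pdual[OF \<phi>] pty_pdual[OF i, unfolded ptyD(8)[OF \<phi>]]] by auto
qed

text \<open>Both endpoints are computed by one recursion because \<open>Du\<close> exchanges
  them.\<close>

primrec tends :: "('o, 'm) mterm \<Rightarrow> 'o \<times> 'o" where
  "tends (At X) = (src B X, trg B X)"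
| "tends (On a) = (a, a)"
| "tends (s \<diamondop> t) = (fst (tends t), snd (tends s))"
| "tends (Du t) = (f0 d (snd (tends t)), f0 d (fst (tends t)))"

definition tsrc :: "('o, 'm) mterm \<Rightarrow> 'o" where "tsrc t = fst (tends t)"

definition ttrg :: "('o, 'm) mterm \<Rightarrow> 'o" where "ttrg t = snd (tends t)"

lemma tends_simps [simp]:
  "tsrc (At X) = src B X" "tsrc (On a) = a" "tsrc (s \<diamondop> t) = tsrc t" "tsrc (Du t) = f0 d (ttrg t)"
  "ttrg (At X) = trg B X" "ttrg (On a) = a" "ttrg (s \<diamondop> t) = ttrg s" "ttrg (Du t) = f0 d (tsrc t)"
  by (simp_all add: tsrc_def ttrg_def)

primrec tok :: "('o, 'm) mterm \<Rightarrow> bool" where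
  "tok (At X) \<longleftrightarrow> X \<in> mor B"
| "tok (On a) \<longleftrightarrow> a \<in> obj B"
| "tok (s \<diamondop> t) \<longleftrightarrow> tok s \<and> tok t \<and> tsrc s = ttrg t"
| "tok (Du t) \<longleftrightarrow> tok t"

primrec tev :: "('o, 'm) mterm \<Rightarrow> 'm" where
  "tev (At X) = X"
| "tev (On a) = \<one> a"
| "tev (s \<diamondop> t) = tev s \<cdot> tev t"
| "tev (Du t) = f1 d (tev t)"

primrec tfl :: "('o, 'm) mterm \<Rightarrow> 'm list" where
  "tfl (At X) = [X]"
| "tfl (On a) = []"
| "tfl (s \<diamondop> t) = tfl s @ tfl t"
| "tfl (Du t) = dl (tfl t)"

primrec tcan :: "('o, 'm) mterm \<Rightarrow> 'c" where
  "tcan (At X) = inv (\<r> X)"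
| "tcan (On a) = id2 B (\<one> a)"
| "tcan (s \<diamondop> t) = cj (tsrc t) (tfl s) (tfl t) \<bullet> (tcan s \<star> tcan t)"
| "tcan (Du t) = inv (phi (tsrc t) (tfl t)) \<bullet> f2 d (tcan t)"

lemma term_simps [simp]:
  assumes "tok t"
  shows "tev t \<in> mor B" "src B (tev t) = tsrc t" "trg B (tev t) = ttrg t"
    "path (tsrc t) (tfl t)" "tgt (tsrc t) (tfl t) = ttrg t"
    "tcan t \<in> cell B" "dom2 B (tcan t) = tev t" "cod2 B (tcan t) = ev (tsrc t) (tfl t)" "iso2 B (tcan t)"
    "tsrc t \<in> obj B" "ttrg t \<in> obj B"
proof -
  have *: "tev t \<in> mor B \<and> src B (tev t) = tsrc t \<and> trg B (tev t) = ttrg t \<and>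
    path (tsrc t) (tfl t) \<and> tgt (tsrc t) (tfl t) = ttrg t \<and>
    tcan t \<in> cell B \<and> dom2 B (tcan t) = tev t \<and> cod2 B (tcan t) = ev (tsrc t) (tfl t) \<and> iso2 B (tcan t)"
    using assms
  proof (induction t)
    case (Du t)
    then have *: "tok t" "tev t \<in> mor B" "src B (tev t) = tsrc t" "trg B (tev t) = ttrg t"
      "path (tsrc t) (tfl t)" "tgt (tsrc t) (tfl t) = ttrg t"
      "tcan t \<in> cell B" "dom2 B (tcan t) = tev t" "cod2 B (tcan t) = ev (tsrc t) (tfl t)" "iso2 B (tcan t)" by auto
    show ?case using * path_dl[OF *(5)] by simp
  qed auto
  then show "tev t \<in> mor B" "src B (tev t) = tsrc t" "trg B (tev t) = ttrg t"
    "path (tsrc t) (tfl t)" "tgt (tsrc t) (tfl t) = ttrg t"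
    "tcan t \<in> cell B" "dom2 B (tcan t) = tev t" "cod2 B (tcan t) = ev (tsrc t) (tfl t)" "iso2 B (tcan t)" by auto
  show "tsrc t \<in> obj B" "ttrg t \<in> obj B" using * path_tgt_obj path_src_obj by metis+
qed

definition rep :: "('o, 'm) mterm \<Rightarrow> 'c \<Rightarrow> ('o, 'm) mterm \<Rightarrow> ('o, 'm, 'c) pcell" where
  "rep t f t' = PCell (tsrc t) (tfl t) (tcan t' \<bullet> f \<bullet> inv (tcan t)) (tfl t')"

definition rty :: "('o, 'm) mterm \<Rightarrow> 'c \<Rightarrow> ('o, 'm) mterm \<Rightarrow> bool" where
  "rty t f t' \<longleftrightarrow> tok t \<and> tok t' \<and> f \<in> cell B \<and> dom2 B f = tev t \<and> cod2 B f = tev t' \<and> tsrc t' = tsrc t"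

lemma rtyD:
  assumes "rty t f t'"
  shows "tok t" "tok t'" "f \<in> cell B" "dom2 B f = tev t" "cod2 B f = tev t'" "tsrc t' = tsrc t" "ttrg t' = ttrg t"
proof -
  show *: "tok t" "tok t'" "f \<in> cell B" "dom2 B f = tev t" "cod2 B f = tev t'" "tsrc t' = tsrc t"
    using assms by (auto simp: rty_def)
  show "ttrg t' = ttrg t" using cell_simps(4)[OF *(3)] * by simp
qed

lemma pty_rep:
  assumes "rty t f t'" shows "pty (rep t f t') (tsrc t) (tfl t) (tfl t')"
proof -
  note f = rtyD[OF assms]
  have "path (tsrc t) (tfl t')" using term_simps(4)[OF f(2)] f(6) by simp
  then show ?thesis using f by (simp add: pty_def rep_def parr_def)
qed

text \<open>The way back from diagrams: conjugation by the invertible \<open>tcan\<close> is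
  injective, so an equation of 2-morphisms may be checked on their diagrams.\<close>

lemma rep_inject:
  assumes "rty t f t'" "rty t g t'" "rep t f t' = rep t g t'" shows "f = g"
proof -
  note f = rtyD[OF assms(1)] and g = rtyD[OF assms(2)]
  have "tcan t' \<bullet> f \<bullet> inv (tcan t) = tcan t' \<bullet> g \<bullet> inv (tcan t)"
    using assms(3) by (simp add: rep_def)
  then have "f \<bullet> inv (tcan t) = g \<bullet> inv (tcan t)"
    by (rule iso2_cancel_left[rotated -1]) (use f g in simp_all)
  then show ?thesis
    by (rule iso2_cancel_right[rotated -1]) (use f g in simp_all)
qed

lemma rty_vcomp: "rty t f t' \<Longrightarrow> rty t' g t'' \<Longrightarrow> rty t (g \<bullet> f) t''"
  by (auto simp: rty_def)

lemma rep_vcomp: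
  assumes "rty t f t'" "rty t' g t''" shows "rep t (g \<bullet> f) t'' = rep t' g t'' \<odot> rep t f t'"
proof -
  note f = rtyD[OF assms(1)] and g = rtyD[OF assms(2)]
  have r: "parr (rep t' g t'' \<odot> rep t f t')"
    using ptyD[OF pty_rep[OF assms(1)]] ptyD[OF pty_rep[OF assms(2)]] f by simp
  show ?thesis
    by (rule pcell_eqI[OF ptyD(1)[OF pty_rep[OF rty_vcomp[OF assms]]] r], unfold pcomp_simps[OF r])
      (use f g in \<open>simp_all add: rep_def\<close>)
qed

lemma rty_hcomp:
  assumes "rty t f t'" "rty s g s'" "tsrc s = ttrg t"
  shows "rty (s \<diamondop> t) (g \<star> f) (s' \<diamondop> t')"
  unfolding rty_def using rtyD[OF assms(1)] rtyD[OF assms(2)] assms(3) by simp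

lemma rep_hcomp:
  assumes "rty t f t'" "rty s g s'" "tsrc s = ttrg t"
  shows "rep (s \<diamondop> t) (g \<star> f) (s' \<diamondop> t') = rep s g s' \<otimes> rep t f t'"
proof -
  note f = rtyD[OF assms(1)] and g = rtyD[OF assms(2)]
  have p: "path (tsrc t) (tfl t')" "tgt (tsrc t) (tfl t') = ttrg t" "path (ttrg t) (tfl s')" "tgt (ttrg t) (tfl s') = ttrg s"
    "path (ttrg t) (tfl s)" "tgt (ttrg t) (tfl s) = ttrg s"
    using term_simps(4,5)[OF f(2)] f(6,7) term_simps(4,5)[OF g(2)] g(6,7) term_simps(4,5)[OF g(1)] assms(3) by simp_all
  have e: "cod2 B (tcan t') = ev (tsrc t) (tfl t')" "cod2 B (tcan s') = ev (ttrg t) (tfl s')" "cod2 B (tcan s) = ev (ttrg t) (tfl s)"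
    using term_simps(8)[OF f(2)] term_simps(8)[OF g(2)] term_simps(8)[OF g(1)] f(6) g(6) assms(3) by simp_all
  have r: "parr (rep s g s' \<otimes> rep t f t')"
    using ptyD[OF pty_rep[OF assms(1)]] ptyD[OF pty_rep[OF assms(2)]] f assms(3) by simp
  have "(cj (tsrc t) (tfl s') (tfl t') \<bullet> (tcan s' \<star> tcan t')) \<bullet> (g \<star> f) \<bullet> inv (cj (tsrc t) (tfl s) (tfl t) \<bullet> (tcan s \<star> tcan t))
    = cj (tsrc t) (tfl s') (tfl t') \<bullet> ((tcan s' \<bullet> g \<bullet> inv (tcan s)) \<star> (tcan t' \<bullet> f \<bullet> inv (tcan t))) \<bullet> inv (cj (tsrc t) (tfl s) (tfl t))"
    using f g p e assms(3) hcomp_vcomp[of "f \<bullet> inv (tcan t)" "g \<bullet> inv (tcan s)" "tcan t'" "tcan s'"]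
      hcomp_vcomp[of "inv (tcan t)" "inv (tcan s)" "f" "g"] by simp
  then show ?thesis
    by (intro pcell_eqI[OF ptyD(1)[OF pty_rep[OF rty_hcomp[OF assms]]] r], unfold ptensor_simps[OF r])
      (use f(6) in \<open>simp_all add: rep_def\<close>)
qed

text \<open>A coherence isomorphism is recognised by its compatibility with the canonical maps
  \<open>tcan\<close>. Identities, associators, both unitors, \<open>fcomp\<close> and
  \<open>funit\<close> are all treated by this criterion, so they disappear from diagrams.\<close>

lemma rep_eq_pid:
  assumes "rty t f t'" "tfl t = tfl t'" "tcan t' \<bullet> f = tcan t"
  shows "rep t f t' = pid (tsrc t) (tfl t)"
proof -
  note f = rtyD[OF assms(1)]
  have "tcan t' \<bullet> f \<bullet> inv (tcan t) = (tcan t' \<bullet> f) \<bullet> inv (tcan t)" using f by simp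
  then have "tcan t' \<bullet> f \<bullet> inv (tcan t) = id2 B (ev (tsrc t) (tfl t))"
    using f unfolding assms(3) by simp
  then show ?thesis using f assms(2) term_simps(4)[OF f(1)] by (simp add: rep_def pid_def)
qed

lemma rep_id: assumes "tok t" shows "rty t (id2 B (tev t)) t" "rep t (id2 B (tev t)) t = pid (tsrc t) (tfl t)"
proof -
  show *: "rty t (id2 B (tev t)) t" using assms by (simp add: rty_def)
  show "rep t (id2 B (tev t)) t = pid (tsrc t) (tfl t)" by (rule rep_eq_pid[OF *]) (use assms in simp_all)
qed

lemma rep_assoc:
  assumes "tok s" "tok t" "tok u" "tsrc s = ttrg t" "tsrc t = ttrg u"
  shows "rty ((s \<diamondop> t) \<diamondop> u) (\<a> (tev s) (tev t) (tev u)) (s \<diamondop> t \<diamondop> u)" (is ?A)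
    "rep ((s \<diamondop> t) \<diamondop> u) (\<a> (tev s) (tev t) (tev u)) (s \<diamondop> t \<diamondop> u) = pid (tsrc u) (tfl s @ tfl t @ tfl u)" (is ?B)
proof -
  show A: ?A using assms by (simp add: rty_def)
  let ?S = "tfl s" and ?T = "tfl t" and ?U = "tfl u" and ?a = "tsrc u" and ?b = "ttrg u" and ?c = "ttrg t"
  have p: "path ?b ?T" "tgt ?b ?T = ?c" "path ?c ?S" "cod2 B (tcan t) = ev ?b ?T" "cod2 B (tcan s) = ev ?c ?S"
    using term_simps[OF assms(1)] term_simps[OF assms(2)] assms(4,5) by simp_all
  have "(cj ?a ?S (?T @ ?U) \<bullet> (tcan s \<star> (cj ?a ?T ?U \<bullet> (tcan t \<star> tcan u)))) \<bullet> \<a> (tev s) (tev t) (tev u)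
    = cj ?a ?S (?T @ ?U) \<bullet> (ev ?c ?S \<rhd> cj ?a ?T ?U) \<bullet> ((tcan s \<star> (tcan t \<star> tcan u)) \<bullet> \<a> (tev s) (tev t) (tev u))"
    using assms p hcomp_vcomp[of "tcan t \<star> tcan u" "tcan s" "cj ?a ?T ?U" "id2 B (ev ?c ?S)"] by simp
  also have "(tcan s \<star> (tcan t \<star> tcan u)) \<bullet> \<a> (tev s) (tev t) (tev u)
    = \<a> (ev ?c ?S) (ev ?b ?T) (ev ?a ?U) \<bullet> ((tcan s \<star> tcan t) \<star> tcan u)"
    by (rule assoc_nat[symmetric]) (use assms p in simp_all)
  also have "cj ?a ?S (?T @ ?U) \<bullet> (ev ?c ?S \<rhd> cj ?a ?T ?U) \<bullet> (\<a> (ev ?c ?S) (ev ?b ?T) (ev ?a ?U) \<bullet> ((tcan s \<star> tcan t) \<star> tcan u))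
    = (cj ?a ?S (?T @ ?U) \<bullet> (ev ?c ?S \<rhd> cj ?a ?T ?U) \<bullet> \<a> (ev ?c ?S) (ev ?b ?T) (ev ?a ?U)) \<bullet> ((tcan s \<star> tcan t) \<star> tcan u)"
    using assms p by simp
  also have "\<dots> = (cj ?a (?S @ ?T) ?U \<bullet> (cj ?b ?S ?T \<lhd> ev ?a ?U)) \<bullet> ((tcan s \<star> tcan t) \<star> tcan u)"
    using assms p cj_assoc[of ?a ?U ?T ?S] by simp
  also have "\<dots> = cj ?a (?S @ ?T) ?U \<bullet> ((cj ?b ?S ?T \<bullet> (tcan s \<star> tcan t)) \<star> tcan u)"
    using assms p hcomp_vcomp[of "tcan u" "tcan s \<star> tcan t" "id2 B (ev ?a ?U)" "cj ?b ?S ?T"] by simp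
  finally show ?B
    using rep_eq_pid[OF A] assms by simp
qed

lemma rep_lunit:
  assumes "tok t"
  shows "rty (On (ttrg t) \<diamondop> t) (\<l> (tev t)) t" (is ?A) "rep (On (ttrg t) \<diamondop> t) (\<l> (tev t)) t = pid (tsrc t) (tfl t)"
proof -
  show A: ?A using assms by (simp add: rty_def)
  show "rep (On (ttrg t) \<diamondop> t) (\<l> (tev t)) t = pid (tsrc t) (tfl t)"
    using rep_eq_pid[OF A] assms lunit_nat[of "tcan t" "ev (tsrc t) (tfl t)" "tev t" "ttrg t"] by simp
qed

lemma rep_runit:
  assumes "tok t"
  shows "rty (t \<diamondop> On (tsrc t)) (\<r> (tev t)) t" (is ?A) "rep (t \<diamondop> On (tsrc t)) (\<r> (tev t)) t = pid (tsrc t) (tfl t)"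
proof -
  show A: ?A using assms by (simp add: rty_def)
  show "rep (t \<diamondop> On (tsrc t)) (\<r> (tev t)) t = pid (tsrc t) (tfl t)"
    using rep_eq_pid[OF A] assms runit_nat[of "tcan t" "ev (tsrc t) (tfl t)" "tev t" "tsrc t"] by (simp add: cj_Nil_right)
qed

lemma rep_inv:
  assumes "rty t f t'" "iso2 B f"
  shows "rty t' (inv f) t" "piso (rep t f t')" "rep t' (inv f) t = pinv (rep t f t')"
proof -
  note f = rtyD[OF assms(1)]
  show "rty t' (inv f) t" "piso (rep t f t')" "rep t' (inv f) t = pinv (rep t f t')"
    using f assms(2) ptyD(1)[OF pty_rep[OF assms(1)]] by (simp_all add: rty_def rep_def pinv_def piso_def)
qed

lemma rep_f2:
  assumes "rty t f t'"
  shows "rty (Du t) (f2 d f) (Du t')" "rep (Du t) (f2 d f) (Du t') = pdual (rep t f t')"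
proof -
  note f = rtyD[OF assms]
  show A: "rty (Du t) (f2 d f) (Du t')" using f by (simp add: rty_def)
  note p = path_dl[of "tsrc t" "tfl t"] path_dl[of "tsrc t" "tfl t'"]
  have q: "path (tsrc t) (tfl t')" "tgt (tsrc t) (tfl t') = ttrg t" "cod2 B (tcan t') = ev (tsrc t) (tfl t')"
    using term_simps[OF f(2)] f(6,7) by simp_all
  show "rep (Du t) (f2 d f) (Du t') = pdual (rep t f t')"
    by (rule pcell_eqI[OF ptyD(1)[OF pty_rep[OF A]] pdual_simps(1)[OF ptyD(1)[OF pty_rep[OF assms]]]],
      unfold pdual_simps[OF ptyD(1)[OF pty_rep[OF assms]]] ptyD(2-4,7)[OF pty_rep[OF assms]])
      (use f p q in \<open>simp_all add: rep_def f2_vcomp'\<close>)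
qed

text \<open>The compatibility with \<open>tcan\<close> that the criterion asks for is
  \<open>phi_append'\<close> combined with naturality of \<open>fcomp\<close> at the two maps
  \<open>tcan\<close>.\<close>

lemma rep_fcomp:
  assumes "tok s" "tok t" "tsrc s = ttrg t"
  shows "rty (Du t \<diamondop> Du s) (fcomp d (tev s) (tev t)) (Du (s \<diamondop> t))" (is ?A)
    "rep (Du t \<diamondop> Du s) (fcomp d (tev s) (tev t)) (Du (s \<diamondop> t)) = pid (f0 d (ttrg s)) (dl (tfl t) @ dl (tfl s))"
proof -
  show A: ?A using assms by (simp add: rty_def)
  let ?S = "tfl s" and ?T = "tfl t" and ?a = "tsrc t" and ?b = "ttrg t" and ?c = "ttrg s"
  have q: "path ?b ?S" "tgt ?b ?S = ?c" "path ?a ?T" "tgt ?a ?T = ?b" "cod2 B (tcan s) = ev ?b ?S"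
    using term_simps[OF assms(1)] term_simps[OF assms(2)] assms(3) by simp_all
  note p = path_dl[OF q(1)] path_dl[OF q(3)]
  let ?k = "cj (f0 d ?c) (dl ?T) (dl ?S)"
  have "(phi ?a ?T \<star> phi ?b ?S) \<bullet> ((inv (phi ?a ?T) \<bullet> f2 d (tcan t)) \<star> (inv (phi ?b ?S) \<bullet> f2 d (tcan s)))
    = f2 d (tcan t) \<star> f2 d (tcan s)"
    using assms q p by (simp flip: hcomp_vcomp)
  then have "(fcomp d (ev ?b ?S) (ev ?a ?T) \<bullet> (phi ?a ?T \<star> phi ?b ?S) \<bullet> inv ?k) \<bullet>
     ?k \<bullet> ((inv (phi ?a ?T) \<bullet> f2 d (tcan t)) \<star> (inv (phi ?b ?S) \<bullet> f2 d (tcan s)))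
    = fcomp d (ev ?b ?S) (ev ?a ?T) \<bullet> (f2 d (tcan t) \<star> f2 d (tcan s))"
    using assms q p by simp
  also have "\<dots> = f2 d (tcan s \<star> tcan t) \<bullet> fcomp d (tev s) (tev t)"
    using assms q by (simp add: fcomp_nat)
  finally have 1: "(fcomp d (ev ?b ?S) (ev ?a ?T) \<bullet> (phi ?a ?T \<star> phi ?b ?S) \<bullet> inv ?k) \<bullet>
     ?k \<bullet> ((inv (phi ?a ?T) \<bullet> f2 d (tcan t)) \<star> (inv (phi ?b ?S) \<bullet> f2 d (tcan s))) = f2 d (tcan s \<star> tcan t) \<bullet> fcomp d (tev s) (tev t)" .
  have ph: "phi ?a (?S @ ?T) = f2 d (cj ?a ?S ?T) \<bullet> fcomp d (ev ?b ?S) (ev ?a ?T) \<bullet> (phi ?a ?T \<star> phi ?b ?S) \<bullet> inv ?k"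
    using phi_append'[of ?a ?T ?S] q by simp
  have "(inv (phi ?a (?S @ ?T)) \<bullet> f2 d (cj ?a ?S ?T \<bullet> (tcan s \<star> tcan t))) \<bullet> fcomp d (tev s) (tev t)
    = ?k \<bullet> ((inv (phi ?a ?T) \<bullet> f2 d (tcan t)) \<star> (inv (phi ?b ?S) \<bullet> f2 d (tcan s)))"
  proof (rule iso2_cancel_left[of "phi ?a (?S @ ?T)"])
    have "phi ?a (?S @ ?T) \<bullet> (inv (phi ?a (?S @ ?T)) \<bullet> f2 d (cj ?a ?S ?T \<bullet> (tcan s \<star> tcan t))) \<bullet> fcomp d (tev s) (tev t)
      = f2 d (cj ?a ?S ?T) \<bullet> f2 d (tcan s \<star> tcan t) \<bullet> fcomp d (tev s) (tev t)"
      using assms q p by (simp add: f2_vcomp')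
    also have "\<dots> = f2 d (cj ?a ?S ?T) \<bullet> (fcomp d (ev ?b ?S) (ev ?a ?T) \<bullet> (phi ?a ?T \<star> phi ?b ?S) \<bullet> inv ?k) \<bullet>
     ?k \<bullet> ((inv (phi ?a ?T) \<bullet> f2 d (tcan t)) \<star> (inv (phi ?b ?S) \<bullet> f2 d (tcan s)))"
      by (simp only: 1)
    also have "\<dots> = phi ?a (?S @ ?T) \<bullet> ?k \<bullet> ((inv (phi ?a ?T) \<bullet> f2 d (tcan t)) \<star> (inv (phi ?b ?S) \<bullet> f2 d (tcan s)))"
      unfolding ph using assms q p by simp
    finally show "phi ?a (?S @ ?T) \<bullet> (inv (phi ?a (?S @ ?T)) \<bullet> f2 d (cj ?a ?S ?T \<bullet> (tcan s \<star> tcan t))) \<bullet> fcomp d (tev s) (tev t)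
      = phi ?a (?S @ ?T) \<bullet> ?k \<bullet> ((inv (phi ?a ?T) \<bullet> f2 d (tcan t)) \<star> (inv (phi ?b ?S) \<bullet> f2 d (tcan s)))" .
  qed (use assms q p in simp_all)
  then show "rep (Du t \<diamondop> Du s) (fcomp d (tev s) (tev t)) (Du (s \<diamondop> t)) = pid (f0 d (ttrg s)) (dl (tfl t) @ dl (tfl s))"
    using rep_eq_pid[OF A] assms by simp
qed

lemma rep_funit:
  assumes "a \<in> obj B"
  shows "rty (On (f0 d a)) (funit d a) (Du (On a))" (is ?A) "rep (On (f0 d a)) (funit d a) (Du (On a)) = pid (f0 d a) []"
proof -
  show A: ?A using assms by (simp add: rty_def)
  show "rep (On (f0 d a)) (funit d a) (Du (On a)) = pid (f0 d a) []"
    using rep_eq_pid[OF A] assms by simp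
qed

section \<open>Computing the diagram of an expression\<close>

primrec pl :: "'o \<Rightarrow> 'm list \<Rightarrow> ('o, 'm, 'c) pcell list \<Rightarrow> ('o, 'm, 'c) pcell" where
  "pl a xs [] = pid a xs"
| "pl a xs (\<phi> # \<phi>s) = \<phi> \<odot> pl a xs \<phi>s"

text \<open>The composite of a nonempty list without the trailing identity of \<open>pl\<close>;
  this is the form in which equations between diagrams are stated, while \<open>pl\<close> also
  covers pure coherence isomorphisms.\<close>

fun pprod :: "('o, 'm, 'c) pcell list \<Rightarrow> ('o, 'm, 'c) pcell" where
  "pprod [] = PNull"
| "pprod [\<phi>] = \<phi>"
| "pprod (\<phi> # \<psi> # \<phi>s) = \<phi> \<odot> pprod (\<psi> # \<phi>s)"

definition tm :: "'m \<Rightarrow> ('o, 'm) mterm \<Rightarrow> 'o \<Rightarrow> 'o \<Rightarrow> bool" where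
  "tm X t a b \<longleftrightarrow> tok t \<and> tev t = X \<and> tsrc t = a \<and> ttrg t = b"

text \<open>
  The diagram of \<open>f : t \<Rightarrow> t'\<close> is the composite of \<open>\<phi>s\<close>. The rules for this predicate compute \<open>\<phi>s\<close>
  by recursion on an expression for \<open>f\<close>; coherence isomorphisms contribute the empty list.
\<close>

definition rp where
  "rp a b t f t' \<phi>s \<longleftrightarrow> rty t f t' \<and> tsrc t = a \<and> ttrg t = b \<and> rep t f t' = pl a (tfl t) \<phi>s"

lemma parr_pl: "parr (pl a xs \<phi>s) \<Longrightarrow> psrc (pl a xs \<phi>s) = a \<and> pdom (pl a xs \<phi>s) = xs \<and> path a xs"
proof (induction \<phi>s)
  case (Cons \<phi> \<phi>s)
  then have p: "parr (\<phi> \<odot> pl a xs \<phi>s)" by simp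
  then show ?case using Cons.IH by (simp add: pcomp_simps[OF p])
qed auto

lemma pl_pprod: "parr (pl a xs (\<phi> # \<phi>s)) \<Longrightarrow> pl a xs (\<phi> # \<phi>s) = pprod (\<phi> # \<phi>s)"
proof (induction \<phi>s arbitrary: \<phi>)
  case Nil
  then show ?case using parr_pl[of a xs "[]"] by (auto simp: parr_pcomp)
qed simp

lemma pl_append: "pl a xs \<phi>s = \<phi> \<Longrightarrow> parr \<phi> \<Longrightarrow> pl a (pcod \<phi>) \<psi>s \<odot> \<phi> = pl a xs (\<psi>s @ \<phi>s)"
  using parr_pl[of a xs \<phi>s] by (induction \<psi>s) auto

lemma pl_wh:
  assumes "parr (wh us (pl a xs \<phi>s) vs)"
  shows "wh us (pl a xs \<phi>s) vs = pl (psrcl a vs) (us @ xs @ vs) (map (\<lambda>\<phi>. wh us \<phi> vs) \<phi>s)"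
  using assms
proof (induction \<phi>s)
  case Nil
  then show ?case by (auto simp: wh_pid parr_wh)
next
  case (Cons \<phi> \<phi>s)
  then have "parr (wh us (pl a xs \<phi>s) vs)" by (auto simp: wh_pcomp)
  then show ?case using Cons.IH by (simp add: wh_pcomp)
qed

lemma pl_pdual:
  assumes "parr (pl a xs \<phi>s)"
  shows "pdual (pl a xs \<phi>s) = pl (f0 d (tgt a xs)) (dl xs) (map pdual \<phi>s)"
  using assms by (induction \<phi>s) (auto simp: pdual_pid pdual_pcomp)

text \<open>The last rule matches every 1-morphism, so it stands behind the rules for identities,
  composites and duals when a term has to be found.\<close>

lemma tm_rules:
  "a \<in> obj B \<Longrightarrow> tm (\<one> a) (On a) a a"
  "tm X t a b \<Longrightarrow> tm Y s b c \<Longrightarrow> tm (Y \<cdot> X) (s \<diamondop> t) a c"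
  "tm X t a b \<Longrightarrow> tm (f1 d X) (Du t) (f0 d b) (f0 d a)"
  "X \<in> hom B a b \<Longrightarrow> tm X (At X) a b"
  by (auto simp: tm_def hom_iff)

lemma rpD:
  assumes "rp a b t f t' \<phi>s"
  shows "rty t f t'" "tsrc t = a" "ttrg t = b" "rep t f t' = pl a (tfl t) \<phi>s" "pty (rep t f t') a (tfl t) (tfl t')"
    "tsrc t' = a" "ttrg t' = b"
proof -
  show *: "rty t f t'" "tsrc t = a" "ttrg t = b" "rep t f t' = pl a (tfl t) \<phi>s" using assms by (auto simp: rp_def)
  show "pty (rep t f t') a (tfl t) (tfl t')" "tsrc t' = a" "ttrg t' = b" using pty_rep[OF *(1)] rtyD[OF *(1)] *(2,3) by simp_all
qed

lemma rp_canonical: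
  "tm X t a b \<Longrightarrow> rp a b t (id2 B X) t []"
  "tm X u a b \<Longrightarrow> tm Y t b c \<Longrightarrow> tm Z s c e \<Longrightarrow> rp a e ((s \<diamondop> t) \<diamondop> u) (\<a> Z Y X) (s \<diamondop> t \<diamondop> u) []"
  "tm X t a b \<Longrightarrow> rp a b (On b \<diamondop> t) (\<l> X) t []"
  "tm X t a b \<Longrightarrow> rp a b (t \<diamondop> On a) (\<r> X) t []"
  "tm X t a b \<Longrightarrow> tm Y s b c \<Longrightarrow> rp (f0 d c) (f0 d a) (Du t \<diamondop> Du s) (fcomp d Y X) (Du (s \<diamondop> t)) []"
  "a \<in> obj B \<Longrightarrow> rp (f0 d a) (f0 d a) (On (f0 d a)) (funit d a) (Du (On a)) []"
  by (auto simp: rp_def tm_def rep_id rep_assoc rep_lunit rep_runit rep_fcomp rep_funit)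

lemma rp_inv_canonical:
  assumes "rp a b t f t' []" "iso2 B f"
  shows "rp a b t' (inv f) t []"
proof -
  note f = rpD[OF assms(1)] and i = rep_inv[OF rpD(1)[OF assms(1)] assms(2)]
  have p: "path a (tfl t)" using ptyD(5)[OF f(5)] .
  then have e: "tfl t' = tfl t" using f(4) ptyD(4)[OF f(5)] by simp
  have "rep t' (inv f) t = pid a (tfl t)"
    by (rule pcell_eqI) (use p ptyD[OF pty_rep[OF i(1)]] f(4) i(2) f(6) e in
        \<open>simp_all add: i(3)\<close>, simp_all add: pinv_def)
  then show ?thesis using f i(1) e by (simp add: rp_def)
qed

lemma rp_inv_canonical_rules:
  "tm X u a b \<Longrightarrow> tm Y t b c \<Longrightarrow> tm Z s c e \<Longrightarrow> rp a e (s \<diamondop> t \<diamondop> u) (inv (\<a> Z Y X)) ((s \<diamondop> t) \<diamondop> u) []"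
  "tm X t a b \<Longrightarrow> rp a b t (inv (\<l> X)) (On b \<diamondop> t) []"
  "tm X t a b \<Longrightarrow> rp a b t (inv (\<r> X)) (t \<diamondop> On a) []"
  "tm X t a b \<Longrightarrow> tm Y s b c \<Longrightarrow> rp (f0 d c) (f0 d a) (Du (s \<diamondop> t)) (inv (fcomp d Y X)) (Du t \<diamondop> Du s) []"
  "a \<in> obj B \<Longrightarrow> rp (f0 d a) (f0 d a) (Du (On a)) (inv (funit d a)) (On (f0 d a)) []"
  by (rule rp_inv_canonical, rule rp_canonical; assumption?; fastforce simp: tm_def)+

lemma rp_vcomp:
  assumes "rp a b t f t' \<phi>s" "rp a b t' g t'' \<psi>s" shows "rp a b t (g \<bullet> f) t'' (\<psi>s @ \<phi>s)"
proof -
  note f = rpD[OF assms(1)] and g = rpD[OF assms(2)]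
  have "rep t (g \<bullet> f) t'' = pl a (tfl t) (\<psi>s @ \<phi>s)"
    unfolding rep_vcomp[OF f(1) g(1)] g(4) ptyD(4)[OF f(5), symmetric]
    by (rule pl_append[OF f(4)[symmetric] ptyD(1)[OF f(5)]])
  then show ?thesis using f(2,3) rty_vcomp[OF f(1) g(1)] by (simp add: rp_def)
qed

lemma rp_lwhisker:
  assumes "rp a b t f t' \<phi>s" "tm Y s b c"
  shows "rp a c (s \<diamondop> t) (Y \<rhd> f) (s \<diamondop> t') (map (\<lambda>\<phi>. wh (tfl s) \<phi> []) \<phi>s)"
proof -
  note f = rpD[OF assms(1)]
  have s: "tok s" "tev s = Y" "tsrc s = b" "ttrg s = c" using assms(2) by (auto simp: tm_def)
  note i = rep_id[OF s(1), unfolded s(2,3)]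
  have st: "tsrc s = ttrg t" using s f by simp
  have "rep (s \<diamondop> t) (Y \<rhd> f) (s \<diamondop> t') = pid b (tfl s) \<otimes> rep t f t'"
    using rep_hcomp[OF f(1) i(1) st] i(2) by simp
  also have "\<dots> = wh (tfl s) (rep t f t') []"
    using ptyD[OF f(5)] f(1,2,3) s(1,3) term_simps(5)[of t] by (simp add: wh_def psrcl_def rty_def)
  finally have e: "rep (s \<diamondop> t) (Y \<rhd> f) (s \<diamondop> t') = wh (tfl s) (rep t f t') []" .
  have "parr (wh (tfl s) (rep t f t') [])"
    unfolding e[symmetric] using pty_rep[OF rty_hcomp[OF f(1) i(1) st]] by (simp add: pty_def)
  then show ?thesis using e rty_hcomp[OF f(1) i(1) st] f s pl_wh[of "tfl s" a "tfl t" \<phi>s "[]"]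
    by (simp add: rp_def psrcl_def)
qed

lemma rp_rwhisker:
  assumes "tm X t a b" "rp b c s g s' \<psi>s"
  shows "rp a c (s \<diamondop> t) (g \<lhd> X) (s' \<diamondop> t) (map (\<lambda>\<phi>. wh [] \<phi> (tfl t)) \<psi>s)"
proof -
  note g = rpD[OF assms(2)]
  have t: "tok t" "tev t = X" "tsrc t = a" "ttrg t = b" using assms(1) by (auto simp: tm_def)
  note i = rep_id[OF t(1), unfolded t(2,3)]
  have st: "tsrc s = ttrg t" using t g by simp
  have p: "psrcl b (tfl t) = a" by (rule psrcl_path) (use term_simps[OF t(1)] t in simp_all)
  have b: "path c []" using term_simps(11)[of s] g(1,3) by (simp add: rty_def)
  have q: "ptrg (rep s g s' \<otimes> pid a (tfl t)) = c" "parr (rep s g s' \<otimes> pid a (tfl t))"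
    using pty_rep[OF rty_hcomp[OF i(1) g(1) st]] rep_hcomp[OF i(1) g(1) st] i(2) ptyD[OF g(5)] g(1,3) t term_simps[OF t(1)]
     term_simps(5)[of s] g(2)
    by (auto simp: pty_def ptensor_simps rty_def)
  have "rep (s \<diamondop> t) (g \<lhd> X) (s' \<diamondop> t) = rep s g s' \<otimes> pid a (tfl t)"
    using rep_hcomp[OF i(1) g(1) st] i(2) by simp
  also have "\<dots> = wh [] (rep s g s') (tfl t)"
    using ptyD[OF g(5)] p q b g(3) term_simps(5)[of s] g(1,2) by (simp add: wh_def rty_def)
  finally have e: "rep (s \<diamondop> t) (g \<lhd> X) (s' \<diamondop> t) = wh [] (rep s g s') (tfl t)" .
  have "parr (wh [] (rep s g s') (tfl t))"
    unfolding e[symmetric] using pty_rep[OF rty_hcomp[OF i(1) g(1) st]] by (simp add: pty_def)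
  then show ?thesis using e rty_hcomp[OF i(1) g(1) st] g t pl_wh[of "[]" b "tfl s" \<psi>s "tfl t"] p
    by (simp add: rp_def)
qed

text \<open>A horizontal composite has to be put in some vertical order; here the right-hand
  2-morphism \<open>f\<close> comes first. \<open>exchange\<close> relates this to the other
  order.\<close>

lemma rp_hcomp:
  assumes "rp a b t f t' \<phi>s" "rp b c s g s' \<psi>s"
  shows "rp a c (s \<diamondop> t) (g \<star> f) (s' \<diamondop> t') (map (\<lambda>\<phi>. wh [] \<phi> (tfl t')) \<psi>s @ map (\<lambda>\<phi>. wh (tfl s) \<phi> []) \<phi>s)"
proof -
  note f = rpD[OF assms(1)] and g = rpD[OF assms(2)]
  have t': "tm (tev t') t' a b" and s: "tm (tev s) s b c"
    using f(1,6,7) g(1,2,3) by (auto simp: tm_def rty_def)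
  have "g \<star> f = (g \<lhd> tev t') \<bullet> (tev s \<rhd> f)"
    using rtyD[OF f(1)] rtyD[OF g(1)] f g by (simp flip: hcomp_vcomp)
  then show ?thesis using rp_vcomp[OF rp_lwhisker[OF assms(1) s] rp_rwhisker[OF t' assms(2)]] by simp
qed

lemma rp_f2:
  assumes "rp a b t f t' \<phi>s"
  shows "rp (f0 d b) (f0 d a) (Du t) (f2 d f) (Du t') (map pdual \<phi>s)"
proof -
  note f = rpD[OF assms]
  have "tgt a (tfl t) = b" using f(1-3) term_simps(5)[of t] by (auto simp: rty_def)
  then show ?thesis using f rep_f2[OF f(1)] pl_pdual[of a "tfl t" \<phi>s] ptyD(1)[OF f(5)] by (simp add: rp_def)
qed

lemma rp_atom:
  assumes "rty t f t'" "tsrc t = a" "ttrg t = b" shows "rp a b t f t' [rep t f t']"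
  using assms ptyD[OF pty_rep[OF assms(1)]] by (simp add: rp_def)

lemma rp_atom_inv:
  assumes "rty t f t'" "tsrc t = a" "ttrg t = b" "iso2 B f" shows "rp a b t' (inv f) t [pinv (rep t f t')]"
  using rp_atom[OF rep_inv(1)[OF assms(1,4)], of a b] rep_inv(3)[OF assms(1,4)] rtyD[OF assms(1)] assms by simp

text \<open>Separates computing from comparing: the list of generators is first left open and filled
  in by the rules, and only then simplified to the list that is wanted.\<close>

lemma rp_cong: "rp a b t f t' \<psi>s \<Longrightarrow> \<psi>s = \<phi>s \<Longrightarrow> rp a b t f t' \<phi>s"
  by simp

lemma rp_rep: "rp a b t f t' (\<phi> # \<phi>s) \<Longrightarrow> rep t f t' = pprod (\<phi> # \<phi>s)"
  using rpD(4,5) ptyD(1) pl_pprod by metis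

lemma rp_eqI:
  assumes "rp a b t f t' \<phi>s" "rp a b t g t' \<psi>s" "pl a (tfl t) \<phi>s = pl a (tfl t) \<psi>s" shows "f = g"
  using rep_inject[OF rpD(1)[OF assms(1)] rpD(1)[OF assms(2)]] assms(3) rpD(4)[OF assms(1)] rpD(4)[OF assms(2)] by simp

text \<open>The general rule \<open>rp_hcomp\<close> is kept apart because its pattern also matches
  whiskerings; where it is needed, it is tried after these rules.\<close>

lemmas rp_rules = rp_canonical rp_inv_canonical_rules rp_lwhisker rp_rwhisker rp_vcomp

end

section \<open>Adjoint equivalences and mates\<close>

context bicategory
begin

lemma pty_simps:
  assumes "pty \<phi> a xs ys"
  shows "parr \<phi>" "psrc \<phi> = a" "pdom \<phi> = xs" "pcod \<phi> = ys" "ptrg \<phi> = tgt a xs"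
  using ptyD[OF assms] by blast+

lemma piso_simps:
  assumes "piso \<phi>" "pty \<phi> a xs ys"
  shows "piso \<phi>" "piso (pinv \<phi>)" "parr (pinv \<phi>)" "psrc (pinv \<phi>) = a" "pdom (pinv \<phi>) = ys" "pcod (pinv \<phi>) = xs"
    "ptrg (pinv \<phi>) = tgt a xs"
  using ptyD(1-4)[OF pty_pinv[OF assms]] trans[OF ptyD(7)[OF pty_pinv[OF assms]] ptyD(8)[OF assms(2)]]
    assms(1) piso_pinv[OF assms(1)] by blast+

lemmas cell_typing = parr_wh wh_simps pcomp_simps psrcl_simps

lemma pinv_pinv [simp]: "piso \<phi> \<Longrightarrow> pinv (pinv \<phi>) = \<phi>"
  by (cases \<phi>) (auto simp: pinv_def piso_def)

text \<open>The only typing condition is that the composite as a whole is well-typed, which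
  rewriting decides with \<open>cell_typing\<close>.\<close>

lemma wh_cancel:
  assumes "piso \<phi>" "parr (wh us \<phi> vs \<odot> wh us (pinv \<phi>) vs \<odot> \<psi>)"
  shows "wh us \<phi> vs \<odot> wh us (pinv \<phi>) vs \<odot> \<psi> = \<psi>"
proof -
  have p: "parr (wh us \<phi> vs)" "parr (wh us (pinv \<phi>) vs)" "parr \<psi>" using assms(2) by auto
  note w = piso_wh[OF assms(1) p(1)]
  have "parr (pinv (wh us \<phi> vs) \<odot> \<psi>)" using assms(2) unfolding w by simp
  then have e: "psrc \<psi> = psrc (pinv (wh us \<phi> vs))" "pcod \<psi> = pdom (pinv (wh us \<phi> vs))" by auto
  have "(wh us \<phi> vs \<odot> pinv (wh us \<phi> vs)) \<odot> \<psi> = \<psi>"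
    unfolding pinv_pcomp(2)[OF w(1)] using e p by (simp add: pinv_def)
  then show ?thesis unfolding w by simp
qed

lemma wh_cancel':
  assumes "piso \<phi>" "parr (wh us (pinv \<phi>) vs \<odot> wh us \<phi> vs \<odot> \<psi>)"
  shows "wh us (pinv \<phi>) vs \<odot> wh us \<phi> vs \<odot> \<psi> = \<psi>"
  using wh_cancel[OF piso_pinv[OF assms(1)], of us vs \<psi>] assms by simp

definition adj :: "'o \<Rightarrow> 'o \<Rightarrow> 'm \<Rightarrow> 'm \<Rightarrow> ('o, 'm, 'c) pcell \<Rightarrow> ('o, 'm, 'c) pcell \<Rightarrow> bool" where
  "adj a b X X' \<iota> \<epsilon> \<longleftrightarrow> X \<in> hom B a b \<and> X' \<in> hom B b a \<and> a \<in> obj B \<and> b \<in> obj B \<and> piso \<iota> \<and> piso \<epsilon> \<and>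
     pty \<iota> a [] [X', X] \<and> pty \<epsilon> b [X, X'] [] \<and>
     wh [] \<epsilon> [X] \<odot> wh [X] \<iota> [] = pid a [X] \<and> wh [X'] \<epsilon> [] \<odot> wh [] \<iota> [X'] = pid b [X']"

lemma adjD:
  assumes "adj a b X X' \<iota> \<epsilon>"
  shows "X \<in> mor B" "src B X = a" "trg B X = b" "X' \<in> mor B" "src B X' = b" "trg B X' = a" "a \<in> obj B" "b \<in> obj B"
    "piso \<iota>" "piso \<epsilon>" "pty \<iota> a [] [X', X]" "pty \<epsilon> b [X, X'] []"
    "wh [] \<epsilon> [X] \<odot> wh [X] \<iota> [] = pid a [X]" "wh [X'] \<epsilon> [] \<odot> wh [] \<iota> [X'] = pid b [X']"
  using assms by (auto simp: adj_def hom_iff)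

lemma adj_typing:
  assumes "adj a b X X' \<iota> \<epsilon>"
  shows "X \<in> mor B" "src B X = a" "trg B X = b" "X' \<in> mor B" "src B X' = b" "trg B X' = a" "a \<in> obj B" "b \<in> obj B"
    "parr \<iota>" "psrc \<iota> = a" "pdom \<iota> = []" "pcod \<iota> = [X', X]" "ptrg \<iota> = a"
    "parr \<epsilon>" "psrc \<epsilon> = b" "pdom \<epsilon> = [X, X']" "pcod \<epsilon> = []" "ptrg \<epsilon> = b"
    "piso \<iota>" "piso (pinv \<iota>)" "parr (pinv \<iota>)" "psrc (pinv \<iota>) = a" "pcod (pinv \<iota>) = []" "pdom (pinv \<iota>) = [X', X]" "ptrg (pinv \<iota>) = a"
    "piso \<epsilon>" "piso (pinv \<epsilon>)" "parr (pinv \<epsilon>)" "psrc (pinv \<epsilon>) = b" "pcod (pinv \<epsilon>) = [X, X']" "pdom (pinv \<epsilon>) = []" "ptrg (pinv \<epsilon>) = b"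
  using adjD[OF assms] pty_simps[OF adjD(11)[OF assms]] pty_simps[OF adjD(12)[OF assms]]
    piso_simps[OF adjD(9,11)[OF assms]] piso_simps[OF adjD(10,12)[OF assms]] by simp_all

text \<open>Each zigzag identity relates two invertible diagrams, so it can be solved: next to
  \<open>X\<close> or \<open>X'\<close>, a unit on one side is the inverse of a counit on the other.
  These forms replace the zigzags in most later calculations.\<close>

lemma adj_slide0:
  assumes "adj a b X X' \<iota> \<epsilon>"
  shows "wh [X] \<iota> [] = wh [] (pinv \<epsilon>) [X]" "wh [] \<iota> [X'] = wh [X'] (pinv \<epsilon>) []"
    "wh [X] (pinv \<iota>) [] = wh [] \<epsilon> [X]" "wh [] (pinv \<iota>) [X'] = wh [X'] \<epsilon> []"
proof -
  note t = adj_typing[OF assms]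
  have p: "parr (wh [X] \<iota> [])" "parr (wh [] \<epsilon> [X])" "parr (wh [] \<iota> [X'])" "parr (wh [X'] \<epsilon> [])"
    by (simp_all add: cell_typing t)
  have "wh [] (pinv \<epsilon>) [X] \<odot> (wh [] \<epsilon> [X] \<odot> wh [X] \<iota> []) = wh [X] \<iota> []"
    by (rule wh_cancel') (simp_all add: cell_typing t)
  then show 1: "wh [X] \<iota> [] = wh [] (pinv \<epsilon>) [X]"
    unfolding adjD(13)[OF assms] using t by (simp add: cell_typing)
  have "wh [X'] (pinv \<epsilon>) [] \<odot> (wh [X'] \<epsilon> [] \<odot> wh [] \<iota> [X']) = wh [] \<iota> [X']"
    by (rule wh_cancel') (simp_all add: cell_typing t)
  then show 2: "wh [] \<iota> [X'] = wh [X'] (pinv \<epsilon>) []"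
    unfolding adjD(14)[OF assms] using t by (simp add: cell_typing)
  show "wh [X] (pinv \<iota>) [] = wh [] \<epsilon> [X]"
    using arg_cong[OF 1, of pinv] piso_wh[OF t(19) p(1)] piso_wh[OF t(27), of "[]" "[X]"] t by (simp add: cell_typing)
  show "wh [] (pinv \<iota>) [X'] = wh [X'] \<epsilon> []"
    using arg_cong[OF 2, of pinv] piso_wh[OF t(19) p(3)] piso_wh[OF t(27), of "[X']" "[]"] t by (simp add: cell_typing)
qed

lemma adj_slide:
  assumes "adj a b X X' \<iota> \<epsilon>"
  shows "wh (us @ [X]) \<iota> vs = wh us (pinv \<epsilon>) (X # vs)" "wh us \<iota> (X' # vs) = wh (us @ [X']) (pinv \<epsilon>) vs"
    "wh (us @ [X]) (pinv \<iota>) vs = wh us \<epsilon> (X # vs)" "wh us (pinv \<iota>) (X' # vs) = wh (us @ [X']) \<epsilon> vs"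
  using adj_slide0[OF assms, THEN arg_cong, of "\<lambda>\<phi>. wh us \<phi> vs"] by simp_all

text \<open>Whiskering by an equivalence is faithful, on either side.\<close>

lemma adj_inject:
  assumes "adj a b X X' \<iota> \<epsilon>"
  shows "pty \<phi> c xs ys \<Longrightarrow> pty \<psi> c xs ys \<Longrightarrow> tgt c xs = a \<Longrightarrow> wh [X] \<phi> [] = wh [X] \<psi> [] \<Longrightarrow> \<phi> = \<psi>"
    "pty \<phi> b xs ys \<Longrightarrow> pty \<psi> b xs ys \<Longrightarrow> wh [] \<phi> [X] = wh [] \<psi> [X] \<Longrightarrow> \<phi> = \<psi>"
proof -
  note t = adj_typing[OF assms] and d = adjD[OF assms]
  assume 1: "pty \<phi> c xs ys" "pty \<psi> c xs ys" "tgt c xs = a" "wh [X] \<phi> [] = wh [X] \<psi> []"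
  note t1 = pty_simps[OF 1(1)] pty_simps[OF 1(2)] ptyD(5,6,8)[OF 1(1)]
  \<comment> \<open>A diagram is recovered from its whiskering by \<open>X'\<close> and
    \<open>X\<close> through conjugation by the unit; interchange moves the unit past it.\<close>
  have 2: "wh [] (pinv \<iota>) ys \<odot> wh [X', X] \<omega> [] \<odot> wh [] \<iota> xs = \<omega>" if w: "pty \<omega> c xs ys" for \<omega>
  proof -
    note tw = pty_simps[OF w]
    have "wh [X', X] \<omega> [] \<odot> wh [] \<iota> xs = wh [] \<iota> ys \<odot> wh [] \<omega> []"
      using exchange[OF d(11) w, of "[]" "[]" "[]"] by simp
    then have e: "wh [] (pinv \<iota>) ys \<odot> wh [X', X] \<omega> [] \<odot> wh [] \<iota> xs = wh [] (pinv \<iota>) ys \<odot> wh [] \<iota> ys \<odot> \<omega>"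
      using tw(1) by simp
    have ys: "path c ys" "tgt c ys = a" using t1 1(3) by simp_all
    have s: "psrcl a ys = c" by (rule psrcl_path[OF ys])
    have p: "parr (wh [] \<iota> ys)" "parr (wh [] (pinv \<iota>) ys)" using t s ys by (simp_all add: parr_wh)
    show ?thesis unfolding e
      by (rule wh_cancel'[OF d(9)]) (use t tw s p in \<open>simp add: wh_simps pcomp_simps\<close>)
  qed
  have "wh [X', X] \<phi> [] = wh [X', X] \<psi> []"
    using arg_cong[OF 1(4), of "\<lambda>x. wh [X'] x []"] by simp
  then show "\<phi> = \<psi>" using 2[OF 1(1)] 2[OF 1(2)] by metis
next
  note t = adj_typing[OF assms] and d = adjD[OF assms]
  assume 1: "pty \<phi> b xs ys" "pty \<psi> b xs ys" "wh [] \<phi> [X] = wh [] \<psi> [X]"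
  note t1 = pty_simps[OF 1(1)] pty_simps[OF 1(2)] ptyD(5,6,8)[OF 1(1)]
  have 2: "wh ys \<epsilon> [] \<odot> wh [] \<omega> [X, X'] \<odot> wh xs (pinv \<epsilon>) [] = \<omega>" if w: "pty \<omega> b xs ys" for \<omega>
  proof -
    note tw = pty_simps[OF w]
    have "wh [] \<omega> [X, X'] \<odot> wh xs (pinv \<epsilon>) [] = wh ys (pinv \<epsilon>) [] \<odot> wh [] \<omega> []"
      using exchange[OF w pty_pinv[OF d(10,12)], of "[]" "[]" "[]"] by simp
    then have e: "wh ys \<epsilon> [] \<odot> wh [] \<omega> [X, X'] \<odot> wh xs (pinv \<epsilon>) [] = wh ys \<epsilon> [] \<odot> wh ys (pinv \<epsilon>) [] \<odot> \<omega>"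
      using tw(1) by simp
    have p: "parr (wh ys \<epsilon> [])" "parr (wh ys (pinv \<epsilon>) [])" using t t1 by (simp_all add: parr_wh psrcl_def)
    show ?thesis unfolding e
      by (rule wh_cancel[OF d(10)]) (use t tw p in \<open>simp add: wh_simps pcomp_simps psrcl_def\<close>)
  qed
  have "wh [] \<phi> [X, X'] = wh [] \<psi> [X, X']"
    using arg_cong[OF 1(3), of "\<lambda>x. wh [] x [X']"] by simp
  then show "\<phi> = \<psi>" using 2[OF 1(1)] 2[OF 1(2)] by metis
qed

text \<open>The mates \<open>Q' R \<Rightarrow> E'\<close>, \<open>R \<Rightarrow> Q E'\<close> and \<open>R E \<Rightarrow> Q\<close> of \<open>\<Pi> : E Q' R \<Rightarrow> \<one>\<close>.\<close>

definition sq_g where "sq_g E' \<iota>E Q' R \<Pi> = wh [E'] \<Pi> [] \<odot> wh [] \<iota>E [Q', R]"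

definition sq_h where "sq_h E' \<iota>E Q Q' \<epsilon>Q R \<Pi> = wh [Q] (sq_g E' \<iota>E Q' R \<Pi>) [] \<odot> wh [] (pinv \<epsilon>Q) [R]"

definition sq_p where "sq_p E E' \<iota>E Q Q' \<epsilon>Q R \<Pi> = wh [Q] (pinv \<iota>E) [] \<odot> wh [] (sq_h E' \<iota>E Q Q' \<epsilon>Q R \<Pi>) [E]"

lemma sq_typing:
  assumes E: "adj e c E E' \<iota>E \<epsilon>E" and Q: "adj e f Q Q' \<iota>Q \<epsilon>Q" and R: "R \<in> hom B c f"
    and \<Pi>: "pty \<Pi> c [E, Q', R] []" "piso \<Pi>"
  shows "pty (sq_g E' \<iota>E Q' R \<Pi>) c [Q', R] [E']" "pty (sq_h E' \<iota>E Q Q' \<epsilon>Q R \<Pi>) c [R] [Q, E']"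
    "pty (sq_p E E' \<iota>E Q Q' \<epsilon>Q R \<Pi>) e [R, E] [Q]"
    "piso (sq_g E' \<iota>E Q' R \<Pi>)" "piso (sq_h E' \<iota>E Q Q' \<epsilon>Q R \<Pi>)" "piso (sq_p E E' \<iota>E Q Q' \<epsilon>Q R \<Pi>)"
proof -
  note t = adj_typing[OF E] adj_typing[OF Q] R[unfolded hom_iff] pty_simps[OF \<Pi>(1)]
  have 1: "pty (wh [E'] \<Pi> []) c [E', E, Q', R] [E']" "pty (wh [] \<iota>E [Q', R]) c [Q', R] [E', E, Q', R]"
    by (simp_all add: pty_def cell_typing t)
  show g: "pty (sq_g E' \<iota>E Q' R \<Pi>) c [Q', R] [E']" "piso (sq_g E' \<iota>E Q' R \<Pi>)"
    unfolding sq_g_def using pty_pcomp[OF 1(2,1)] piso_pcomp(1)[OF piso_wh(1) piso_wh(1) 1(2,1)] ptyD(1)[OF 1(1)] ptyD(1)[OF 1(2)] t \<Pi>(2) by auto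
  note t = t pty_simps[OF g(1)]
  have 2: "pty (wh [Q] (sq_g E' \<iota>E Q' R \<Pi>) []) c [Q, Q', R] [Q, E']" "pty (wh [] (pinv \<epsilon>Q) [R]) c [R] [Q, Q', R]"
    by (simp_all add: pty_def cell_typing t)
  show h: "pty (sq_h E' \<iota>E Q Q' \<epsilon>Q R \<Pi>) c [R] [Q, E']" "piso (sq_h E' \<iota>E Q Q' \<epsilon>Q R \<Pi>)"
    unfolding sq_h_def using pty_pcomp[OF 2(2,1)] piso_pcomp(1)[OF piso_wh(1) piso_wh(1) 2(2,1)] ptyD(1)[OF 2(1)] ptyD(1)[OF 2(2)] t g by auto
  note t = t pty_simps[OF h(1)]
  have 3: "pty (wh [Q] (pinv \<iota>E) []) e [Q, E', E] [Q]" "pty (wh [] (sq_h E' \<iota>E Q Q' \<epsilon>Q R \<Pi>) [E]) e [R, E] [Q, E', E]"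
    by (simp_all add: pty_def cell_typing t)
  show "pty (sq_p E E' \<iota>E Q Q' \<epsilon>Q R \<Pi>) e [R, E] [Q]" "piso (sq_p E E' \<iota>E Q Q' \<epsilon>Q R \<Pi>)"
    unfolding sq_p_def using pty_pcomp[OF 3(2,1)] piso_pcomp(1)[OF piso_wh(1) piso_wh(1) 3(2,1)] ptyD(1)[OF 3(1)] ptyD(1)[OF 3(2)] t h by auto
qed

text \<open>These equations recover \<open>\<Pi>\<close> and the intermediate mate from the last
  mate p. With \<open>E\<close> free on the right, \<open>\<Pi>\<close> is p followed by contracting
  \<open>Q'\<close> and \<open>Q\<close> with the inverse unit; with \<open>R\<close> free on the
  left, it is p followed by the counit of \<open>Q\<close>. All three come from straightening
  zigzags.\<close>

lemma sq_equations:
  assumes E: "adj e c E E' \<iota>E \<epsilon>E" and Q: "adj e f Q Q' \<iota>Q \<epsilon>Q" and R: "R \<in> hom B c f"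
    and \<Pi>: "pty \<Pi> c [E, Q', R] []" "piso \<Pi>"
  shows "wh [] \<Pi> [E] = wh [E] (pinv \<iota>Q) [] \<odot> wh [E, Q'] (sq_p E E' \<iota>E Q Q' \<epsilon>Q R \<Pi>) []" (is ?K)
    "wh [R] \<Pi> [] = wh [] \<epsilon>Q [R] \<odot> wh [] (sq_p E E' \<iota>E Q Q' \<epsilon>Q R \<Pi>) [Q', R]" (is ?K2)
    "sq_h E' \<iota>E Q Q' \<epsilon>Q R \<Pi> = wh [] (sq_p E E' \<iota>E Q Q' \<epsilon>Q R \<Pi>) [E'] \<odot> wh [R] (pinv \<epsilon>E) []" (is ?H)
proof -
  let ?g = "sq_g E' \<iota>E Q' R \<Pi>" and ?h = "sq_h E' \<iota>E Q Q' \<epsilon>Q R \<Pi>" and ?p = "sq_p E E' \<iota>E Q Q' \<epsilon>Q R \<Pi>"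
  note y = sq_typing[OF assms]
  note dE = adjD[OF E] and dQ = adjD[OF Q]
  note t = adj_typing[OF E] adj_typing[OF Q] R[unfolded hom_iff] pty_simps[OF \<Pi>(1)] \<Pi>(2)
    pty_simps[OF y(1)] pty_simps[OF y(2)] pty_simps[OF y(3)] y(4-6)
    piso_simps(2-)[OF y(4,1)]
  note sl = adj_slide[OF E] adj_slide[OF Q]
  note xc = pcomp_extend
  have g: "wh us ?g vs = wh (us @ [E']) \<Pi> vs \<odot> wh us \<iota>E (Q' # R # vs)" for us vs
    by (simp add: sq_g_def wh_pcomp)
  have h: "wh us ?h vs = wh (us @ [Q]) ?g vs \<odot> wh us (pinv \<epsilon>Q) (R # vs)" for us vs
    by (simp add: sq_h_def wh_pcomp)
  have p: "wh us ?p vs = wh (us @ [Q]) (pinv \<iota>E) vs \<odot> wh us ?h (E # vs)" for us vs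
    by (simp add: sq_p_def wh_pcomp)
  have 1: "wh [E, Q'] (pinv \<epsilon>Q) [R, E] = wh [E] \<iota>Q [Q', R, E]"
    using adj_slide(2)[OF Q, of "[E]" "[R, E]"] by simp
  have 2: "wh [E, Q', Q] ?g [E] \<odot> wh [E] \<iota>Q [Q', R, E] = wh [E] \<iota>Q [E', E] \<odot> wh [E] ?g [E]"
    using exchange[OF dQ(11) y(1), of "[E]" "[]" "[E]"] by simp
  have 3: "wh [E, Q', Q] (pinv \<iota>E) [] \<odot> wh [E] \<iota>Q [E', E] = wh [E] \<iota>Q [] \<odot> wh [E] (pinv \<iota>E) []"
    using exchange[OF dQ(11) pty_pinv[OF dE(9,11)], of "[E]" "[]" "[]"] by simp
  have 4: "wh [E] \<iota>E [Q', R, E] = wh [] (pinv \<epsilon>E) [E, Q', R, E]"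
    using adj_slide(1)[OF E, of "[]" "[Q', R, E]"] by simp
  have 5: "wh [E, E'] \<Pi> [E] \<odot> wh [] (pinv \<epsilon>E) [E, Q', R, E] = wh [] (pinv \<epsilon>E) [E] \<odot> wh [] \<Pi> [E]"
    using exchange[OF pty_pinv[OF dE(10,12)] \<Pi>(1), of "[]" "[]" "[E]"] by simp
  have 6: "wh [E] (pinv \<iota>E) [] = wh [] \<epsilon>E [E]"
    using adj_slide(3)[OF E, of "[]" "[]"] by simp
  have "wh [E] (pinv \<iota>Q) [] \<odot> wh [E, Q'] ?p []
    = wh [E] (pinv \<iota>Q) [] \<odot> wh [E, Q', Q] (pinv \<iota>E) [] \<odot> wh [E, Q', Q] ?g [E] \<odot> wh [E] \<iota>Q [Q', R, E]"
    by (simp add: p h 1)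
  also have "\<dots> = wh [E] (pinv \<iota>Q) [] \<odot> wh [E] \<iota>Q [] \<odot> wh [E] (pinv \<iota>E) [] \<odot> wh [E] ?g [E]"
    by (simp only: 2 xc[OF 3] pcomp_assoc)
  also have "\<dots> = wh [E] (pinv \<iota>E) [] \<odot> wh [E] ?g [E]"
    by (rule wh_cancel'[OF dQ(9)]) (simp add: cell_typing t)
  also have "\<dots> = wh [] \<epsilon>E [E] \<odot> wh [] (pinv \<epsilon>E) [E] \<odot> wh [] \<Pi> [E]"
    by (simp add: g 4 5 6)
  also have "\<dots> = wh [] \<Pi> [E]"
    by (rule wh_cancel[OF dE(10)]) (simp add: cell_typing t)
  finally show ?K by simp
  \<comment> \<open>Of the two ways to contract the word \<open>Q' R E Q' R\<close> to
    \<open>Q' R\<close>, turning the first pair into \<open>E'\<close> and cancelling it with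
    \<open>E\<close> agrees with applying \<open>\<Pi>\<close> to the last three letters. This is
    checked after composing with the invertible \<open>?g\<close>, where it becomes an
    interchange.\<close>
  have 7: "wh [] (pinv \<iota>E) [Q', R] \<odot> wh [] ?g [E, Q', R] = wh [Q', R] \<Pi> []"
  proof (rule pcomp_cancel_left[OF _ y(4,1)])
    have "?g \<odot> wh [] (pinv \<iota>E) [Q', R] \<odot> wh [] ?g [E, Q', R]
      = wh [E'] \<Pi> [] \<odot> wh [] \<iota>E [Q', R] \<odot> wh [] (pinv \<iota>E) [Q', R] \<odot> wh [] ?g [E, Q', R]"
      by (simp add: sq_g_def)
    also have "wh [] \<iota>E [Q', R] \<odot> wh [] (pinv \<iota>E) [Q', R] \<odot> wh [] ?g [E, Q', R] = wh [] ?g [E, Q', R]"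
      by (rule wh_cancel[OF dE(9)]) (simp add: cell_typing t)
    also have "wh [E'] \<Pi> [] \<odot> wh [] ?g [E, Q', R] = ?g \<odot> wh [Q', R] \<Pi> []"
      using exchange[OF y(1) \<Pi>(1), of "[]" "[]" "[]"] t by simp
    finally show "?g \<odot> wh [] (pinv \<iota>E) [Q', R] \<odot> wh [] ?g [E, Q', R] = ?g \<odot> wh [Q', R] \<Pi> []" .
    show "pty (wh [] (pinv \<iota>E) [Q', R] \<odot> wh [] ?g [E, Q', R]) c [Q', R, E, Q', R] [Q', R]"
      "pty (wh [Q', R] \<Pi> []) c [Q', R, E, Q', R] [Q', R]"
      by (simp_all add: pty_def cell_typing t)
  qed
  have 8: "wh [Q, Q', R] \<Pi> [] \<odot> wh [] (pinv \<epsilon>Q) [R, E, Q', R] = wh [] (pinv \<epsilon>Q) [R] \<odot> wh [R] \<Pi> []"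
    using exchange[OF pty_pinv[OF dQ(10,12)] \<Pi>(1), of "[]" "[R]" "[]"] by simp
  have "wh [] \<epsilon>Q [R] \<odot> wh [] ?p [Q', R]
    = wh [] \<epsilon>Q [R] \<odot> wh [Q] (wh [] (pinv \<iota>E) [Q', R] \<odot> wh [] ?g [E, Q', R]) [] \<odot> wh [] (pinv \<epsilon>Q) [R, E, Q', R]"
    by (simp add: p h wh_pcomp)
  also have "\<dots> = wh [] \<epsilon>Q [R] \<odot> wh [] (pinv \<epsilon>Q) [R] \<odot> wh [R] \<Pi> []"
    unfolding 7 by (simp add: 8)
  also have "\<dots> = wh [R] \<Pi> []"
    by (rule wh_cancel[OF dQ(10)]) (simp add: cell_typing t)
  finally show ?K2 by simp
  have 9: "wh [Q] (pinv \<iota>E) [E'] = wh [Q, E'] \<epsilon>E []"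
    using adj_slide(4)[OF E, of "[Q]" "[]"] by simp
  have 10: "wh [] ?h [E, E'] \<odot> wh [R] (pinv \<epsilon>E) [] = wh [Q, E'] (pinv \<epsilon>E) [] \<odot> ?h"
    using exchange[OF y(2) pty_pinv[OF dE(10,12)], of "[]" "[]" "[]"] t by simp
  have "wh [] ?p [E'] \<odot> wh [R] (pinv \<epsilon>E) [] = wh [Q, E'] \<epsilon>E [] \<odot> wh [Q, E'] (pinv \<epsilon>E) [] \<odot> ?h"
    by (simp add: p 9 10)
  also have "\<dots> = ?h"
    by (rule wh_cancel[OF dE(10)]) (simp add: cell_typing t)
  finally show ?H by simp
qed

lemma wh_cancel_end:
  assumes "piso \<phi>" "parr (\<psi> \<odot> wh us (pinv \<phi>) vs \<odot> wh us \<phi> vs)"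
  shows "\<psi> \<odot> wh us (pinv \<phi>) vs \<odot> wh us \<phi> vs = \<psi>"
proof -
  have p: "parr (wh us \<phi> vs)" "parr \<psi>" "parr (\<psi> \<odot> wh us (pinv \<phi>) vs)" using assms(2) by (auto simp: pcomp_simps)
  have *: "\<psi> \<odot> pinv \<chi> \<odot> \<chi> = \<psi>" if "piso \<chi>" "parr (\<psi> \<odot> pinv \<chi>)" for \<chi>
    unfolding pinv_pcomp(1)[OF that(1)] by (rule pid_pcomp_right) (use that(2) in \<open>auto simp: pinv_def\<close>)
  note w = piso_wh[OF assms(1) p(1)]
  show ?thesis using *[OF w(1)] p(3) unfolding w(2) by simp
qed

lemma adj_sym:
  assumes "adj a b X X' \<iota> \<epsilon>" shows "adj b a X' X (pinv \<epsilon>) (pinv \<iota>)"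
proof -
  note t = adj_typing[OF assms] and d = adjD[OF assms] and s = adj_slide0[OF assms]
  have "wh [] (pinv \<iota>) [X'] \<odot> wh [X'] (pinv \<epsilon>) [] = wh [X'] (\<epsilon> \<odot> pinv \<epsilon>) []"
    unfolding s(4) by (simp add: wh_pcomp)
  also have "\<dots> = pid b [X']" using t by (simp add: pinv_pcomp wh_pid psrcl_def)
  finally have 1: "wh [] (pinv \<iota>) [X'] \<odot> wh [X'] (pinv \<epsilon>) [] = pid b [X']" .
  have "wh [X] (pinv \<iota>) [] \<odot> wh [] (pinv \<epsilon>) [X] = wh [] (\<epsilon> \<odot> pinv \<epsilon>) [X]"
    unfolding s(3) by (simp add: wh_pcomp)
  also have "\<dots> = pid a [X]" using t by (simp add: pinv_pcomp wh_pid psrcl_def)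
  finally have 2: "wh [X] (pinv \<iota>) [] \<odot> wh [] (pinv \<epsilon>) [X] = pid a [X]" .
  show ?thesis using 1 2 d pty_pinv[OF d(9,11)] pty_pinv[OF d(10,12)] by (simp add: adj_def hom_iff piso_pinv)
qed

end

context contravariant_functor
begin

text \<open>The dual of an inverse is an inverse of the dual. The two witnesses exchange their roles
  because \<open>d\<close> reverses composites.\<close>

lemma invertible1_dual:
  assumes "invertible1 B X" shows "invertible1 B (f1 d X)"
proof -
  obtain Y f g where X: "X \<in> mor B" and Y: "Y \<in> mor B" "src B Y = trg B X" "trg B Y = src B X"
    and f: "f \<in> isos B (\<one> (src B X)) (Y \<cdot> X)" and g: "g \<in> isos B (X \<cdot> Y) (\<one> (trg B X))"
    using assms by (auto simp: invertible1_def hom_iff)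
  have "inv (fcomp d X Y) \<bullet> f2 d (inv g) \<bullet> funit d (trg B X) \<in> isos B (\<one> (src B (f1 d X))) (f1 d Y \<cdot> f1 d X)"
    "inv (funit d (src B X)) \<bullet> f2 d (inv f) \<bullet> fcomp d Y X \<in> isos B (f1 d X \<cdot> f1 d Y) (\<one> (trg B (f1 d X)))"
    using X Y f g by (simp_all add: isos_iff)
  then show ?thesis using X Y by (auto simp: invertible1_def hom_iff)
qed

text \<open>For such terms the choice between \<open>t\<close> and the 1-morphism \<open>tev t\<close> does not affect diagrams.\<close>

definition simple :: "('o, 'm) mterm \<Rightarrow> bool" where
  "simple t \<longleftrightarrow> tok t \<and> tfl t = [tev t] \<and> tcan t = inv (\<r> (tev t))"

lemma simple_At: "X \<in> mor B \<Longrightarrow> simple (At X)"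
  by (simp add: simple_def)

text \<open>By the unit axiom \<open>fcomp_runit'\<close>, \<open>phi\<close> at a one-element list
  consists of unitors only up to \<open>d\<close>. Hence the dual of an atom may be read as a new
  atom, and the inverses chosen for d(X) and d^2(X) fit the terms built with
  \<open>Du\<close>.\<close>

lemma simple_Du:
  assumes "simple t" shows "simple (Du t)"
proof -
  let ?X = "tev t"
  have t: "tok t" "tfl t = [?X]" "tcan t = inv (\<r> ?X)" using assms by (auto simp: simple_def)
  note s = term_simps[OF t(1)]
  let ?a = "tsrc t" and ?b = "ttrg t" and ?Y = "f1 d (tev t)"
  have o: "?a \<in> obj B" "?b \<in> obj B" "f0 d ?a \<in> obj B" "f0 d ?b \<in> obj B" using s by simp_all
  have "phi ?a [?X] = fcomp d ?X (\<one> ?a) \<bullet> (funit d ?a \<star> \<r> ?Y) \<bullet> inv (\<l> (?Y \<cdot> \<one> (f0 d ?b)))"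
    using s by simp
  moreover have "funit d ?a \<star> \<r> ?Y = (funit d ?a \<lhd> ?Y) \<bullet> (\<one> (f0 d ?a) \<rhd> \<r> ?Y)"
    using s o by (simp flip: hcomp_vcomp)
  moreover have "(\<one> (f0 d ?a) \<rhd> \<r> ?Y) \<bullet> inv (\<l> (?Y \<cdot> \<one> (f0 d ?b))) = inv (\<l> ?Y) \<bullet> \<r> ?Y"
  proof (rule iso2_cancel_left[of "\<l> ?Y"])
    have "\<l> ?Y \<bullet> (\<one> (f0 d ?a) \<rhd> \<r> ?Y) \<bullet> inv (\<l> (?Y \<cdot> \<one> (f0 d ?b)))
      = (\<l> ?Y \<bullet> (\<one> (f0 d ?a) \<rhd> \<r> ?Y)) \<bullet> inv (\<l> (?Y \<cdot> \<one> (f0 d ?b)))"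
      using s o by simp
    also have "\<l> ?Y \<bullet> (\<one> (f0 d ?a) \<rhd> \<r> ?Y) = \<r> ?Y \<bullet> \<l> (?Y \<cdot> \<one> (f0 d ?b))"
      by (rule lunit_nat) (use s o in simp_all)
    finally show "\<l> ?Y \<bullet> (\<one> (f0 d ?a) \<rhd> \<r> ?Y) \<bullet> inv (\<l> (?Y \<cdot> \<one> (f0 d ?b))) = \<l> ?Y \<bullet> inv (\<l> ?Y) \<bullet> \<r> ?Y"
      using s o by simp
  qed (use s o in simp_all)
  ultimately have ph: "phi ?a [?X] = fcomp d ?X (\<one> ?a) \<bullet> (funit d ?a \<lhd> ?Y) \<bullet> inv (\<l> ?Y) \<bullet> \<r> ?Y"
    using s o by simp
  have "f2 d (\<r> ?X) \<bullet> phi ?a [?X] = (f2 d (\<r> ?X) \<bullet> fcomp d ?X (\<one> ?a) \<bullet> (funit d ?a \<lhd> ?Y)) \<bullet> inv (\<l> ?Y) \<bullet> \<r> ?Y"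
    unfolding ph using s o by simp
  also have "\<dots> = \<r> ?Y"
    using s o fcomp_runit'[of ?X ?a] by simp
  finally have e: "f2 d (\<r> ?X) \<bullet> phi ?a [?X] = \<r> ?Y" .
  have p: "path ?a [?X]" using s o by simp
  have "inv (phi ?a [?X]) \<bullet> f2 d (inv (\<r> ?X)) = inv (f2 d (\<r> ?X) \<bullet> phi ?a [?X])"
    using s phi_simps[OF p] by simp
  then have "tcan (Du t) = inv (\<r> ?Y)" unfolding e by (simp add: t)
  then show ?thesis using t by (simp add: simple_def)
qed

lemma rp_eqD: "rp a b t f t' \<phi>s \<Longrightarrow> rp a b t f t' \<psi>s \<Longrightarrow> pl a (tfl t) \<phi>s = pl a (tfl t) \<psi>s"
  by (simp add: rp_def)

lemma rep_simple_cong: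
  "simple t \<Longrightarrow> rep (s \<diamondop> At (tev t)) f r = rep (s \<diamondop> t) f r" "simple t \<Longrightarrow> rep r f (s \<diamondop> At (tev t)) = rep r f (s \<diamondop> t)"
  "simple t \<Longrightarrow> rep (At (tev t) \<diamondop> s) f r = rep (t \<diamondop> s) f r"
  by (simp_all add: rep_def simple_def)

end

section \<open>Volutive 2-categories\<close>

lemma double_dual_simps [simp]:
  "f0 (double_dual C e) = (\<lambda>a. f0 e (f0 e a))" "f1 (double_dual C e) = (\<lambda>a. f1 e (f1 e a))"
  "f2 (double_dual C e) = (\<lambda>a. f2 e (f2 e a))"
  "fcomp (double_dual C e) Y X = vcomp C (f2 e (fcomp e Y X)) (fcomp e (f1 e X) (f1 e Y))"
  "funit (double_dual C e) a = vcomp C (f2 e (funit e a)) (funit e (f0 e a))"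
  by (simp_all add: double_dual_def comp_functor_def op1_functor_def)

lemma id_functor_simps [simp]:
  "f0 (id_functor C) = (\<lambda>a. a)" "f1 (id_functor C) = (\<lambda>a. a)" "f2 (id_functor C) = (\<lambda>a. a)"
  "fcomp (id_functor C) Y X = id2 C (comp1 C Y X)" "funit (id_functor C) a = id2 C (one C a)"
  by (simp_all add: id_functor_def)

sublocale O1_volutive \<subseteq> contravariant_functor B d ..

sublocale O1_volutive \<subseteq> volutive_data B J d \<eta> \<tau> .

context O1_volutive
begin

definition iota :: "'m \<Rightarrow> ('o, 'm, 'c) pcell" where
  "iota X = rep (On (src B X)) (iunit J X) (At (inv1 J X) \<diamondop> At X)"

definition epsi :: "'m \<Rightarrow> ('o, 'm, 'c) pcell" where
  "epsi X = rep (At X \<diamondop> At (inv1 J X)) (icounit J X) (On (trg B X))"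

lemma invertible1_mor: "invertible1 B X \<Longrightarrow> X \<in> mor B"
  by (simp add: invertible1_def)

lemma inv1_simps:
  assumes "invertible1 B X"
  shows "inv1 J X \<in> hom B (trg B X) (src B X)" "inv1 J X \<in> mor B" "src B (inv1 J X) = trg B X" "trg B (inv1 J X) = src B X"
  using inv1_hom[OF assms, of "src B X" "trg B X"] invertible1_mor[OF assms] by (auto simp: hom_iff)

text \<open>Stated for an arbitrary simple term, so that the units and counits of d(X) and d^2(X)
  can be used with terms such as \<open>Du (At X)\<close> while each 1-morphism still has only one
  diagram \<open>iota X\<close> and one \<open>epsi X\<close>.\<close>

lemma rp_unit_counit:
  assumes "invertible1 B X" "tm X t a b" "simple t"
  shows "rp a a (On a) (iunit J X) (At (inv1 J X) \<diamondop> t) [iota X]"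
    "rp b b (t \<diamondop> At (inv1 J X)) (icounit J X) (On b) [epsi X]"
    "rp a a (At (inv1 J X) \<diamondop> t) (inv (iunit J X)) (On a) [pinv (iota X)]"
    "rp b b (On b) (inv (icounit J X)) (t \<diamondop> At (inv1 J X)) [pinv (epsi X)]"
    "piso (iota X)" "piso (epsi X)"
proof -
  note m = invertible1_mor[OF assms(1)]
  note x = inv1_simps[OF assms(1)]
  have t: "tok t" "tev t = X" "tsrc t = a" "ttrg t = b" using assms(2) by (auto simp: tm_def)
  have ab: "src B X = a" "trg B X = b" using term_simps(2,3)[OF t(1)] t by simp_all
  note i = iunit_iso[OF assms(1), of a b, unfolded hom_iff isos_iff] icounit_iso[OF assms(1), of a b, unfolded hom_iff isos_iff]
  have r1: "rty (On a) (iunit J X) (At (inv1 J X) \<diamondop> t)"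
    using m x t ab i term_simps(10,11)[OF t(1)] by (simp add: rty_def)
  have r2: "rty (t \<diamondop> At (inv1 J X)) (icounit J X) (On b)"
    using m x t ab i term_simps(10,11)[OF t(1)] by (simp add: rty_def)
  have e: "iota X = rep (On a) (iunit J X) (At (inv1 J X) \<diamondop> t)" "epsi X = rep (t \<diamondop> At (inv1 J X)) (icounit J X) (On b)"
    using rep_simple_cong[OF assms(3)] t(2) ab by (simp_all add: iota_def epsi_def)
  show "rp a a (On a) (iunit J X) (At (inv1 J X) \<diamondop> t) [iota X]" "rp b b (t \<diamondop> At (inv1 J X)) (icounit J X) (On b) [epsi X]"
    unfolding e by (rule rp_atom[OF r1] rp_atom[OF r2]; use x t ab in simp)+
  show "rp a a (At (inv1 J X) \<diamondop> t) (inv (iunit J X)) (On a) [pinv (iota X)]"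
    "rp b b (On b) (inv (icounit J X)) (t \<diamondop> At (inv1 J X)) [pinv (epsi X)]"
    unfolding e by (rule rp_atom_inv[OF r1] rp_atom_inv[OF r2]; use x t ab i m in simp)+
  show "piso (iota X)" "piso (epsi X)"
    unfolding e using rep_inv(2)[OF r1] rep_inv(2)[OF r2] i m ab by simp_all
qed

text \<open>The two triangle identities of the choice \<open>J\<close> lose all their associators
  and unitors on diagrams and become the zigzags of \<open>adj\<close>.\<close>

lemma adj_invertible:
  assumes "invertible1 B X" "X \<in> hom B a b"
  shows "adj a b X (inv1 J X) (iota X) (epsi X)"
proof -
  have X: "X \<in> mor B" "src B X = a" "trg B X = b" using assms(2) by (auto simp: hom_iff)
  note i = inv1_simps[OF assms(1), unfolded X]
  have o: "a \<in> obj B" "b \<in> obj B" using X mor_src_trg by auto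
  have tX: "tm X (At X) a b" and tX': "tm (inv1 J X) (At (inv1 J X)) b a"
    using tm_rules(4)[OF assms(2)] tm_rules(4)[OF i(1)] by auto
  note r = rp_unit_counit[OF assms(1) tX simple_At[OF X(1)]]
  have "rp a b (At X \<diamondop> On a) (\<l> X \<bullet> (icounit J X \<lhd> X) \<bullet> inv (\<a> X (inv1 J X) X) \<bullet> (X \<rhd> iunit J X)) (At X)
    [wh [] (epsi X) [X], wh [X] (iota X) []]"
    by (rule rp_cong, (rule r tX tX' rp_rules)+) simp
  moreover have "rp a b (At X \<diamondop> On a) (\<r> X) (At X) []" by (rule rp_rules tX)+
  ultimately have 1: "pl a [X] [wh [] (epsi X) [X], wh [X] (iota X) []] = pl a [X] []"
    unfolding triangle_left[OF assms(1)] by (auto dest: rp_eqD)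
  have "rp b a (On a \<diamondop> At (inv1 J X)) (\<r> (inv1 J X) \<bullet> (inv1 J X \<rhd> icounit J X) \<bullet> \<a> (inv1 J X) X (inv1 J X)
          \<bullet> (iunit J X \<lhd> inv1 J X)) (At (inv1 J X)) [wh [inv1 J X] (epsi X) [], wh [] (iota X) [inv1 J X]]"
    by (rule rp_cong, (rule r tX tX' rp_rules)+) simp
  moreover have "rp b a (On a \<diamondop> At (inv1 J X)) (\<l> (inv1 J X)) (At (inv1 J X)) []" by (rule rp_rules tX')+
  ultimately have 2: "pl b [inv1 J X] [wh [inv1 J X] (epsi X) [], wh [] (iota X) [inv1 J X]] = pl b [inv1 J X] []"
    unfolding triangle_right[OF assms(1)] by (auto dest: rp_eqD)
  have y: "pty (iota X) a [] [inv1 J X, X]" "pty (epsi X) b [X, inv1 J X] []"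
    using rpD(5)[OF r(1)] rpD(5)[OF r(2)] rp_rep[OF r(1)] rp_rep[OF r(2)] by simp_all
  have p: "parr (pid a [X])" "parr (pid b [inv1 J X])" using X i o by simp_all
  have "wh [] (epsi X) [X] \<odot> wh [X] (iota X) [] = pid a [X]"
    using 1 p pl_pprod[of a "[X]" "wh [] (epsi X) [X]" "[wh [X] (iota X) []]"] by simp
  moreover have "wh [inv1 J X] (epsi X) [] \<odot> wh [] (iota X) [inv1 J X] = pid b [inv1 J X]"
    using 2 p pl_pprod[of b "[inv1 J X]" "wh [inv1 J X] (epsi X) []" "[wh [] (iota X) [inv1 J X]]"] by simp
  ultimately show ?thesis using assms(2) i(1) o r(5,6) y by (simp add: adj_def)
qed

section \<open>The diagrams of \<eta>\<close>

lemma eta_hom [simp]: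
  assumes "a \<in> obj B"
  shows "t1 \<eta> a \<in> hom B (f0 d (f0 d a)) a" "t1 \<eta> a \<in> mor B" "src B (t1 \<eta> a) = f0 d (f0 d a)" "trg B (t1 \<eta> a) = a"
  using eta.t1_hom[OF assms]
  by (auto simp: double_dual_def comp_functor_def op1_functor_def id_functor_def hom_iff)

lemma eta_invertible [simp]: "a \<in> obj B \<Longrightarrow> invertible1 B (t1 \<eta> a)"
  by (rule eta.t1_invertible)

text \<open>Indexed by a term and not by a 1-morphism: the boundary must display the factors of the
  argument for \<open>eta_diag_comp\<close> to make sense as an equation of diagrams.\<close>

definition eta_diag :: "('o, 'm) mterm \<Rightarrow> ('o, 'm, 'c) pcell" where
  "eta_diag t = rep (t \<diamondop> At (t1 \<eta> (tsrc t))) (t2 \<eta> (tev t)) (At (t1 \<eta> (ttrg t)) \<diamondop> Du (Du t))"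

lemma t2_simps:
  assumes "tm X t a b"
  shows "rty (t \<diamondop> At (t1 \<eta> a)) (t2 \<eta> X) (At (t1 \<eta> b) \<diamondop> Du (Du t))" "iso2 B (t2 \<eta> X)"
proof -
  have t: "tok t" "tev t = X" "tsrc t = a" "ttrg t = b" using assms by (auto simp: tm_def)
  note s = term_simps[OF t(1), unfolded t(2-4)]
  show "rty (t \<diamondop> At (t1 \<eta> a)) (t2 \<eta> X) (At (t1 \<eta> b) \<diamondop> Du (Du t))" "iso2 B (t2 \<eta> X)"
proof -
    have "X \<in> hom B a b" using s by (simp add: hom_iff)
    note i = eta.t2_iso[OF this, unfolded isos_iff double_dual_simps id_functor_simps]
    show "rty (t \<diamondop> At (t1 \<eta> a)) (t2 \<eta> X) (At (t1 \<eta> b) \<diamondop> Du (Du t))"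
      unfolding rty_def using i s t by simp
    show "iso2 B (t2 \<eta> X)" using i by simp
  qed
qed

lemma rp_eta:
  assumes "tm X t a b"
  shows "rp (f0 d (f0 d a)) b (t \<diamondop> At (t1 \<eta> a)) (t2 \<eta> X) (At (t1 \<eta> b) \<diamondop> Du (Du t)) [eta_diag t]"
    "rp (f0 d (f0 d a)) b (At (t1 \<eta> b) \<diamondop> Du (Du t)) (inv (t2 \<eta> X)) (t \<diamondop> At (t1 \<eta> a)) [pinv (eta_diag t)]"
    "pty (eta_diag t) (f0 d (f0 d a)) (tfl t @ [t1 \<eta> a]) (t1 \<eta> b # dl (dl (tfl t)))" "piso (eta_diag t)"
proof -
  have t: "tok t" "tev t = X" "tsrc t = a" "ttrg t = b" using assms by (auto simp: tm_def)
  note s = term_simps[OF t(1), unfolded t(2-4)]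
  have e: "eta_diag t = rep (t \<diamondop> At (t1 \<eta> a)) (t2 \<eta> X) (At (t1 \<eta> b) \<diamondop> Du (Du t))"
    using t by (simp add: eta_diag_def)
  note r = t2_simps[OF assms]
  show "rp (f0 d (f0 d a)) b (t \<diamondop> At (t1 \<eta> a)) (t2 \<eta> X) (At (t1 \<eta> b) \<diamondop> Du (Du t)) [eta_diag t]"
    "rp (f0 d (f0 d a)) b (At (t1 \<eta> b) \<diamondop> Du (Du t)) (inv (t2 \<eta> X)) (t \<diamondop> At (t1 \<eta> a)) [pinv (eta_diag t)]"
    unfolding e by (rule rp_atom[OF r(1)] rp_atom_inv[OF r(1) _ _ r(2)]; use s t in simp)+
  show "pty (eta_diag t) (f0 d (f0 d a)) (tfl t @ [t1 \<eta> a]) (t1 \<eta> b # dl (dl (tfl t)))" "piso (eta_diag t)"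
    unfolding e using pty_rep[OF r(1)] rep_inv(2)[OF r] s by simp_all
qed

lemma rp_pl_eq:
  assumes "f = g" "rp a b t f t' \<phi>s" "rp a b t g t' \<psi>s"
  shows "pl a (tfl t) \<phi>s = pl a (tfl t) \<psi>s"
  using assms by (simp add: rp_def)

lemma rp_pprod_eq:
  assumes "f = g" "rp a b t f t' (\<phi> # \<phi>s)" "rp a b t g t' (\<psi> # \<psi>s)"
  shows "pprod (\<phi> # \<phi>s) = pprod (\<psi> # \<psi>s)"
  using assms rp_rep by metis

lemma tm_rty: "rty t f t' \<Longrightarrow> tm (dom2 B f) t (tsrc t) (ttrg t)" "rty t f t' \<Longrightarrow> tm (cod2 B f) t' (tsrc t) (ttrg t)"
  using rtyD[of t f t'] by (auto simp: tm_def)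

lemma tm_hom: "tm X t a b \<Longrightarrow> X \<in> hom B a b" "tm X t a b \<Longrightarrow> a \<in> obj B" "tm X t a b \<Longrightarrow> b \<in> obj B"
  using term_simps[of t] by (auto simp: tm_def hom_iff)

lemma eta_diag_natural:
  assumes "rty t f t'" "tsrc t = a" "ttrg t = b"
  shows "eta_diag t' \<odot> wh [] (rep t f t') [t1 \<eta> a] = wh [t1 \<eta> b] (pdual (pdual (rep t f t'))) [] \<odot> eta_diag t"
proof -
  let ?X = "dom2 B f" and ?Y = "cod2 B f"
  have X: "tm ?X t a b" and Y: "tm ?Y t' a b" using tm_rty[OF assms(1)] assms(2,3) by simp_all
  note h = eta_hom(1)[OF tm_hom(2)[OF X]] eta_hom(1)[OF tm_hom(3)[OF X]]
  have eq: "t2 \<eta> ?Y \<bullet> (f \<lhd> t1 \<eta> a) = (t1 \<eta> b \<rhd> f2 d (f2 d f)) \<bullet> t2 \<eta> ?X"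
    using eta.t2_natural[of f ?X ?Y a b] tm_hom(1)[OF X] rtyD(3)[OF assms(1)] by (simp add: cells_iff)
  have L: "rp (f0 d (f0 d a)) b (t \<diamondop> At (t1 \<eta> a)) (t2 \<eta> ?Y \<bullet> (f \<lhd> t1 \<eta> a)) (At (t1 \<eta> b) \<diamondop> Du (Du t'))
    [eta_diag t', wh [] (rep t f t') [t1 \<eta> a]]"
    by (rule rp_cong, (rule rp_atom[OF assms] rp_eta[OF Y] X Y rp_rules tm_rules h)+) simp
  have R: "rp (f0 d (f0 d a)) b (t \<diamondop> At (t1 \<eta> a)) ((t1 \<eta> b \<rhd> f2 d (f2 d f)) \<bullet> t2 \<eta> ?X) (At (t1 \<eta> b) \<diamondop> Du (Du t'))
    [wh [t1 \<eta> b] (pdual (pdual (rep t f t'))) [], eta_diag t]"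
    by (rule rp_cong, (rule rp_atom[OF assms] rp_eta[OF X] X Y rp_rules rp_f2 tm_rules h)+) simp
  show ?thesis using rp_pprod_eq[OF eq L R] by simp
qed

lemma eta_diag_comp:
  assumes X: "tm X t a b" and Y: "tm Y s b c"
  shows "eta_diag (s \<diamondop> t) = wh [] (eta_diag s) (dl (dl (tfl t))) \<odot> wh (tfl s) (eta_diag t) []"
proof -
  have YX: "tm (Y \<cdot> X) (s \<diamondop> t) a c" using X Y by (rule tm_rules)
  note h = eta_hom(1)[OF tm_hom(2)[OF X]] eta_hom(1)[OF tm_hom(3)[OF X]] eta_hom(1)[OF tm_hom(3)[OF Y]]
  note eq = eta.t2_comp1[OF tm_hom(1)[OF X] tm_hom(1)[OF Y], unfolded double_dual_simps id_functor_simps]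
  have L: "rp (f0 d (f0 d a)) c ((s \<diamondop> t) \<diamondop> At (t1 \<eta> a)) (t2 \<eta> (Y \<cdot> X) \<bullet> (id2 B (Y \<cdot> X) \<lhd> t1 \<eta> a))
      (At (t1 \<eta> c) \<diamondop> Du (Du (s \<diamondop> t))) [eta_diag (s \<diamondop> t)]"
    by (rule rp_cong, (rule rp_eta[OF YX] X Y rp_rules tm_rules h)+) simp
  have R: "rp (f0 d (f0 d a)) c ((s \<diamondop> t) \<diamondop> At (t1 \<eta> a)) ((t1 \<eta> c \<rhd> (f2 d (fcomp d Y X) \<bullet> fcomp d (f1 d X) (f1 d Y))) \<bullet>
    \<a> (t1 \<eta> c) (f1 d (f1 d Y)) (f1 d (f1 d X)) \<bullet>
    (t2 \<eta> Y \<lhd> f1 d (f1 d X)) \<bullet> inv (\<a> Y (t1 \<eta> b) (f1 d (f1 d X))) \<bullet> (Y \<rhd> t2 \<eta> X) \<bullet> \<a> Y X (t1 \<eta> a))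
      (At (t1 \<eta> c) \<diamondop> Du (Du (s \<diamondop> t))) [wh [] (eta_diag s) (dl (dl (tfl t))), wh (tfl s) (eta_diag t) []]"
    by (rule rp_cong, (rule rp_eta[OF X] rp_eta[OF Y] X Y rp_rules rp_f2 tm_rules h)+) simp
  show ?thesis using rp_pprod_eq[OF eq L R] by simp
qed

lemma eta_diag_one:
  assumes "a \<in> obj B"
  shows "eta_diag (On a) = pid (f0 d (f0 d a)) [t1 \<eta> a]"
proof -
  note h = eta_hom(1)[OF assms]
  have o: "tm (\<one> a) (On a) a a" using assms by (rule tm_rules)
  note eq = eta.t2_one[OF assms, unfolded double_dual_simps id_functor_simps]
  have L: "rp (f0 d (f0 d a)) a (On a \<diamondop> At (t1 \<eta> a)) (t2 \<eta> (\<one> a) \<bullet> (id2 B (\<one> a) \<lhd> t1 \<eta> a))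
      (At (t1 \<eta> a) \<diamondop> Du (Du (On a))) [eta_diag (On a)]"
    by (rule rp_cong, (rule rp_eta[OF o] o rp_rules tm_rules h assms)+) simp
  have R: "rp (f0 d (f0 d a)) a (On a \<diamondop> At (t1 \<eta> a))
     ((t1 \<eta> a \<rhd> (f2 d (funit d a) \<bullet> funit d (f0 d a))) \<bullet> inv (\<r> (t1 \<eta> a)) \<bullet> \<l> (t1 \<eta> a))
      (At (t1 \<eta> a) \<diamondop> Du (Du (On a))) []"
    by (rule rp_cong, (rule o rp_rules rp_f2 tm_rules h assms f0_obj')+) simp
  have "pl (f0 d (f0 d a)) [t1 \<eta> a] [eta_diag (On a)] = pid (f0 d (f0 d a)) [t1 \<eta> a]"
    using rp_pl_eq[OF eq L R] by simp
  then show ?thesis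
    using pl_pprod[of "f0 d (f0 d a)" "[t1 \<eta> a]" "eta_diag (On a)" "[]"] assms by simp
qed

section \<open>The diagrams of \<tau>\<close>

definition tau_diag :: "'o \<Rightarrow> ('o, 'm, 'c) pcell" where
  "tau_diag a = rep (At (inv1 J (t1 \<eta> (f0 d a)))) (\<tau> a) (Du (At (t1 \<eta> a)))"

text \<open>\<open>\<tau>\<^sub>a\<close> as a pairing \<open>\<eta>\<^bsub>d(a)\<^esub> d(\<eta>\<^sub>a) \<Rightarrow> \<one>\<close>.\<close>

definition tau_counit :: "'o \<Rightarrow> ('o, 'm, 'c) pcell" where
  "tau_counit a = epsi (t1 \<eta> (f0 d a)) \<odot> wh [t1 \<eta> (f0 d a)] (pinv (tau_diag a)) []"

lemma rp_tau:
  assumes a: "a \<in> obj B"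
  shows "rp (f0 d a) (f0 d (f0 d (f0 d a))) (At (inv1 J (t1 \<eta> (f0 d a)))) (\<tau> a) (Du (At (t1 \<eta> a))) [tau_diag a]"
    "rp (f0 d a) (f0 d (f0 d (f0 d a))) (Du (At (t1 \<eta> a))) (inv (\<tau> a)) (At (inv1 J (t1 \<eta> (f0 d a)))) [pinv (tau_diag a)]"
    "pty (tau_diag a) (f0 d a) [inv1 J (t1 \<eta> (f0 d a))] [f1 d (t1 \<eta> a)]" "piso (tau_diag a)"
proof -
  have *: "\<tau> a \<in> isos B (inv1 J (t1 \<eta> (f0 d a))) (f1 d (t1 \<eta> a))"
    using tau.modification_iso[OF a]
    by (simp add: whisker_functor_right_def whisker_functor_left_def inv_trans_def op1_trans_def op1_inverses_def Let_def)
  note h = inv1_simps[OF eta_invertible[of "f0 d a"], OF f0_obj'[OF a]] eta_hom[OF a] eta_hom[OF f0_obj'[OF a]]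
  have r: "rty (At (inv1 J (t1 \<eta> (f0 d a)))) (\<tau> a) (Du (At (t1 \<eta> a)))" and i: "iso2 B (\<tau> a)"
    using * h by (simp_all add: rty_def isos_iff)
  show "rp (f0 d a) (f0 d (f0 d (f0 d a))) (At (inv1 J (t1 \<eta> (f0 d a)))) (\<tau> a) (Du (At (t1 \<eta> a))) [tau_diag a]"
    "rp (f0 d a) (f0 d (f0 d (f0 d a))) (Du (At (t1 \<eta> a))) (inv (\<tau> a)) (At (inv1 J (t1 \<eta> (f0 d a)))) [pinv (tau_diag a)]"
    unfolding tau_diag_def by (rule rp_atom[OF r] rp_atom_inv[OF r _ _ i]; use h in simp)+
  show "pty (tau_diag a) (f0 d a) [inv1 J (t1 \<eta> (f0 d a))] [f1 d (t1 \<eta> a)]" "piso (tau_diag a)"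
    unfolding tau_diag_def using pty_rep[OF r] rep_inv(2)[OF r i] h by simp_all
qed

text \<open>The modification axiom with the inverse 2-transformation written out. It is formed in
  \<open>op1 B\<close>, where unit and counit are exchanged and inverted; this is why
  \<open>pinv (iota A)\<close> and \<open>pinv (epsi C)\<close> occur.\<close>

lemma modification_strict:
  assumes X: "X \<in> hom B a b"
  defines "A \<equiv> t1 \<eta> (f0 d a)" and "C \<equiv> t1 \<eta> (f0 d b)" and "dX \<equiv> f1 d X" and "dddX \<equiv> f1 d (f1 d (f1 d X))"
  shows "wh [dddX] (tau_diag b) [] \<odot> wh [] (pinv (iota A)) [dddX, inv1 J C] \<odot> wh [inv1 J A] (eta_diag (Du (At X))) [inv1 J C]
      \<odot> wh [inv1 J A, dX] (pinv (epsi C)) []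
    = pdual (eta_diag (At X)) \<odot> wh [] (tau_diag a) [dX]"
proof -
  have o: "a \<in> obj B" "b \<in> obj B" "f0 d a \<in> obj B" "f0 d b \<in> obj B" and m: "X \<in> mor B" "src B X = a" "trg B X = b" using X by (auto simp: hom_iff)
  have tX: "tm X (At X) a b" using X by (rule tm_rules)
  have dX: "tm (f1 d X) (Du (At X)) (f0 d b) (f0 d a)" using tX by (rule tm_rules)
  note iA = eta_invertible[OF o(3)] and iC = eta_invertible[OF o(4)]
  note h = eta_hom(1)[OF o(1)] eta_hom(1)[OF o(2)] eta_hom(1)[OF o(3)] eta_hom(1)[OF o(4)]
    inv1_simps(1)[OF iA, unfolded eta_hom[OF o(3)]] inv1_simps(1)[OF iC, unfolded eta_hom[OF o(4)]]
  have mors: "A \<in> mor B" "src B A = f0 d (f0 d (f0 d a))" "trg B A = f0 d a" "inv1 J A \<in> mor B"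
    "src B (inv1 J A) = f0 d a" "trg B (inv1 J A) = f0 d (f0 d (f0 d a))"
    "C \<in> mor B" "src B C = f0 d (f0 d (f0 d b))" "trg B C = f0 d b" "inv1 J C \<in> mor B"
    "src B (inv1 J C) = f0 d b" "trg B (inv1 J C) = f0 d (f0 d (f0 d b))"
    using h by (auto simp: A_def C_def hom_iff)
  have sA: "simple (At A)" "simple (At C)" using mors simple_At by auto
  have tA: "tm A (At A) (f0 d (f0 d (f0 d a))) (f0 d a)" "tm C (At C) (f0 d (f0 d (f0 d b))) (f0 d b)"
    using h tm_rules(4) by (auto simp: A_def C_def)
  note u = rp_unit_counit[OF iA[folded A_def] tA(1) sA(1)] rp_unit_counit[OF iC[folded C_def] tA(2) sA(2)]
  note h = h[folded A_def C_def]
  have eq: "(f1 d (f1 d (f1 d X)) \<rhd> \<tau> b) \<bullet> (\<l> (f1 d (f1 d (f1 d X))) \<lhd> inv1 J C) \<bullet>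
      ((inv (iunit J A) \<lhd> f1 d (f1 d (f1 d X))) \<lhd> inv1 J C) \<bullet> (inv (\<a> (inv1 J A) A (f1 d (f1 d (f1 d X)))) \<lhd> inv1 J C) \<bullet>
      ((inv1 J A \<rhd> t2 \<eta> (f1 d X)) \<lhd> inv1 J C) \<bullet> (\<a> (inv1 J A) (f1 d X) C \<lhd> inv1 J C) \<bullet>
      inv (\<a> (inv1 J A \<cdot> f1 d X) C (inv1 J C)) \<bullet> ((inv1 J A \<cdot> f1 d X) \<rhd> inv (icounit J C)) \<bullet> inv (\<r> (inv1 J A \<cdot> f1 d X))
    = (inv (fcomp d (t1 \<eta> b) (f1 d (f1 d X))) \<bullet> f2 d (t2 \<eta> X) \<bullet> fcomp d X (t1 \<eta> a)) \<bullet> (\<tau> a \<lhd> f1 d X)"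
    using tau.modification_natural[OF X] m mors t2_simps(2)[OF dX]
    by (simp add: whisker_functor_right_def whisker_functor_left_def inv_trans_def op1_trans_def op1_inverses_def Let_def
        comp_functor_def op1_functor_def id_functor_def A_def C_def)
  note tau = rp_tau[OF o(1), folded A_def] rp_tau[OF o(2), folded C_def]
  have L: "rp (f0 d b) (f0 d (f0 d (f0 d a))) (At (inv1 J A) \<diamondop> Du (At X)) ((f1 d (f1 d (f1 d X)) \<rhd> \<tau> b) \<bullet> (\<l> (f1 d (f1 d (f1 d X))) \<lhd> inv1 J C) \<bullet>
      ((inv (iunit J A) \<lhd> f1 d (f1 d (f1 d X))) \<lhd> inv1 J C) \<bullet> (inv (\<a> (inv1 J A) A (f1 d (f1 d (f1 d X)))) \<lhd> inv1 J C) \<bullet>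
      ((inv1 J A \<rhd> t2 \<eta> (f1 d X)) \<lhd> inv1 J C) \<bullet> (\<a> (inv1 J A) (f1 d X) C \<lhd> inv1 J C) \<bullet>
      inv (\<a> (inv1 J A \<cdot> f1 d X) C (inv1 J C)) \<bullet> ((inv1 J A \<cdot> f1 d X) \<rhd> inv (icounit J C)) \<bullet> inv (\<r> (inv1 J A \<cdot> f1 d X)))
      (Du (Du (Du (At X))) \<diamondop> Du (At (t1 \<eta> b)))
     [wh [dddX] (tau_diag b) [], wh [] (pinv (iota A)) [dddX, inv1 J C], wh [inv1 J A] (eta_diag (Du (At X))) [inv1 J C],
      wh [inv1 J A, dX] (pinv (epsi C)) []]"
    by (rule rp_cong, (rule u rp_eta[OF dX, folded A_def C_def] tau tA rp_rules tX tm_rules h o)+) (simp add: dX_def dddX_def)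
  have R: "rp (f0 d b) (f0 d (f0 d (f0 d a))) (At (inv1 J A) \<diamondop> Du (At X))
     ((inv (fcomp d (t1 \<eta> b) (f1 d (f1 d X))) \<bullet> f2 d (t2 \<eta> X) \<bullet> fcomp d X (t1 \<eta> a)) \<bullet> (\<tau> a \<lhd> f1 d X))
      (Du (Du (Du (At X))) \<diamondop> Du (At (t1 \<eta> b))) [pdual (eta_diag (At X)), wh [] (tau_diag a) [dX]]"
    by (rule rp_cong, (rule rp_eta[OF tX] tau rp_rules rp_f2 tX tm_rules h)+) (simp add: dX_def)
  show ?thesis using rp_pprod_eq[OF eq L R] by simp
qed

lemma dual_strict_inv1:
  assumes "invertible1 B X" "X \<in> hom B a b"
  shows "invertible1 B (f1 d X)" "f1 d X \<in> hom B (f0 d b) (f0 d a)" "inv1 J X \<in> hom B b a"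
    "adj a b X (inv1 J X) (iota X) (epsi X)"
    "adj (f0 d b) (f0 d a) (f1 d X) (inv1 J (f1 d X)) (iota (f1 d X)) (epsi (f1 d X))"
proof -
  show 1: "invertible1 B (f1 d X)" "f1 d X \<in> hom B (f0 d b) (f0 d a)" "inv1 J X \<in> hom B b a"
    using assms invertible1_dual inv1_simps(1)[OF assms(1)] by (auto simp: hom_iff)
  show "adj a b X (inv1 J X) (iota X) (epsi X)"
    "adj (f0 d b) (f0 d a) (f1 d X) (inv1 J (f1 d X)) (iota (f1 d X)) (epsi (f1 d X))"
    using adj_invertible assms 1 by auto
qed

text \<open>The same axiom in terms of the pairing \<open>tau_counit\<close>. The chosen inverses of
  the components of \<open>\<eta>\<close> no longer occur on the boundary, so the equation can be
  combined with forms directly.\<close>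

lemma modification_counit:
  assumes X: "X \<in> hom B a b"
  shows "wh [f1 d X] (tau_counit b) [] \<odot> wh [] (pinv (eta_diag (Du (At X)))) [f1 d (t1 \<eta> b)]
      \<odot> wh [t1 \<eta> (f0 d a)] (pdual (eta_diag (At X))) []
    = wh [] (tau_counit a) [f1 d X]"
proof -
  let ?A = "t1 \<eta> (f0 d a)" and ?C = "t1 \<eta> (f0 d b)" and ?X = "f1 d X" and ?X3 = "f1 d (f1 d (f1 d X))"
  let ?A' = "inv1 J ?A" and ?C' = "inv1 J ?C" and ?Ta = "tau_diag a" and ?Tb = "tau_diag b" and ?N = "eta_diag (Du (At X))"
  have o: "a \<in> obj B" "b \<in> obj B" "f0 d a \<in> obj B" "f0 d b \<in> obj B" and m: "X \<in> mor B" "src B X = a" "trg B X = b" using X by (auto simp: hom_iff)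
  note tX = tm_rules(4)[OF X] and tdX = tm_rules(3)[OF tm_rules(4)[OF X]]
  note A = adj_invertible[OF eta_invertible[OF o(3)] eta_hom(1)[OF o(3)]]
  note C = adj_invertible[OF eta_invertible[OF o(4)] eta_hom(1)[OF o(4)]]
  note N = rp_eta(3,4)[OF tdX, simplified] and N1 = rp_eta(3)[OF tX, simplified]
  note ta = rp_tau(3,4)[OF o(1)] and tb = rp_tau(3,4)[OF o(2)]
  note t = adj_typing[OF A] adj_typing[OF C] pty_simps[OF N(1)] piso_simps[OF N(2,1)] pty_simps[OF ta(1)] piso_simps[OF ta(2,1)]
    pty_simps[OF tb(1)] piso_simps[OF tb(2,1)] m o pty_simps[OF pty_pdual[OF N1], simplified]
  note adA = adjD[OF A] and adC = adjD[OF C]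
  have mod: "wh [?A] (pdual (eta_diag (At X))) [] \<odot> wh [?A] ?Ta [?X]
     = wh [?A, ?X3] ?Tb [] \<odot> wh [?A] (pinv (iota ?A)) [?X3, ?C'] \<odot> wh [?A, ?A'] ?N [?C'] \<odot> wh [?A, ?A', ?X] (pinv (epsi ?C)) []"
    using arg_cong[OF modification_strict[OF X], of "\<lambda>\<phi>. wh [?A] \<phi> []"] by (simp add: wh_pcomp)
  have 1: "wh [] (pinv ?N) [f1 d (t1 \<eta> b)] \<odot> wh [?A, ?X3] ?Tb [] = wh [?X, ?C] ?Tb [] \<odot> wh [] (pinv ?N) [?C']"
    using exchange[OF pty_pinv[OF N(2,1)] tb(1), of "[]" "[]" "[]"] by simp
  have 2: "wh [?A] (pinv (iota ?A)) [?X3, ?C'] = wh [] (epsi ?A) [?A, ?X3, ?C']"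
    using adj_slide(3)[OF A, of "[]" "[?X3, ?C']"] by simp
  have 3: "wh [] (epsi ?A) [?A, ?X3, ?C'] \<odot> wh [?A, ?A'] ?N [?C'] = wh [] ?N [?C'] \<odot> wh [] (epsi ?A) [?X, ?C, ?C']"
    using exchange[OF adA(12) N(1), of "[]" "[]" "[?C']"] by simp
  have 4: "wh [] (epsi ?A) [?X, ?C, ?C'] \<odot> wh [?A, ?A', ?X] (pinv (epsi ?C)) [] = wh [?X] (pinv (epsi ?C)) [] \<odot> wh [] (epsi ?A) [?X]"
    using exchange[OF adA(12) pty_pinv[OF adC(10,12)], of "[]" "[?X]" "[]"] by simp
  have v: "wh us (tau_counit b) vs = wh us (epsi ?C) vs \<odot> wh (us @ [?C]) (pinv ?Tb) vs"
    "wh us (tau_counit a) vs = wh us (epsi ?A) vs \<odot> wh (us @ [?A]) (pinv ?Ta) vs" for us vs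
    by (simp_all add: tau_counit_def wh_pcomp)
  \<comment> \<open>Composing with the invertible \<open>tau_diag a\<close> makes \<open>mod\<close>
    applicable. The inverses of \<open>tau_diag b\<close>, of eta at d(X) and of the counit then
    meet what they cancel.\<close>
  have "(wh [?X] (tau_counit b) [] \<odot> wh [] (pinv ?N) [f1 d (t1 \<eta> b)] \<odot> wh [?A] (pdual (eta_diag (At X))) []) \<odot> wh [?A] ?Ta [?X]
    = wh [?X] (epsi ?C) [] \<odot> wh [?X, ?C] (pinv ?Tb) [] \<odot> wh [] (pinv ?N) [f1 d (t1 \<eta> b)] \<odot> wh [?A, ?X3] ?Tb [] \<odot>
      wh [?A] (pinv (iota ?A)) [?X3, ?C'] \<odot> wh [?A, ?A'] ?N [?C'] \<odot> wh [?A, ?A', ?X] (pinv (epsi ?C)) []"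
    by (simp add: v mod)
  also have "\<dots> = wh [?X] (epsi ?C) [] \<odot> wh [?X, ?C] (pinv ?Tb) [] \<odot> wh [?X, ?C] ?Tb [] \<odot> wh [] (pinv ?N) [?C'] \<odot> wh [] ?N [?C']
     \<odot> wh [?X] (pinv (epsi ?C)) [] \<odot> wh [] (epsi ?A) [?X]"
    by (simp only: pcomp_extend[OF 1] 2 pcomp_extend[OF 3] 4 pcomp_assoc)
  also have "wh [?X, ?C] (pinv ?Tb) [] \<odot> wh [?X, ?C] ?Tb [] \<odot> wh [] (pinv ?N) [?C'] \<odot> wh [] ?N [?C']
     \<odot> wh [?X] (pinv (epsi ?C)) [] \<odot> wh [] (epsi ?A) [?X]
    = wh [] (pinv ?N) [?C'] \<odot> wh [] ?N [?C'] \<odot> wh [?X] (pinv (epsi ?C)) [] \<odot> wh [] (epsi ?A) [?X]"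
    by (rule wh_cancel'[OF tb(2)]) (simp add: cell_typing t)
  also have "\<dots> = wh [?X] (pinv (epsi ?C)) [] \<odot> wh [] (epsi ?A) [?X]"
    by (rule wh_cancel'[OF N(2)]) (simp add: cell_typing t)
  also have "wh [?X] (epsi ?C) [] \<odot> \<dots> = wh [] (epsi ?A) [?X]"
    by (rule wh_cancel[OF adC(10)]) (simp add: cell_typing t)
  also have "\<dots> = wh [] (epsi ?A) [?X] \<odot> wh [?A] (pinv ?Ta) [?X] \<odot> wh [?A] ?Ta [?X]"
    by (rule wh_cancel_end[OF ta(2), symmetric]) (simp add: cell_typing t)
  also have "\<dots> = wh [] (tau_counit a) [?X] \<odot> wh [?A] ?Ta [?X]"
    by (simp add: v)
  finally have e: "(wh [?X] (tau_counit b) [] \<odot> wh [] (pinv ?N) [f1 d (t1 \<eta> b)] \<odot> wh [?A] (pdual (eta_diag (At X))) []) \<odot> wh [?A] ?Ta [?X]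
      = wh [] (tau_counit a) [?X] \<odot> wh [?A] ?Ta [?X]" .
  have p: "parr (wh [?A] ?Ta [?X])" by (simp add: cell_typing t)
  show ?thesis
    by (rule pcomp_cancel_right[OF e piso_wh(1)[OF ta(2) p], of "f0 d b" "[?A, ?A', ?X]" "[?A, f1 d (t1 \<eta> a), ?X]" "[?X]"])
      (simp_all add: pty_def v cell_typing t eta_hom)
qed

text \<open>The diagram of \<open>dual_inverse\<close>.\<close>

definition delta :: "'m \<Rightarrow> ('o, 'm, 'c) pcell" where
  "delta X = wh [] (pinv (iota (f1 d X))) [f1 d (inv1 J X)] \<odot> wh [inv1 J (f1 d X)] (pdual (iota X)) []"

text \<open>Dualising a zigzag of \<open>X\<close> shows that the dual of the unit, whiskered by
  d(X), is the inverse of the dual of the counit. Thus the comparison followed by d(epsilon)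
  contracts d(X)^-1 d(X) just as the inverse unit of d(X) does.\<close>

lemma delta_counit:
  assumes "invertible1 B X" "X \<in> hom B a b"
  shows "wh [] (delta X) [f1 d X] = pinv (pdual (epsi X)) \<odot> pinv (iota (f1 d X))"
    "pty (delta X) (f0 d a) [inv1 J (f1 d X)] [f1 d (inv1 J X)]"
    "pty (pdual (epsi X)) (f0 d b) [f1 d (inv1 J X), f1 d X] []" "piso (pdual (epsi X))" "piso (delta X)"
proof -
  note i = dual_strict_inv1[OF assms]
  note A = i(4) and C = i(5)
  note dA = adjD[OF A] and dC = adjD[OF C]
  have o: "f0 d a \<in> obj B" "f0 d b \<in> obj B" using dA by simp_all
  have y: "pty (pdual (iota X)) (f0 d a) [] [f1 d X, f1 d (inv1 J X)]" "pty (pdual (epsi X)) (f0 d b) [f1 d (inv1 J X), f1 d X] []"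
    using pty_pdual[OF dA(11)] pty_pdual[OF dA(12)] dA by simp_all
  have e: "piso (pdual (epsi X))" using piso_pdual(1)[OF dA(10)] .
  note t = adj_typing[OF A] adj_typing[OF C] pty_simps[OF y(1)] pty_simps[OF y(2)] piso_simps[OF e y(2)] o
  show "pty (pdual (epsi X)) (f0 d b) [f1 d (inv1 J X), f1 d X] []" "piso (pdual (epsi X))" by fact+
  have pi: "piso (pdual (iota X))" using piso_pdual(1)[OF dA(9)] .
  have w: "pty (wh [] (pinv (iota (f1 d X))) [f1 d (inv1 J X)]) (f0 d a) [inv1 J (f1 d X), f1 d X, f1 d (inv1 J X)] [f1 d (inv1 J X)]"
    "pty (wh [inv1 J (f1 d X)] (pdual (iota X)) []) (f0 d a) [inv1 J (f1 d X)] [inv1 J (f1 d X), f1 d X, f1 d (inv1 J X)]"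
    by (simp_all add: pty_def cell_typing t)
  show "pty (delta X) (f0 d a) [inv1 J (f1 d X)] [f1 d (inv1 J X)]"
    unfolding delta_def by (rule pty_pcomp[OF w(2,1)])
  show "piso (delta X)"
    unfolding delta_def by (rule piso_pcomp(1)[OF piso_wh(1)[OF pi ptyD(1)[OF w(2)]] piso_wh(1)[OF piso_pinv[OF dC(9)] ptyD(1)[OF w(1)]] w(2,1)])
  have "parr (wh [] (epsi X) [X] \<odot> wh [X] (iota X) [])" "parr (wh [] (epsi X) [X])" "parr (wh [X] (iota X) [])"
    by (simp_all add: cell_typing t)
  then have "pdual (wh [] (epsi X) [X] \<odot> wh [X] (iota X) []) = wh [f1 d X] (pdual (epsi X)) [] \<odot> wh [] (pdual (iota X)) [f1 d X]"
    by (simp add: pdual_pcomp pdual_wh del: parr_pcomp)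
  then have "wh [f1 d X] (pdual (epsi X)) [] \<odot> wh [] (pdual (iota X)) [f1 d X] = pid (f0 d b) [f1 d X]"
    unfolding dA(13) using t by (simp add: pdual_pid)
  then have "wh [f1 d X] (pinv (pdual (epsi X))) [] \<odot> wh [f1 d X] (pdual (epsi X)) [] \<odot> wh [] (pdual (iota X)) [f1 d X]
    = wh [f1 d X] (pinv (pdual (epsi X))) []" by (simp add: cell_typing t)
  moreover have "wh [f1 d X] (pinv (pdual (epsi X))) [] \<odot> wh [f1 d X] (pdual (epsi X)) [] \<odot> wh [] (pdual (iota X)) [f1 d X]
    = wh [] (pdual (iota X)) [f1 d X]"
    by (rule wh_cancel'[OF e]) (simp add: cell_typing t)
  ultimately have 1: "wh [] (pdual (iota X)) [f1 d X] = wh [f1 d X] (pinv (pdual (epsi X))) []" by simp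
  have 2: "wh [inv1 J (f1 d X)] (pdual (iota X)) [f1 d X] = wh [inv1 J (f1 d X), f1 d X] (pinv (pdual (epsi X))) []"
    using arg_cong[OF 1, of "\<lambda>\<phi>. wh [inv1 J (f1 d X)] \<phi> []"] by simp
  have "wh [] (pinv (iota (f1 d X))) [f1 d (inv1 J X), f1 d X] \<odot> wh [inv1 J (f1 d X), f1 d X] (pinv (pdual (epsi X))) []
     = pinv (pdual (epsi X)) \<odot> pinv (iota (f1 d X))"
    using exchange[OF pty_pinv[OF dC(9,11)] pty_pinv[OF e y(2)], of "[]" "[]" "[]"] t by simp
  then show "wh [] (delta X) [f1 d X] = pinv (pdual (epsi X)) \<odot> pinv (iota (f1 d X))"
    by (simp add: delta_def wh_pcomp 2)
qed

text \<open>Packs a computed composite into one generator, so that a construction is expanded once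
  and then used under its name.\<close>

lemma rp_single: "rp a b t f t' (\<phi> # \<phi>s) \<Longrightarrow> rp a b t f t' [pprod (\<phi> # \<phi>s)]"
  using rp_atom[OF rpD(1,2,3)] rp_rep by metis

lemma iso2_of_rep:
  assumes "rty t f t'" "piso (rep t f t')" shows "iso2 B f"
proof -
  note f = rtyD[OF assms(1)]
  define k where "k = tcan t' \<bullet> f \<bullet> inv (tcan t)"
  have k: "iso2 B k" using assms(2) by (simp add: piso_def rep_def k_def)
  have c: "dom2 B k = cod2 B (tcan t)" "cod2 B k = cod2 B (tcan t')" "f = inv (tcan t') \<bullet> k \<bullet> tcan t"
    using f by (simp_all add: k_def)
  show ?thesis unfolding c(3) using f c(1,2) k iso2_cell[OF k] by simp
qed

lemma rp_iso:
  assumes "rp a b t f t' (\<phi> # \<phi>s)" "piso (pprod (\<phi> # \<phi>s))"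
  shows "iso2 B f" "rp a b t' (inv f) t [pinv (pprod (\<phi> # \<phi>s))]"
proof -
  show 1: "iso2 B f" using iso2_of_rep[OF rpD(1)[OF assms(1)]] rp_rep[OF assms(1)] assms(2) by simp
  show "rp a b t' (inv f) t [pinv (pprod (\<phi> # \<phi>s))]"
    using rp_atom_inv[OF rpD(1,2,3)[OF assms(1)] 1] rp_rep[OF assms(1)] by simp
qed

lemma rp_transpose_inverse:
  assumes P: "invertible1 B P" "tm P p a b" "simple p" and Q: "invertible1 B Q" "tm Q q b a" "simple q"
    and f: "rp b a q (inv f) (At (inv1 J P)) [\<phi>]"
  shows "rp a b p (transpose_inverse B J P Q f) (At (inv1 J Q))
    [wh [] (epsi P) [inv1 J Q], wh [P] \<phi> [inv1 J Q], wh [P] (pinv (epsi Q)) []]"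
proof -
  note u = rp_unit_counit[OF P] rp_unit_counit[OF Q]
  note h = inv1_hom[OF P(1) tm_hom(1)[OF P(2)]] inv1_hom[OF Q(1) tm_hom(1)[OF Q(2)]]
  have fl: "tfl p = [P]" using P by (simp add: simple_def tm_def)
  show ?thesis unfolding transpose_inverse_def
    by (rule rp_cong, (rule u f P(2) Q(2) rp_rules tm_rules h)+) (simp add: fl)
qed

lemma rp_dual_inverse:
  assumes X: "invertible1 B X" "tm X t a b" "simple t"
  shows "rp (f0 d a) (f0 d b) (At (inv1 J (f1 d X))) (dual_inverse B J d X) (Du (At (inv1 J X))) [delta X]"
proof -
  note dX = invertible1_dual[OF X(1)] tm_rules(3)[OF X(2)] simple_Du[OF X(3)]
  note u = rp_unit_counit[OF X] rp_unit_counit[OF dX]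
  note h = inv1_hom[OF X(1) tm_hom(1)[OF X(2)]] inv1_hom[OF dX(1) tm_hom(1)[OF dX(2)]]
  have s: "src B X = a" "a \<in> obj B" using tm_hom[OF X(2)] by (auto simp: hom_iff)
  have "rp (f0 d a) (f0 d b) (At (inv1 J (f1 d X))) (dual_inverse B J d X) (Du (At (inv1 J X)))
    [wh [] (pinv (iota (f1 d X))) [f1 d (inv1 J X)], wh [inv1 J (f1 d X)] (pdual (iota X)) []]"
    unfolding dual_inverse_def Let_def s
    by (rule rp_cong, (rule u X(2) dX(2) rp_rules rp_f2 tm_rules h s)+) simp
  from rp_single[OF this] show ?thesis by (simp add: delta_def)
qed

text \<open>Moving \<open>P\<close> and then the inverse of \<open>Q\<close> to the other side is
  precisely the mate \<open>sq_h\<close>; the last move contributes the unit of \<open>R\<close>.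
  This connects the definition of the objects with \<open>sq_equations\<close>.\<close>

lemma rp_pass_to_inverses:
  assumes P: "invertible1 B P" "tm P p e c" "simple p" and Q: "invertible1 B Q" "tm Q q e f" "simple q"
    and R: "invertible1 B R" "tm R r c f" "simple r" and \<phi>: "rp c c (p \<diamondop> At (inv1 J Q) \<diamondop> r) g (On c) [\<phi>]"
  shows "rp c c (On c) (pass_to_inverses B J P Q R g) (At (inv1 J R) \<diamondop> q \<diamondop> At (inv1 J P))
    [wh [inv1 J R] (sq_h (inv1 J P) (iota P) Q (inv1 J Q) (epsi Q) R \<phi>) [] \<odot> iota R]"
proof -
  note u = rp_unit_counit[OF P] rp_unit_counit[OF Q] rp_unit_counit[OF R]
  note h = inv1_hom[OF P(1) tm_hom(1)[OF P(2)]] inv1_hom[OF Q(1) tm_hom(1)[OF Q(2)]] inv1_hom[OF R(1) tm_hom(1)[OF R(2)]]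
  have fl: "tfl p = [P]" "tfl q = [Q]" "tfl r = [R]" using P Q R by (auto simp add: simple_def tm_def)
  have s: "src B R = c" "c \<in> obj B" using tm_hom[OF R(2)] by (auto simp: hom_iff)
  have pi: "parr (iota R)" using ptyD(1)[OF adjD(11)[OF adj_invertible[OF R(1) tm_hom(1)[OF R(2)]]]] .
  have "rp c c (On c) (pass_to_inverses B J P Q R g) (At (inv1 J R) \<diamondop> q \<diamondop> At (inv1 J P))
    [wh [inv1 J R, Q, inv1 J P] \<phi> [], wh [inv1 J R, Q] (iota P) [inv1 J Q, R], wh [inv1 J R] (pinv (epsi Q)) [R], iota R]"
    unfolding pass_to_inverses_def move_left_def move_left_inverse_def Let_def s
    by (rule rp_cong, (rule u \<phi> P(2) Q(2) R(2) rp_rules tm_rules h s)+) (simp add: fl pi)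
  from rp_single[OF this] show ?thesis
    by (simp add: sq_h_def sq_g_def wh_pcomp)
qed

section \<open>Objects of the strictification as symmetric forms\<close>

lemma S_objD:
  assumes "(c, \<theta>, \<Pi>) \<in> S_obj"
  shows "c \<in> obj B" "\<theta> \<in> hom B c (f0 d c)" "invertible1 B \<theta>"
    "\<Pi> \<in> isos B (t1 \<eta> c \<cdot> (inv1 J (f1 d \<theta>) \<cdot> \<theta>)) (\<one> c)" "object_cell_1 c \<theta> \<Pi> = object_cell_2 c \<theta> \<Pi>"
  using assms by (auto simp: S_obj_def)

definition Pi_diag :: "'o \<Rightarrow> 'm \<Rightarrow> 'c \<Rightarrow> ('o, 'm, 'c) pcell" where
  "Pi_diag c \<theta> \<Pi> = rep (At (t1 \<eta> c) \<diamondop> At (inv1 J (f1 d \<theta>)) \<diamondop> At \<theta>) \<Pi> (On c)"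

text \<open>In contrast to \<open>\<Pi>\<close>, neither end involves a chosen inverse, so the form
  can be dualised and whiskered without the comparison \<open>delta\<close>.\<close>

definition form :: "'o \<Rightarrow> 'm \<Rightarrow> 'c \<Rightarrow> ('o, 'm, 'c) pcell" where
  "form c \<theta> \<Pi> = sq_p (t1 \<eta> c) (inv1 J (t1 \<eta> c)) (iota (t1 \<eta> c)) (f1 d \<theta>) (inv1 J (f1 d \<theta>)) (epsi (f1 d \<theta>)) \<theta> (Pi_diag c \<theta> \<Pi>)"

context
  fixes c \<theta> \<Pi> assumes obj: "(c, \<theta>, \<Pi>) \<in> S_obj"
begin

lemmas object_data = S_objD[OF obj]

lemma dual_homs:
  "f1 d \<theta> \<in> hom B (f0 d (f0 d c)) (f0 d c)" "invertible1 B (f1 d \<theta>)"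
  "f1 d (f1 d \<theta>) \<in> hom B (f0 d (f0 d c)) (f0 d (f0 d (f0 d c)))" "invertible1 B (f1 d (f1 d \<theta>))"
  "f1 d (t1 \<eta> c) \<in> hom B (f0 d c) (f0 d (f0 d (f0 d c)))" "invertible1 B (f1 d (t1 \<eta> c))"
  "t1 \<eta> c \<in> hom B (f0 d (f0 d c)) c" "invertible1 B (t1 \<eta> c)"
  "t1 \<eta> (f0 d c) \<in> hom B (f0 d (f0 d (f0 d c))) (f0 d c)" "invertible1 B (t1 \<eta> (f0 d c))"
  using object_data(1-3) invertible1_dual by (auto simp: hom_iff)

lemmas dual_adj = adj_invertible[OF object_data(3,2)] adj_invertible[OF dual_homs(2,1)] adj_invertible[OF dual_homs(4,3)]
  adj_invertible[OF dual_homs(6,5)] adj_invertible[OF dual_homs(8,7)] adj_invertible[OF dual_homs(10,9)]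

lemmas dual_inv_homs = inv1_hom[OF object_data(3,2)] inv1_hom[OF dual_homs(2,1)] inv1_hom[OF dual_homs(4,3)]
  inv1_hom[OF dual_homs(6,5)] inv1_hom[OF dual_homs(8,7)] inv1_hom[OF dual_homs(10,9)]

lemma simple_terms: "simple (At \<theta>)" "simple (Du (At \<theta>))" "simple (Du (Du (At \<theta>)))" "simple (At (t1 \<eta> c))"
   "simple (Du (At (t1 \<eta> c)))" "simple (At (t1 \<eta> (f0 d c)))"
  using object_data(1,2) simple_At simple_Du by (auto simp: hom_iff)

lemmas obj_tms = tm_rules(4)[OF object_data(2)] tm_rules(3)[OF tm_rules(4)[OF object_data(2)]] tm_rules(3)[OF tm_rules(3)[OF tm_rules(4)[OF object_data(2)]]]
  tm_rules(3)[OF tm_rules(4)[OF dual_homs(7)]] tm_rules(4)[OF dual_homs(7)] tm_rules(4)[OF dual_homs(9)]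

lemma rp_Pi:
  "rp c c (At (t1 \<eta> c) \<diamondop> At (inv1 J (f1 d \<theta>)) \<diamondop> At \<theta>) \<Pi> (On c) [Pi_diag c \<theta> \<Pi>]"
  "rp c c (On c) (inv \<Pi>) (At (t1 \<eta> c) \<diamondop> At (inv1 J (f1 d \<theta>)) \<diamondop> At \<theta>) [pinv (Pi_diag c \<theta> \<Pi>)]"
  "pty (Pi_diag c \<theta> \<Pi>) c [t1 \<eta> c, inv1 J (f1 d \<theta>), \<theta>] []" "piso (Pi_diag c \<theta> \<Pi>)"
proof -
  have r: "rty (At (t1 \<eta> c) \<diamondop> At (inv1 J (f1 d \<theta>)) \<diamondop> At \<theta>) \<Pi> (On c)" "iso2 B \<Pi>"
    using object_data dual_homs(7) dual_inv_homs by (auto simp: rty_def isos_iff hom_iff)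
  show "rp c c (At (t1 \<eta> c) \<diamondop> At (inv1 J (f1 d \<theta>)) \<diamondop> At \<theta>) \<Pi> (On c) [Pi_diag c \<theta> \<Pi>]"
    "rp c c (On c) (inv \<Pi>) (At (t1 \<eta> c) \<diamondop> At (inv1 J (f1 d \<theta>)) \<diamondop> At \<theta>) [pinv (Pi_diag c \<theta> \<Pi>)]"
    unfolding Pi_diag_def by (rule rp_atom[OF r(1)] rp_atom_inv[OF r(1) _ _ r(2)]; use object_data in \<open>simp add: hom_iff\<close>)+
  show "pty (Pi_diag c \<theta> \<Pi>) c [t1 \<eta> c, inv1 J (f1 d \<theta>), \<theta>] []" "piso (Pi_diag c \<theta> \<Pi>)"
    unfolding Pi_diag_def using pty_rep[OF r(1)] rep_inv(2)[OF r] object_data by (simp_all add: hom_iff)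
qed

lemmas form_sq = sq_typing[OF dual_adj(5,2) object_data(2) rp_Pi(3,4), folded form_def]
  and form_eq = sq_equations[OF dual_adj(5,2) object_data(2) rp_Pi(3,4), folded form_def]

text \<open>The factor \<open>delta\<close> trades the chosen inverse of d^2(theta) for the dual of
  the inverse of d(theta), to which the dual of \<open>\<Pi>\<close> then applies.\<close>

definition dual_Pi_diag where "dual_Pi_diag = pdual (Pi_diag c \<theta> \<Pi>) \<odot> wh [f1 d \<theta>] (delta (f1 d \<theta>)) [f1 d (t1 \<eta> c)]"

lemma rp_dual_Pi:
  "rp (f0 d c) (f0 d c) (Du (At \<theta>) \<diamondop> At (inv1 J (f1 d (f1 d \<theta>))) \<diamondop> Du (At (t1 \<eta> c))) (dual_Pi c \<theta> \<Pi>) (On (f0 d c)) [dual_Pi_diag]"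
  "pty dual_Pi_diag (f0 d c) [f1 d \<theta>, inv1 J (f1 d (f1 d \<theta>)), f1 d (t1 \<eta> c)] []" "piso dual_Pi_diag"
proof -
  have py: "pty (pdual (Pi_diag c \<theta> \<Pi>)) (f0 d c) [f1 d \<theta>, f1 d (inv1 J (f1 d \<theta>)), f1 d (t1 \<eta> c)] []"
    using pty_pdual[OF rp_Pi(3)] object_data(1) by simp
  have h: "\<theta> \<in> mor B" "src B \<theta> = c" "trg B \<theta> = f0 d c" using object_data(2) by (auto simp: hom_iff)
  note dl = delta_counit[OF dual_homs(2,1)]
  note t = pty_simps[OF py] pty_simps[OF dl(2)] dual_homs[unfolded hom_iff] dual_inv_homs[unfolded hom_iff] object_data(1) h
  have w: "pty (wh [f1 d \<theta>] (delta (f1 d \<theta>)) [f1 d (t1 \<eta> c)]) (f0 d c) [f1 d \<theta>, inv1 J (f1 d (f1 d \<theta>)), f1 d (t1 \<eta> c)]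
     [f1 d \<theta>, f1 d (inv1 J (f1 d \<theta>)), f1 d (t1 \<eta> c)]"
    by (simp add: pty_def cell_typing t)
  show "pty dual_Pi_diag (f0 d c) [f1 d \<theta>, inv1 J (f1 d (f1 d \<theta>)), f1 d (t1 \<eta> c)] []" "piso dual_Pi_diag"
    unfolding dual_Pi_diag_def using pty_pcomp[OF w py] piso_pcomp(1)[OF piso_wh(1)[OF dl(5) ptyD(1)[OF w]] piso_pdual(1)[OF rp_Pi(4)] w py] by simp_all
  have p: "parr (pdual (Pi_diag c \<theta> \<Pi>))" using ptyD(1)[OF py] .
  have "rp (f0 d c) (f0 d c) (Du (At \<theta>) \<diamondop> At (inv1 J (f1 d (f1 d \<theta>))) \<diamondop> Du (At (t1 \<eta> c))) (dual_Pi c \<theta> \<Pi>) (On (f0 d c))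
     [pdual (Pi_diag c \<theta> \<Pi>), wh [f1 d \<theta>] (delta (f1 d \<theta>)) [f1 d (t1 \<eta> c)]]"
    unfolding dual_Pi_def Let_def
    by (rule rp_cong, (rule rp_Pi(1,2) rp_dual_inverse[OF dual_homs(2) obj_tms(2) simple_terms(2)] obj_tms rp_rules rp_f2 tm_rules dual_inv_homs object_data dual_homs)+) (simp add: p)
  from rp_single[OF this] show "rp (f0 d c) (f0 d c) (Du (At \<theta>) \<diamondop> At (inv1 J (f1 d (f1 d \<theta>))) \<diamondop> Du (At (t1 \<eta> c))) (dual_Pi c \<theta> \<Pi>) (On (f0 d c)) [dual_Pi_diag]"
    by (simp add: dual_Pi_diag_def)
qed

text \<open>The mates of the dualised \<open>\<Pi>\<close>, for which d(theta), d^2(theta) and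
  d(eta_c) take the places of \<open>E\<close>, \<open>Q\<close> and \<open>R\<close>.\<close>

lemmas dform_sq = sq_typing[OF dual_adj(2,3) dual_homs(5) rp_dual_Pi(2,3)]
  and dform_eq = sq_equations[OF dual_adj(2,3) dual_homs(5) rp_dual_Pi(2,3)]

text \<open>Taking mates commutes with dualising. The second of the \<open>sq_equations\<close> for
  \<open>\<Pi>\<close>, dualised, becomes the first one for d(\<open>\<Pi>\<close>), so both
  diagrams solve the same equation; it has only one solution because its other factor is invertible
  and whiskering by equivalences is faithful.\<close>

lemma dform_eq_dual_form:
  "sq_p (f1 d \<theta>) (inv1 J (f1 d \<theta>)) (iota (f1 d \<theta>)) (f1 d (f1 d \<theta>)) (inv1 J (f1 d (f1 d \<theta>))) (epsi (f1 d (f1 d \<theta>)))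
     (f1 d (t1 \<eta> c)) dual_Pi_diag = pdual (form c \<theta> \<Pi>)" (is "?pf = pdual ?p")
proof -
  let ?T = "f1 d \<theta>" and ?U = "f1 d (f1 d \<theta>)" and ?D = "f1 d (t1 \<eta> c)"
  let ?U' = "inv1 J ?U" and ?V = "f1 d (inv1 J ?T)" and ?P = "pdual (Pi_diag c \<theta> \<Pi>)" and ?e = "pdual (epsi ?T)"
  note A = dual_adj(2) and C = dual_adj(3)
  have h: "\<theta> \<in> mor B" "src B \<theta> = c" "trg B \<theta> = f0 d c" using object_data(2) by (auto simp: hom_iff)
  have py: "pty ?P (f0 d c) [?T, ?V, ?D] []" "pty (pdual ?p) (f0 d (f0 d c)) [?D, ?T] [?U]"
    using pty_pdual[OF rp_Pi(3)] pty_pdual[OF form_sq(3)] object_data(1) h by simp_all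
  note dl = delta_counit[OF dual_homs(2,1)]
  note t = pty_simps[OF py(1)] pty_simps[OF py(2)] pty_simps[OF dform_sq(3)] pty_simps[OF dl(2)] adj_typing[OF A] adj_typing[OF C]
    pty_simps[OF dl(3)] piso_simps[OF dl(4,3)]
    dual_homs[unfolded hom_iff] dual_inv_homs[unfolded hom_iff] object_data(1) h pty_simps[OF rp_Pi(3)] pty_simps[OF form_sq(3)]
  have "pdual (wh [\<theta>] (Pi_diag c \<theta> \<Pi>) []) = pdual (wh [] (epsi ?T) [\<theta>] \<odot> wh [] ?p [inv1 J ?T, \<theta>])"
    using form_eq(2) by simp
  moreover have "parr (wh [\<theta>] (Pi_diag c \<theta> \<Pi>) [])" "parr (wh [] (epsi ?T) [\<theta>])" "parr (wh [] ?p [inv1 J ?T, \<theta>])"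
    "parr (wh [] (epsi ?T) [\<theta>] \<odot> wh [] ?p [inv1 J ?T, \<theta>])"
    by (simp_all add: cell_typing t)
  ultimately have 1: "wh [] ?P [?T] = wh [?T] ?e [] \<odot> wh [?T, ?V] (pdual ?p) []"
    by (simp add: pdual_pcomp pdual_wh del: parr_pcomp)
  have 2: "wh [?T, ?V] (pdual ?p) [] \<odot> wh [?T] (delta ?T) [?D, ?T] = wh [?T] (delta ?T) [?U] \<odot> wh [?T, ?U'] (pdual ?p) []"
    using exchange[OF dl(2) py(2), of "[?T]" "[]" "[]"] by simp
  have 3: "wh [?T] (delta ?T) [?U] = wh [?T] (pinv ?e) [] \<odot> wh [?T] (pinv (iota ?U)) []"
    using arg_cong[OF dl(1), of "\<lambda>\<phi>. wh [?T] \<phi> []"] by (simp add: wh_pcomp)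
  have "wh [] dual_Pi_diag [?T] = wh [?T] ?e [] \<odot> wh [?T] (pinv ?e) [] \<odot> wh [?T] (pinv (iota ?U)) [] \<odot> wh [?T, ?U'] (pdual ?p) []"
    by (simp add: dual_Pi_diag_def wh_pcomp 1 2 3)
  also have "\<dots> = wh [?T] (pinv (iota ?U)) [] \<odot> wh [?T, ?U'] (pdual ?p) []"
    by (rule wh_cancel[OF dl(4)]) (simp add: cell_typing t)
  finally have e: "wh [?T] (pinv (iota ?U)) [] \<odot> wh [?T, ?U'] ?pf [] = wh [?T] (pinv (iota ?U)) [] \<odot> wh [?T, ?U'] (pdual ?p) []"
    unfolding dform_eq(1) .
  have p: "parr (wh [?T] (pinv (iota ?U)) [])" by (simp add: cell_typing t)
  have 5: "wh [?T, ?U'] ?pf [] = wh [?T, ?U'] (pdual ?p) []"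
    by (rule pcomp_cancel_left[OF e piso_wh(1)[OF piso_pinv[OF adjD(9)[OF C]] p], of "f0 d (f0 d c)" "[?T, ?U', ?U]" "[?T]" "[?T, ?U', ?D, ?T]"])
      (simp_all add: pty_def cell_typing t)
  have 6: "wh [?U'] ?pf [] = wh [?U'] (pdual ?p) []"
    by (rule adj_inject(1)[OF A, of _ "f0 d (f0 d c)" "[?U', ?D, ?T]" "[?U', ?U]"]) (use 5 in \<open>simp_all add: pty_def cell_typing t\<close>)
  show ?thesis
    by (rule adj_inject(1)[OF adj_sym[OF C], of _ "f0 d (f0 d c)" "[?D, ?T]" "[?U]"]) (use 6 in \<open>simp_all add: pty_def cell_typing t\<close>)
qed

text \<open>The condition \<open>object_cell_1 = object_cell_2\<close> in terms of the form. Both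
  cells factor through the counit of d(theta): in the first, \<open>\<Pi>\<close> is replaced by the
  form through \<open>form_eq(2)\<close>; in the second, the passage to inverses becomes the dual of
  the form through \<open>dform_eq_dual_form\<close>. After cancelling the counit, the transposed
  \<open>\<tau>\<close> is rewritten as the pairing.\<close>

lemma form_symmetric:
  "form c \<theta> \<Pi> \<odot> pinv (eta_diag (At \<theta>)) = wh [] (tau_counit c) [f1 d \<theta>] \<odot> wh [t1 \<eta> (f0 d c)] (pinv (pdual (form c \<theta> \<Pi>))) []"
proof -
  let ?p = "form c \<theta> \<Pi>" and ?q = "pdual (form c \<theta> \<Pi>)" and ?P = "Pi_diag c \<theta> \<Pi>" and ?N = "eta_diag (At \<theta>)"
  let ?T = "f1 d \<theta>" and ?U = "f1 d (f1 d \<theta>)" and ?D = "f1 d (t1 \<eta> c)" and ?A = "t1 \<eta> (f0 d c)" and ?E = "t1 \<eta> c"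
  let ?T' = "inv1 J ?T" and ?D' = "inv1 J ?D" and ?U' = "inv1 J ?U" and ?A' = "inv1 J ?A" and ?t = "tau_diag c" and ?v = "tau_counit c"
  note A = dual_adj(6) and T = dual_adj(2) and D = dual_adj(4) and U = dual_adj(3)
  have h: "\<theta> \<in> mor B" "src B \<theta> = c" "trg B \<theta> = f0 d c" using object_data(2) by (auto simp: hom_iff)
  note N = rp_eta(3,4)[OF obj_tms(1), simplified]
  note tc = rp_tau(3,4)[OF object_data(1)]
  have qy: "pty ?q (f0 d (f0 d c)) [?D, ?T] [?U]" "piso ?q"
    using pty_pdual[OF form_sq(3)] piso_pdual(1)[OF form_sq(6)] object_data(1) h by simp_all
  note t = adj_typing[OF A] adj_typing[OF T] adj_typing[OF D] adj_typing[OF U] h object_data(1) pty_simps[OF N(1)] piso_simps[OF N(2,1)]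
    pty_simps[OF tc(1)] piso_simps[OF tc(2,1)] pty_simps[OF qy(1)] piso_simps[OF qy(2,1)] pty_simps[OF rp_Pi(3)]
    pty_simps[OF form_sq(3)]
  let ?h = "sq_h ?T' (iota ?T) ?U ?U' (epsi ?U) ?D dual_Pi_diag"
  let ?PT = "wh [?D'] ?h [] \<odot> iota ?D"
  note hy = dform_sq(2,5)
  have hD: "parr (wh [?D'] ?h [])" "pty (wh [?D'] ?h []) (f0 d c) [?D', ?D] [?D', ?U, ?T']"
    using pty_simps[OF hy(1)] by (simp_all add: pty_def cell_typing t)
  have PT: "pty ?PT (f0 d c) [] [?D', ?U, ?T']" "piso ?PT"
    using pty_pcomp[OF adjD(11)[OF D] hD(2)] piso_pcomp(1)[OF adjD(9)[OF D] piso_wh(1)[OF hy(2) hD(1)] adjD(11)[OF D] hD(2)] by simp_all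
  note rp_pass = rp_pass_to_inverses[OF dual_homs(2) obj_tms(2) simple_terms(2) dual_homs(4) obj_tms(3) simple_terms(3)
      dual_homs(6) obj_tms(4) simple_terms(5) rp_dual_Pi(1)]
  have rp_pass': "rp (f0 d c) (f0 d c) (At ?D' \<diamondop> Du (Du (At \<theta>)) \<diamondop> At ?T')
      (inv (pass_to_inverses B J ?T ?U ?D (dual_Pi c \<theta> \<Pi>))) (On (f0 d c)) [pinv ?PT]"
    using rp_iso(2)[OF rp_pass] PT(2) by simp
  note rp_tr = rp_transpose_inverse[OF dual_homs(10) obj_tms(6) simple_terms(6) dual_homs(6) obj_tms(4) simple_terms(5) rp_tau(2)[OF object_data(1)]]
  let ?dom = "At ?A \<diamondop> Du (Du (At \<theta>)) \<diamondop> At ?T' \<diamondop> At \<theta>"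
  have C1: "rp c (f0 d c) ?dom (object_cell_1 c \<theta> \<Pi>) (At \<theta>) [wh [\<theta>] ?P [], wh [] (pinv ?N) [?T', \<theta>]]"
    unfolding object_cell_1_def Let_def
    by (rule rp_cong, (rule rp_Pi(1,2) rp_eta[OF obj_tms(1)] obj_tms rp_rules tm_rules dual_inv_homs object_data dual_homs)+) simp
  have C2: "rp c (f0 d c) ?dom (object_cell_2 c \<theta> \<Pi>) (At \<theta>)
    [wh [] (pinv ?PT) [\<theta>], wh [] (epsi ?A) [?D', ?U, ?T', \<theta>], wh [?A] (pinv ?t) [?D', ?U, ?T', \<theta>], wh [?A] (pinv (epsi ?D)) [?U, ?T', \<theta>]]"
    unfolding object_cell_2_def Let_def
    by (rule rp_cong, (rule rp_pass' rp_tr obj_tms rp_rules tm_rules dual_inv_homs object_data dual_homs)+) simp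
  \<comment> \<open>The 2-isomorphism eta_{d(c)} => d(eta_c)^-1 induced by \<open>\<tau>\<close>,
    that is, the diagram of \<open>transpose_inverse\<close>.\<close>
  define tr where "tr = wh [] (epsi ?A) [?D'] \<odot> wh [?A] (pinv ?t) [?D'] \<odot> wh [?A] (pinv (epsi ?D)) []"
  have try1: "pty tr (f0 d (f0 d (f0 d c))) [?A] [?D']" by (simp add: tr_def pty_def cell_typing t)
  note t = t pty_simps[OF try1] pty_simps[OF hy(1)]
  have "pprod [wh [\<theta>] ?P [], wh [] (pinv ?N) [?T', \<theta>]] =
    pprod [wh [] (pinv ?PT) [\<theta>], wh [] (epsi ?A) [?D', ?U, ?T', \<theta>], wh [?A] (pinv ?t) [?D', ?U, ?T', \<theta>], wh [?A] (pinv (epsi ?D)) [?U, ?T', \<theta>]]"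
    by (rule rp_pprod_eq[OF object_data(5) C1 C2])
  then have C: "wh [\<theta>] ?P [] \<odot> wh [] (pinv ?N) [?T', \<theta>] = wh [] (pinv ?PT) [\<theta>] \<odot> wh [] tr [?U, ?T', \<theta>]"
    by (simp add: tr_def wh_pcomp)
  \<comment> \<open>The dual form with d(eta_c) moved to the other side, d(theta) => d(eta_c)^-1
    d^2(theta). The diagram \<open>?PT\<close> turns out to be \<open>u\<close> after the inverse
    counit of d(theta).\<close>
  define u where "u = wh [?D'] ?q [] \<odot> wh [] (iota ?D) [?T]"
  have w: "parr (wh [?D'] ?q [])" "parr (wh [] (iota ?D) [?T])"
    "pty (wh [?D'] ?q []) (f0 d (f0 d c)) [?D', ?D, ?T] [?D', ?U]" "pty (wh [] (iota ?D) [?T]) (f0 d (f0 d c)) [?T] [?D', ?D, ?T]"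
    by (simp_all add: pty_def cell_typing t)
  have uy: "pty u (f0 d (f0 d c)) [?T] [?D', ?U]" "piso u"
    unfolding u_def using pty_pcomp[OF w(4,3)] piso_pcomp(1)[OF piso_wh(1)[OF adjD(9)[OF D] w(2)] piso_wh(1)[OF qy(2) w(1)] w(4,3)] by simp_all
  note t = t pty_simps[OF uy(1)] piso_simps[OF uy(2,1)]
  have x1: "wh [?D', ?D] (pinv (epsi ?T)) [] \<odot> iota ?D = wh [] (iota ?D) [?T, ?T'] \<odot> pinv (epsi ?T)"
    using exchange[OF adjD(11)[OF D] pty_pinv[OF adjD(10,12)[OF T]], of "[]" "[]" "[]"] by (simp add: t)
  have "?PT = wh [] u [?T'] \<odot> pinv (epsi ?T)"
    by (simp add: dform_eq(3) dform_eq_dual_form u_def wh_pcomp x1)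
  moreover have uT: "pty (wh [] u [?T']) (f0 d c) [?T, ?T'] [?D', ?U, ?T']" by (simp add: pty_def cell_typing t)
  ultimately have "pinv ?PT = epsi ?T \<odot> wh [] (pinv u) [?T']"
    using piso_pcomp(2)[OF piso_pinv[OF adjD(10)[OF T]] piso_wh(1)[OF uy(2) ptyD(1)[OF uT]] pty_pinv[OF adjD(10,12)[OF T]] uT]
      piso_wh(2)[OF uy(2) ptyD(1)[OF uT]] adjD(10)[OF T] by simp
  then have e: "wh [] (epsi ?T) [\<theta>] \<odot> wh [] (?p \<odot> pinv ?N) [?T', \<theta>] = wh [] (epsi ?T) [\<theta>] \<odot> wh [] (pinv u \<odot> wh [] tr [?U]) [?T', \<theta>]"
    using C unfolding form_eq(2) by (simp add: wh_pcomp)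
  have y2: "pty (?p \<odot> pinv ?N) (f0 d (f0 d c)) [?A, ?U] [?T]" "pty (pinv u \<odot> wh [] tr [?U]) (f0 d (f0 d c)) [?A, ?U] [?T]"
    by (simp_all add: pty_def cell_typing t)
  note t2 = pty_simps[OF y2(1)] pty_simps[OF y2(2)]
  have w2: "parr (wh [] (epsi ?T) [\<theta>])" by (simp add: cell_typing t)
  \<comment> \<open>The common material at the right end is removed in three steps: the invertible
    counit, then theta, then the inverse of d(theta).\<close>
  have e1: "wh [] (?p \<odot> pinv ?N) [?T', \<theta>] = wh [] (pinv u \<odot> wh [] tr [?U]) [?T', \<theta>]"
    by (rule pcomp_cancel_left[OF e piso_wh(1)[OF adjD(10)[OF T] w2], of c "[?T, ?T', \<theta>]" "[\<theta>]" "[?A, ?U, ?T', \<theta>]"])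
      (simp_all add: pty_def parr_wh wh_simps psrcl_def t t2 del: parr_pcomp)
  have e2: "wh [] (?p \<odot> pinv ?N) [?T'] = wh [] (pinv u \<odot> wh [] tr [?U]) [?T']"
    by (rule adj_inject(2)[OF dual_adj(1), of _ "[?A, ?U, ?T']" "[?T, ?T']"])
      (use e1 in \<open>simp_all add: pty_def parr_wh wh_simps psrcl_def t t2 del: parr_pcomp\<close>)
  have e3: "?p \<odot> pinv ?N = pinv u \<odot> wh [] tr [?U]"
    by (rule adj_inject(2)[OF adj_sym[OF T] y2 e2])
  have v: "wh us ?v vs = wh us (epsi ?A) vs \<odot> wh (us @ [?A]) (pinv ?t) vs" for us vs
    by (simp add: tau_counit_def wh_pcomp)
  have vy: "pty ?v (f0 d c) [?A, ?D] []" by (simp add: tau_counit_def pty_def cell_typing t)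
  note t = t pty_simps[OF vy]
  have x2: "pinv (iota ?D) \<odot> wh [] (epsi ?A) [?D', ?D] = epsi ?A \<odot> wh [?A, ?A'] (pinv (iota ?D)) []"
    using exchange[OF adjD(12)[OF A] pty_pinv[OF adjD(9,11)[OF D]], of "[]" "[]" "[]"] by (simp add: t)
  have x3: "wh [?A, ?A'] (pinv (iota ?D)) [] \<odot> wh [?A] (pinv ?t) [?D', ?D] = wh [?A] (pinv ?t) [] \<odot> wh [?A, ?D] (pinv (iota ?D)) []"
    using exchange[OF pty_pinv[OF tc(2,1)] pty_pinv[OF adjD(9,11)[OF D]], of "[?A]" "[]" "[]"] by simp
  have x4: "wh [?A, ?D] (pinv (iota ?D)) [] = wh [?A] (epsi ?D) [?D]"
    using adj_slide(3)[OF D, of "[?A]" "[]"] by simp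
  \<comment> \<open>Contracting the inverse of d(eta_c) in \<open>tr\<close> against d(eta_c) gives
    the pairing; the counit of d(eta_c) inside \<open>tr\<close> cancels by a zigzag.\<close>
  have "pinv (iota ?D) \<odot> wh [] tr [?D] = epsi ?A \<odot> wh [?A] (pinv ?t) [] \<odot> wh [?A] (epsi ?D) [?D] \<odot> wh [?A] (pinv (epsi ?D)) [?D]"
    by (simp add: tr_def wh_pcomp pcomp_extend[OF x2] pcomp_extend[OF x3] x4)
  also have "\<dots> = (epsi ?A \<odot> wh [?A] (pinv ?t) []) \<odot> wh [?A] (pinv (pinv (epsi ?D))) [?D] \<odot> wh [?A] (pinv (epsi ?D)) [?D]"
    by (simp add: t)
  also have "\<dots> = ?v"
    by (subst wh_cancel_end) (simp_all add: cell_typing t tau_counit_def)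
  finally have "wh [] (pinv (iota ?D)) [] \<odot> wh [] tr [?D] = ?v" by (simp add: t)
  then have "wh [] (iota ?D) [] \<odot> wh [] ?v [] = wh [] (iota ?D) [] \<odot> wh [] (pinv (iota ?D)) [] \<odot> wh [] tr [?D]"
    by (simp add: t)
  also have "\<dots> = wh [] tr [?D]"
    by (rule wh_cancel[OF adjD(9)[OF D]]) (simp add: cell_typing t)
  finally have x5: "wh [] (iota ?D) [?T] \<odot> wh [] ?v [?T] = wh [] tr [?D, ?T]"
    using arg_cong[of _ _ "\<lambda>\<phi>. wh [] \<phi> [?T]"] by (simp add: wh_pcomp) (metis wh_pcomp wh_wh append_Nil append_Cons)
  have x6: "wh [?D'] ?q [] \<odot> wh [] tr [?D, ?T] = wh [] tr [?U] \<odot> wh [?A] ?q []"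
    using exchange[OF try1 qy(1), of "[]" "[]" "[]"] by simp
  have "u \<odot> wh [] ?v [?T] \<odot> wh [?A] (pinv ?q) [] = wh [] tr [?U] \<odot> wh [?A] ?q [] \<odot> wh [?A] (pinv ?q) []"
    by (simp add: u_def pcomp_extend[OF x5] pcomp_extend[OF x6])
  also have "\<dots> = wh [] tr [?U] \<odot> wh [?A] (pinv (pinv ?q)) [] \<odot> wh [?A] (pinv ?q) []" by (simp add: t)
  also have "\<dots> = wh [] tr [?U]"
    by (rule wh_cancel_end) (simp_all add: cell_typing t)
  finally have e4: "u \<odot> wh [] ?v [?T] \<odot> wh [?A] (pinv ?q) [] = wh [] tr [?U]" .
  have "u \<odot> pinv u \<odot> wh [] tr [?U] = wh [] tr [?U]"
    using wh_cancel[OF uy(2), of "[]" "[]" "wh [] tr [?U]"] by (simp add: cell_typing t)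
  then have "u \<odot> (?p \<odot> pinv ?N) = u \<odot> (wh [] ?v [?T] \<odot> wh [?A] (pinv ?q) [])"
    using e4 unfolding e3 by simp
  then show ?thesis
    by (rule pcomp_cancel_left[OF _ uy(2,1) y2(1)]) (simp add: pty_def cell_typing t)
qed

end

end

section \<open>Adjoint pairs of 2-morphisms\<close>

context contravariant_functor
begin

text \<open>Naturality of \<open>\<eta>\<close> is stated for 2-morphisms of \<open>B\<close>; this
  makes it available for a diagram given only by its boundary, as in
  \<open>adjoint_pair_sym\<close>.\<close>

lemma rep_surj:
  assumes "tok t" "tok t'" "tsrc t' = tsrc t" "pty \<phi> (tsrc t) (tfl t) (tfl t')"
  obtains f where "rty t f t'" "rep t f t' = \<phi>"
proof
  note p = ptyD[OF assms(4)] and q = parrD[OF ptyD(1)[OF assms(4)]]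
  let ?f = "inv (tcan t') \<bullet> pun \<phi> \<bullet> tcan t"
  have c: "pun \<phi> \<in> cell B" "dom2 B (pun \<phi>) = ev (tsrc t) (tfl t)" "cod2 B (pun \<phi>) = ev (tsrc t) (tfl t')"
    using p q by simp_all
  show r: "rty t ?f t'" using assms(1-3) c by (simp add: rty_def)
  show "rep t ?f t' = \<phi>"
    by (rule pcell_eqI[OF ptyD(1)[OF pty_rep[OF r]] p(1)]) (use p(2-4) assms(1-3) c in \<open>simp_all add: rep_def\<close>)
qed

end

context O1_volutive
begin

text \<open>Terms \<open>x\<close> and \<open>y\<close> are used instead of 1-morphisms because the
  boundaries list factors: composites and the dual of a dual have to be visible as lists.\<close>

fun adjoint_pair :: "('o, 'm, 'c) sobj \<Rightarrow> ('o, 'm, 'c) sobj \<Rightarrow> ('o, 'm) mterm \<Rightarrow> ('o, 'm) mterm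
    \<Rightarrow> ('o, 'm, 'c) pcell \<Rightarrow> ('o, 'm, 'c) pcell \<Rightarrow> bool" where
  "adjoint_pair (a, \<theta>, \<Pi>) (b, \<theta>', \<Pi>') x y \<phi> \<psi> \<longleftrightarrow>
    tok x \<and> tsrc x = a \<and> ttrg x = b \<and> tok y \<and> tsrc y = b \<and> ttrg y = a \<and>
    pty \<phi> b (\<theta> # tfl y) (dl (tfl x) @ [\<theta>']) \<and> pty \<psi> a (\<theta>' # tfl x) (dl (tfl y) @ [\<theta>]) \<and>
    pdual \<phi> \<odot> wh (dl (tfl y)) (form a \<theta> \<Pi>) [] \<odot> wh [] \<psi> [t1 \<eta> a]
      = wh [] (form b \<theta>' \<Pi>') (dl (dl (tfl x))) \<odot> wh [\<theta>'] (eta_diag x) []"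

lemma obj_typing:
  assumes "(c, \<theta>, \<Pi>) \<in> S_obj"
  shows "c \<in> obj B" "\<theta> \<in> mor B" "src B \<theta> = c" "trg B \<theta> = f0 d c" "invertible1 B \<theta>"
    "f1 d \<theta> \<in> mor B" "src B (f1 d \<theta>) = f0 d (f0 d c)" "trg B (f1 d \<theta>) = f0 d c"
    "parr (form c \<theta> \<Pi>)" "psrc (form c \<theta> \<Pi>) = f0 d (f0 d c)" "pdom (form c \<theta> \<Pi>) = [\<theta>, t1 \<eta> c]" "pcod (form c \<theta> \<Pi>) = [f1 d \<theta>]"
    "ptrg (form c \<theta> \<Pi>) = f0 d c" "piso (form c \<theta> \<Pi>)" "parr (pinv (form c \<theta> \<Pi>))" "psrc (pinv (form c \<theta> \<Pi>)) = f0 d (f0 d c)"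
    "pcod (pinv (form c \<theta> \<Pi>)) = [\<theta>, t1 \<eta> c]" "pdom (pinv (form c \<theta> \<Pi>)) = [f1 d \<theta>]"
    "ptrg (pinv (form c \<theta> \<Pi>)) = f0 d c"
    "t1 \<eta> c \<in> mor B" "src B (t1 \<eta> c) = f0 d (f0 d c)" "trg B (t1 \<eta> c) = c"
    "pty (form c \<theta> \<Pi>) (f0 d (f0 d c)) [\<theta>, t1 \<eta> c] [f1 d \<theta>]"
  using S_objD(1-3)[OF assms] dual_homs(1)[OF assms] pty_simps[OF form_sq(3)[OF assms]] form_sq(6)[OF assms]
    piso_simps[OF form_sq(6,3)[OF assms]] form_sq(3)[OF assms] by (auto simp: hom_iff)

lemma tau_counit_typing:
  assumes "a \<in> obj B"
  shows "pty (tau_counit a) (f0 d a) [t1 \<eta> (f0 d a), f1 d (t1 \<eta> a)] []" "piso (tau_counit a)"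
proof -
  note o = f0_obj'[OF assms]
  note A = adj_invertible[OF eta_invertible[OF o] eta_hom(1)[OF o]]
  note tc = rp_tau(3,4)[OF assms]
  note t = adj_typing[OF A] pty_simps[OF tc(1)] piso_simps[OF tc(2,1)] assms
  have w: "pty (wh [t1 \<eta> (f0 d a)] (pinv (tau_diag a)) []) (f0 d a) [t1 \<eta> (f0 d a), f1 d (t1 \<eta> a)] [t1 \<eta> (f0 d a), inv1 J (t1 \<eta> (f0 d a))]"
    by (simp add: pty_def cell_typing t)
  show "pty (tau_counit a) (f0 d a) [t1 \<eta> (f0 d a), f1 d (t1 \<eta> a)] []" "piso (tau_counit a)"
    unfolding tau_counit_def using pty_pcomp[OF w adjD(12)[OF A]]
      piso_pcomp(1)[OF piso_wh(1)[OF piso_pinv[OF tc(2)] ptyD(1)[OF w]] adjD(10)[OF A] w adjD(12)[OF A]] by simp_all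
qed

text \<open>The left side of the adjointness equation is an injective function of its last factor:
  the dual of phi and the form are invertible, and eta_a is an equivalence. Stated apart from
  \<open>adjoint_pair\<close> so that it also serves for naturality.\<close>

lemma form_whisker_inject:
  assumes A: "(a, \<theta>, \<Pi>) \<in> S_obj" and r: "pty \<phi> b (\<theta> # ys) zs" "piso \<phi>" "path b ys" "tgt b ys = a"
    "pty \<psi> a xs (dl ys @ [\<theta>])" "pty \<psi>' a xs (dl ys @ [\<theta>])"
    and e: "pdual \<phi> \<odot> wh (dl ys) (form a \<theta> \<Pi>) [] \<odot> wh [] \<psi> [t1 \<eta> a] = pdual \<phi> \<odot> wh (dl ys) (form a \<theta> \<Pi>) [] \<odot> wh [] \<psi>' [t1 \<eta> a]"
  shows "\<psi> = \<psi>'"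
proof -
  note t = obj_typing[OF A]
  note pd = path_dl[OF r(3), unfolded r(4)]
  have d\<phi>: "pty (pdual \<phi>) (f0 d (f0 d a)) (dl ys @ [f1 d \<theta>]) (dl zs)"
    using pty_pdual[OF r(1)] t by simp
  note t = t pty_simps[OF r(5)] pty_simps[OF r(6)] r(3,4) pd pty_simps[OF d\<phi>] path_tgt_obj[OF ptyD(5)[OF r(5)]] ptyD(5)[OF r(5), simplified]
  have w: "pty (wh (dl ys) (form a \<theta> \<Pi>) []) (f0 d (f0 d a)) (dl ys @ [\<theta>, t1 \<eta> a]) (dl ys @ [f1 d \<theta>])"
    "pty (wh [] \<psi> [t1 \<eta> a]) (f0 d (f0 d a)) (xs @ [t1 \<eta> a]) (dl ys @ [\<theta>, t1 \<eta> a])"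
    "pty (wh [] \<psi>' [t1 \<eta> a]) (f0 d (f0 d a)) (xs @ [t1 \<eta> a]) (dl ys @ [\<theta>, t1 \<eta> a])"
    by (simp_all add: pty_def cell_typing t)
  have e1: "wh (dl ys) (form a \<theta> \<Pi>) [] \<odot> wh [] \<psi> [t1 \<eta> a] = wh (dl ys) (form a \<theta> \<Pi>) [] \<odot> wh [] \<psi>' [t1 \<eta> a]"
    by (rule pcomp_cancel_left[OF e piso_pdual(1)[OF r(2)] d\<phi> pty_pcomp[OF w(2,1)] pty_pcomp[OF w(3,1)]])
  have e2: "wh [] \<psi> [t1 \<eta> a] = wh [] \<psi>' [t1 \<eta> a]"
    by (rule pcomp_cancel_left[OF e1 piso_wh(1)[OF t(14) ptyD(1)[OF w(1)]] w])
  show ?thesis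
    by (rule adj_inject(2)[OF adj_invertible[OF eta_invertible eta_hom(1)] r(5,6) e2]) (rule t)+
qed

lemma adjoint_pair_unique:
  assumes A: "(a, \<theta>, \<Pi>) \<in> S_obj" and "adjoint_pair (a, \<theta>, \<Pi>) (b, \<theta>', \<Pi>') x y \<phi> \<psi>" "adjoint_pair (a, \<theta>, \<Pi>) (b, \<theta>', \<Pi>') x y \<phi> \<psi>'" "piso \<phi>"
  shows "\<psi> = \<psi>'"
proof -
  have y: "tok y" "tsrc y = b" "ttrg y = a" using assms(2) by auto
  show ?thesis
    by (rule form_whisker_inject[OF A _ assms(4)]) (use assms(2,3) term_simps(4,5)[OF y(1)] y in auto)
qed

lemma adjoint_pair_unit:
  assumes A: "(a, \<theta>, \<Pi>) \<in> S_obj"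
  shows "adjoint_pair (a, \<theta>, \<Pi>) (a, \<theta>, \<Pi>) (On a) (On a) (pid a [\<theta>]) (pid a [\<theta>])"
proof -
  note t = obj_typing[OF A]
  show ?thesis
    using t by (simp add: pty_def pdual_pid eta_diag_one wh_pid psrcl_simps)
qed

text \<open>A 2-morphism gamma between the candidates for the adjoint can be moved from one member
  of the pair to the other: its dual slides past the form of \<open>a\<close>.\<close>

lemma adjoint_pair_precomp:
  assumes A: "(a, \<theta>, \<Pi>) \<in> S_obj"
    and R: "adjoint_pair (a, \<theta>, \<Pi>) (b, \<theta>', \<Pi>') x y (\<phi> \<odot> wh [\<theta>] \<gamma> []) \<psi>"
    and y': "tok y'" "tsrc y' = b" "ttrg y' = a"
    and \<phi>: "pty \<phi> b (\<theta> # tfl y') (dl (tfl x) @ [\<theta>'])" and \<gamma>: "pty \<gamma> b (tfl y) (tfl y')"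
  shows "adjoint_pair (a, \<theta>, \<Pi>) (b, \<theta>', \<Pi>') x y' \<phi> (wh [] (pdual \<gamma>) [\<theta>] \<odot> \<psi>)"
proof -
  note t = obj_typing[OF A]
  have r: "tok x" "tsrc x = a" "ttrg x = b" "tok y" "tsrc y = b" "ttrg y = a"
    "pty \<psi> a (\<theta>' # tfl x) (dl (tfl y) @ [\<theta>])"
    and e: "pdual (\<phi> \<odot> wh [\<theta>] \<gamma> []) \<odot> wh (dl (tfl y)) (form a \<theta> \<Pi>) [] \<odot> wh [] \<psi> [t1 \<eta> a] =
      wh [] (form b \<theta>' \<Pi>') (dl (dl (tfl x))) \<odot> wh [\<theta>'] (eta_diag x) []"
    using R by auto
  have py: "path b (tfl y)" "tgt b (tfl y) = a" "path b (tfl y')" "tgt b (tfl y') = a"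
    using term_simps(4,5)[OF r(4)] term_simps(4,5)[OF y'(1)] r y' by simp_all
  note t = t py pty_simps[OF \<phi>] pty_simps[OF \<gamma>] pty_simps[OF r(7)] path_src_obj[OF py(1)]
  have d\<gamma>: "pty (pdual \<gamma>) (f0 d a) (dl (tfl y)) (dl (tfl y'))" using pty_pdual[OF \<gamma>] py by simp
  note pd = path_dl[OF py(1), unfolded py(2)] path_dl[OF py(3), unfolded py(4)]
  note t = t pty_simps[OF d\<gamma>] pd
  have p: "parr (\<phi> \<odot> wh [\<theta>] \<gamma> [])" "parr (wh [\<theta>] \<gamma> [])" by (simp_all add: cell_typing t)
  have 1: "pdual (\<phi> \<odot> wh [\<theta>] \<gamma> []) = pdual \<phi> \<odot> wh [] (pdual \<gamma>) [f1 d \<theta>]"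
    using pdual_pcomp[OF p(1)] pdual_wh[OF p(2)] by simp
  have 2: "wh [] (pdual \<gamma>) [f1 d \<theta>] \<odot> wh (dl (tfl y)) (form a \<theta> \<Pi>) [] = wh (dl (tfl y')) (form a \<theta> \<Pi>) [] \<odot> wh [] (pdual \<gamma>) [\<theta>, t1 \<eta> a]"
    using exchange[OF d\<gamma> t(23), of "[]" "[]" "[]"] by simp
  have "pdual \<phi> \<odot> wh (dl (tfl y')) (form a \<theta> \<Pi>) [] \<odot> wh [] (wh [] (pdual \<gamma>) [\<theta>] \<odot> \<psi>) [t1 \<eta> a]
    = pdual (\<phi> \<odot> wh [\<theta>] \<gamma> []) \<odot> wh (dl (tfl y)) (form a \<theta> \<Pi>) [] \<odot> wh [] \<psi> [t1 \<eta> a]"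
    by (simp add: 1 wh_pcomp pcomp_extend[OF 2])
  moreover have "pty (wh [] (pdual \<gamma>) [\<theta>] \<odot> \<psi>) a (\<theta>' # tfl x) (dl (tfl y') @ [\<theta>])"
    by (simp add: pty_def cell_typing t)
  ultimately show ?thesis using r y' \<phi> e by simp
qed

text \<open>The form of the middle object \<open>b\<close> ends the equation of the first pair and
  begins that of the second. After the two inner diagrams are exchanged, the equations can be
  chained there, and the two components of eta combine by \<open>eta_diag_comp\<close>.\<close>

lemma adjoint_pair_comp:
  assumes A: "(a, \<theta>, \<Pi>) \<in> S_obj" and A': "(b, \<theta>', \<Pi>') \<in> S_obj" and A'': "(c, \<theta>'', \<Pi>'') \<in> S_obj"
    and R1: "adjoint_pair (a, \<theta>, \<Pi>) (b, \<theta>', \<Pi>') x y \<phi> \<psi>" and R2: "adjoint_pair (b, \<theta>', \<Pi>') (c, \<theta>'', \<Pi>'') z w \<phi>' \<psi>'"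
  shows "adjoint_pair (a, \<theta>, \<Pi>) (c, \<theta>'', \<Pi>'') (z \<diamondop> x) (y \<diamondop> w) (wh (dl (tfl x)) \<phi>' [] \<odot> wh [] \<phi> (tfl w)) (wh (dl (tfl w)) \<psi> [] \<odot> wh [] \<psi>' (tfl x))"
proof -
  have r: "tok x" "tsrc x = a" "ttrg x = b" "tok y" "tsrc y = b" "ttrg y = a"
    "pty \<phi> b (\<theta> # tfl y) (dl (tfl x) @ [\<theta>'])" "pty \<psi> a (\<theta>' # tfl x) (dl (tfl y) @ [\<theta>])"
    and e1: "pdual \<phi> \<odot> wh (dl (tfl y)) (form a \<theta> \<Pi>) [] \<odot> wh [] \<psi> [t1 \<eta> a] =
      wh [] (form b \<theta>' \<Pi>') (dl (dl (tfl x))) \<odot> wh [\<theta>'] (eta_diag x) []"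
    using R1 by auto
  have s: "tok z" "tsrc z = b" "ttrg z = c" "tok w" "tsrc w = c" "ttrg w = b"
    "pty \<phi>' c (\<theta>' # tfl w) (dl (tfl z) @ [\<theta>''])" "pty \<psi>' b (\<theta>'' # tfl z) (dl (tfl w) @ [\<theta>'])"
    and e2: "pdual \<phi>' \<odot> wh (dl (tfl w)) (form b \<theta>' \<Pi>') [] \<odot> wh [] \<psi>' [t1 \<eta> b] =
      wh [] (form c \<theta>'' \<Pi>'') (dl (dl (tfl z))) \<odot> wh [\<theta>''] (eta_diag z) []"
    using R2 by auto
  have px: "path a (tfl x)" "tgt a (tfl x) = b" "path b (tfl y)" "tgt b (tfl y) = a"
    "path b (tfl z)" "tgt b (tfl z) = c" "path c (tfl w)" "tgt c (tfl w) = b"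
    using term_simps(4,5)[OF r(1)] term_simps(4,5)[OF r(4)] term_simps(4,5)[OF s(1)] term_simps(4,5)[OF s(4)] r s by simp_all
  note pd = path_dl[OF px(1), unfolded px] path_dl[OF px(3), unfolded px] path_dl[OF px(5), unfolded px] path_dl[OF px(7), unfolded px]
  note pdd = path_dl[OF pd(1), unfolded pd] path_dl[OF pd(3), unfolded pd] path_dl[OF pd(5), unfolded pd] path_dl[OF pd(7), unfolded pd]
  have ps: "psrcl b (tfl x) = a" "psrcl b (tfl w) = c" by (rule psrcl_path; simp add: px)+
  have d: "pty (pdual \<phi>) (f0 d (f0 d a)) (dl (tfl y) @ [f1 d \<theta>]) (f1 d \<theta>' # dl (dl (tfl x)))"
    using pty_pdual[OF r(7)] obj_typing[OF A] px by simp
  have tmx: "tm (tev x) x a b" "tm (tev z) z b c" using r s by (auto simp: tm_def)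
  note N = rp_eta(3)[OF tmx(1)]
  note t = obj_typing[OF A] obj_typing[OF A'] obj_typing[OF A''] px pd pdd ps pty_simps[OF r(7)] pty_simps[OF r(8)] pty_simps[OF s(7)] pty_simps[OF s(8)]
    pty_simps[OF d]
  let ?x = "tfl x" and ?y = "tfl y" and ?z = "tfl z" and ?w = "tfl w"
  let ?\<Phi> = "wh (dl ?x) \<phi>' [] \<odot> wh [] \<phi> ?w" and ?\<Psi> = "wh (dl ?w) \<psi> [] \<odot> wh [] \<psi>' ?x"
  have y: "pty ?\<Phi> c (\<theta> # ?y @ ?w) (dl ?x @ dl ?z @ [\<theta>''])" "pty ?\<Psi> a (\<theta>'' # ?z @ ?x) (dl ?w @ dl ?y @ [\<theta>])"
    by (simp_all add: pty_def cell_typing t)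
  have p: "parr (wh (dl ?x) \<phi>' [])" "parr (wh [] \<phi> ?w)" by (simp_all add: cell_typing t)
  have dd: "pdual ?\<Phi> = wh [] (pdual \<phi>') (dl (dl ?x)) \<odot> wh (dl ?w) (pdual \<phi>) []"
    using pdual_pcomp[OF ptyD(1)[OF y(1)]] pdual_wh[OF p(1)] pdual_wh[OF p(2)] by simp
  have e1': "wh (dl ?w) (pdual \<phi>) [] \<odot> wh (dl ?w @ dl ?y) (form a \<theta> \<Pi>) [] \<odot> wh (dl ?w) \<psi> [t1 \<eta> a]
     = wh (dl ?w) (form b \<theta>' \<Pi>') (dl (dl ?x)) \<odot> wh (dl ?w @ [\<theta>']) (eta_diag x) []"
    using arg_cong[OF e1, of "\<lambda>\<phi>. wh (dl ?w) \<phi> []"] by (simp add: wh_pcomp)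
  have e2': "wh [] (pdual \<phi>') (dl (dl ?x)) \<odot> wh (dl ?w) (form b \<theta>' \<Pi>') (dl (dl ?x)) \<odot> wh [] \<psi>' (t1 \<eta> b # dl (dl ?x)) =
      wh [] (form c \<theta>'' \<Pi>'') (dl (dl ?z) @ dl (dl ?x)) \<odot> wh [\<theta>''] (eta_diag z) (dl (dl ?x))"
    using arg_cong[OF e2, of "\<lambda>\<phi>. wh [] \<phi> (dl (dl ?x))"] by (simp add: wh_pcomp)
  have x: "wh (dl ?w @ [\<theta>']) (eta_diag x) [] \<odot> wh [] \<psi>' (?x @ [t1 \<eta> a]) = wh [] \<psi>' (t1 \<eta> b # dl (dl ?x)) \<odot> wh (\<theta>'' # ?z) (eta_diag x) []"
    using exchange[OF s(8) N, of "[]" "[]" "[]"] by simp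
  have "pdual ?\<Phi> \<odot> wh (dl ?w @ dl ?y) (form a \<theta> \<Pi>) [] \<odot> wh [] ?\<Psi> [t1 \<eta> a]
    = wh [] (pdual \<phi>') (dl (dl ?x)) \<odot> (wh (dl ?w) (pdual \<phi>) [] \<odot> wh (dl ?w @ dl ?y) (form a \<theta> \<Pi>) [] \<odot> wh (dl ?w) \<psi> [t1 \<eta> a])
      \<odot> wh [] \<psi>' (?x @ [t1 \<eta> a])"
    unfolding dd by (simp add: wh_pcomp)
  also have "\<dots> = (wh [] (pdual \<phi>') (dl (dl ?x)) \<odot> wh (dl ?w) (form b \<theta>' \<Pi>') (dl (dl ?x)) \<odot> wh [] \<psi>' (t1 \<eta> b # dl (dl ?x))) \<odot> wh (\<theta>'' # ?z) (eta_diag x) []"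
    unfolding e1' by (simp add: x)
  also have "\<dots> = wh [] (form c \<theta>'' \<Pi>'') (dl (dl ?z) @ dl (dl ?x)) \<odot> wh [\<theta>''] (eta_diag (z \<diamondop> x)) []"
    unfolding e2' eta_diag_comp[OF tmx] by (simp add: wh_pcomp)
  finally show ?thesis using r s y by simp
qed

text \<open>The equation is dualised, which yields an expression for d(psi) with dual forms and
  d^2(phi). Symmetry of the forms turns the dual forms back into forms at the price of pairings,
  naturality of eta turns d^2(phi) back into phi, and the modification property carries one pairing
  into the other.\<close>

lemma adjoint_pair_sym:
  assumes A: "(a, \<theta>, \<Pi>) \<in> S_obj" and A': "(b, \<theta>', \<Pi>') \<in> S_obj" and X: "X \<in> hom B a b"
    and R: "adjoint_pair (a, \<theta>, \<Pi>) (b, \<theta>', \<Pi>') (At X) y \<phi> \<psi>" and i: "piso \<phi>"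
  shows "adjoint_pair (b, \<theta>', \<Pi>') (a, \<theta>, \<Pi>) y (At X) \<psi> \<phi>"
proof -
  let ?dX = "f1 d X" and ?p = "form a \<theta> \<Pi>" and ?q = "form b \<theta>' \<Pi>'" and ?y = "tfl y"
  let ?N = "eta_diag (At X)" and ?N' = "eta_diag (Du (At X))" and ?A = "t1 \<eta> (f0 d a)" and ?C = "t1 \<eta> (f0 d b)"
  let ?ea = "t1 \<eta> a" and ?eb = "t1 \<eta> b" and ?va = "tau_counit a" and ?vb = "tau_counit b"
  have r: "tok y" "tsrc y = b" "ttrg y = a" "pty \<phi> b (\<theta> # ?y) [?dX, \<theta>']" "pty \<psi> a [\<theta>', X] (dl ?y @ [\<theta>])"
    and e: "pdual \<phi> \<odot> wh (dl ?y) ?p [] \<odot> wh [] \<psi> [?ea] = wh [] ?q [f1 d ?dX] \<odot> wh [\<theta>'] ?N []"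
    using R by auto
  note oa = obj_typing[OF A] and ob = obj_typing[OF A']
  have m: "X \<in> mor B" "src B X = a" "trg B X = b" using X by (auto simp: hom_iff)
  note tX = tm_rules(4)[OF X]
  note tdX = tm_rules(3)[OF tX] and t\<theta> = tm_rules(4)[OF S_objD(2)[OF A]] and t\<theta>' = tm_rules(4)[OF S_objD(2)[OF A']]
  have ty: "tm (tev y) y b a" using r by (simp add: tm_def)
  note N = rp_eta(3,4)[OF tX, simplified] and N' = rp_eta(3,4)[OF tdX, simplified] and Ny = rp_eta(3,4)[OF ty]
    and N\<theta> = rp_eta(3,4)[OF t\<theta>, simplified] and N\<theta>' = rp_eta(3,4)[OF t\<theta>', simplified]
  have py: "path b ?y" "tgt b ?y = a" using term_simps(4,5)[OF r(1)] r by simp_all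
  note pd = path_dl[OF py(1), unfolded py]
  note pdd = path_dl[OF pd(1), unfolded pd]
  have s: "psrcl (f0 d (f0 d a)) (dl (dl ?y)) = f0 d (f0 d b)" by (rule psrcl_path) (use pdd in simp_all)
  have d: "pty (pdual \<phi>) (f0 d (f0 d a)) (dl ?y @ [f1 d \<theta>]) [f1 d \<theta>', f1 d ?dX]" "piso (pdual \<phi>)"
    "pty (pdual (pdual \<phi>)) (f0 d (f0 d b)) (f1 d (f1 d \<theta>) # dl (dl ?y)) [f1 d (f1 d ?dX), f1 d (f1 d \<theta>')]" "piso (pdual (pdual \<phi>))"
    "pty (pdual \<psi>) (f0 d (f0 d b)) [?dX, f1 d \<theta>'] (f1 d \<theta> # dl (dl ?y))"
    "pty (pdual ?p) (f0 d (f0 d a)) [f1 d ?ea, f1 d \<theta>] [f1 d (f1 d \<theta>)]" "piso (pdual ?p)"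
    "pty (pdual ?q) (f0 d (f0 d b)) [f1 d ?eb, f1 d \<theta>'] [f1 d (f1 d \<theta>')]" "piso (pdual ?q)"
    "pty (pdual ?N) (f0 d b) [f1 d ?ea, ?dX] [f1 d (f1 d ?dX), f1 d ?eb]"
    using pty_pdual[OF r(4)] piso_pdual(1)[OF i] pty_pdual[OF r(5)] pty_pdual[OF oa(23)] pty_pdual[OF ob(23)]
      piso_pdual(1)[OF oa(14)] piso_pdual(1)[OF ob(14)] pty_pdual[OF N(1)] oa ob m pd
      piso_pdual(1)[OF piso_pdual(1)[OF i]] pty_pdual[OF pty_pdual[OF r(4)]] by simp_all
  have vy: "pty ?va (f0 d a) [?A, f1 d ?ea] []" "pty ?vb (f0 d b) [?C, f1 d ?eb] []" "piso ?va"
    using tau_counit_typing[OF oa(1)] tau_counit_typing[OF ob(1)] by auto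
  note t = oa ob m py pd pdd s pty_simps[OF r(4)] pty_simps[OF r(5)] piso_simps[OF i r(4)]
    pty_simps[OF N'(1)] piso_simps[OF N'(2,1)] pty_simps[OF N(1)] pty_simps[OF N\<theta>(1)] piso_simps[OF N\<theta>(2,1)]
    pty_simps[OF N\<theta>'(1)] piso_simps[OF N\<theta>'(2,1)] pty_simps[OF Ny(1)]
    pty_simps[OF d(1)] pty_simps[OF d(3)] piso_simps[OF d(4,3)] pty_simps[OF d(5)] pty_simps[OF d(6)] piso_simps[OF d(7,6)]
    pty_simps[OF d(8)] piso_simps[OF d(9,8)] pty_simps[OF d(10)] pty_simps[OF vy(1)] piso_simps[OF vy(3,1)] pty_simps[OF vy(2)]
    eta_hom[OF f0_obj'[OF oa(1)]] eta_hom[OF f0_obj'[OF ob(1)]]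
  \<comment> \<open>Symmetry of the form of \<open>a\<close>, solved for the pairing;
    \<open>sym'\<close> is the same for \<open>b\<close>, solved for the terms that contain the dual
    form.\<close>
  have sym: "wh [] ?va [f1 d \<theta>] = ?p \<odot> pinv (eta_diag (At \<theta>)) \<odot> wh [?A] (pdual ?p) []"
  proof -
    have "?p \<odot> pinv (eta_diag (At \<theta>)) \<odot> wh [?A] (pdual ?p) [] = wh [] ?va [f1 d \<theta>] \<odot> wh [?A] (pinv (pdual ?p)) [] \<odot> wh [?A] (pdual ?p) []"
      using pcomp_extend[OF form_symmetric[OF A], of "wh [?A] (pdual ?p) []"] by simp
    also have "\<dots> = wh [] ?va [f1 d \<theta>]"
      by (rule wh_cancel_end[OF d(7)]) (simp add: cell_typing t)
    finally show ?thesis by simp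
  qed
  have sym': "pinv (eta_diag (At \<theta>')) \<odot> wh [?C] (pdual ?q) [] = pinv ?q \<odot> wh [] ?vb [f1 d \<theta>']"
  proof -
    have "?q \<odot> pinv (eta_diag (At \<theta>')) \<odot> wh [?C] (pdual ?q) [] = wh [] ?vb [f1 d \<theta>'] \<odot> wh [?C] (pinv (pdual ?q)) [] \<odot> wh [?C] (pdual ?q) []"
      using pcomp_extend[OF form_symmetric[OF A'], of "wh [?C] (pdual ?q) []"] by simp
    also have "\<dots> = wh [] ?vb [f1 d \<theta>']"
      by (rule wh_cancel_end[OF d(9)]) (simp add: cell_typing t)
    finally have "?q \<odot> pinv (eta_diag (At \<theta>')) \<odot> wh [?C] (pdual ?q) [] = wh [] ?vb [f1 d \<theta>']" .
    then have "wh [] (pinv ?q) [] \<odot> wh [] ?q [] \<odot> pinv (eta_diag (At \<theta>')) \<odot> wh [?C] (pdual ?q) [] = pinv ?q \<odot> wh [] ?vb [f1 d \<theta>']"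
      by (simp add: t)
    moreover have "wh [] (pinv ?q) [] \<odot> wh [] ?q [] \<odot> pinv (eta_diag (At \<theta>')) \<odot> wh [?C] (pdual ?q) [] = pinv (eta_diag (At \<theta>')) \<odot> wh [?C] (pdual ?q) []"
      by (rule wh_cancel'[OF ob(14)]) (simp add: cell_typing t)
    ultimately show ?thesis by simp
  qed
  have M: "wh [?dX] ?vb [] \<odot> wh [] (pinv ?N') [f1 d ?eb] \<odot> wh [?A] (pdual ?N) [] = wh [] ?va [?dX]"
    by (rule modification_counit[OF X])
  \<comment> \<open>The dual of the hypothesis. The order of the vertical factors is kept, while
    every whiskering changes sides.\<close>
  have dE: "pdual (pdual \<phi>) \<odot> wh [] (pdual ?p) (dl (dl ?y)) \<odot> wh [f1 d ?ea] (pdual \<psi>) []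
    = wh [f1 d (f1 d ?dX)] (pdual ?q) [] \<odot> wh [] (pdual ?N) [f1 d \<theta>']"
  proof -
    have p: "parr (wh (dl ?y) ?p [])" "parr (wh [] \<psi> [?ea])" "parr (wh [] ?q [f1 d ?dX])" "parr (wh [\<theta>'] ?N [])"
      "parr (pdual \<phi> \<odot> wh (dl ?y) ?p [] \<odot> wh [] \<psi> [?ea])" "parr (wh [] ?q [f1 d ?dX] \<odot> wh [\<theta>'] ?N [])"
      "parr (wh (dl ?y) ?p [] \<odot> wh [] \<psi> [?ea])"
      by (simp_all add: cell_typing t)
    show ?thesis using arg_cong[OF e, of pdual] pdual_pcomp[OF p(5)] pdual_pcomp[OF p(6)] pdual_pcomp[OF p(7)]
      pdual_wh[OF p(1)] pdual_wh[OF p(2)] pdual_wh[OF p(3)] pdual_wh[OF p(4)] by simp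
  qed
  obtain f where f: "rty (At \<theta> \<diamondop> y) f (Du (At X) \<diamondop> At \<theta>')" and rf: "rep (At \<theta> \<diamondop> y) f (Du (At X) \<diamondop> At \<theta>') = \<phi>"
    by (rule rep_surj[of "At \<theta> \<diamondop> y" "Du (At X) \<diamondop> At \<theta>'" \<phi>]) (use r oa ob m in simp_all)
  have nat: "wh [] ?N' [f1 d (f1 d \<theta>')] \<odot> wh [?dX] (eta_diag (At \<theta>')) [] \<odot> wh [] \<phi> [?eb]
    = wh [?A] (pdual (pdual \<phi>)) [] \<odot> wh [] (eta_diag (At \<theta>)) (dl (dl ?y)) \<odot> wh [\<theta>] (eta_diag y) []"
    using eta_diag_natural[OF f, of b "f0 d a"] r oa eta_diag_comp[OF ty t\<theta>] eta_diag_comp[OF t\<theta>' tdX] by (simp add: rf)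
  \<comment> \<open>With \<open>?K\<close> as the remaining inverse components of eta, the
    naturality square is solved for the inverse of d^2(phi) preceded on its other side by the
    inverse of eta at \<open>\<theta>\<close>; this is where invertibility of phi is needed.\<close>
  let ?K = "wh [?dX] (pinv (eta_diag (At \<theta>'))) [] \<odot> wh [] (pinv ?N') [f1 d (f1 d \<theta>')]"
  have nat': "wh [] (pinv (eta_diag (At \<theta>))) (dl (dl ?y)) \<odot> wh [?A] (pinv (pdual (pdual \<phi>))) []
    = wh [\<theta>] (eta_diag y) [] \<odot> wh [] (pinv \<phi>) [?eb] \<odot> ?K"
  proof -
    have 1: "wh [] (pinv (eta_diag (At \<theta>))) (dl (dl ?y)) \<odot> wh [?A] (pinv (pdual (pdual \<phi>))) [] \<odot>
       (wh [] ?N' [f1 d (f1 d \<theta>')] \<odot> wh [?dX] (eta_diag (At \<theta>')) [] \<odot> wh [] \<phi> [?eb]) = wh [\<theta>] (eta_diag y) []"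
      unfolding nat
      by (subst wh_cancel'[OF d(4)], simp add: cell_typing t, subst wh_cancel'[OF N\<theta>(2)], simp_all add: cell_typing t)
    have "wh [\<theta>] (eta_diag y) [] \<odot> wh [] (pinv \<phi>) [?eb] \<odot> ?K = wh [] (pinv (eta_diag (At \<theta>))) (dl (dl ?y)) \<odot> wh [?A] (pinv (pdual (pdual \<phi>))) [] \<odot>
       wh [] ?N' [f1 d (f1 d \<theta>')] \<odot> wh [?dX] (eta_diag (At \<theta>')) [] \<odot> wh [] \<phi> [?eb] \<odot> wh [] (pinv \<phi>) [?eb] \<odot> ?K"
      unfolding 1[symmetric] by simp
    also have "\<dots> = wh [] (pinv (eta_diag (At \<theta>))) (dl (dl ?y)) \<odot> wh [?A] (pinv (pdual (pdual \<phi>))) [] \<odot>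
       wh [] ?N' [f1 d (f1 d \<theta>')] \<odot> wh [?dX] (eta_diag (At \<theta>')) [] \<odot> ?K"
      by (subst wh_cancel[OF i]) (simp_all add: cell_typing t)
    also have "\<dots> = wh [] (pinv (eta_diag (At \<theta>))) (dl (dl ?y)) \<odot> wh [?A] (pinv (pdual (pdual \<phi>))) [] \<odot>
       wh [] (pinv (pinv ?N')) [f1 d (f1 d \<theta>')] \<odot> wh [] (pinv ?N') [f1 d (f1 d \<theta>')]"
      by (subst wh_cancel[OF N\<theta>'(2)]) (simp_all add: cell_typing t)
    also have "\<dots> = (wh [] (pinv (eta_diag (At \<theta>))) (dl (dl ?y)) \<odot> wh [?A] (pinv (pdual (pdual \<phi>))) []) \<odot>
       wh [] (pinv (pinv ?N')) [f1 d (f1 d \<theta>')] \<odot> wh [] (pinv ?N') [f1 d (f1 d \<theta>')]"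
      by simp
    also have "\<dots> = wh [] (pinv (eta_diag (At \<theta>))) (dl (dl ?y)) \<odot> wh [?A] (pinv (pdual (pdual \<phi>))) []"
      by (rule wh_cancel_end) (simp_all add: cell_typing t)
    finally show ?thesis by simp
  qed
  have x1: "wh [] ?va (f1 d \<theta> # dl (dl ?y)) \<odot> wh [?A, f1 d ?ea] (pdual \<psi>) [] = pdual \<psi> \<odot> wh [] ?va [?dX, f1 d \<theta>']"
    using exchange[OF vy(1) d(5), of "[]" "[]" "[]"] by (simp add: t)
  have x2: "wh [] (pinv ?N') [f1 d (f1 d \<theta>')] \<odot> wh [?A, f1 d (f1 d ?dX)] (pdual ?q) [] = wh [?dX, ?C] (pdual ?q) [] \<odot> wh [] (pinv ?N') [f1 d ?eb, f1 d \<theta>']"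
    using exchange[OF pty_pinv[OF N'(2,1)] d(8), of "[]" "[]" "[]"] by simp
  have dE': "wh [?A] (pdual ?p) (dl (dl ?y)) \<odot> wh [?A, f1 d ?ea] (pdual \<psi>) []
    = wh [?A] (pinv (pdual (pdual \<phi>))) [] \<odot> wh [?A, f1 d (f1 d ?dX)] (pdual ?q) [] \<odot> wh [?A] (pdual ?N) [f1 d \<theta>']"
  proof -
    have "wh [?A] (pinv (pdual (pdual \<phi>))) [] \<odot> wh [?A] (pdual (pdual \<phi>)) [] \<odot> wh [?A] (pdual ?p) (dl (dl ?y)) \<odot> wh [?A, f1 d ?ea] (pdual \<psi>) []
      = wh [?A] (pdual ?p) (dl (dl ?y)) \<odot> wh [?A, f1 d ?ea] (pdual \<psi>) []"
      by (rule wh_cancel'[OF d(4)]) (simp add: cell_typing t)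
    moreover have "wh [?A] (pdual (pdual \<phi>)) [] \<odot> wh [?A] (pdual ?p) (dl (dl ?y)) \<odot> wh [?A, f1 d ?ea] (pdual \<psi>) []
      = wh [?A, f1 d (f1 d ?dX)] (pdual ?q) [] \<odot> wh [?A] (pdual ?N) [f1 d \<theta>']"
      using arg_cong[OF dE, of "\<lambda>\<phi>. wh [?A] \<phi> []"] by (simp add: wh_pcomp)
    ultimately show ?thesis by simp
  qed
  \<comment> \<open>The dual of psi is computed with the pairing of \<open>a\<close> attached at its
    source. The chain ends with the same pairing in the same place, so that it can be
    cancelled.\<close>
  have "pdual \<psi> \<odot> wh [] ?va [?dX, f1 d \<theta>'] = wh [] ?va (f1 d \<theta> # dl (dl ?y)) \<odot> wh [?A, f1 d ?ea] (pdual \<psi>) []"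
    by (rule x1[symmetric])
  also have "\<dots> = wh [] ?p (dl (dl ?y)) \<odot> wh [] (pinv (eta_diag (At \<theta>))) (dl (dl ?y)) \<odot> wh [?A] (pdual ?p) (dl (dl ?y)) \<odot> wh [?A, f1 d ?ea] (pdual \<psi>) []"
    using arg_cong[OF sym, of "\<lambda>\<phi>. wh [] \<phi> (dl (dl ?y))"] by (simp add: wh_pcomp)
  also have "\<dots> = wh [] ?p (dl (dl ?y)) \<odot> (wh [] (pinv (eta_diag (At \<theta>))) (dl (dl ?y)) \<odot> wh [?A] (pinv (pdual (pdual \<phi>))) []) \<odot> wh [?A, f1 d (f1 d ?dX)] (pdual ?q) [] \<odot> wh [?A] (pdual ?N) [f1 d \<theta>']"
    unfolding dE' by simp
  also have "\<dots> = wh [] ?p (dl (dl ?y)) \<odot> wh [\<theta>] (eta_diag y) [] \<odot> wh [] (pinv \<phi>) [?eb] \<odot> wh [?dX] (pinv (eta_diag (At \<theta>')) \<odot> wh [?C] (pdual ?q) []) []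
     \<odot> wh [] (pinv ?N') [f1 d ?eb, f1 d \<theta>'] \<odot> wh [?A] (pdual ?N) [f1 d \<theta>']"
    unfolding nat' by (simp add: pcomp_extend[OF x2] wh_pcomp)
  also have "\<dots> = wh [] ?p (dl (dl ?y)) \<odot> wh [\<theta>] (eta_diag y) [] \<odot> wh [] (pinv \<phi>) [?eb] \<odot> wh [?dX] (pinv ?q) [] \<odot>
     wh [] (wh [?dX] ?vb [] \<odot> wh [] (pinv ?N') [f1 d ?eb] \<odot> wh [?A] (pdual ?N) []) [f1 d \<theta>']"
    unfolding sym' by (simp add: wh_pcomp)
  also have "\<dots> = (wh [] ?p (dl (dl ?y)) \<odot> wh [\<theta>] (eta_diag y) [] \<odot> wh [] (pinv \<phi>) [?eb] \<odot> wh [?dX] (pinv ?q) []) \<odot> wh [] ?va [?dX, f1 d \<theta>']"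
    unfolding M by simp
  finally have E: "pdual \<psi> \<odot> wh [] ?va [?dX, f1 d \<theta>'] = (wh [] ?p (dl (dl ?y)) \<odot> wh [\<theta>] (eta_diag y) [] \<odot> wh [] (pinv \<phi>) [?eb] \<odot> wh [?dX] (pinv ?q) []) \<odot> wh [] ?va [?dX, f1 d \<theta>']" .
  have pv: "parr (wh [] ?va [?dX, f1 d \<theta>'])" by (simp add: cell_typing t)
  have F: "pdual \<psi> = wh [] ?p (dl (dl ?y)) \<odot> wh [\<theta>] (eta_diag y) [] \<odot> wh [] (pinv \<phi>) [?eb] \<odot> wh [?dX] (pinv ?q) []"
    by (rule pcomp_cancel_right[OF E piso_wh(1)[OF vy(3) pv], of "f0 d (f0 d b)" "[?A, f1 d ?ea, ?dX, f1 d \<theta>']" "[?dX, f1 d \<theta>']" "f1 d \<theta> # dl (dl ?y)"])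
      (simp_all add: pty_def cell_typing t)
  have "pdual \<psi> \<odot> wh [?dX] ?q [] \<odot> wh [] \<phi> [?eb] = wh [] ?p (dl (dl ?y)) \<odot> wh [\<theta>] (eta_diag y) [] \<odot> wh [] (pinv \<phi>) [?eb] \<odot> wh [?dX] (pinv ?q) [] \<odot> wh [?dX] ?q [] \<odot> wh [] \<phi> [?eb]"
    unfolding F by simp
  also have "\<dots> = (wh [] ?p (dl (dl ?y)) \<odot> wh [\<theta>] (eta_diag y) []) \<odot> wh [] (pinv \<phi>) [?eb] \<odot> wh [] \<phi> [?eb]"
    by (subst wh_cancel'[OF ob(14)]) (simp_all add: cell_typing t)
  also have "\<dots> = wh [] ?p (dl (dl ?y)) \<odot> wh [\<theta>] (eta_diag y) []"
    by (rule wh_cancel_end[OF i]) (simp add: cell_typing t)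
  finally show ?thesis using r m by simp
qed

section \<open>The comparison with the double dual\<close>

definition dag_term :: "'m \<Rightarrow> ('o, 'm) mterm \<Rightarrow> 'm \<Rightarrow> ('o, 'm) mterm" where
  "dag_term \<theta> x \<theta>' = At (inv1 J \<theta>) \<diamondop> Du x \<diamondop> At \<theta>'"

lemma tfl_dag_term [simp]: "tfl (dag_term \<theta> x \<theta>') = inv1 J \<theta> # dl (tfl x) @ [\<theta>']"
  by (simp add: dag_term_def)

lemma dag_term_typing:
  assumes "(a, \<theta>, \<Pi>) \<in> S_obj" "(b, \<theta>', \<Pi>') \<in> S_obj" "tm X x a b"
  shows "tm (inv1 J \<theta> \<cdot> (f1 d X \<cdot> \<theta>')) (dag_term \<theta> x \<theta>') b a"
  unfolding dag_term_def by (rule tm_rules(2)[OF tm_rules(2)[OF tm_rules(4)[OF S_objD(2)[OF assms(2)]] tm_rules(3)[OF assms(3)]]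
      tm_rules(4)[OF inv1_hom[OF S_objD(3,2)[OF assms(1)]]]])

text \<open>The diagram 1 => theta^-1 d(theta) eta_c^-1 to which \<open>pass_to_inverses\<close>
  turns \<open>\<Pi>\<close>; it is the left half of the first arrow in (S eta)_X.\<close>

definition Pi_inverses_diag :: "'o \<Rightarrow> 'm \<Rightarrow> 'c \<Rightarrow> ('o, 'm, 'c) pcell" where
  "Pi_inverses_diag c \<theta> \<Pi> = wh [inv1 J \<theta>] (sq_h (inv1 J (t1 \<eta> c)) (iota (t1 \<eta> c)) (f1 d \<theta>) (inv1 J (f1 d \<theta>)) (epsi (f1 d \<theta>)) \<theta> (Pi_diag c \<theta> \<Pi>)) [] \<odot> iota \<theta>"

text \<open>The diagram of \<open>S_eta_cell\<close>.\<close>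

fun S_eta_diag :: "('o, 'm, 'c) sobj \<Rightarrow> ('o, 'm) mterm \<Rightarrow> ('o, 'm, 'c) sobj \<Rightarrow> ('o, 'm, 'c) pcell" where
  "S_eta_diag (a, \<theta>, \<Pi>) x (b, \<theta>', \<Pi>') =
     wh (inv1 J \<theta>' # f1 d \<theta>' # dl (dl (tfl x))) (delta \<theta>) [\<theta>] \<odot>
     wh [inv1 J \<theta>', f1 d \<theta>'] (pinv (iota (t1 \<eta> b))) (dl (dl (tfl x)) @ [inv1 J (f1 d \<theta>), \<theta>]) \<odot>
     wh [inv1 J \<theta>', f1 d \<theta>', inv1 J (t1 \<eta> b)] (eta_diag x) [inv1 J (f1 d \<theta>), \<theta>] \<odot>
     wh [] (Pi_inverses_diag b \<theta>' \<Pi>') (tfl x @ [t1 \<eta> a, inv1 J (f1 d \<theta>), \<theta>]) \<odot>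
     wh (tfl x) (pinv (Pi_diag a \<theta> \<Pi>)) []"

text \<open>The explicit composite is opened only to identify its origin and to prove the
  adjointness; everything afterwards relies on adjointness.\<close>

declare S_eta_diag.simps [simp del]

lemma rp_S_eta_diag:
  assumes A: "(a, \<theta>, \<Pi>) \<in> S_obj" and A': "(b, \<theta>', \<Pi>') \<in> S_obj" and X: "tm X x a b"
  shows "rp a b x (S_eta_cell ((a, \<theta>, \<Pi>), X, (b, \<theta>', \<Pi>'))) (dag_term \<theta>' (dag_term \<theta> x \<theta>') \<theta>)
    [S_eta_diag (a, \<theta>, \<Pi>) x (b, \<theta>', \<Pi>')]"
proof -
  note oa = S_objD[OF A] and ob = S_objD[OF A'] and ha = dual_homs[OF A] and hb = dual_homs[OF A']
  have trg: "trg B X = b" using tm_hom(1)[OF X] by (simp add: hom_iff)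
  note rules = rp_Pi(1,2)[OF A] rp_dual_inverse[OF oa(3) obj_tms(1)[OF A] simple_terms(1)[OF A]]
    rp_eta[OF X] rp_unit_counit[OF hb(8) obj_tms(5)[OF A'] simple_terms(4)[OF A']]
    rp_pass_to_inverses[OF hb(8) obj_tms(5)[OF A'] simple_terms(4)[OF A'] hb(2) obj_tms(2)[OF A'] simple_terms(2)[OF A']
      ob(3) obj_tms(1)[OF A'] simple_terms(1)[OF A'] rp_Pi(1)[OF A'], folded Pi_inverses_diag_def]
  note homs = dual_inv_homs[OF A] dual_inv_homs[OF A'] oa ob ha hb
  have "rp a b x (S_eta_cell ((a, \<theta>, \<Pi>), X, (b, \<theta>', \<Pi>'))) (dag_term \<theta>' (dag_term \<theta> x \<theta>') \<theta>)
    [wh (inv1 J \<theta>' # f1 d \<theta>' # dl (dl (tfl x))) (delta \<theta>) [\<theta>],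
     wh [inv1 J \<theta>', f1 d \<theta>'] (pinv (iota (t1 \<eta> b))) (dl (dl (tfl x)) @ [inv1 J (f1 d \<theta>), \<theta>]),
     wh [inv1 J \<theta>', f1 d \<theta>', inv1 J (t1 \<eta> b)] (eta_diag x) [inv1 J (f1 d \<theta>), \<theta>],
     wh [] (Pi_inverses_diag b \<theta>' \<Pi>') (tfl x @ [t1 \<eta> a, inv1 J (f1 d \<theta>), \<theta>]),
     wh (tfl x) (pinv (Pi_diag a \<theta> \<Pi>)) []]"
    unfolding S_eta_cell_def S_double_dual_iso_def eta_induced_def Let_def prod.case dag_term_def trg
    by (rule rp_cong, (rule rules obj_tms[OF A] obj_tms[OF A'] X rp_rules rp_hcomp tm_rules homs)+) simp
  from rp_single[OF this] show ?thesis by (simp add: S_eta_diag.simps)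
qed

text \<open>All ingredients of (S eta)_X are consumed here. The comparison \<open>delta\<close>
  cancels against the dual counit of theta, \<open>\<Pi>\<close> of \<open>b\<close> becomes the
  form of \<open>b\<close>, and the inverse of \<open>\<Pi>\<close> of \<open>a\<close> cancels
  against the form of \<open>a\<close>. What survives is eta_X after the counit of theta' has slid
  past it.\<close>

lemma adjoint_pair_S_eta_diag:
  assumes A: "(a, \<theta>, \<Pi>) \<in> S_obj" and A': "(b, \<theta>', \<Pi>') \<in> S_obj" and X: "tm X x a b"
  shows "adjoint_pair (a, \<theta>, \<Pi>) (b, \<theta>', \<Pi>') x (dag_term \<theta> x \<theta>') (wh [] (epsi \<theta>) (dl (tfl x) @ [\<theta>']))
    (wh [] (epsi \<theta>') (f1 d \<theta>' # dl (dl (tfl x)) @ [f1 d (inv1 J \<theta>), \<theta>]) \<odot> wh [\<theta>'] (S_eta_diag (a, \<theta>, \<Pi>) x (b, \<theta>', \<Pi>')) [])" (is ?R)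
    "piso (S_eta_diag (a, \<theta>, \<Pi>) x (b, \<theta>', \<Pi>'))" (is ?I)
    "pty (S_eta_diag (a, \<theta>, \<Pi>) x (b, \<theta>', \<Pi>')) a (tfl x) (inv1 J \<theta>' # f1 d \<theta>' # dl (dl (tfl x)) @ [f1 d (inv1 J \<theta>), \<theta>])" (is ?P)
proof -
  let ?i = "inv1 J \<theta>" and ?i' = "inv1 J \<theta>'" and ?T = "f1 d \<theta>" and ?U = "f1 d \<theta>'" and ?X2 = "dl (dl (tfl x))"
  let ?ea = "t1 \<eta> a" and ?eb = "t1 \<eta> b" and ?j = "f1 d ?i" and ?T' = "inv1 J ?T" and ?N = "eta_diag x" and ?\<delta> = "delta \<theta>"
  let ?e = "S_eta_diag (a, \<theta>, \<Pi>) x (b, \<theta>', \<Pi>')" and ?k = "Pi_inverses_diag b \<theta>' \<Pi>'" and ?Pi = "Pi_diag a \<theta> \<Pi>"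
  let ?p = "form a \<theta> \<Pi>" and ?q = "form b \<theta>' \<Pi>'" and ?eb' = "inv1 J ?eb"
  let ?h = "sq_h (inv1 J (t1 \<eta> b)) (iota (t1 \<eta> b)) (f1 d \<theta>') (inv1 J (f1 d \<theta>')) (epsi (f1 d \<theta>')) \<theta>' (Pi_diag b \<theta>' \<Pi>')"
  note oa = obj_typing[OF A] and ob = obj_typing[OF A']
  note da = dual_adj[OF A] and db = dual_adj[OF A']
  have m: "tok x" "tsrc x = a" "ttrg x = b" using X by (auto simp: tm_def)
  have px: "path a (tfl x)" "tgt a (tfl x) = b" using term_simps(4,5)[OF m(1)] m by simp_all
  note pd = path_dl[OF px(1), unfolded px]
  note pdd = path_dl[OF pd(1), unfolded pd]
  have ps: "psrcl b (tfl x) = a" "psrcl (f0 d (f0 d b)) (dl (dl (tfl x))) = f0 d (f0 d a)" "psrcl (f0 d a) (dl (tfl x)) = f0 d b"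
    by (rule psrcl_path; simp add: px pd pdd)+
  note N = rp_eta(3,4)[OF X]
  note dl = delta_counit[OF S_objD(3,2)[OF A]]
  note sb = form_sq[OF A']
  note t = oa ob px pd pdd ps adj_typing[OF da(1)] adj_typing[OF da(2)] adj_typing[OF da(5)] adj_typing[OF db(1)] adj_typing[OF db(2)] adj_typing[OF db(5)]
    pty_simps[OF N(1)] pty_simps[OF dl(2)] pty_simps[OF dl(3)] piso_simps[OF dl(4,3)] pty_simps[OF sb(2)]
    pty_simps[OF rp_Pi(3)[OF A]] piso_simps[OF rp_Pi(4,3)[OF A]]
  have ky: "pty ?k b [] [?i', ?U, ?eb']" by (simp add: Pi_inverses_diag_def pty_def cell_typing t)
  have kw: "pty (wh [?i'] ?h []) b [?i', \<theta>'] [?i', ?U, ?eb']" by (simp add: pty_def cell_typing t)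
  have ki: "piso ?k" unfolding Pi_inverses_diag_def
    by (rule piso_pcomp(1)[OF adjD(9)[OF db(1)] piso_wh(1)[OF sb(5) ptyD(1)[OF kw]] adjD(11)[OF db(1)] kw])
  note t = t pty_simps[OF ky]
  have w11: "pty (wh ([?i', ?U] @ ?X2) ?\<delta> [\<theta>]) a ([?i', ?U] @ ?X2 @ [?T', \<theta>]) ([?i', ?U] @ ?X2 @ [?j, \<theta>])"
    by (simp add: pty_def cell_typing t)
  have w12: "pty (wh [?i', ?U] (pinv (iota ?eb)) (?X2 @ [?T', \<theta>])) a ([?i', ?U, ?eb', ?eb] @ ?X2 @ [?T', \<theta>]) ([?i', ?U] @ ?X2 @ [?T', \<theta>])"
    by (simp add: pty_def cell_typing t)
  have w13: "pty (wh [?i', ?U, ?eb'] ?N [?T', \<theta>]) a ([?i', ?U, ?eb'] @ tfl x @ [?ea, ?T', \<theta>]) ([?i', ?U, ?eb', ?eb] @ ?X2 @ [?T', \<theta>])"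
    by (simp add: pty_def cell_typing t)
  have w14: "pty (wh [] ?k (tfl x @ [?ea, ?T', \<theta>])) a (tfl x @ [?ea, ?T', \<theta>]) ([?i', ?U, ?eb'] @ tfl x @ [?ea, ?T', \<theta>])"
    by (simp add: pty_def cell_typing t)
  have w15: "pty (wh (tfl x) (pinv ?Pi) []) a (tfl x) (tfl x @ [?ea, ?T', \<theta>])"
    by (simp add: pty_def cell_typing t)
  note w = w11 w12 w13 w14 w15
  note wi = piso_wh(1)[OF dl(5) ptyD(1)[OF w(1)]] piso_wh(1)[OF piso_pinv[OF adjD(9)[OF db(5)]] ptyD(1)[OF w(2)]]
    piso_wh(1)[OF N(2) ptyD(1)[OF w(3)]] piso_wh(1)[OF ki ptyD(1)[OF w(4)]] piso_wh(1)[OF piso_pinv[OF rp_Pi(4)[OF A]] ptyD(1)[OF w(5)]]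
  note w1 = pty_pcomp[OF w(5,4)] piso_pcomp(1)[OF wi(5,4) w(5,4)]
  note w2 = pty_pcomp[OF w1(1) w(3)] piso_pcomp(1)[OF w1(2) wi(3) w1(1) w(3)]
  note w3 = pty_pcomp[OF w2(1) w(2)] piso_pcomp(1)[OF w2(2) wi(2) w2(1) w(2)]
  show P: ?P ?I
    unfolding S_eta_diag.simps by (rule pty_pcomp[OF w3(1) w(1), unfolded append_Cons append_Nil]
      piso_pcomp(1)[OF w3(2) wi(1) w3(1) w(1), unfolded append_Cons append_Nil])+
  note t = t pty_simps[OF P(1)]
  have d: "pty (wh [] (epsi \<theta>) (dl (tfl x) @ [\<theta>'])) b ([\<theta>, ?i] @ dl (tfl x) @ [\<theta>']) (dl (tfl x) @ [\<theta>'])"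
    "pty (wh [] (epsi \<theta>') ([?U] @ ?X2 @ [?j, \<theta>]) \<odot> wh [\<theta>'] ?e []) a ([\<theta>'] @ tfl x) ([?U] @ ?X2 @ [?j, \<theta>])"
    by (simp_all add: pty_def cell_typing t)
  have dc: "pdual (wh [] (epsi \<theta>) (dl (tfl x) @ [\<theta>'])) = wh ([?U] @ ?X2) (pdual (epsi \<theta>)) []"
    using pdual_wh[OF ptyD(1)[OF d(1)]] by simp
  \<comment> \<open>This is \<open>\<Pi>\<close> of \<open>a\<close> with eta_a moved from the left
    end to the right end; the first of the \<open>sq_equations\<close> says that eta_a may be
    attached on either side (\<open>\<mu>1\<close>).\<close>
  define \<mu> where "\<mu> = pinv (iota ?T) \<odot> wh [?T'] ?p []"
  have \<mu>y: "pty \<mu> (f0 d (f0 d a)) [?T', \<theta>, ?ea] []" by (simp add: \<mu>_def pty_def cell_typing t)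
  have \<mu>1: "wh us ?Pi (?ea # vs) = wh (us @ [?ea]) \<mu> vs" for us vs
    using arg_cong[OF form_eq(1)[OF A], of "\<lambda>\<phi>. wh us \<phi> vs"] by (simp add: \<mu>_def wh_pcomp)
  have "wh [?j] ?p [] \<odot> wh [] ?\<delta> [\<theta>, ?ea] = wh [] ?\<delta> [?T] \<odot> wh [?T'] ?p []"
    using exchange[OF dl(2) oa(23), of "[]" "[]" "[]"] by simp
  then have "pdual (epsi \<theta>) \<odot> wh [?j] ?p [] \<odot> wh [] ?\<delta> [\<theta>, ?ea] = wh [] (pdual (epsi \<theta>)) [] \<odot> wh [] (pinv (pdual (epsi \<theta>))) [] \<odot> \<mu>"
    by (simp add: dl(1) \<mu>_def t)
  also have "\<dots> = \<mu>"
    by (rule wh_cancel[OF dl(4)]) (simp add: cell_typing t pty_simps[OF \<mu>y])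
  finally have \<mu>2: "pdual (epsi \<theta>) \<odot> wh [?j] ?p [] \<odot> wh [] ?\<delta> [\<theta>, ?ea] = \<mu>" .
  have \<mu>2': "wh ([?U] @ ?X2) (pdual (epsi \<theta>)) [] \<odot> wh ([?U] @ ?X2 @ [?j]) ?p [] \<odot> wh ([?U] @ ?X2) ?\<delta> [\<theta>, ?ea] = wh ([?U] @ ?X2) \<mu> []"
    using arg_cong[OF \<mu>2, of "\<lambda>\<phi>. wh ([?U] @ ?X2) \<phi> []"] by (simp add: wh_pcomp)
  \<comment> \<open>The counit of theta' undoes the last move of \<open>pass_to_inverses\<close>, by
    a zigzag, and leaves the mate that occurs in the form of \<open>b\<close>.\<close>
  have k1: "wh [] (epsi \<theta>') [?U, ?eb'] \<odot> wh [\<theta>'] ?k [] = ?h"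
  proof -
    have 1: "wh [] (epsi \<theta>') [?U, ?eb'] \<odot> wh [\<theta>', ?i'] ?h [] = ?h \<odot> wh [] (epsi \<theta>') [\<theta>']"
      using exchange[OF adjD(12)[OF db(1)] sb(2), of "[]" "[]" "[]"] by (simp add: t)
    show ?thesis using adjD(13)[OF db(1)] by (simp add: Pi_inverses_diag_def wh_pcomp pcomp_extend[OF 1] t)
  qed
  have k1': "wh [] (epsi \<theta>') (?U # ?eb' # vs) \<odot> wh [\<theta>'] ?k vs = wh [] ?h vs" for vs
    using arg_cong[OF k1, of "\<lambda>\<phi>. wh [] \<phi> vs"] by (simp add: wh_pcomp)
  have q: "wh [] ?q vs = wh [?U] (pinv (iota ?eb)) vs \<odot> wh [] ?h (?eb # vs)" for vs
    by (simp add: form_def[of b] sq_p_def wh_pcomp)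
  note ap = append_Cons append_Nil
  have x1: "wh [] (epsi \<theta>') ([?U] @ ?X2 @ [?j, \<theta>, ?ea]) \<odot> wh ([\<theta>', ?i', ?U] @ ?X2) ?\<delta> [\<theta>, ?ea] = wh ([?U] @ ?X2) ?\<delta> [\<theta>, ?ea] \<odot> wh [] (epsi \<theta>') ([?U] @ ?X2 @ [?T', \<theta>, ?ea])"
    using exchange[OF adjD(12)[OF db(1)] dl(2), of "[]" "([?U] @ ?X2)" "[\<theta>, ?ea]"] by simp
  have x2: "wh [] (epsi \<theta>') ([?U] @ ?X2 @ [?T', \<theta>, ?ea]) \<odot> wh [\<theta>', ?i', ?U] (pinv (iota ?eb)) (?X2 @ [?T', \<theta>, ?ea])
     = wh [?U] (pinv (iota ?eb)) (?X2 @ [?T', \<theta>, ?ea]) \<odot> wh [] (epsi \<theta>') ([?U, ?eb', ?eb] @ ?X2 @ [?T', \<theta>, ?ea])"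
    using exchange[OF adjD(12)[OF db(1)] pty_pinv[OF adjD(9,11)[OF db(5)]], of "[]" "[?U]" "(?X2 @ [?T', \<theta>, ?ea])"] by simp
  have x3: "wh [] (epsi \<theta>') ([?U, ?eb', ?eb] @ ?X2 @ [?T', \<theta>, ?ea]) \<odot> wh [\<theta>', ?i', ?U, ?eb'] ?N [?T', \<theta>, ?ea]
     = wh [?U, ?eb'] ?N [?T', \<theta>, ?ea] \<odot> wh [] (epsi \<theta>') ([?U, ?eb'] @ tfl x @ [?ea, ?T', \<theta>, ?ea])"
    using exchange[OF adjD(12)[OF db(1)] N(1), of "[]" "[?U, ?eb']" "[?T', \<theta>, ?ea]"] by simp
  have x4: "wh [?U, ?eb'] ?N [?T', \<theta>, ?ea] \<odot> wh [] ?h (tfl x @ [?ea, ?T', \<theta>, ?ea]) = wh [] ?h ([?eb] @ ?X2 @ [?T', \<theta>, ?ea]) \<odot> wh [\<theta>'] ?N [?T', \<theta>, ?ea]"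
    using exchange[OF sb(2) N(1), of "[]" "[]" "[?T', \<theta>, ?ea]"] by simp
  have x5: "wh ([?U] @ ?X2) \<mu> [] \<odot> wh [] ?q (?X2 @ [?T', \<theta>, ?ea]) = wh [] ?q (?X2) \<odot> wh ([\<theta>', ?eb] @ ?X2) \<mu> []"
    using exchange[OF ob(23) \<mu>y, of "[]" "(?X2)" "[]"] by simp
  have x6: "wh ([\<theta>', ?eb] @ ?X2) \<mu> [] \<odot> wh [\<theta>'] ?N [?T', \<theta>, ?ea] = wh [\<theta>'] ?N [] \<odot> wh ([\<theta>'] @ tfl x @ [?ea]) \<mu> []"
    using exchange[OF N(1) \<mu>y, of "[\<theta>']" "[]" "[]"] by simp
  have "wh ([?U] @ ?X2) (pdual (epsi \<theta>)) [] \<odot> wh ([?U] @ ?X2 @ [?j]) ?p [] \<odot> wh [] (wh [] (epsi \<theta>') ([?U] @ ?X2 @ [?j, \<theta>]) \<odot> wh [\<theta>'] ?e []) [?ea]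
    = (wh ([?U] @ ?X2) (pdual (epsi \<theta>)) [] \<odot> wh ([?U] @ ?X2 @ [?j]) ?p [] \<odot> wh ([?U] @ ?X2) ?\<delta> [\<theta>, ?ea]) \<odot>
      wh [?U] (pinv (iota ?eb)) (?X2 @ [?T', \<theta>, ?ea]) \<odot> wh [] ?h ([?eb] @ ?X2 @ [?T', \<theta>, ?ea]) \<odot> wh [\<theta>'] ?N [?T', \<theta>, ?ea] \<odot> wh ([\<theta>'] @ tfl x) (pinv ?Pi) [?ea]"
    by (simp add: S_eta_diag.simps wh_pcomp x1[unfolded ap, THEN pcomp_extend] x2[unfolded ap, THEN pcomp_extend]
      x3[unfolded ap, THEN pcomp_extend] pcomp_extend[OF k1'] x4[unfolded ap, THEN pcomp_extend])
  also have "\<dots> = wh [] ?q (?X2) \<odot> wh [\<theta>'] ?N [] \<odot> wh ([\<theta>'] @ tfl x @ [?ea]) \<mu> [] \<odot> wh ([\<theta>'] @ tfl x) (pinv ?Pi) [?ea]"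
    unfolding \<mu>2' using pcomp_extend[OF x5] pcomp_extend[OF x6] by (simp add: q)
  \<comment> \<open>By \<open>\<mu>1\<close>, what is left of the form of \<open>a\<close> is
    \<open>\<Pi>\<close> with eta_a on its right, exactly the inverse of the last factor.\<close>
  also have "\<dots> = (wh [] ?q (?X2) \<odot> wh [\<theta>'] ?N []) \<odot> wh ([\<theta>'] @ tfl x) (pinv (pinv ?Pi)) [?ea] \<odot> wh ([\<theta>'] @ tfl x) (pinv ?Pi) [?ea]"
    using \<mu>1[of "([\<theta>'] @ tfl x)" "[]"] rp_Pi(4)[OF A] by simp
  also have "\<dots> = wh [] ?q (?X2) \<odot> wh [\<theta>'] ?N []"
    by (rule wh_cancel_end) (simp_all add: cell_typing t)
  finally have E: "wh ([?U] @ ?X2) (pdual (epsi \<theta>)) [] \<odot> wh ([?U] @ ?X2 @ [?j]) ?p [] \<odot> wh [] (wh [] (epsi \<theta>') ([?U] @ ?X2 @ [?j, \<theta>]) \<odot> wh [\<theta>'] ?e []) [?ea]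
     = wh [] ?q (?X2) \<odot> wh [\<theta>'] ?N []" .
  show ?R
    using E d m by (simp add: dc dag_term_def t)
qed

section \<open>Properties of the comparison deduced from adjointness\<close>

lemma term_paths:
  assumes "tm X x a b"
  shows "path a (tfl x)" "tgt a (tfl x) = b" "path (f0 d b) (dl (tfl x))" "tgt (f0 d b) (dl (tfl x)) = f0 d a"
    "path (f0 d (f0 d a)) (dl (dl (tfl x)))" "tgt (f0 d (f0 d a)) (dl (dl (tfl x))) = f0 d (f0 d b)"
    "psrcl b (tfl x) = a" "psrcl (f0 d a) (dl (tfl x)) = f0 d b" "psrcl (f0 d (f0 d b)) (dl (dl (tfl x))) = f0 d (f0 d a)"
proof -
  have m: "tok x" "tsrc x = a" "ttrg x = b" using assms by (auto simp: tm_def)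
  show px: "path a (tfl x)" "tgt a (tfl x) = b" using term_simps(4,5)[OF m(1)] m by simp_all
  show pd: "path (f0 d b) (dl (tfl x))" "tgt (f0 d b) (dl (tfl x)) = f0 d a" using path_dl[OF px(1)] px by simp_all
  show pdd: "path (f0 d (f0 d a)) (dl (dl (tfl x)))" "tgt (f0 d (f0 d a)) (dl (dl (tfl x))) = f0 d (f0 d b)"
    using path_dl[OF pd(1)] pd by simp_all
  show "psrcl b (tfl x) = a" "psrcl (f0 d a) (dl (tfl x)) = f0 d b" "psrcl (f0 d (f0 d b)) (dl (dl (tfl x))) = f0 d (f0 d a)"
    by (rule psrcl_path; simp add: px pd pdd)+
qed

lemma obj_adj: "(a, \<theta>, \<Pi>) \<in> S_obj \<Longrightarrow> adj a (f0 d a) \<theta> (inv1 J \<theta>) (iota \<theta>) (epsi \<theta>)"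
  by (rule dual_adj(1))

lemma counit_dag:
  assumes A: "(a, \<theta>, \<Pi>) \<in> S_obj" and A': "(b, \<theta>', \<Pi>') \<in> S_obj" and X: "tm X x a b"
  shows "pty (wh [] (epsi \<theta>) (dl (tfl x) @ [\<theta>'])) b (\<theta> # tfl (dag_term \<theta> x \<theta>')) (dl (tfl x) @ [\<theta>'])"
    "piso (wh [] (epsi \<theta>) (dl (tfl x) @ [\<theta>']))"
proof -
  note t = obj_typing[OF A] obj_typing[OF A'] adj_typing[OF obj_adj[OF A]] term_paths[OF X]
  show p: "pty (wh [] (epsi \<theta>) (dl (tfl x) @ [\<theta>'])) b (\<theta> # tfl (dag_term \<theta> x \<theta>')) (dl (tfl x) @ [\<theta>'])"
    by (simp add: pty_def cell_typing t)
  show "piso (wh [] (epsi \<theta>) (dl (tfl x) @ [\<theta>']))"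
    by (rule piso_wh(1)[OF _ ptyD(1)[OF p]]) (rule t)
qed

text \<open>A 2-morphism into theta^-1 d(X) theta' is determined by its mate into d(X) theta'.
  Together with uniqueness of the adjoint this reduces identities for (S eta) to identities of
  adjoint pairs.\<close>

lemma counit_dag_inject:
  assumes A: "(a, \<theta>, \<Pi>) \<in> S_obj" and A': "(b, \<theta>', \<Pi>') \<in> S_obj" and X: "tm X x a b"
    and \<phi>: "pty \<phi> b ys (tfl (dag_term \<theta> x \<theta>'))" and \<psi>: "pty \<psi> b ys (tfl (dag_term \<theta> x \<theta>'))"
    and e: "wh [] (epsi \<theta>) (dl (tfl x) @ [\<theta>']) \<odot> wh [\<theta>] \<phi> [] = wh [] (epsi \<theta>) (dl (tfl x) @ [\<theta>']) \<odot> wh [\<theta>] \<psi> []"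
  shows "\<phi> = \<psi>"
proof -
  note t = obj_typing[OF A] obj_typing[OF A'] adj_typing[OF obj_adj[OF A]] term_paths[OF X] pty_simps[OF \<phi>] pty_simps[OF \<psi>]
    ptyD(8)[OF \<phi>]
  have y: "tgt b ys = a" using ptyD(8)[OF \<phi>] t(1-8) adj_typing[OF obj_adj[OF A]] by simp
  have w: "pty (wh [\<theta>] \<phi> []) b (\<theta> # ys) (\<theta> # tfl (dag_term \<theta> x \<theta>'))" "pty (wh [\<theta>] \<psi> []) b (\<theta> # ys) (\<theta> # tfl (dag_term \<theta> x \<theta>'))"
    using pty_wh[OF \<phi>, of b "[\<theta>]" "[]"] pty_wh[OF \<psi>, of b "[\<theta>]" "[]"] ptyD(5)[OF \<phi>] y obj_typing(1-4)[OF A] by simp_all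
  note c = counit_dag[OF A A' X]
  have "wh [\<theta>] \<phi> [] = wh [\<theta>] \<psi> []" by (rule pcomp_cancel_left[OF e c(2,1) w])
  then show ?thesis by (intro adj_inject(1)[OF obj_adj[OF A] \<phi> \<psi> y])
qed

text \<open>A zigzag writes the identity of theta as the unit followed by the counit, so the trivial
  pair of \<open>adjoint_pair_unit\<close> can be carried along the unit to a pair whose first
  member is the counit. Uniqueness then compares it with the pair of (S eta).\<close>

lemma S_eta_diag_one:
  assumes A: "(a, \<theta>, \<Pi>) \<in> S_obj"
  shows "S_eta_diag (a, \<theta>, \<Pi>) (On a) (a, \<theta>, \<Pi>) = wh [inv1 J \<theta>] (pdual (iota \<theta>)) [\<theta>] \<odot> iota \<theta>"
proof -
  let ?i = "inv1 J \<theta>" and ?c = "wh [] (epsi \<theta>) [\<theta>]"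
  note X = tm_rules(1)[OF S_objD(1)[OF A]]
  note R = adjoint_pair_S_eta_diag[OF A A X, unfolded tfl.simps dl_simps append_Nil append_Cons]
  note ad = adjD[OF obj_adj[OF A]]
  have i: "pty (pdual (iota \<theta>)) (f0 d a) [] [f1 d \<theta>, f1 d ?i]" using pty_pdual[OF ad(11)] ad by simp
  note t = obj_typing[OF A] adj_typing[OF obj_adj[OF A]] pty_simps[OF i]
  note Xd = dag_term_typing[OF A A X]
  have "adjoint_pair (a, \<theta>, \<Pi>) (a, \<theta>, \<Pi>) (On a) (On a) (?c \<odot> wh [\<theta>] (iota \<theta>) []) (pid a [\<theta>])"
    using adjoint_pair_unit[OF A] ad(13) by simp
  then have R': "adjoint_pair (a, \<theta>, \<Pi>) (a, \<theta>, \<Pi>) (On a) (dag_term \<theta> (On a) \<theta>) ?c (wh [] (pdual (iota \<theta>)) [\<theta>] \<odot> pid a [\<theta>])"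
    by (rule adjoint_pair_precomp[OF A]) (use Xd counit_dag(1)[OF A A X] ad(11) in \<open>simp_all add: tm_def\<close>)
  have 1: "wh [] (pdual (iota \<theta>)) [\<theta>] \<odot> pid a [\<theta>] = wh [] (epsi \<theta>) [f1 d \<theta>, f1 d ?i, \<theta>] \<odot> wh [\<theta>] (S_eta_diag (a, \<theta>, \<Pi>) (On a) (a, \<theta>, \<Pi>)) []"
    by (rule adjoint_pair_unique[OF A R' R(1)]) (use counit_dag(2)[OF A A X] in simp)
  have 2: "wh [] (epsi \<theta>) [f1 d \<theta>, f1 d ?i, \<theta>] \<odot> wh [\<theta>, ?i] (pdual (iota \<theta>)) [\<theta>] = wh [] (pdual (iota \<theta>)) [\<theta>] \<odot> ?c"
    using exchange[OF ad(12) i, of "[]" "[]" "[\<theta>]"] by simp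
  have y: "pty (S_eta_diag (a, \<theta>, \<Pi>) (On a) (a, \<theta>, \<Pi>)) a [] (tfl (dag_term \<theta> (dag_term \<theta> (On a) \<theta>) \<theta>))" using R(3) by simp
  have 3: "wh [] (epsi \<theta>) [f1 d \<theta>, f1 d ?i, \<theta>] \<odot> wh [\<theta>] (wh [?i] (pdual (iota \<theta>)) [\<theta>] \<odot> iota \<theta>) [] = wh [] (pdual (iota \<theta>)) [\<theta>] \<odot> pid a [\<theta>]"
    by (simp only: wh_pcomp wh_wh append_Nil append_Cons pcomp_extend[OF 2] pcomp_assoc ad(13))
  show ?thesis
    by (rule counit_dag_inject[OF A A Xd y], simp add: pty_def cell_typing t)
      (simp only: 1 3 tfl_dag_term tfl.simps dl_simps append_Nil append_Cons)
qed

text \<open>Reading the pair of (S eta)_X in the other direction gives a pair whose first member is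
  the counit for Y = (S d)(X), preceded by (S eta)_X. Moving (S eta)_X across makes its dual part of
  the second member, and uniqueness compares this with the pair belonging to (S eta)_Y.\<close>

lemma S_eta_diag_dual:
  assumes A: "(a, \<theta>, \<Pi>) \<in> S_obj" and A': "(b, \<theta>', \<Pi>') \<in> S_obj" and X: "X \<in> hom B a b"
  shows "wh [inv1 J \<theta>] (pdual (S_eta_diag (a, \<theta>, \<Pi>) (At X) (b, \<theta>', \<Pi>'))) [\<theta>']
    = S_eta_diag (b, \<theta>', \<Pi>') (dag_term \<theta> (At X) \<theta>') (a, \<theta>, \<Pi>)"
proof -
  let ?i = "inv1 J \<theta>" and ?e = "S_eta_diag (a, \<theta>, \<Pi>) (At X) (b, \<theta>', \<Pi>')" and ?x = "dag_term \<theta> (At X) \<theta>'"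
  note tX = tm_rules(4)[OF X]
  note Xd = dag_term_typing[OF A A' tX]
  note Xdd = dag_term_typing[OF A' A Xd]
  note Xddd = dag_term_typing[OF A A' Xdd]
  note R1 = adjoint_pair_S_eta_diag[OF A A' tX] and R2 = adjoint_pair_S_eta_diag[OF A' A Xd]
  note c = counit_dag[OF A A' tX] and cd = counit_dag[OF A' A Xd] and cdd = counit_dag[OF A A' Xdd]
  have e: "pty ?e a (tfl (At X)) (tfl (dag_term \<theta>' ?x \<theta>))" using R1(3) by simp
  have b: "tgt a (tfl (At X)) = b" by (rule term_paths(2)[OF tX])
  have de: "pty (pdual ?e) (f0 d b) [f1 d X] (dl (tfl (dag_term \<theta>' ?x \<theta>)))"
    using pty_pdual[OF e] b by simp
  note ad = adjD[OF obj_adj[OF A]]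
  have "adjoint_pair (b, \<theta>', \<Pi>') (a, \<theta>, \<Pi>) ?x (At X) (wh [] (epsi \<theta>') (dl (tfl ?x) @ [\<theta>]) \<odot> wh [\<theta>'] ?e []) (wh [] (epsi \<theta>) (dl (tfl (At X)) @ [\<theta>']))"
    using adjoint_pair_sym[OF A A' X R1(1) c(2)] by simp
  then have R3: "adjoint_pair (b, \<theta>', \<Pi>') (a, \<theta>, \<Pi>) ?x (dag_term \<theta>' ?x \<theta>) (wh [] (epsi \<theta>') (dl (tfl ?x) @ [\<theta>]))
     (wh [] (pdual ?e) [\<theta>'] \<odot> wh [] (epsi \<theta>) (dl (tfl (At X)) @ [\<theta>']))"
    by (rule adjoint_pair_precomp[OF A']) (use Xdd cd(1) e in \<open>simp_all add: tm_def\<close>)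
  have 1: "wh [] (pdual ?e) [\<theta>'] \<odot> wh [] (epsi \<theta>) (dl (tfl (At X)) @ [\<theta>'])
    = wh [] (epsi \<theta>) (dl (tfl (dag_term \<theta>' ?x \<theta>)) @ [\<theta>']) \<odot> wh [\<theta>] (S_eta_diag (b, \<theta>', \<Pi>') ?x (a, \<theta>, \<Pi>)) []"
    using adjoint_pair_unique[OF A' R3 R2(1) cd(2)] by simp
  have 2: "wh [] (epsi \<theta>) (dl (tfl (dag_term \<theta>' ?x \<theta>)) @ [\<theta>']) \<odot> wh [\<theta>, ?i] (pdual ?e) [\<theta>']
    = wh [] (pdual ?e) [\<theta>'] \<odot> wh [] (epsi \<theta>) (dl (tfl (At X)) @ [\<theta>'])"
    using exchange[OF ad(12) de, of "[]" "[]" "[\<theta>']"] by simp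
  have y: "pty (wh [?i] (pdual ?e) [\<theta>']) b (tfl ?x) (tfl (dag_term \<theta> (dag_term \<theta>' ?x \<theta>) \<theta>'))"
    using pty_wh[OF de, of b "[?i]" "[\<theta>']"] term_paths(1)[OF Xd] obj_typing(1-8)[OF A'] by simp
  show ?thesis
    by (rule counit_dag_inject[OF A A' Xdd y]) (use R2(3) in simp, unfold 1[symmetric] 2[symmetric], simp)
qed

text \<open>Here the 1-morphism \<open>x\<close> itself varies, which
  \<open>adjoint_pair_precomp\<close> does not cover. Both sides are therefore inserted into the
  adjointness equation of \<open>y\<close>, where they become equal by the equations of
  \<open>x\<close> and \<open>y\<close> and naturality of eta, and
  \<open>form_whisker_inject\<close> removes the rest.\<close>

lemma S_eta_diag_natural:
  assumes A: "(a, \<theta>, \<Pi>) \<in> S_obj" and A': "(b, \<theta>', \<Pi>') \<in> S_obj" and X: "tm X x a b" and Y: "tm Y y a b" and f: "rty x f y"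
  shows "S_eta_diag (a, \<theta>, \<Pi>) y (b, \<theta>', \<Pi>') \<odot> rep x f y
    = wh [inv1 J \<theta>'] (pdual (wh [inv1 J \<theta>] (pdual (rep x f y)) [\<theta>'])) [\<theta>] \<odot> S_eta_diag (a, \<theta>, \<Pi>) x (b, \<theta>', \<Pi>')"
proof -
  let ?i = "inv1 J \<theta>" and ?i' = "inv1 J \<theta>'" and ?\<phi> = "rep x f y" and ?p = "form a \<theta> \<Pi>" and ?q = "form b \<theta>' \<Pi>'"
  let ?ex = "S_eta_diag (a, \<theta>, \<Pi>) x (b, \<theta>', \<Pi>')" and ?ey = "S_eta_diag (a, \<theta>, \<Pi>) y (b, \<theta>', \<Pi>')"
  let ?f = "wh [?i] (pdual ?\<phi>) [\<theta>']" and ?dx = "dl (tfl x)" and ?dy = "dl (tfl y)"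
  let ?cx = "wh [] (epsi \<theta>) (?dx @ [\<theta>'])" and ?cy = "wh [] (epsi \<theta>) (?dy @ [\<theta>'])"
  let ?gx = "wh [] (epsi \<theta>') (f1 d \<theta>' # dl ?dx @ [f1 d ?i, \<theta>])" and ?gy = "wh [] (epsi \<theta>') (f1 d \<theta>' # dl ?dy @ [f1 d ?i, \<theta>])"
  have m: "tsrc x = a" "ttrg x = b" using X by (auto simp: tm_def)
  note Xd = dag_term_typing[OF A A' X] and Yd = dag_term_typing[OF A A' Y]
  note Rx = adjoint_pair_S_eta_diag[OF A A' X] and Ry = adjoint_pair_S_eta_diag[OF A A' Y]
  have \<phi>: "pty ?\<phi> a (tfl x) (tfl y)" using pty_rep[OF f] m by simp
  have d\<phi>: "pty (pdual ?\<phi>) (f0 d b) ?dx ?dy" using pty_pdual[OF \<phi>] term_paths[OF X] by simp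
  have dd\<phi>: "pty (pdual (pdual ?\<phi>)) (f0 d (f0 d a)) (dl ?dx) (dl ?dy)" using pty_pdual[OF d\<phi>] term_paths[OF X] by simp
  note ad = adjD[OF obj_adj[OF A]] and ad' = adjD[OF obj_adj[OF A']]
  note t = obj_typing[OF A] obj_typing[OF A'] adj_typing[OF obj_adj[OF A]] adj_typing[OF obj_adj[OF A']] term_paths[OF X] term_paths[OF Y]
    pty_simps[OF \<phi>] pty_simps[OF d\<phi>] pty_simps[OF dd\<phi>] pty_simps[OF Rx(3)] pty_simps[OF Ry(3)]
    pty_simps[OF rp_eta(3)[OF X]] pty_simps[OF rp_eta(3)[OF Y]]
  have fy: "pty ?f b (tfl (dag_term \<theta> x \<theta>')) (tfl (dag_term \<theta> y \<theta>'))" by (simp add: pty_def cell_typing t)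
  have df: "pty (pdual ?f) (f0 d a) (dl (tfl (dag_term \<theta> x \<theta>'))) (dl (tfl (dag_term \<theta> y \<theta>')))"
    using pty_pdual[OF fy] term_paths(1,2)[OF Xd] by simp
  note t = t pty_simps[OF fy] pty_simps[OF df]
  have 1: "?gy \<odot> wh [\<theta>', ?i'] (pdual ?f) [\<theta>] = wh [] (pdual ?f) [\<theta>] \<odot> ?gx"
    using exchange[OF ad'(12) df, of "[]" "[]" "[\<theta>]"] by simp
  have 2: "?cy \<odot> wh [\<theta>] ?f [] = wh [] (pdual ?\<phi>) [\<theta>'] \<odot> ?cx"
    using exchange[OF ad(12) d\<phi>, of "[]" "[]" "[\<theta>']"] by simp
  \<comment> \<open>The dual of the preceding exchange; it lets the dual of (S d)(f) be absorbed by
    the dual of the counit.\<close>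
  have dc: "pdual ?cy \<odot> wh [] (pdual ?f) [f1 d \<theta>] = wh [f1 d \<theta>'] (pdual (pdual ?\<phi>)) [] \<odot> pdual ?cx"
  proof -
    have p: "parr (?cy \<odot> wh [\<theta>] ?f [])" "parr (wh [\<theta>] ?f [])" "parr (wh [] (pdual ?\<phi>) [\<theta>'] \<odot> ?cx)" "parr (wh [] (pdual ?\<phi>) [\<theta>'])"
      by (simp_all add: cell_typing t)
    show ?thesis using arg_cong[OF 2, of pdual] pdual_pcomp[OF p(1)] pdual_wh[OF p(2)] pdual_pcomp[OF p(3)] pdual_wh[OF p(4)] by simp
  qed
  have Ex: "pdual ?cx \<odot> wh (f1 d \<theta>' # dl ?dx @ [f1 d ?i]) ?p [] \<odot> wh [] (?gx \<odot> wh [\<theta>'] ?ex []) [t1 \<eta> a] = wh [] ?q (dl ?dx) \<odot> wh [\<theta>'] (eta_diag x) []"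
    using Rx(1) by simp
  have Ey: "pdual ?cy \<odot> wh (f1 d \<theta>' # dl ?dy @ [f1 d ?i]) ?p [] \<odot> wh [] (?gy \<odot> wh [\<theta>'] ?ey []) [t1 \<eta> a] = wh [] ?q (dl ?dy) \<odot> wh [\<theta>'] (eta_diag y) []"
    using Ry(1) by simp
  have 3: "wh (f1 d \<theta>' # dl ?dy @ [f1 d ?i]) ?p [] \<odot> wh [] (pdual ?f) [\<theta>, t1 \<eta> a] = wh [] (pdual ?f) [f1 d \<theta>] \<odot> wh (f1 d \<theta>' # dl ?dx @ [f1 d ?i]) ?p []"
    using exchange[OF df t(23), of "[]" "[]" "[]"] by simp
  have n: "wh [\<theta>'] (eta_diag y) [] \<odot> wh [\<theta>'] ?\<phi> [t1 \<eta> a] = wh [\<theta>', t1 \<eta> b] (pdual (pdual ?\<phi>)) [] \<odot> wh [\<theta>'] (eta_diag x) []"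
    using arg_cong[OF eta_diag_natural[OF f m], of "\<lambda>\<phi>. wh [\<theta>'] \<phi> []"] by (simp add: wh_pcomp)
  have 4: "wh [] ?q (dl ?dy) \<odot> wh [\<theta>', t1 \<eta> b] (pdual (pdual ?\<phi>)) [] = wh [f1 d \<theta>'] (pdual (pdual ?\<phi>)) [] \<odot> wh [] ?q (dl ?dx)"
    using exchange[OF obj_typing(23)[OF A'] dd\<phi>, of "[]" "[]" "[]"] by simp
  have L: "pdual ?cy \<odot> wh (f1 d \<theta>' # dl ?dy @ [f1 d ?i]) ?p [] \<odot> wh [] (?gy \<odot> wh [\<theta>'] (?ey \<odot> ?\<phi>) []) [t1 \<eta> a]
    = wh [f1 d \<theta>'] (pdual (pdual ?\<phi>)) [] \<odot> wh [] ?q (dl ?dx) \<odot> wh [\<theta>'] (eta_diag x) []"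
  proof -
    have "pdual ?cy \<odot> wh (f1 d \<theta>' # dl ?dy @ [f1 d ?i]) ?p [] \<odot> wh [] (?gy \<odot> wh [\<theta>'] (?ey \<odot> ?\<phi>) []) [t1 \<eta> a]
      = (pdual ?cy \<odot> wh (f1 d \<theta>' # dl ?dy @ [f1 d ?i]) ?p [] \<odot> wh [] (?gy \<odot> wh [\<theta>'] ?ey []) [t1 \<eta> a]) \<odot> wh [\<theta>'] ?\<phi> [t1 \<eta> a]"
      by (simp add: wh_pcomp)
    also have "\<dots> = wh [f1 d \<theta>'] (pdual (pdual ?\<phi>)) [] \<odot> wh [] ?q (dl ?dx) \<odot> wh [\<theta>'] (eta_diag x) []"
      unfolding Ey by (simp add: n pcomp_extend[OF 4])
    finally show ?thesis .
  qed
  have "pdual ?cy \<odot> wh (f1 d \<theta>' # dl ?dy @ [f1 d ?i]) ?p [] \<odot> wh [] (?gy \<odot> wh [\<theta>'] (wh [?i'] (pdual ?f) [\<theta>] \<odot> ?ex) []) [t1 \<eta> a]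
    = pdual ?cy \<odot> (wh (f1 d \<theta>' # dl ?dy @ [f1 d ?i]) ?p [] \<odot> wh [] (pdual ?f) [\<theta>, t1 \<eta> a]) \<odot> wh [] (?gx \<odot> wh [\<theta>'] ?ex []) [t1 \<eta> a]"
    using arg_cong[OF pcomp_extend[OF 1, of "wh [\<theta>'] ?ex []"], of "\<lambda>\<phi>. wh [] \<phi> [t1 \<eta> a]"] by (simp add: wh_pcomp)
  also have "\<dots> = (pdual ?cy \<odot> wh [] (pdual ?f) [f1 d \<theta>]) \<odot> wh (f1 d \<theta>' # dl ?dx @ [f1 d ?i]) ?p [] \<odot> wh [] (?gx \<odot> wh [\<theta>'] ?ex []) [t1 \<eta> a]"
    unfolding 3 by simp
  also have "\<dots> = wh [f1 d \<theta>'] (pdual (pdual ?\<phi>)) [] \<odot> wh [] ?q (dl ?dx) \<odot> wh [\<theta>'] (eta_diag x) []"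
    unfolding dc pcomp_assoc Ex ..
  finally have R: "pdual ?cy \<odot> wh (f1 d \<theta>' # dl ?dy @ [f1 d ?i]) ?p [] \<odot> wh [] (?gy \<odot> wh [\<theta>'] (wh [?i'] (pdual ?f) [\<theta>] \<odot> ?ex) []) [t1 \<eta> a]
    = wh [f1 d \<theta>'] (pdual (pdual ?\<phi>)) [] \<odot> wh [] ?q (dl ?dx) \<odot> wh [\<theta>'] (eta_diag x) []" .
  have y1: "pty (?ey \<odot> ?\<phi>) a (tfl x) (tfl (dag_term \<theta>' (dag_term \<theta> y \<theta>') \<theta>))"
    "pty (wh [?i'] (pdual ?f) [\<theta>] \<odot> ?ex) a (tfl x) (tfl (dag_term \<theta>' (dag_term \<theta> y \<theta>') \<theta>))"
    by (simp_all add: pty_def cell_typing t)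
  have y2: "pty (?gy \<odot> wh [\<theta>'] (?ey \<odot> ?\<phi>) []) a (\<theta>' # tfl x) (dl (tfl (dag_term \<theta> y \<theta>')) @ [\<theta>])"
    "pty (?gy \<odot> wh [\<theta>'] (wh [?i'] (pdual ?f) [\<theta>] \<odot> ?ex) []) a (\<theta>' # tfl x) (dl (tfl (dag_term \<theta> y \<theta>')) @ [\<theta>])"
    by (simp_all add: pty_def cell_typing t)
  have E: "?gy \<odot> wh [\<theta>'] (?ey \<odot> ?\<phi>) [] = ?gy \<odot> wh [\<theta>'] (wh [?i'] (pdual ?f) [\<theta>] \<odot> ?ex) []"
    by (rule form_whisker_inject[OF A counit_dag[OF A A' Y] term_paths(1,2)[OF Yd] y2]) (use L R in simp)
  show ?thesis
    by (rule counit_dag_inject[OF A' A Yd y1]) (use E in simp)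
qed

text \<open>The pairs of \<open>x\<close> and \<open>y\<close> compose to a pair whose first member
  is the counit for the composite preceded by \<open>?F\<close>, the contraction of theta' with its
  inverse. Moving \<open>?F\<close> across produces its dual. The two contractions of theta' on the
  right are the coherence cells of the double dual: one for (S d) applied to a coherence cell, one
  for (S d) at the duals.\<close>

lemma S_eta_diag_comp:
  assumes A: "(a, \<theta>, \<Pi>) \<in> S_obj" and A': "(b, \<theta>', \<Pi>') \<in> S_obj" and A'': "(c, \<theta>'', \<Pi>'') \<in> S_obj"
    and X: "tm X x a b" and Y: "tm Y y b c"
  shows "S_eta_diag (a, \<theta>, \<Pi>) (y \<diamondop> x) (c, \<theta>'', \<Pi>'')
    = wh [inv1 J \<theta>''] (pdual (wh (inv1 J \<theta> # dl (tfl x)) (epsi \<theta>') (dl (tfl y) @ [\<theta>'']))) [\<theta>] \<odot>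
      wh (inv1 J \<theta>'' # dl (tfl (dag_term \<theta>' y \<theta>''))) (epsi \<theta>') (dl (tfl (dag_term \<theta> x \<theta>')) @ [\<theta>]) \<odot>
      wh [] (S_eta_diag (b, \<theta>', \<Pi>') y (c, \<theta>'', \<Pi>'')) (tfl (dag_term \<theta>' (dag_term \<theta> x \<theta>') \<theta>)) \<odot>
      wh (tfl y) (S_eta_diag (a, \<theta>, \<Pi>) x (b, \<theta>', \<Pi>')) []"
proof -
  let ?ex = "S_eta_diag (a, \<theta>, \<Pi>) x (b, \<theta>', \<Pi>')" and ?ey = "S_eta_diag (b, \<theta>', \<Pi>') y (c, \<theta>'', \<Pi>'')" and ?e = "S_eta_diag (a, \<theta>, \<Pi>) (y \<diamondop> x) (c, \<theta>'', \<Pi>'')"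
  let ?x = "tfl x" and ?y = "tfl y" and ?i = "inv1 J \<theta>" and ?i' = "inv1 J \<theta>'" and ?i'' = "inv1 J \<theta>''"
  let ?dx = "dl ?x" and ?dy = "dl ?y" and ?xd = "dag_term \<theta> x \<theta>'" and ?yd = "dag_term \<theta>' y \<theta>''"
  let ?fx = "dl (tfl ?xd)" and ?fy = "dl (tfl ?yd)"
  let ?F = "wh (?i # ?dx) (epsi \<theta>') (?dy @ [\<theta>''])"
  let ?cx = "wh [] (epsi \<theta>) (?dx @ [\<theta>'])" and ?cy = "wh [] (epsi \<theta>') (?dy @ [\<theta>''])" and ?c = "wh [] (epsi \<theta>) (?dx @ ?dy @ [\<theta>''])"
  let ?px = "wh [] (epsi \<theta>') (?fx @ [\<theta>]) \<odot> wh [\<theta>'] ?ex []" and ?py = "wh [] (epsi \<theta>'') (?fy @ [\<theta>']) \<odot> wh [\<theta>''] ?ey []"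
  note YX = tm_rules(2)[OF X Y]
  note Xd = dag_term_typing[OF A A' X] and Yd = dag_term_typing[OF A' A'' Y] and YXd = dag_term_typing[OF A A'' YX]
  note Xdd = dag_term_typing[OF A' A Xd] and Ydd = dag_term_typing[OF A'' A' Yd]
  note Rx = adjoint_pair_S_eta_diag[OF A A' X] and Ry = adjoint_pair_S_eta_diag[OF A' A'' Y] and R = adjoint_pair_S_eta_diag[OF A A'' YX]
  note ad = adjD[OF obj_adj[OF A]] and ad' = adjD[OF obj_adj[OF A']] and ad'' = adjD[OF obj_adj[OF A'']]
  note t = obj_typing[OF A] obj_typing[OF A'] obj_typing[OF A''] adj_typing[OF obj_adj[OF A]] adj_typing[OF obj_adj[OF A']] adj_typing[OF obj_adj[OF A'']]
    term_paths[OF X] term_paths[OF Y] pty_simps[OF Rx(3)] pty_simps[OF Ry(3)] pty_simps[OF R(3)]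
  have Fy: "pty ?F c (tfl (?xd \<diamondop> ?yd)) (tfl (dag_term \<theta> (y \<diamondop> x) \<theta>''))" by (simp add: pty_def cell_typing t)
  have dF: "pty (pdual ?F) (f0 d a) (?fy @ ?fx) (dl (tfl (dag_term \<theta> (y \<diamondop> x) \<theta>'')))"
    using pty_pdual[OF Fy] term_paths(2)[OF tm_rules(2)[OF Yd Xd]] by simp
  note t = t pty_simps[OF Fy] pty_simps[OF dF]
  \<comment> \<open>The counits of theta and of theta' act on disjoint factors; exchanging them
    isolates \<open>?F\<close> behind the counit for the composite.\<close>
  have 1: "wh ?dx ?cy [] \<odot> wh [] ?cx (tfl ?yd) = ?c \<odot> wh [\<theta>] ?F []"
    using exchange[OF ad(12) ad'(12), of "[]" "?dx" "?dy @ [\<theta>'']"] by simp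
  have "adjoint_pair (a, \<theta>, \<Pi>) (c, \<theta>'', \<Pi>'') (y \<diamondop> x) (?xd \<diamondop> ?yd) (wh ?dx ?cy [] \<odot> wh [] ?cx (tfl ?yd)) (wh ?fy ?px [] \<odot> wh [] ?py ?x)"
    by (rule adjoint_pair_comp[OF A A' A'']) (use Rx(1) Ry(1) in simp_all)
  then have "adjoint_pair (a, \<theta>, \<Pi>) (c, \<theta>'', \<Pi>'') (y \<diamondop> x) (?xd \<diamondop> ?yd) (?c \<odot> wh [\<theta>] ?F []) (wh ?fy ?px [] \<odot> wh [] ?py ?x)"
    unfolding 1 .
  then have R': "adjoint_pair (a, \<theta>, \<Pi>) (c, \<theta>'', \<Pi>'') (y \<diamondop> x) (dag_term \<theta> (y \<diamondop> x) \<theta>'') ?c (wh [] (pdual ?F) [\<theta>] \<odot> wh ?fy ?px [] \<odot> wh [] ?py ?x)"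
    by (rule adjoint_pair_precomp[OF A]) (use YXd counit_dag(1)[OF A A'' YX] Fy in \<open>simp_all add: tm_def\<close>)
  have R'': "adjoint_pair (a, \<theta>, \<Pi>) (c, \<theta>'', \<Pi>'') (y \<diamondop> x) (dag_term \<theta> (y \<diamondop> x) \<theta>'') ?c
      (wh [] (epsi \<theta>'') (dl (tfl (dag_term \<theta> (y \<diamondop> x) \<theta>'')) @ [\<theta>]) \<odot> wh [\<theta>''] ?e [])"
    using R(1) by (simp del: adjoint_pair.simps)
  have 2: "wh [] (pdual ?F) [\<theta>] \<odot> wh ?fy ?px [] \<odot> wh [] ?py ?x = wh [] (epsi \<theta>'') (dl (tfl (dag_term \<theta> (y \<diamondop> x) \<theta>'')) @ [\<theta>]) \<odot> wh [\<theta>''] ?e []"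
    by (rule adjoint_pair_unique[OF A R' R'']) (use counit_dag(2)[OF A A'' YX] in simp)
  have 3: "wh [] (epsi \<theta>'') (dl (tfl (dag_term \<theta> (y \<diamondop> x) \<theta>'')) @ [\<theta>]) \<odot> wh [\<theta>'', ?i''] (pdual ?F) [\<theta>] = wh [] (pdual ?F) [\<theta>] \<odot> wh [] (epsi \<theta>'') (?fy @ ?fx @ [\<theta>])"
    using exchange[OF ad''(12) dF, of "[]" "[]" "[\<theta>]"] by simp
  have 4: "wh [] (epsi \<theta>'') (?fy @ ?fx @ [\<theta>]) \<odot> wh (\<theta>'' # ?i'' # ?fy) (epsi \<theta>') (?fx @ [\<theta>]) = wh ?fy (epsi \<theta>') (?fx @ [\<theta>]) \<odot> wh [] (epsi \<theta>'') (?fy @ [\<theta>', ?i'] @ ?fx @ [\<theta>])"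
    using exchange[OF ad''(12) ad'(12), of "[]" "?fy" "?fx @ [\<theta>]"] by simp
  have yy: "pty ?py b (\<theta>'' # ?y) (?fy @ [\<theta>'])" using Ry(1) by simp
  have 5: "wh [] ?py (tfl (dag_term \<theta>' ?xd \<theta>)) \<odot> wh (\<theta>'' # ?y) ?ex [] = wh (?fy @ [\<theta>']) ?ex [] \<odot> wh [] ?py ?x"
    using exchange[OF yy Rx(3), of "[]" "[]" "[]"] by simp
  let ?rhs = "wh [?i''] (pdual ?F) [\<theta>] \<odot> wh (?i'' # ?fy) (epsi \<theta>') (?fx @ [\<theta>]) \<odot> wh [] ?ey (tfl (dag_term \<theta>' ?xd \<theta>)) \<odot> wh ?y ?ex []"
  have 6: "wh [] (epsi \<theta>'') (dl (tfl (dag_term \<theta> (y \<diamondop> x) \<theta>'')) @ [\<theta>]) \<odot> wh [\<theta>''] ?rhs [] = wh [] (pdual ?F) [\<theta>] \<odot> wh ?fy ?px [] \<odot> wh [] ?py ?x"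
  proof -
    have "wh [] (epsi \<theta>'') (dl (tfl (dag_term \<theta> (y \<diamondop> x) \<theta>'')) @ [\<theta>]) \<odot> wh [\<theta>''] ?rhs []
      = wh [] (epsi \<theta>'') (dl (tfl (dag_term \<theta> (y \<diamondop> x) \<theta>'')) @ [\<theta>]) \<odot> wh [\<theta>'', ?i''] (pdual ?F) [\<theta>] \<odot> wh (\<theta>'' # ?i'' # ?fy) (epsi \<theta>') (?fx @ [\<theta>])
        \<odot> wh [\<theta>''] ?ey (tfl (dag_term \<theta>' ?xd \<theta>)) \<odot> wh (\<theta>'' # ?y) ?ex []"
      by (simp only: wh_pcomp wh_wh append_Nil append_Cons append_Nil2)
    also have "\<dots> = wh [] (pdual ?F) [\<theta>] \<odot> wh ?fy (epsi \<theta>') (?fx @ [\<theta>]) \<odot> (wh [] (epsi \<theta>'') (?fy @ [\<theta>', ?i'] @ ?fx @ [\<theta>])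
        \<odot> wh [\<theta>''] ?ey (tfl (dag_term \<theta>' ?xd \<theta>))) \<odot> wh (\<theta>'' # ?y) ?ex []"
      by (simp only: pcomp_extend[OF 3] pcomp_extend[OF 4] pcomp_assoc)
    also have "wh [] (epsi \<theta>'') (?fy @ [\<theta>', ?i'] @ ?fx @ [\<theta>]) \<odot> wh [\<theta>''] ?ey (tfl (dag_term \<theta>' ?xd \<theta>)) = wh [] ?py (tfl (dag_term \<theta>' ?xd \<theta>))"
      by (simp add: wh_pcomp)
    also have "wh [] (pdual ?F) [\<theta>] \<odot> wh ?fy (epsi \<theta>') (?fx @ [\<theta>]) \<odot> wh [] ?py (tfl (dag_term \<theta>' ?xd \<theta>)) \<odot> wh (\<theta>'' # ?y) ?ex []
      = wh [] (pdual ?F) [\<theta>] \<odot> wh ?fy ?px [] \<odot> wh [] ?py ?x"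
      unfolding 5 by (simp add: wh_pcomp)
    finally show ?thesis .
  qed
  have y1: "pty ?e a (tfl (y \<diamondop> x)) (tfl (dag_term \<theta>'' (dag_term \<theta> (y \<diamondop> x) \<theta>'') \<theta>))" using R(3) by simp
  have y2: "pty ?rhs a (tfl (y \<diamondop> x)) (tfl (dag_term \<theta>'' (dag_term \<theta> (y \<diamondop> x) \<theta>'') \<theta>))"
    by (simp add: pty_def cell_typing t)
  show ?thesis
    by (rule counit_dag_inject[OF A'' A YXd y1 y2]) (simp only: 6 2)
qed

section \<open>The coherence cells of (S d) as diagrams\<close>

lemma rp_S_fcomp:
  assumes A: "(a, \<theta>, \<Pi>) \<in> S_obj" and A': "(b, \<theta>', \<Pi>') \<in> S_obj" and A'': "(c, \<theta>'', \<Pi>'') \<in> S_obj"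
    and X: "tm X x a b" and Y: "tm Y y b c"
  shows "rp c a (dag_term \<theta> x \<theta>' \<diamondop> dag_term \<theta>' y \<theta>'') (S_fcomp \<theta> \<theta>' \<theta>'' Y X) (dag_term \<theta> (y \<diamondop> x) \<theta>'')
    [wh (inv1 J \<theta> # dl (tfl x)) (epsi \<theta>') (dl (tfl y) @ [\<theta>''])]"
proof -
  note homs = dual_inv_homs(1)[OF A] dual_inv_homs(1)[OF A'] dual_inv_homs(1)[OF A''] S_objD(1,2)[OF A] S_objD(1,2)[OF A'] S_objD(1,2)[OF A'']
  show ?thesis
    unfolding S_fcomp_def Let_def dag_term_def
    by (rule rp_cong, (rule rp_unit_counit[OF S_objD(3)[OF A'] obj_tms(1)[OF A'] simple_terms(1)[OF A']] X Y rp_rules tm_rules homs)+) simp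
qed

lemma rp_S_funit:
  assumes A: "(a, \<theta>, \<Pi>) \<in> S_obj"
  shows "rp a a (On a) (S_funit a \<theta>) (dag_term \<theta> (On a) \<theta>) [iota \<theta>]"
proof -
  note homs = dual_inv_homs(1)[OF A] S_objD(1,2)[OF A]
  show ?thesis
    unfolding S_funit_def dag_term_def
    by (rule rp_cong, (rule rp_unit_counit[OF S_objD(3)[OF A] obj_tms(1)[OF A] simple_terms(1)[OF A]] rp_rules tm_rules homs)+) simp
qed

section \<open>The strictification\<close>

abbreviation (input) "mid X \<equiv> fst (snd X)"

abbreviation (input) "dst X \<equiv> snd (snd X)"

text \<open>Written with projections instead of patterns, so that these equations rewrite also when
  the triples are not displayed.\<close>

lemma S_proj:
  "obj S_bicat = S_obj"
  "X \<in> mor S_bicat \<longleftrightarrow> fst X \<in> S_obj \<and> dst X \<in> S_obj \<and> mid X \<in> hom B (fst (fst X)) (fst (dst X))"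
  "src S_bicat X = fst X" "trg S_bicat X = dst X" "one S_bicat A = (A, \<one> (fst A), A)"
  "comp1 S_bicat Y X = (fst X, mid Y \<cdot> mid X, dst Y)"
  "f \<in> cell S_bicat \<longleftrightarrow> fst f \<in> S_obj \<and> dst f \<in> S_obj \<and> mid f \<in> cell B \<and> dom2 B (mid f) \<in> hom B (fst (fst f)) (fst (dst f))"
  "dom2 S_bicat f = (fst f, dom2 B (mid f), dst f)" "cod2 S_bicat f = (fst f, cod2 B (mid f), dst f)"
  "id2 S_bicat X = (fst X, id2 B (mid X), dst X)"
  "vcomp S_bicat g f = (fst g, mid g \<bullet> mid f, dst g)" "hcomp S_bicat g f = (fst f, mid g \<star> mid f, dst g)"
  "assoc S_bicat Z Y X = (fst X, \<a> (mid Z) (mid Y) (mid X), dst Z)"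
  "lunit S_bicat X = (fst X, \<l> (mid X), dst X)" "runit S_bicat X = (fst X, \<r> (mid X), dst X)"
  by (simp_all add: S_bicat_def case_prod_unfold)

lemma smor_eq_iff:
  fixes X :: "('o, 'm, 'c) sobj \<times> 't \<times> ('o, 'm, 'c) sobj"
  shows "X = Y \<longleftrightarrow> fst X = fst Y \<and> mid X = mid Y \<and> dst X = dst Y"
  by (cases X; cases Y) auto

lemma S_obj_obj [simp]: "A \<in> S_obj \<Longrightarrow> fst A \<in> obj B"
  by (cases A) (auto dest: S_objD(1))

lemma inverse_cells_S:
  assumes "F \<in> cell S_bicat" "inverse_cells B (mid F) g"
  shows "inverse_cells S_bicat F (fst F, g, dst F)"
  using assms unfolding inverse_cells_def cells_iff by (auto simp: S_proj hom_iff)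

lemma iso2_S: "F \<in> cell S_bicat \<Longrightarrow> iso2 B (mid F) \<Longrightarrow> iso2 S_bicat F"
  using inverse_cells_S unfolding iso2_def by blast

text \<open>Morphisms and cells are those of \<open>B\<close> tagged with their end objects, so each
  axiom is the corresponding one of \<open>B\<close> on the middle component.\<close>

lemma bicategory_S: "bicategory S_bicat"
proof
  show "X \<in> mor S_bicat \<Longrightarrow> src S_bicat X \<in> obj S_bicat" "X \<in> mor S_bicat \<Longrightarrow> trg S_bicat X \<in> obj S_bicat" for X
    by (auto simp: S_proj)
  show "a \<in> obj S_bicat \<Longrightarrow> one S_bicat a \<in> hom S_bicat a a" for a
    by (auto simp: S_proj hom_iff)
  show "X \<in> hom S_bicat a b \<Longrightarrow> Y \<in> hom S_bicat b c \<Longrightarrow> comp1 S_bicat Y X \<in> hom S_bicat a c" for X Y a b c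
    by (auto simp: S_proj hom_iff)
  show "f \<in> cell S_bicat \<Longrightarrow> dom2 S_bicat f \<in> mor S_bicat" for f
    by (auto simp: S_proj hom_iff)
  show "f \<in> cell S_bicat \<Longrightarrow> cod2 S_bicat f \<in> hom S_bicat (src S_bicat (dom2 S_bicat f)) (trg S_bicat (dom2 S_bicat f))" for f
    by (auto simp: S_proj hom_iff)
  show "X \<in> mor S_bicat \<Longrightarrow> id2 S_bicat X \<in> cells S_bicat X X" for X
    by (auto simp: S_proj hom_iff cells_iff smor_eq_iff)
  show "f \<in> cells S_bicat X Y \<Longrightarrow> g \<in> cells S_bicat Y Z \<Longrightarrow> vcomp S_bicat g f \<in> cells S_bicat X Z" for f g X Y Z
    by (auto simp: S_proj hom_iff cells_iff smor_eq_iff)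
  show "f \<in> cells S_bicat W X \<Longrightarrow> g \<in> cells S_bicat X Y \<Longrightarrow> h \<in> cells S_bicat Y Z \<Longrightarrow>
    vcomp S_bicat (vcomp S_bicat h g) f = vcomp S_bicat h (vcomp S_bicat g f)" for f g h W X Y Z
    by (auto simp: S_proj hom_iff cells_iff smor_eq_iff)
  show "f \<in> cells S_bicat X Y \<Longrightarrow> vcomp S_bicat (id2 S_bicat Y) f = f" "f \<in> cells S_bicat X Y \<Longrightarrow> vcomp S_bicat f (id2 S_bicat X) = f" for f X Y
    by (auto simp: S_proj hom_iff cells_iff smor_eq_iff)
  show "f \<in> cells S_bicat X X' \<Longrightarrow> g \<in> cells S_bicat Y Y' \<Longrightarrow> X \<in> hom S_bicat a b \<Longrightarrow> Y \<in> hom S_bicat b c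
    \<Longrightarrow> hcomp S_bicat g f \<in> cells S_bicat (comp1 S_bicat Y X) (comp1 S_bicat Y' X')" for f g X X' Y Y' a b c
    by (auto simp: S_proj hom_iff cells_iff smor_eq_iff)
  show "X \<in> hom S_bicat a b \<Longrightarrow> Y \<in> hom S_bicat b c \<Longrightarrow> hcomp S_bicat (id2 S_bicat Y) (id2 S_bicat X) = id2 S_bicat (comp1 S_bicat Y X)" for X Y a b c
    by (auto simp: S_proj hom_iff smor_eq_iff)
  show "f \<in> cells S_bicat X X' \<Longrightarrow> f' \<in> cells S_bicat X' X'' \<Longrightarrow> g \<in> cells S_bicat Y Y' \<Longrightarrow> g' \<in> cells S_bicat Y' Y'' \<Longrightarrow>
        X \<in> hom S_bicat a b \<Longrightarrow> Y \<in> hom S_bicat b c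
        \<Longrightarrow> hcomp S_bicat (vcomp S_bicat g' g) (vcomp S_bicat f' f) = vcomp S_bicat (hcomp S_bicat g' f') (hcomp S_bicat g f)"
    for f f' g g' X X' X'' Y Y' Y'' a b c
    by (auto simp: S_proj hom_iff cells_iff smor_eq_iff intro!: hcomp_vcomp)
  show "X \<in> hom S_bicat a b \<Longrightarrow> Y \<in> hom S_bicat b c \<Longrightarrow> Z \<in> hom S_bicat c e
        \<Longrightarrow> assoc S_bicat Z Y X \<in> isos S_bicat (comp1 S_bicat (comp1 S_bicat Z Y) X) (comp1 S_bicat Z (comp1 S_bicat Y X))" for X Y Z a b c e
    by (auto simp: S_proj hom_iff isos_iff smor_eq_iff intro!: iso2_S)
  show "X \<in> hom S_bicat a b \<Longrightarrow> lunit S_bicat X \<in> isos S_bicat (comp1 S_bicat (one S_bicat b) X) X"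
    "X \<in> hom S_bicat a b \<Longrightarrow> runit S_bicat X \<in> isos S_bicat (comp1 S_bicat X (one S_bicat a)) X" for X a b
    by (auto simp: S_proj hom_iff isos_iff smor_eq_iff intro!: iso2_S)
  show "f \<in> cells S_bicat X X' \<Longrightarrow> g \<in> cells S_bicat Y Y' \<Longrightarrow> h \<in> cells S_bicat Z Z' \<Longrightarrow>
        X \<in> hom S_bicat a b \<Longrightarrow> Y \<in> hom S_bicat b c \<Longrightarrow> Z \<in> hom S_bicat c e
        \<Longrightarrow> vcomp S_bicat (assoc S_bicat Z' Y' X') (hcomp S_bicat (hcomp S_bicat h g) f)
          = vcomp S_bicat (hcomp S_bicat h (hcomp S_bicat g f)) (assoc S_bicat Z Y X)" for f g h X X' Y Y' Z Z' a b c e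
    by (auto simp: S_proj hom_iff cells_iff smor_eq_iff intro!: assoc_nat)
  show "f \<in> cells S_bicat X X' \<Longrightarrow> X \<in> hom S_bicat a b \<Longrightarrow>
     vcomp S_bicat (lunit S_bicat X') (lwhisker S_bicat (one S_bicat b) f) = vcomp S_bicat f (lunit S_bicat X)"
    "f \<in> cells S_bicat X X' \<Longrightarrow> X \<in> hom S_bicat a b \<Longrightarrow>
     vcomp S_bicat (runit S_bicat X') (rwhisker S_bicat f (one S_bicat a)) = vcomp S_bicat f (runit S_bicat X)" for f X X' a b
    by (auto simp: S_proj hom_iff cells_iff smor_eq_iff intro!: lunit_nat runit_nat)
  show "W \<in> hom S_bicat a b \<Longrightarrow> X \<in> hom S_bicat b c \<Longrightarrow> Y \<in> hom S_bicat c e \<Longrightarrow> Z \<in> hom S_bicat e f \<Longrightarrow>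
     vcomp S_bicat (assoc S_bicat Z Y (comp1 S_bicat X W)) (assoc S_bicat (comp1 S_bicat Z Y) X W)
     = vcomp S_bicat (lwhisker S_bicat Z (assoc S_bicat Y X W)) (vcomp S_bicat (assoc S_bicat Z (comp1 S_bicat Y X) W) (rwhisker S_bicat (assoc S_bicat Z Y X) W))"
    for W X Y Z a b c e f
    by (auto simp: S_proj hom_iff smor_eq_iff intro!: pentagon')
  show "X \<in> hom S_bicat a b \<Longrightarrow> Y \<in> hom S_bicat b c \<Longrightarrow>
    vcomp S_bicat (lwhisker S_bicat Y (lunit S_bicat X)) (assoc S_bicat Y (one S_bicat b) X) = rwhisker S_bicat (runit S_bicat Y) X" for X Y a b c
    by (auto simp: S_proj hom_iff smor_eq_iff intro!: triangle')
qed

interpretation S: bicategory S_bicat by (rule bicategory_S)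

lemma inv2_S:
  assumes "F \<in> cell S_bicat" "iso2 B (mid F)"
  shows "inv2 S_bicat F = (fst F, inv (mid F), dst F)"
  using S.inv2_eq[OF inverse_cells_S[OF assms(1) iso2_inverse[OF assms(2)]]] .

section \<open>The 2-functor (S d)\<close>

lemma S_dual_simps:
  "f0 S_dual A = A"
  "f1 S_dual ((a, \<theta>, \<Pi>), X, (b, \<theta>', \<Pi>')) = ((b, \<theta>', \<Pi>'), inv1 J \<theta> \<cdot> (f1 d X \<cdot> \<theta>'), (a, \<theta>, \<Pi>))"
  "f2 S_dual ((a, \<theta>, \<Pi>), f, (b, \<theta>', \<Pi>')) = ((b, \<theta>', \<Pi>'), inv1 J \<theta> \<rhd> (f2 d f \<lhd> \<theta>'), (a, \<theta>, \<Pi>))"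
  "fcomp S_dual ((b, \<theta>', \<Pi>'), Y, (c, \<theta>'', \<Pi>'')) ((a, \<theta>, \<Pi>), X, Z) = ((c, \<theta>'', \<Pi>''), S_fcomp \<theta> \<theta>' \<theta>'' Y X, (a, \<theta>, \<Pi>))"
  "funit S_dual (a, \<theta>, \<Pi>) = ((a, \<theta>, \<Pi>), S_funit a \<theta>, (a, \<theta>, \<Pi>))"
  by (simp_all add: S_dual_def)

lemma obj_facts:
  assumes "(a, \<theta>, \<Pi>) \<in> S_obj"
  shows "a \<in> obj B" "\<theta> \<in> mor B" "src B \<theta> = a" "trg B \<theta> = f0 d a"
    "inv1 J \<theta> \<in> mor B" "src B (inv1 J \<theta>) = f0 d a" "trg B (inv1 J \<theta>) = a"
  using S_objD(1-3)[OF assms] dual_inv_homs(1)[OF assms] by (auto simp: hom_iff)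

text \<open>Displays the triples of both end objects, as required for unfolding
  \<open>S_dual\<close>, which is defined by patterns on them.\<close>

lemma S_homE:
  assumes "X \<in> hom S_bicat A A'"
  obtains a \<theta> \<Pi> b \<theta>' \<Pi>' Y where "A = (a, \<theta>, \<Pi>)" "A' = (b, \<theta>', \<Pi>')" "X = ((a, \<theta>, \<Pi>), Y, (b, \<theta>', \<Pi>'))"
    "(a, \<theta>, \<Pi>) \<in> S_obj" "(b, \<theta>', \<Pi>') \<in> S_obj" "Y \<in> hom B a b"
proof -
  obtain a \<theta> \<Pi> Y b \<theta>' \<Pi>' where "X = ((a, \<theta>, \<Pi>), Y, (b, \<theta>', \<Pi>'))" by (metis prod.exhaust)
  with assms that show thesis by (auto simp add: hom_iff[of _ S_bicat] S_proj)
qed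

lemma S_cellsE:
  assumes "f \<in> cells S_bicat X X'" "X = ((a, \<theta>, \<Pi>), Y, (b, \<theta>', \<Pi>'))"
  obtains g Y' where "f = ((a, \<theta>, \<Pi>), g, (b, \<theta>', \<Pi>'))" "X' = ((a, \<theta>, \<Pi>), Y', (b, \<theta>', \<Pi>'))" "g \<in> cell B" "dom2 B g = Y" "cod2 B g = Y'"
    "(a, \<theta>, \<Pi>) \<in> S_obj" "(b, \<theta>', \<Pi>') \<in> S_obj" "Y \<in> hom B a b" "Y' \<in> hom B a b"
proof -
  obtain A g A' where f: "f = (A, g, A')" by (metis prod.exhaust)
  have g: "g \<in> cell B" "dom2 B g = Y" "A = (a, \<theta>, \<Pi>)" "A' = (b, \<theta>', \<Pi>')" "X' = (A, cod2 B g, A')" "A \<in> S_obj" "A' \<in> S_obj"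
    "Y \<in> hom B a b"
    using assms unfolding f by (auto simp: cells_iff S_proj)
  show thesis
    by (rule that[of g "cod2 B g"]) (use g f in \<open>simp_all add: hom_iff\<close>)
qed

text \<open>On diagrams the coherence cell is only the counit of theta', which acts on factors that
  neither d(f) nor d(g) touches; three exchanges bring the two lists into agreement.\<close>

lemma S_fcomp_natural:
  assumes A: "(a, \<theta>, \<Pi>) \<in> S_obj" and A': "(b, \<theta>', \<Pi>') \<in> S_obj" and A'': "(c, \<theta>'', \<Pi>'') \<in> S_obj"
    and X: "X \<in> hom B a b" and X': "X' \<in> hom B a b" and Y: "Y \<in> hom B b c" and Y': "Y' \<in> hom B b c"
    and f: "f \<in> cell B" "dom2 B f = X" "cod2 B f = X'" and g: "g \<in> cell B" "dom2 B g = Y" "cod2 B g = Y'"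
  shows "S_fcomp \<theta> \<theta>' \<theta>'' Y' X' \<bullet> ((inv1 J \<theta> \<rhd> (f2 d f \<lhd> \<theta>')) \<star> (inv1 J \<theta>' \<rhd> (f2 d g \<lhd> \<theta>'')))
    = (inv1 J \<theta> \<rhd> (f2 d (g \<star> f) \<lhd> \<theta>'')) \<bullet> S_fcomp \<theta> \<theta>' \<theta>'' Y X"
proof -
  let ?i = "inv1 J \<theta>" and ?i' = "inv1 J \<theta>'" and ?F = "rep (At X) f (At X')" and ?G = "rep (At Y) g (At Y')"
  note ms = X[unfolded hom_iff] X'[unfolded hom_iff] Y[unfolded hom_iff] Y'[unfolded hom_iff]
  note tms = tm_rules(4)[OF X] tm_rules(4)[OF X'] tm_rules(4)[OF Y] tm_rules(4)[OF Y']
  note homs = dual_inv_homs(1)[OF A] dual_inv_homs(1)[OF A'] S_objD(1,2)[OF A] S_objD(1,2)[OF A'] S_objD(1,2)[OF A'']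
  have r: "rty (At X) f (At X')" "rty (At Y) g (At Y')" using ms f g by (auto simp: rty_def)
  have rf: "rp a b (At X) f (At X') [?F]" and rg: "rp b c (At Y) g (At Y') [?G]"
    by (rule rp_atom[OF r(1)] rp_atom[OF r(2)]; use ms in simp)+
  have y: "pty (pdual ?F) (f0 d b) [f1 d X] [f1 d X']" "pty (pdual ?G) (f0 d c) [f1 d Y] [f1 d Y']"
    using pty_pdual[OF pty_rep[OF r(1)]] pty_pdual[OF pty_rep[OF r(2)]] ms by simp_all
  note y0 = pty_rep[OF r(1)] pty_rep[OF r(2)]
  have w: "parr (wh [] ?G [X'])" "parr (wh [Y] ?F [])" using pty_simps[OF y0(1)] pty_simps[OF y0(2)] ms S_objD(1)[OF A] S_objD(1)[OF A'] S_objD(1)[OF A''] by (simp_all add: cell_typing)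
  have L: "rp c a ((At ?i \<diamondop> Du (At X) \<diamondop> At \<theta>') \<diamondop> At ?i' \<diamondop> Du (At Y) \<diamondop> At \<theta>'')
      (S_fcomp \<theta> \<theta>' \<theta>'' Y' X' \<bullet> ((?i \<rhd> (f2 d f \<lhd> \<theta>')) \<star> (?i' \<rhd> (f2 d g \<lhd> \<theta>'')))) (At ?i \<diamondop> Du (At Y' \<diamondop> At X') \<diamondop> At \<theta>'')
    [wh [?i, f1 d X'] (epsi \<theta>') [f1 d Y', \<theta>''], wh [?i] (pdual ?F) [\<theta>', ?i', f1 d Y', \<theta>''], wh [?i, f1 d X, \<theta>', ?i'] (pdual ?G) [\<theta>'']]"
    by (rule rp_cong, (rule rp_S_fcomp[OF A A' A'' tms(2,4), unfolded dag_term_def] rf rg tms rp_rules rp_f2 rp_hcomp tm_rules homs)+) simp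
  have R: "rp c a ((At ?i \<diamondop> Du (At X) \<diamondop> At \<theta>') \<diamondop> At ?i' \<diamondop> Du (At Y) \<diamondop> At \<theta>'')
      ((?i \<rhd> (f2 d (g \<star> f) \<lhd> \<theta>'')) \<bullet> S_fcomp \<theta> \<theta>' \<theta>'' Y X) (At ?i \<diamondop> Du (At Y' \<diamondop> At X') \<diamondop> At \<theta>'')
    [wh [?i, f1 d X'] (pdual ?G) [\<theta>''], wh [?i] (pdual ?F) [f1 d Y, \<theta>''], wh [?i, f1 d X] (epsi \<theta>') [f1 d Y, \<theta>'']]"
    by (rule rp_cong, (rule rp_S_fcomp[OF A A' A'' tms(1,3), unfolded dag_term_def] rf rg tms rp_rules rp_f2 rp_hcomp tm_rules homs)+)
      (simp add: pdual_wh[OF w(1)] pdual_wh[OF w(2)])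
  note e = adjD(12)[OF obj_adj[OF A']]
  have 1: "wh [?i, f1 d X'] (epsi \<theta>') [f1 d Y', \<theta>''] \<odot> wh [?i] (pdual ?F) [\<theta>', ?i', f1 d Y', \<theta>''] = wh [?i] (pdual ?F) [f1 d Y', \<theta>''] \<odot> wh [?i, f1 d X] (epsi \<theta>') [f1 d Y', \<theta>'']"
    using exchange[OF y(1) e, of "[?i]" "[]" "[f1 d Y', \<theta>'']"] by simp
  have 2: "wh [?i, f1 d X] (epsi \<theta>') [f1 d Y', \<theta>''] \<odot> wh [?i, f1 d X, \<theta>', ?i'] (pdual ?G) [\<theta>''] = wh [?i, f1 d X] (pdual ?G) [\<theta>''] \<odot> wh [?i, f1 d X] (epsi \<theta>') [f1 d Y, \<theta>'']"
    using exchange[OF e y(2), of "[?i, f1 d X]" "[]" "[\<theta>'']"] by simp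
  have 3: "wh [?i] (pdual ?F) [f1 d Y', \<theta>''] \<odot> wh [?i, f1 d X] (pdual ?G) [\<theta>''] = wh [?i, f1 d X'] (pdual ?G) [\<theta>''] \<odot> wh [?i] (pdual ?F) [f1 d Y, \<theta>'']"
    using exchange[OF y(1,2), of "[?i]" "[]" "[\<theta>'']"] by simp
  show ?thesis
    by (rule rp_eqI[OF L R], simp only: pl.simps) (simp only: pcomp_extend[OF 1] pcomp_extend[OF 2] pcomp_extend[OF 3] pcomp_assoc)
qed

text \<open>Both sides contract theta' and theta'' with their inverses, in different orders.\<close>

lemma S_fcomp_assoc:
  assumes A: "(a, \<theta>, \<Pi>) \<in> S_obj" and A': "(b, \<theta>', \<Pi>') \<in> S_obj" and A'': "(c, \<theta>'', \<Pi>'') \<in> S_obj" and A3: "(e, \<theta>3, \<Pi>3) \<in> S_obj"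
    and X: "X \<in> hom B a b" and Y: "Y \<in> hom B b c" and Z: "Z \<in> hom B c e"
  shows "(inv1 J \<theta> \<rhd> (f2 d (\<a> Z Y X) \<lhd> \<theta>3)) \<bullet> S_fcomp \<theta> \<theta>' \<theta>3 (Z \<cdot> Y) X \<bullet> ((inv1 J \<theta> \<cdot> f1 d X \<cdot> \<theta>') \<rhd> S_fcomp \<theta>' \<theta>'' \<theta>3 Z Y)
    = S_fcomp \<theta> \<theta>'' \<theta>3 Z (Y \<cdot> X) \<bullet> (S_fcomp \<theta> \<theta>' \<theta>'' Y X \<lhd> (inv1 J \<theta>'' \<cdot> f1 d Z \<cdot> \<theta>3))
     \<bullet> inv (\<a> (inv1 J \<theta> \<cdot> f1 d X \<cdot> \<theta>') (inv1 J \<theta>' \<cdot> f1 d Y \<cdot> \<theta>'') (inv1 J \<theta>'' \<cdot> f1 d Z \<cdot> \<theta>3))"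
proof -
  let ?i = "inv1 J \<theta>" and ?i' = "inv1 J \<theta>'" and ?i'' = "inv1 J \<theta>''"
  note tms = tm_rules(4)[OF X] tm_rules(4)[OF Y] tm_rules(4)[OF Z]
  note homs = dual_inv_homs(1)[OF A] dual_inv_homs(1)[OF A'] dual_inv_homs(1)[OF A''] S_objD(1,2)[OF A] S_objD(1,2)[OF A'] S_objD(1,2)[OF A'']
    S_objD(1,2)[OF A3]
  let ?X = "At ?i \<diamondop> Du (At X) \<diamondop> At \<theta>'" and ?Y = "At ?i' \<diamondop> Du (At Y) \<diamondop> At \<theta>''" and ?Z = "At ?i'' \<diamondop> Du (At Z) \<diamondop> At \<theta>3"
  let ?cod = "At ?i \<diamondop> Du (At Z \<diamondop> At Y \<diamondop> At X) \<diamondop> At \<theta>3"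
  have L: "rp e a (?X \<diamondop> ?Y \<diamondop> ?Z) ((inv1 J \<theta> \<rhd> (f2 d (\<a> Z Y X) \<lhd> \<theta>3)) \<bullet> S_fcomp \<theta> \<theta>' \<theta>3 (Z \<cdot> Y) X \<bullet> ((inv1 J \<theta> \<cdot> f1 d X \<cdot> \<theta>') \<rhd> S_fcomp \<theta>' \<theta>'' \<theta>3 Z Y))
    ?cod [wh [?i, f1 d X] (epsi \<theta>') [f1 d Y, f1 d Z, \<theta>3], wh [?i, f1 d X, \<theta>', ?i', f1 d Y] (epsi \<theta>'') [f1 d Z, \<theta>3]]"
    by (rule rp_cong, (rule rp_S_fcomp[OF A A' A3 tms(1) tm_rules(2)[OF tms(2,3)], unfolded dag_term_def]
       rp_S_fcomp[OF A' A'' A3 tms(2,3), unfolded dag_term_def] tms rp_rules rp_f2 tm_rules homs)+) simp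
  have R: "rp e a (?X \<diamondop> ?Y \<diamondop> ?Z) (S_fcomp \<theta> \<theta>'' \<theta>3 Z (Y \<cdot> X) \<bullet> (S_fcomp \<theta> \<theta>' \<theta>'' Y X \<lhd> (inv1 J \<theta>'' \<cdot> f1 d Z \<cdot> \<theta>3))
     \<bullet> inv (\<a> (inv1 J \<theta> \<cdot> f1 d X \<cdot> \<theta>') (inv1 J \<theta>' \<cdot> f1 d Y \<cdot> \<theta>'') (inv1 J \<theta>'' \<cdot> f1 d Z \<cdot> \<theta>3)))
    ?cod [wh [?i, f1 d X, f1 d Y] (epsi \<theta>'') [f1 d Z, \<theta>3], wh [?i, f1 d X] (epsi \<theta>') [f1 d Y, \<theta>'', ?i'', f1 d Z, \<theta>3]]"
    by (rule rp_cong, (rule rp_S_fcomp[OF A A'' A3 tm_rules(2)[OF tms(1,2)] tms(3), unfolded dag_term_def]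
       rp_S_fcomp[OF A A' A'' tms(1,2), unfolded dag_term_def] tms rp_rules rp_f2 tm_rules homs)+) simp
  have 1: "wh [?i, f1 d X] (epsi \<theta>') [f1 d Y, f1 d Z, \<theta>3] \<odot> wh [?i, f1 d X, \<theta>', ?i', f1 d Y] (epsi \<theta>'') [f1 d Z, \<theta>3]
    = wh [?i, f1 d X, f1 d Y] (epsi \<theta>'') [f1 d Z, \<theta>3] \<odot> wh [?i, f1 d X] (epsi \<theta>') [f1 d Y, \<theta>'', ?i'', f1 d Z, \<theta>3]"
    using exchange[OF adjD(12)[OF obj_adj[OF A']] adjD(12)[OF obj_adj[OF A'']], of "[?i, f1 d X]" "[f1 d Y]" "[f1 d Z, \<theta>3]"] by simp
  show ?thesis
    by (rule rp_eqI[OF L R], simp only: pl.simps) (simp only: pcomp_extend[OF 1] pcomp_assoc)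
qed

text \<open>Since \<open>d\<close> is contravariant, the left unitor of X involves the unit at the
  target and yields a right unitor, through one zigzag of theta'; the right unitor uses the other
  zigzag, for theta.\<close>

lemma S_fcomp_unit:
  assumes A: "(a, \<theta>, \<Pi>) \<in> S_obj" and A': "(b, \<theta>', \<Pi>') \<in> S_obj" and X: "X \<in> hom B a b"
  shows "(inv1 J \<theta> \<rhd> (f2 d (\<l> X) \<lhd> \<theta>')) \<bullet> S_fcomp \<theta> \<theta>' \<theta>' (\<one> b) X \<bullet> ((inv1 J \<theta> \<cdot> f1 d X \<cdot> \<theta>') \<rhd> S_funit b \<theta>') = \<r> (inv1 J \<theta> \<cdot> f1 d X \<cdot> \<theta>')"
    "(inv1 J \<theta> \<rhd> (f2 d (\<r> X) \<lhd> \<theta>')) \<bullet> S_fcomp \<theta> \<theta> \<theta>' X (\<one> a) \<bullet> (S_funit a \<theta> \<lhd> (inv1 J \<theta> \<cdot> f1 d X \<cdot> \<theta>')) = \<l> (inv1 J \<theta> \<cdot> f1 d X \<cdot> \<theta>')"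
proof -
  let ?i = "inv1 J \<theta>" and ?i' = "inv1 J \<theta>'"
  note tX = tm_rules(4)[OF X]
  note homs = dual_inv_homs(1)[OF A] dual_inv_homs(1)[OF A'] S_objD(1,2)[OF A] S_objD(1,2)[OF A']
  note ob = tm_rules(1)[OF S_objD(1)[OF A']] and oa = tm_rules(1)[OF S_objD(1)[OF A]]
  let ?X = "At ?i \<diamondop> Du (At X) \<diamondop> At \<theta>'"
  note t = obj_typing[OF A] obj_typing[OF A'] adj_typing[OF obj_adj[OF A]] adj_typing[OF obj_adj[OF A']] X[unfolded hom_iff]
  have L: "rp b a (?X \<diamondop> On b) ((?i \<rhd> (f2 d (\<l> X) \<lhd> \<theta>')) \<bullet> S_fcomp \<theta> \<theta>' \<theta>' (\<one> b) X \<bullet> ((?i \<cdot> f1 d X \<cdot> \<theta>') \<rhd> S_funit b \<theta>')) ?X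
     [wh [?i, f1 d X] (epsi \<theta>') [\<theta>'], wh [?i, f1 d X, \<theta>'] (iota \<theta>') []]"
    by (rule rp_cong, (rule rp_S_fcomp[OF A A' A' tX ob, unfolded dag_term_def] rp_S_funit[OF A', unfolded dag_term_def] tX rp_rules rp_f2 tm_rules homs)+) simp
  have R: "rp b a (?X \<diamondop> On b) (\<r> (?i \<cdot> f1 d X \<cdot> \<theta>')) ?X []"
    by (rule tX rp_rules tm_rules homs)+
  have 1: "wh [?i, f1 d X] (epsi \<theta>') [\<theta>'] \<odot> wh [?i, f1 d X, \<theta>'] (iota \<theta>') [] = pid b [?i, f1 d X, \<theta>']"
    using arg_cong[OF adjD(13)[OF obj_adj[OF A']], of "\<lambda>\<phi>. wh [?i, f1 d X] \<phi> []"] t by (simp add: wh_pcomp wh_pid psrcl_simps)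
  show "(?i \<rhd> (f2 d (\<l> X) \<lhd> \<theta>')) \<bullet> S_fcomp \<theta> \<theta>' \<theta>' (\<one> b) X \<bullet> ((?i \<cdot> f1 d X \<cdot> \<theta>') \<rhd> S_funit b \<theta>') = \<r> (?i \<cdot> f1 d X \<cdot> \<theta>')"
    by (rule rp_eqI[OF L R]) (simp add: pcomp_extend[OF 1] t)
  have L': "rp b a (On a \<diamondop> ?X) ((?i \<rhd> (f2 d (\<r> X) \<lhd> \<theta>')) \<bullet> S_fcomp \<theta> \<theta> \<theta>' X (\<one> a) \<bullet> (S_funit a \<theta> \<lhd> (?i \<cdot> f1 d X \<cdot> \<theta>'))) ?X
     [wh [?i] (epsi \<theta>) [f1 d X, \<theta>'], wh [] (iota \<theta>) [?i, f1 d X, \<theta>']]"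
    by (rule rp_cong, (rule rp_S_fcomp[OF A A A' oa tX, unfolded dag_term_def] rp_S_funit[OF A, unfolded dag_term_def] tX rp_rules rp_f2 tm_rules homs)+) simp
  have R': "rp b a (On a \<diamondop> ?X) (\<l> (?i \<cdot> f1 d X \<cdot> \<theta>')) ?X []"
    by (rule tX rp_rules tm_rules homs)+
  have 1: "wh [?i] (epsi \<theta>) [f1 d X, \<theta>'] \<odot> wh [] (iota \<theta>) [?i, f1 d X, \<theta>'] = pid b [?i, f1 d X, \<theta>']"
    using arg_cong[OF adjD(14)[OF obj_adj[OF A]], of "\<lambda>\<phi>. wh [] \<phi> [f1 d X, \<theta>']"] t by (simp add: wh_pcomp wh_pid psrcl_simps)
  show "(?i \<rhd> (f2 d (\<r> X) \<lhd> \<theta>')) \<bullet> S_fcomp \<theta> \<theta> \<theta>' X (\<one> a) \<bullet> (S_funit a \<theta> \<lhd> (?i \<cdot> f1 d X \<cdot> \<theta>')) = \<l> (?i \<cdot> f1 d X \<cdot> \<theta>')"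
    by (rule rp_eqI[OF L' R']) (simp add: pcomp_extend[OF 1] t)
qed

text \<open>Types and invertibility are read off from the diagram, a whiskered counit, rather than
  from the long composite that defines the cell.\<close>

lemma S_fcomp_cell:
  assumes A: "(a, \<theta>, \<Pi>) \<in> S_obj" and A': "(b, \<theta>', \<Pi>') \<in> S_obj" and A'': "(c, \<theta>'', \<Pi>'') \<in> S_obj"
    and X: "X \<in> hom B a b" and Y: "Y \<in> hom B b c"
  shows "S_fcomp \<theta> \<theta>' \<theta>'' Y X \<in> cell B" "dom2 B (S_fcomp \<theta> \<theta>' \<theta>'' Y X) = (inv1 J \<theta> \<cdot> f1 d X \<cdot> \<theta>') \<cdot> (inv1 J \<theta>' \<cdot> f1 d Y \<cdot> \<theta>'')"
    "cod2 B (S_fcomp \<theta> \<theta>' \<theta>'' Y X) = inv1 J \<theta> \<cdot> f1 d (Y \<cdot> X) \<cdot> \<theta>''" "iso2 B (S_fcomp \<theta> \<theta>' \<theta>'' Y X)"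
proof -
  note r = rp_S_fcomp[OF A A' A'' tm_rules(4)[OF X] tm_rules(4)[OF Y]]
  note t = rtyD[OF rpD(1)[OF r]]
  show "S_fcomp \<theta> \<theta>' \<theta>'' Y X \<in> cell B" "dom2 B (S_fcomp \<theta> \<theta>' \<theta>'' Y X) = (inv1 J \<theta> \<cdot> f1 d X \<cdot> \<theta>') \<cdot> (inv1 J \<theta>' \<cdot> f1 d Y \<cdot> \<theta>'')"
    "cod2 B (S_fcomp \<theta> \<theta>' \<theta>'' Y X) = inv1 J \<theta> \<cdot> f1 d (Y \<cdot> X) \<cdot> \<theta>''"
    using t(3-5) by (simp_all add: dag_term_def)
  show "iso2 B (S_fcomp \<theta> \<theta>' \<theta>'' Y X)"
    by (rule rp_iso(1)[OF r]) (use rp_rep[OF r] ptyD(1)[OF pty_rep[OF rpD(1)[OF r]]] piso_wh(1)[OF adjD(10)[OF obj_adj[OF A']]] in simp)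
qed

lemma S_funit_cell:
  assumes A: "(a, \<theta>, \<Pi>) \<in> S_obj"
  shows "S_funit a \<theta> \<in> cell B" "dom2 B (S_funit a \<theta>) = \<one> a" "cod2 B (S_funit a \<theta>) = inv1 J \<theta> \<cdot> f1 d (\<one> a) \<cdot> \<theta>" "iso2 B (S_funit a \<theta>)"
proof -
  note r = rp_S_funit[OF A]
  note t = rtyD[OF rpD(1)[OF r]]
  show "S_funit a \<theta> \<in> cell B" "dom2 B (S_funit a \<theta>) = \<one> a" "cod2 B (S_funit a \<theta>) = inv1 J \<theta> \<cdot> f1 d (\<one> a) \<cdot> \<theta>"
    using t(3-5) by (simp_all add: dag_term_def)
  show "iso2 B (S_funit a \<theta>)"
    by (rule rp_iso(1)[OF r]) (use adjD(9)[OF obj_adj[OF A]] in simp)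
qed

lemma pseudofunctor_S: "pseudofunctor S_bicat (op1 S_bicat) S_dual"
proof
  show "A \<in> obj S_bicat \<Longrightarrow> f0 S_dual A \<in> obj (op1 S_bicat)" for A
    by (simp add: S_dual_simps)
  show "X \<in> hom S_bicat A A' \<Longrightarrow> f1 S_dual X \<in> hom (op1 S_bicat) (f0 S_dual A) (f0 S_dual A')" for X A A'
    by (erule S_homE) (auto simp: S_dual_simps S_proj hom_iff obj_facts)
  have cl: "f2 S_dual f \<in> cells S_bicat (f1 S_dual X) (f1 S_dual Y)" if "f \<in> cells S_bicat X Y" for f X Y
  proof -
    have "X \<in> hom S_bicat (src S_bicat X) (trg S_bicat X)" using that by (auto simp: hom_iff cells_iff)
    then obtain a \<theta> \<Pi> b \<theta>' \<Pi>' x where 1: "X = ((a, \<theta>, \<Pi>), x, (b, \<theta>', \<Pi>'))"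
      "(a, \<theta>, \<Pi>) \<in> S_obj" "(b, \<theta>', \<Pi>') \<in> S_obj" "x \<in> hom B a b" by (rule S_homE)
    from that 1(1) obtain h y where 2: "f = ((a, \<theta>, \<Pi>), h, (b, \<theta>', \<Pi>'))" "Y = ((a, \<theta>, \<Pi>), y, (b, \<theta>', \<Pi>'))" "h \<in> cell B"
      "dom2 B h = x" "cod2 B h = y" "y \<in> hom B a b" by (rule S_cellsE)
    note t = 1(2-3) 1(4)[unfolded hom_iff] 2(3-5) 2(6)[unfolded hom_iff] obj_facts[OF 1(2)] obj_facts[OF 1(3)]
    show ?thesis unfolding 1(1) 2(1,2) by (simp add: S_dual_simps S_proj hom_iff cells_iff t)
  qed
  show "f \<in> cells S_bicat X Y \<Longrightarrow> f2 S_dual f \<in> cells (op1 S_bicat) (f1 S_dual X) (f1 S_dual Y)" for f X Y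
    using cl by simp
  show "f2 S_dual (id2 S_bicat X) = id2 (op1 S_bicat) (f1 S_dual X)" if "X \<in> mor S_bicat" for X
  proof -
    have "X \<in> hom S_bicat (src S_bicat X) (trg S_bicat X)" using that by (auto simp: hom_iff)
    then show ?thesis
      by (rule S_homE) (auto simp: S_dual_simps S_proj hom_iff obj_facts)
  qed
  show "f2 S_dual (vcomp S_bicat g f) = vcomp (op1 S_bicat) (f2 S_dual g) (f2 S_dual f)"
    if f: "f \<in> cells S_bicat X Y" and g: "g \<in> cells S_bicat Y Z" for f g X Y Z
  proof -
    have "X \<in> hom S_bicat (src S_bicat X) (trg S_bicat X)" using f by (auto simp: hom_iff cells_iff)
    then show ?thesis
    proof (rule S_homE, goal_cases)
      case (1 a \<theta> \<Pi> b \<theta>' \<Pi>' x)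
      from f 1(3) obtain h y where 2: "f = ((a, \<theta>, \<Pi>), h, (b, \<theta>', \<Pi>'))" "Y = ((a, \<theta>, \<Pi>), y, (b, \<theta>', \<Pi>'))" "h \<in> cell B"
        "dom2 B h = x" "cod2 B h = y" "y \<in> hom B a b" by (rule S_cellsE)
      from g 2(2) obtain k where 3: "g = ((a, \<theta>, \<Pi>), k, (b, \<theta>', \<Pi>'))" "k \<in> cell B" "dom2 B k = y"
        by (rule S_cellsE)
      note t = 1(6)[unfolded hom_iff] 2(3-5) 2(6)[unfolded hom_iff] 3(2,3) obj_facts[OF 1(4)] obj_facts[OF 1(5)]
      show ?thesis
        unfolding 2(1) 3(1) by (simp add: S_dual_simps S_proj f2_vcomp' lwhisker_vcomp rwhisker_vcomp t)
    qed
  qed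
  show "fcomp S_dual Y X \<in> isos (op1 S_bicat) (comp1 (op1 S_bicat) (f1 S_dual Y) (f1 S_dual X)) (f1 S_dual (comp1 S_bicat Y X))"
    if X: "X \<in> hom S_bicat A A'" and Y: "Y \<in> hom S_bicat A' A''" for X Y A A' A''
    using X
  proof (rule S_homE, goal_cases)
    case (1 a \<theta> \<Pi> b \<theta>' \<Pi>' x)
    from Y show ?case
    proof (rule S_homE, goal_cases)
      case (1 a2 \<theta>2 \<Pi>2 c \<theta>'' \<Pi>'' y)
      with \<open>A' = (b, \<theta>', \<Pi>')\<close> have [simp]: "a2 = b" "\<theta>2 = \<theta>'" "\<Pi>2 = \<Pi>'" by auto
      note 2 = 1[simplified]
      note 1 = \<open>A = _\<close> \<open>A' = (b, \<theta>', \<Pi>')\<close> \<open>X = _\<close> \<open>(a, \<theta>, \<Pi>) \<in> S_obj\<close> \<open>(b, \<theta>', \<Pi>') \<in> S_obj\<close> \<open>x \<in> _\<close>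
      note c = S_fcomp_cell[OF 1(4,5) 2(5) 1(6) 2(6)]
      note t = 1(6)[unfolded hom_iff] 2(6)[unfolded hom_iff] obj_facts[OF 1(4)] obj_facts[OF 1(5)] obj_facts[OF 2(5)]
      show ?thesis unfolding 1(3) 2(3) isos_op1 isos_iff
        by (intro conjI iso2_S) (simp_all add: S_dual_simps S_proj hom_iff c t 1(4,5) 2(5))
    qed
  qed
  show "funit S_dual A \<in> isos (op1 S_bicat) (one (op1 S_bicat) (f0 S_dual A)) (f1 S_dual (one S_bicat A))" if "A \<in> obj S_bicat" for A
  proof -
    obtain a \<theta> \<Pi> where A: "A = (a, \<theta>, \<Pi>)" "(a, \<theta>, \<Pi>) \<in> S_obj" using \<open>A \<in> _\<close> by (cases A) (simp add: S_proj)
    show ?thesis unfolding isos_op1 isos_iff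
      by (intro conjI iso2_S) (simp_all add: A S_dual_simps S_proj hom_iff S_funit_cell[OF A(2)] obj_facts[OF A(2)])
  qed
  show "vcomp (op1 S_bicat) (fcomp S_dual Y' X') (hcomp (op1 S_bicat) (f2 S_dual g) (f2 S_dual f))
    = vcomp (op1 S_bicat) (f2 S_dual (hcomp S_bicat g f)) (fcomp S_dual Y X)"
    if f: "f \<in> cells S_bicat X X'" and g: "g \<in> cells S_bicat Y Y'" and X: "X \<in> hom S_bicat A A'" and Y: "Y \<in> hom S_bicat A' A''"
    for f g X X' Y Y' A A' A''
    using X
  proof (rule S_homE, goal_cases)
    case (1 a \<theta> \<Pi> b \<theta>' \<Pi>' x)
    from Y show ?case
    proof (rule S_homE, goal_cases)
      case (1 a2 \<theta>2 \<Pi>2 c \<theta>'' \<Pi>'' y)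
      with \<open>A' = (b, \<theta>', \<Pi>')\<close> have [simp]: "a2 = b" "\<theta>2 = \<theta>'" "\<Pi>2 = \<Pi>'" by auto
      note 2 = 1[simplified]
      note 1 = \<open>A = _\<close> \<open>A' = (b, \<theta>', \<Pi>')\<close> \<open>X = _\<close> \<open>(a, \<theta>, \<Pi>) \<in> S_obj\<close> \<open>(b, \<theta>', \<Pi>') \<in> S_obj\<close> \<open>x \<in> _\<close>
      from f 1(3) obtain h x' where 3: "f = ((a, \<theta>, \<Pi>), h, (b, \<theta>', \<Pi>'))" "X' = ((a, \<theta>, \<Pi>), x', (b, \<theta>', \<Pi>'))" "h \<in> cell B"
        "dom2 B h = x" "cod2 B h = x'" "x' \<in> hom B a b" by (rule S_cellsE)
      from g 2(3) obtain k y' where 4: "g = ((b, \<theta>', \<Pi>'), k, (c, \<theta>'', \<Pi>''))" "Y' = ((b, \<theta>', \<Pi>'), y', (c, \<theta>'', \<Pi>''))" "k \<in> cell B"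
        "dom2 B k = y" "cod2 B k = y'" "y' \<in> hom B b c" by (rule S_cellsE)
      show ?thesis
        using S_fcomp_natural[OF 1(4,5) 2(5) 1(6) 3(6) 2(6) 4(6) 3(3-5) 4(3-5)]
        unfolding 1(3) 2(3) 3(1,2) 4(1,2) by (simp add: S_dual_simps S_proj op1_simps)
    qed
  qed
  show "vcomp (op1 S_bicat) (f2 S_dual (assoc S_bicat Z Y X)) (vcomp (op1 S_bicat) (fcomp S_dual (comp1 S_bicat Z Y) X)
      (rwhisker (op1 S_bicat) (fcomp S_dual Z Y) (f1 S_dual X)))
    = vcomp (op1 S_bicat) (fcomp S_dual Z (comp1 S_bicat Y X)) (vcomp (op1 S_bicat) (lwhisker (op1 S_bicat) (f1 S_dual Z) (fcomp S_dual Y X))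
      (assoc (op1 S_bicat) (f1 S_dual Z) (f1 S_dual Y) (f1 S_dual X)))"
    if X: "X \<in> hom S_bicat A A'" and Y: "Y \<in> hom S_bicat A' A''" and Z: "Z \<in> hom S_bicat A'' A3"
    for X Y Z A A' A'' A3
    using X
  proof (rule S_homE, goal_cases)
    case (1 a \<theta> \<Pi> b \<theta>' \<Pi>' x)
    from Y show ?case
    proof (rule S_homE, goal_cases)
      case (1 a2 \<theta>2 \<Pi>2 c \<theta>'' \<Pi>'' y)
      with \<open>A' = (b, \<theta>', \<Pi>')\<close> have [simp]: "a2 = b" "\<theta>2 = \<theta>'" "\<Pi>2 = \<Pi>'" by auto
      note 2 = 1[simplified]
      note 1 = \<open>A = _\<close> \<open>A' = (b, \<theta>', \<Pi>')\<close> \<open>X = _\<close> \<open>(a, \<theta>, \<Pi>) \<in> S_obj\<close> \<open>(b, \<theta>', \<Pi>') \<in> S_obj\<close> \<open>x \<in> _\<close>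
      from Z show ?thesis
      proof (rule S_homE, goal_cases)
        case (1 a4 \<theta>4 \<Pi>4 e \<theta>3 \<Pi>3 z)
        with \<open>A'' = (c, \<theta>'', \<Pi>'')\<close> have [simp]: "a4 = c" "\<theta>4 = \<theta>''" "\<Pi>4 = \<Pi>''" by auto
        note 3 = 1[simplified]
        note 1 = \<open>X = _\<close> \<open>(a, \<theta>, \<Pi>) \<in> S_obj\<close> \<open>(b, \<theta>', \<Pi>') \<in> S_obj\<close> \<open>x \<in> _\<close>
        note t = 1(4)[unfolded hom_iff] 2(6)[unfolded hom_iff] 3(6)[unfolded hom_iff] obj_facts[OF 1(2)] obj_facts[OF 1(3)] obj_facts[OF 2(5)] obj_facts[OF 3(5)]
        show ?thesis
          using S_fcomp_assoc[OF 1(2,3) 2(5) 3(5) 1(4) 2(6) 3(6)]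
          unfolding 1(1) 2(3) 3(3) by (simp add: S_dual_simps S_proj op1_def inv2_S hom_iff t 1(2,3) 2(5) 3(5))
      qed
    qed
  qed
  show "vcomp (op1 S_bicat) (f2 S_dual (lunit S_bicat X)) (vcomp (op1 S_bicat) (fcomp S_dual (one S_bicat A') X)
      (rwhisker (op1 S_bicat) (funit S_dual A') (f1 S_dual X))) = lunit (op1 S_bicat) (f1 S_dual X)"
   "vcomp (op1 S_bicat) (f2 S_dual (runit S_bicat X)) (vcomp (op1 S_bicat) (fcomp S_dual X (one S_bicat A))
      (lwhisker (op1 S_bicat) (f1 S_dual X) (funit S_dual A))) = runit (op1 S_bicat) (f1 S_dual X)"
    if X: "X \<in> hom S_bicat A A'" for X A A'
  proof -
    from X obtain a \<theta> \<Pi> b \<theta>' \<Pi>' x where 1: "A = (a, \<theta>, \<Pi>)" "A' = (b, \<theta>', \<Pi>')" "X = ((a, \<theta>, \<Pi>), x, (b, \<theta>', \<Pi>'))"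
      "(a, \<theta>, \<Pi>) \<in> S_obj" "(b, \<theta>', \<Pi>') \<in> S_obj" "x \<in> hom B a b" by (rule S_homE)
    show "vcomp (op1 S_bicat) (f2 S_dual (lunit S_bicat X)) (vcomp (op1 S_bicat) (fcomp S_dual (one S_bicat A') X)
      (rwhisker (op1 S_bicat) (funit S_dual A') (f1 S_dual X))) = lunit (op1 S_bicat) (f1 S_dual X)"
     "vcomp (op1 S_bicat) (f2 S_dual (runit S_bicat X)) (vcomp (op1 S_bicat) (fcomp S_dual X (one S_bicat A))
      (lwhisker (op1 S_bicat) (f1 S_dual X) (funit S_dual A))) = runit (op1 S_bicat) (f1 S_dual X)"
      using S_fcomp_unit[OF 1(4-6)] unfolding 1(1-3) by (simp_all add: S_dual_simps S_proj op1_def)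
  qed
qed

section \<open>The 2-transformation (S eta)\<close>

definition S_ddual :: "'m \<Rightarrow> 'm \<Rightarrow> 'm \<Rightarrow> 'm" where
  "S_ddual \<theta> \<theta>' X = inv1 J \<theta>' \<cdot> f1 d (inv1 J \<theta> \<cdot> f1 d X \<cdot> \<theta>') \<cdot> \<theta>"

definition S_t2 :: "('o, 'm, 'c) sobj \<Rightarrow> 'm \<Rightarrow> ('o, 'm, 'c) sobj \<Rightarrow> 'c" where
  "S_t2 = (\<lambda>(a, \<theta>, \<Pi>) X (b, \<theta>', \<Pi>'). inv (\<l> (S_ddual \<theta> \<theta>' X)) \<bullet> S_eta_cell ((a, \<theta>, \<Pi>), X, (b, \<theta>', \<Pi>')) \<bullet> \<r> X)"

lemma S_eta_simps:
  "t1 S_eta A = (A, \<one> (fst A), A)"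
  "t2 S_eta ((a, \<theta>, \<Pi>), X, (b, \<theta>', \<Pi>')) = ((a, \<theta>, \<Pi>), S_t2 (a, \<theta>, \<Pi>) X (b, \<theta>', \<Pi>'), (b, \<theta>', \<Pi>'))"
  by (simp_all add: S_eta_def S_dual_simps S_t2_def S_ddual_def)

lemma S_eta_cell_typing:
  assumes A: "(a, \<theta>, \<Pi>) \<in> S_obj" and A': "(b, \<theta>', \<Pi>') \<in> S_obj" and X: "X \<in> hom B a b"
  shows "S_eta_cell ((a, \<theta>, \<Pi>), X, (b, \<theta>', \<Pi>')) \<in> cell B" "dom2 B (S_eta_cell ((a, \<theta>, \<Pi>), X, (b, \<theta>', \<Pi>'))) = X"
    "cod2 B (S_eta_cell ((a, \<theta>, \<Pi>), X, (b, \<theta>', \<Pi>'))) = S_ddual \<theta> \<theta>' X" "iso2 B (S_eta_cell ((a, \<theta>, \<Pi>), X, (b, \<theta>', \<Pi>')))"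
    "S_ddual \<theta> \<theta>' X \<in> mor B" "src B (S_ddual \<theta> \<theta>' X) = a" "trg B (S_ddual \<theta> \<theta>' X) = b"
proof -
  note tX = tm_rules(4)[OF X]
  note r = rp_S_eta_diag[OF A A' tX]
  note t = rtyD[OF rpD(1)[OF r]]
  show "S_eta_cell ((a, \<theta>, \<Pi>), X, (b, \<theta>', \<Pi>')) \<in> cell B" "dom2 B (S_eta_cell ((a, \<theta>, \<Pi>), X, (b, \<theta>', \<Pi>'))) = X"
    "cod2 B (S_eta_cell ((a, \<theta>, \<Pi>), X, (b, \<theta>', \<Pi>'))) = S_ddual \<theta> \<theta>' X"
    using t(3-5) by (simp_all add: dag_term_def S_ddual_def)
  show "iso2 B (S_eta_cell ((a, \<theta>, \<Pi>), X, (b, \<theta>', \<Pi>')))"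
    by (rule rp_iso(1)[OF r]) (use adjoint_pair_S_eta_diag(2)[OF A A' tX] in simp)
  show "S_ddual \<theta> \<theta>' X \<in> mor B" "src B (S_ddual \<theta> \<theta>' X) = a" "trg B (S_ddual \<theta> \<theta>' X) = b"
    using X[unfolded hom_iff] by (simp_all add: S_ddual_def obj_facts[OF A] obj_facts[OF A'])
qed

lemma S_t2_typing:
  assumes A: "(a, \<theta>, \<Pi>) \<in> S_obj" and A': "(b, \<theta>', \<Pi>') \<in> S_obj" and X: "X \<in> hom B a b"
  shows "S_t2 (a, \<theta>, \<Pi>) X (b, \<theta>', \<Pi>') \<in> cell B" "dom2 B (S_t2 (a, \<theta>, \<Pi>) X (b, \<theta>', \<Pi>')) = X \<cdot> \<one> a"
    "cod2 B (S_t2 (a, \<theta>, \<Pi>) X (b, \<theta>', \<Pi>')) = \<one> b \<cdot> S_ddual \<theta> \<theta>' X" "iso2 B (S_t2 (a, \<theta>, \<Pi>) X (b, \<theta>', \<Pi>'))"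
  using X[unfolded hom_iff] by (simp_all add: S_t2_def S_eta_cell_typing[OF assms])

lemma rp_S_t2:
  assumes A: "(a, \<theta>, \<Pi>) \<in> S_obj" and A': "(b, \<theta>', \<Pi>') \<in> S_obj" and X: "tm X x a b"
  shows "rp a b (x \<diamondop> On a) (S_t2 (a, \<theta>, \<Pi>) X (b, \<theta>', \<Pi>')) (On b \<diamondop> dag_term \<theta>' (dag_term \<theta> x \<theta>') \<theta>) [S_eta_diag (a, \<theta>, \<Pi>) x (b, \<theta>', \<Pi>')]"
proof -
  note homs = dual_inv_homs(1)[OF A] dual_inv_homs(1)[OF A'] S_objD(1,2)[OF A] S_objD(1,2)[OF A']
  show ?thesis
    unfolding S_t2_def prod.case S_ddual_def dag_term_def
    by (rule rp_cong, (rule rp_S_eta_diag[OF A A' X, unfolded dag_term_def] X rp_rules tm_rules homs)+) simp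
qed

lemma S_t2_natural:
  assumes A: "(a, \<theta>, \<Pi>) \<in> S_obj" and A': "(b, \<theta>', \<Pi>') \<in> S_obj" and X: "X \<in> hom B a b" and Y: "Y \<in> hom B a b"
    and f: "f \<in> cell B" "dom2 B f = X" "cod2 B f = Y"
  shows "S_t2 (a, \<theta>, \<Pi>) Y (b, \<theta>', \<Pi>') \<bullet> (f \<lhd> \<one> a)
    = (\<one> b \<rhd> (inv1 J \<theta>' \<rhd> (f2 d (inv1 J \<theta> \<rhd> (f2 d f \<lhd> \<theta>')) \<lhd> \<theta>))) \<bullet> S_t2 (a, \<theta>, \<Pi>) X (b, \<theta>', \<Pi>')"
proof -
  let ?F = "rep (At X) f (At Y)"
  note ms = X[unfolded hom_iff] Y[unfolded hom_iff]
  note tms = tm_rules(4)[OF X] tm_rules(4)[OF Y]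
  note homs = dual_inv_homs(1)[OF A] dual_inv_homs(1)[OF A'] S_objD(1,2)[OF A] S_objD(1,2)[OF A']
  have r: "rty (At X) f (At Y)" using ms f by (auto simp: rty_def)
  have rf: "rp a b (At X) f (At Y) [?F]" by (rule rp_atom[OF r]; use ms in simp)
  note t2 = rp_S_t2[OF A A' tms(1), unfolded dag_term_def] rp_S_t2[OF A A' tms(2), unfolded dag_term_def]
  let ?cod = "On b \<diamondop> At (inv1 J \<theta>') \<diamondop> Du (At (inv1 J \<theta>) \<diamondop> Du (At Y) \<diamondop> At \<theta>') \<diamondop> At \<theta>"
  have L: "rp a b (At X \<diamondop> On a) (S_t2 (a, \<theta>, \<Pi>) Y (b, \<theta>', \<Pi>') \<bullet> (f \<lhd> \<one> a)) ?cod [S_eta_diag (a, \<theta>, \<Pi>) (At Y) (b, \<theta>', \<Pi>'), ?F]"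
    by (rule rp_cong, (rule t2 rf tms rp_rules rp_f2 rp_hcomp tm_rules homs)+) (simp add: pty_simps[OF pty_rep[OF r]])
  have R: "rp a b (At X \<diamondop> On a) ((\<one> b \<rhd> (inv1 J \<theta>' \<rhd> (f2 d (inv1 J \<theta> \<rhd> (f2 d f \<lhd> \<theta>')) \<lhd> \<theta>))) \<bullet> S_t2 (a, \<theta>, \<Pi>) X (b, \<theta>', \<Pi>')) ?cod
    [wh [inv1 J \<theta>'] (pdual (wh [inv1 J \<theta>] (pdual ?F) [\<theta>'])) [\<theta>], S_eta_diag (a, \<theta>, \<Pi>) (At X) (b, \<theta>', \<Pi>')]"
    by (rule rp_cong, (rule t2 rf tms rp_rules rp_f2 rp_hcomp tm_rules homs)+) simp
  show ?thesis
    by (rule rp_eqI[OF L R], simp only: pl.simps) (simp only: pcomp_extend[OF S_eta_diag_natural[OF A A' tms r]] pcomp_assoc)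
qed

text \<open>The two occurrences of \<open>S_fcomp\<close> are the halves of the coherence cell of
  the double dual, which is why the second one has its 1-morphisms in the opposite order. All
  associators and units vanish, leaving \<open>S_eta_diag_comp\<close>.\<close>

lemma S_t2_comp1:
  assumes A: "(a, \<theta>, \<Pi>) \<in> S_obj" and A': "(b, \<theta>', \<Pi>') \<in> S_obj" and A'': "(c, \<theta>'', \<Pi>'') \<in> S_obj"
    and X: "X \<in> hom B a b" and Y: "Y \<in> hom B b c"
  shows "S_t2 (a, \<theta>, \<Pi>) (Y \<cdot> X) (c, \<theta>'', \<Pi>'') \<bullet> (id2 B (Y \<cdot> X) \<lhd> \<one> a)
    = (\<one> c \<rhd> ((inv1 J \<theta>'' \<rhd> (f2 d (S_fcomp \<theta> \<theta>' \<theta>'' Y X) \<lhd> \<theta>))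
        \<bullet> S_fcomp \<theta>'' \<theta>' \<theta> (inv1 J \<theta> \<cdot> f1 d X \<cdot> \<theta>') (inv1 J \<theta>' \<cdot> f1 d Y \<cdot> \<theta>'')))
      \<bullet> \<a> (\<one> c) (S_ddual \<theta>' \<theta>'' Y) (S_ddual \<theta> \<theta>' X)
      \<bullet> (S_t2 (b, \<theta>', \<Pi>') Y (c, \<theta>'', \<Pi>'') \<lhd> S_ddual \<theta> \<theta>' X) \<bullet> inv (\<a> Y (\<one> b) (S_ddual \<theta> \<theta>' X))
      \<bullet> (Y \<rhd> S_t2 (a, \<theta>, \<Pi>) X (b, \<theta>', \<Pi>')) \<bullet> \<a> Y X (\<one> a)"
proof -
  note tms = tm_rules(4)[OF X] tm_rules(4)[OF Y]
  note homs = dual_inv_homs(1)[OF A] dual_inv_homs(1)[OF A'] dual_inv_homs(1)[OF A''] S_objD(1,2)[OF A] S_objD(1,2)[OF A'] S_objD(1,2)[OF A'']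
  note d = dag_term_typing[OF A A' tms(1)] dag_term_typing[OF A' A'' tms(2)]
  note rules = rp_S_t2[OF A A' tms(1), unfolded dag_term_def] rp_S_t2[OF A' A'' tms(2), unfolded dag_term_def]
    rp_S_t2[OF A A'' tm_rules(2)[OF tms], unfolded dag_term_def]
    rp_S_fcomp[OF A A' A'' tms, unfolded dag_term_def] rp_S_fcomp[OF A'' A' A d(2,1), unfolded dag_term_def]
  let ?X = "At (inv1 J \<theta>) \<diamondop> Du (At X) \<diamondop> At \<theta>'" and ?Y = "At (inv1 J \<theta>') \<diamondop> Du (At Y) \<diamondop> At \<theta>''"
  let ?cod = "On c \<diamondop> At (inv1 J \<theta>'') \<diamondop> Du (At (inv1 J \<theta>) \<diamondop> Du (At Y \<diamondop> At X) \<diamondop> At \<theta>'') \<diamondop> At \<theta>"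
  have L: "rp a c ((At Y \<diamondop> At X) \<diamondop> On a) (S_t2 (a, \<theta>, \<Pi>) (Y \<cdot> X) (c, \<theta>'', \<Pi>'') \<bullet> (id2 B (Y \<cdot> X) \<lhd> \<one> a)) ?cod
    [S_eta_diag (a, \<theta>, \<Pi>) (At Y \<diamondop> At X) (c, \<theta>'', \<Pi>'')]"
    by (rule rp_cong, (rule rules tms rp_rules rp_f2 rp_hcomp tm_rules homs)+) simp
  have R: "rp a c ((At Y \<diamondop> At X) \<diamondop> On a) ((\<one> c \<rhd> ((inv1 J \<theta>'' \<rhd> (f2 d (S_fcomp \<theta> \<theta>' \<theta>'' Y X) \<lhd> \<theta>))
        \<bullet> S_fcomp \<theta>'' \<theta>' \<theta> (inv1 J \<theta> \<cdot> f1 d X \<cdot> \<theta>') (inv1 J \<theta>' \<cdot> f1 d Y \<cdot> \<theta>'')))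
      \<bullet> \<a> (\<one> c) (S_ddual \<theta>' \<theta>'' Y) (S_ddual \<theta> \<theta>' X)
      \<bullet> (S_t2 (b, \<theta>', \<Pi>') Y (c, \<theta>'', \<Pi>'') \<lhd> S_ddual \<theta> \<theta>' X) \<bullet> inv (\<a> Y (\<one> b) (S_ddual \<theta> \<theta>' X))
      \<bullet> (Y \<rhd> S_t2 (a, \<theta>, \<Pi>) X (b, \<theta>', \<Pi>')) \<bullet> \<a> Y X (\<one> a)) ?cod
    [wh [inv1 J \<theta>''] (pdual (wh (inv1 J \<theta> # dl (tfl (At X))) (epsi \<theta>') (dl (tfl (At Y)) @ [\<theta>'']))) [\<theta>],
     wh (inv1 J \<theta>'' # dl (tfl (dag_term \<theta>' (At Y) \<theta>''))) (epsi \<theta>') (dl (tfl (dag_term \<theta> (At X) \<theta>')) @ [\<theta>]),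
     wh [] (S_eta_diag (b, \<theta>', \<Pi>') (At Y) (c, \<theta>'', \<Pi>'')) (tfl (dag_term \<theta>' (dag_term \<theta> (At X) \<theta>') \<theta>)),
     wh (tfl (At Y)) (S_eta_diag (a, \<theta>, \<Pi>) (At X) (b, \<theta>', \<Pi>')) []]"
    unfolding S_ddual_def
    by (rule rp_cong, (rule rules tms rp_rules rp_f2 rp_hcomp tm_rules homs)+) simp
  show ?thesis
    by (rule rp_eqI[OF L R], simp only: pl.simps) (simp only: S_eta_diag_comp[OF A A' A'' tms] pcomp_assoc)
qed

lemma S_t2_one:
  assumes A: "(a, \<theta>, \<Pi>) \<in> S_obj"
  shows "S_t2 (a, \<theta>, \<Pi>) (\<one> a) (a, \<theta>, \<Pi>) \<bullet> (id2 B (\<one> a) \<lhd> \<one> a)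
    = (\<one> a \<rhd> ((inv1 J \<theta> \<rhd> (f2 d (S_funit a \<theta>) \<lhd> \<theta>)) \<bullet> S_funit a \<theta>)) \<bullet> inv (\<r> (\<one> a)) \<bullet> \<l> (\<one> a)"
proof -
  note homs = dual_inv_homs(1)[OF A] S_objD(1,2)[OF A]
  note X = tm_rules(1)[OF S_objD(1)[OF A]]
  note rules = rp_S_t2[OF A A X, unfolded dag_term_def] rp_S_funit[OF A, unfolded dag_term_def]
  let ?cod = "On a \<diamondop> At (inv1 J \<theta>) \<diamondop> Du (At (inv1 J \<theta>) \<diamondop> Du (On a) \<diamondop> At \<theta>) \<diamondop> At \<theta>"
  have L: "rp a a (On a \<diamondop> On a) (S_t2 (a, \<theta>, \<Pi>) (\<one> a) (a, \<theta>, \<Pi>) \<bullet> (id2 B (\<one> a) \<lhd> \<one> a)) ?cod [S_eta_diag (a, \<theta>, \<Pi>) (On a) (a, \<theta>, \<Pi>)]"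
    by (rule rp_cong, (rule rules rp_rules rp_f2 rp_hcomp tm_rules homs)+) simp
  have R: "rp a a (On a \<diamondop> On a) ((\<one> a \<rhd> ((inv1 J \<theta> \<rhd> (f2 d (S_funit a \<theta>) \<lhd> \<theta>)) \<bullet> S_funit a \<theta>)) \<bullet> inv (\<r> (\<one> a)) \<bullet> \<l> (\<one> a)) ?cod
     [wh [inv1 J \<theta>] (pdual (iota \<theta>)) [\<theta>], iota \<theta>]"
    by (rule rp_cong, (rule rules rp_rules rp_f2 rp_hcomp tm_rules homs)+) (simp add: adj_typing[OF obj_adj[OF A]])
  show ?thesis
    by (rule rp_eqI[OF L R], simp only: pl.simps) (simp only: S_eta_diag_one[OF A] pcomp_assoc)
qed

lemma S_eta_cell_dual:
  assumes A: "(a, \<theta>, \<Pi>) \<in> S_obj" and A': "(b, \<theta>', \<Pi>') \<in> S_obj" and X: "X \<in> hom B a b"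
  shows "inv1 J \<theta> \<rhd> (f2 d (S_eta_cell ((a, \<theta>, \<Pi>), X, (b, \<theta>', \<Pi>'))) \<lhd> \<theta>')
    = S_eta_cell ((b, \<theta>', \<Pi>'), inv1 J \<theta> \<cdot> f1 d X \<cdot> \<theta>', (a, \<theta>, \<Pi>))"
proof -
  note tX = tm_rules(4)[OF X]
  note homs = dual_inv_homs(1)[OF A] dual_inv_homs(1)[OF A'] S_objD(1,2)[OF A] S_objD(1,2)[OF A']
  note R = rp_S_eta_diag[OF A' A dag_term_typing[OF A A' tX]]
  have L: "rp b a (dag_term \<theta> (At X) \<theta>') (inv1 J \<theta> \<rhd> (f2 d (S_eta_cell ((a, \<theta>, \<Pi>), X, (b, \<theta>', \<Pi>'))) \<lhd> \<theta>'))
      (dag_term \<theta> (dag_term \<theta>' (dag_term \<theta> (At X) \<theta>') \<theta>) \<theta>') [wh [inv1 J \<theta>] (pdual (S_eta_diag (a, \<theta>, \<Pi>) (At X) (b, \<theta>', \<Pi>'))) [\<theta>']]"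
    unfolding dag_term_def
    by (rule rp_cong, (rule rp_S_eta_diag[OF A A' tX, unfolded dag_term_def] tX rp_rules rp_f2 tm_rules homs)+) simp
  show ?thesis
    by (rule rp_eqI[OF L R], simp only: pl.simps) (simp only: S_eta_diag_dual[OF A A' X])
qed

lemma S_dual_dual:
  "f1 S_dual (f1 S_dual ((a, \<theta>, \<Pi>), X, (b, \<theta>', \<Pi>'))) = ((a, \<theta>, \<Pi>), S_ddual \<theta> \<theta>' X, (b, \<theta>', \<Pi>'))"
  by (simp add: S_dual_simps S_ddual_def)

lemma invertible_one_S:
  assumes "A \<in> S_obj" shows "invertible1 S_bicat (A, \<one> (fst A), A)"
proof -
  let ?I = "(A, \<one> (fst A), A)"
  have o: "A \<in> obj S_bicat" "?I = one S_bicat A" using assms by (simp_all add: S_proj)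
  have h: "one S_bicat A \<in> hom S_bicat A A" using S.one_hom[OF o(1)] .
  have l: "lunit S_bicat (one S_bicat A) \<in> isos S_bicat (comp1 S_bicat (one S_bicat A) (one S_bicat A)) (one S_bicat A)"
    using S.lunit_iso[OF h] .
  then have i: "inv2 S_bicat (lunit S_bicat (one S_bicat A)) \<in> isos S_bicat (one S_bicat A) (comp1 S_bicat (one S_bicat A) (one S_bicat A))"
    by (auto simp: isos_iff)
  show ?thesis unfolding invertible1_def o(2)
    using h l i by (auto simp: hom_iff[of _ S_bicat])
qed

lemma pseudotransformation_S: "pseudotransformation S_bicat S_bicat (double_dual S_bicat S_dual) (id_functor S_bicat) S_eta"
proof (unfold_locales, goal_cases)
  case (1 A)
  then show ?case by (simp add: S_dual_simps S_eta_simps S_proj hom_iff)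
next
  case (2 X A A')
  then obtain a \<theta> \<Pi> b \<theta>' \<Pi>' x where 1: "A = (a, \<theta>, \<Pi>)" "A' = (b, \<theta>', \<Pi>')" "X = ((a, \<theta>, \<Pi>), x, (b, \<theta>', \<Pi>'))"
    "(a, \<theta>, \<Pi>) \<in> S_obj" "(b, \<theta>', \<Pi>') \<in> S_obj" "x \<in> hom B a b" by (rule S_homE)
  note t = S_t2_typing[OF 1(4-6)] 1(6)[unfolded hom_iff] obj_facts(1)[OF 1(4)] obj_facts(1)[OF 1(5)] S_eta_cell_typing(5-7)[OF 1(4-6)]
  show ?case unfolding 1(1-3) isos_iff
    by (intro conjI iso2_S) (simp_all add: S_dual_dual S_eta_simps S_proj hom_iff t 1(4,5))
next
  case (3 f X Y A A')
  from 3(2) obtain a \<theta> \<Pi> b \<theta>' \<Pi>' x where 1: "A = (a, \<theta>, \<Pi>)" "A' = (b, \<theta>', \<Pi>')" "X = ((a, \<theta>, \<Pi>), x, (b, \<theta>', \<Pi>'))"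
    "(a, \<theta>, \<Pi>) \<in> S_obj" "(b, \<theta>', \<Pi>') \<in> S_obj" "x \<in> hom B a b" by (rule S_homE)
  from 3(1) 1(3) obtain h y where 2: "f = ((a, \<theta>, \<Pi>), h, (b, \<theta>', \<Pi>'))" "Y = ((a, \<theta>, \<Pi>), y, (b, \<theta>', \<Pi>'))" "h \<in> cell B"
      "dom2 B h = x" "cod2 B h = y" "y \<in> hom B a b" by (rule S_cellsE)
  show ?case using S_t2_natural[OF 1(4-6) 2(6,3-5)]
    unfolding 1(1-3) 2(1,2) by (simp add: S_dual_simps S_eta_simps S_proj)
next
  case (4 X A A' Y A'')
  from 4(1) obtain a \<theta> \<Pi> b \<theta>' \<Pi>' x where 1: "A = (a, \<theta>, \<Pi>)" "A' = (b, \<theta>', \<Pi>')" "X = ((a, \<theta>, \<Pi>), x, (b, \<theta>', \<Pi>'))"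
    "(a, \<theta>, \<Pi>) \<in> S_obj" "(b, \<theta>', \<Pi>') \<in> S_obj" "x \<in> hom B a b" by (rule S_homE)
  from 4(2) 1(2) obtain c \<theta>'' \<Pi>'' y where 2: "A'' = (c, \<theta>'', \<Pi>'')" "Y = ((b, \<theta>', \<Pi>'), y, (c, \<theta>'', \<Pi>''))"
    "(c, \<theta>'', \<Pi>'') \<in> S_obj" "y \<in> hom B b c" by (auto elim!: S_homE)
  note t = 1(4,5) 2(3) 1(6)[unfolded hom_iff] 2(4)[unfolded hom_iff] obj_facts(1)[OF 1(4)] obj_facts(1)[OF 1(5)] obj_facts(1)[OF 2(3)]
    S_eta_cell_typing(5-7)[OF 1(4-6)] S_eta_cell_typing(5-7)[OF 1(5) 2(3,4)]
  have a: "inv2 S_bicat (assoc S_bicat Y (one S_bicat A') (f1 S_dual (f1 S_dual X)))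
      = (A, inv (\<a> y (\<one> b) (S_ddual \<theta> \<theta>' x)), A'')"
    unfolding 1(1-3) 2(1,2) by (simp add: S_dual_dual S_proj inv2_S hom_iff t)
  show ?case using S_t2_comp1[OF 1(4,5) 2(3) 1(6) 2(4)] a
    unfolding 1(1-3) 2(1,2)
    by (simp add: S_dual_dual S_eta_simps S_proj) (simp add: S_dual_simps)
next
  case (5 A)
  then obtain a \<theta> \<Pi> where 1: "A = (a, \<theta>, \<Pi>)" "(a, \<theta>, \<Pi>) \<in> S_obj" by (cases A) (simp add: S_proj)
  note t = obj_facts(1)[OF 1(2)] 1(2)
  have a: "inv2 S_bicat (runit S_bicat (one S_bicat A)) = (A, inv (\<r> (\<one> a)), A)"
    unfolding 1(1) by (simp add: S_proj inv2_S hom_iff t)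
  show ?case using S_t2_one[OF 1(2)] a
    unfolding 1(1) by (simp add: S_dual_simps S_eta_simps S_proj)
qed

text \<open>The unit isomorphisms inserted in \<open>S_eta\<close> are those that
  \<open>dagger_cell\<close> removes, so the condition on the dagger concerns
  \<open>S_eta_cell\<close> itself.\<close>

lemma dagger_cell_S:
  assumes "(a, \<theta>, \<Pi>) \<in> S_obj" "(b, \<theta>', \<Pi>') \<in> S_obj" "X \<in> hom B a b"
  shows "dagger_cell S_bicat S_dual S_eta ((a, \<theta>, \<Pi>), X, (b, \<theta>', \<Pi>'))
    = ((a, \<theta>, \<Pi>), S_eta_cell ((a, \<theta>, \<Pi>), X, (b, \<theta>', \<Pi>')), (b, \<theta>', \<Pi>'))"
proof -
  note t = S_eta_cell_typing[OF assms] assms(3)[unfolded hom_iff] assms(1,2) obj_facts(1)[OF assms(1)] obj_facts(1)[OF assms(2)]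
  show ?thesis
    unfolding dagger_cell_def by (simp add: S_dual_dual S_eta_simps S_proj inv2_S hom_iff S_t2_def t)
qed

theorem O1_dagger_S: "O1_dagger S_bicat S_dual S_eta"
proof -
  interpret dual: pseudofunctor S_bicat "op1 S_bicat" S_dual by (rule pseudofunctor_S)
  interpret eta: pseudotransformation S_bicat S_bicat "double_dual S_bicat S_dual" "id_functor S_bicat" S_eta
    by (rule pseudotransformation_S)
  show ?thesis
  proof (unfold_locales, goal_cases)
    case (1 A)
    then show ?case by (simp add: S_eta_simps S_proj invertible_one_S)
  next
    case (2 A)
    show ?case by (simp add: S_dual_simps)
  next
    case (3 A)
    show ?case by (simp add: S_eta_simps S_proj)
  next
    case (4 X)
    then have "X \<in> hom S_bicat (src S_bicat X) (trg S_bicat X)" by (auto simp: hom_iff)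
    then obtain a \<theta> \<Pi> b \<theta>' \<Pi>' x where 1: "X = ((a, \<theta>, \<Pi>), x, (b, \<theta>', \<Pi>'))"
      "(a, \<theta>, \<Pi>) \<in> S_obj" "(b, \<theta>', \<Pi>') \<in> S_obj" "x \<in> hom B a b" by (rule S_homE)
    have d: "inv1 J \<theta> \<cdot> f1 d x \<cdot> \<theta>' \<in> hom B b a"
      using 1(4)[unfolded hom_iff] by (simp add: hom_iff obj_facts[OF 1(2)] obj_facts[OF 1(3)])
    show ?case
      unfolding 1(1) by (simp add: dagger_cell_S[OF 1(2-4)] S_dual_simps dagger_cell_S[OF 1(3,2) d] S_eta_cell_dual[OF 1(2-4)])
  qed
qed

end

theorem lemma2p54:
  fixes B :: "('o, 'm, 'c) bicat"
    and J :: "('m, 'c) inverses"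
    and d :: "('o, 'm, 'c, 'o, 'm, 'c) functor2"
    and \<eta> :: "('o, 'm, 'm, 'c) trans2"
    and \<tau> :: "'o \<Rightarrow> 'c"
  assumes "O1_volutive B J d \<eta> \<tau>"
  shows "O1_dagger (volutive_data.S_bicat B J d \<eta> \<tau>)
           (volutive_data.S_dual B J d)
           (volutive_data.S_eta B J d \<eta>)"
  by (rule O1_volutive.O1_dagger_S[OF assms])

end
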